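(* Let $1<p<\infty$, $d\ge1$, and let $M$ be a nonempty compact subset of $\mathbb{R}^d$. There is a constant $\lambda_p\ge1$ depending only on $p$ and a unital isomorphism $\eta_M:C(M)\to B(l^p)$ such that: (i) $\lambda_p^{-1}\|h\|\le\|\eta_M(h)\|\le\lambda_p\|h\|$ for all $h\in C(M)$; (ii) $\eta_M$ is $\lambda_p$-similar to $\eta_M\oplus\eta_M$; (iii) $\pi\circ\eta_M$ is an isomorphism; (iv) whenever $\psi:C(M)\to B(l^p)$ is a map such that $\pi\circ\psi$ is a bounded unital homomorphism, there exist an invertible operator $S:l^p\oplus l^p\to l^p$ and a map $\psi^{(-1)}:C(M)\to B(l^p)$ such that (a) $\pi\circ\psi^{(-1)}$ is a unital isomorphism (into) $C(M)\to B(l^p)/K(l^p)$, (b) $\|S\|\|S^{-1}\|\le 2^{12d}\|\pi\circ\psi\|^{12}\lambda_p$, and (c) $\eta_M(h)-S(\psi(h)\oplus\psi^{(-1)}(h))S^{-1}$ is compact for all $h\in C(M)$.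
   Context: $\pi:B(l^p)\to B(l^p)/K(l^p)$ is the quotient map; a map means a function with no assumed continuity or algebraic property. A homomorphism between Banach algebras is an isomorphism (into) if it is bounded above and below by constant multiples of the norm. Two maps $\rho_1:\Lambda\to B(\mathcal{Y}_1)$, $\rho_2:\Lambda\to B(\mathcal{Y}_2)$ are $\lambda$-similar if there is an invertible $S:\mathcal{Y}_1\to\mathcal{Y}_2$ with $\|S\|\|S^{-1}\|\le\lambda$ and $\rho_2(a)=S\rho_1(a)S^{-1}$ for all $a$. Direct sums are $l^p$-direct sums, and $(\rho_1\oplus\rho_2)(a)=\rho_1(a)\oplus\rho_2(a)$. *)

theory Defs
  imports "HOL-Analysis.Analysis"
begin

definition lp :: "real \<Rightarrow> (nat \<Rightarrow> complex) set" where
  "lp p = {x. summable (\<lambda>n. cmod (x n) powr p)}"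

definition lpnorm :: "real \<Rightarrow> (nat \<Rightarrow> complex) \<Rightarrow> real" where
  "lpnorm p x = (\<Sum>n. cmod (x n) powr p) powr (1 / p)"

definition vadd :: "(nat \<Rightarrow> complex) \<Rightarrow> (nat \<Rightarrow> complex) \<Rightarrow> (nat \<Rightarrow> complex)" where
  "vadd x y = (\<lambda>n. x n + y n)"

definition vsub :: "(nat \<Rightarrow> complex) \<Rightarrow> (nat \<Rightarrow> complex) \<Rightarrow> (nat \<Rightarrow> complex)" where
  "vsub x y = (\<lambda>n. x n - y n)"

definition vsmul :: "complex \<Rightarrow> (nat \<Rightarrow> complex) \<Rightarrow> (nat \<Rightarrow> complex)" where
  "vsmul c x = (\<lambda>n. c * x n)"

definition lp2 :: "real \<Rightarrow> ((nat \<Rightarrow> complex) \<times> (nat \<Rightarrow> complex)) set" where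
  "lp2 p = lp p \<times> lp p"

definition lp2norm :: "real \<Rightarrow> (nat \<Rightarrow> complex) \<times> (nat \<Rightarrow> complex) \<Rightarrow> real" where
  "lp2norm p z = (lpnorm p (fst z) powr p + lpnorm p (snd z) powr p) powr (1 / p)"

definition padd where
  "padd z w = (vadd (fst z) (fst w), vadd (snd z) (snd w))"

definition psmul where
  "psmul c z = (vsmul c (fst z), vsmul c (snd z))"

text \<open>Bounded linear operators on l^p (only values on l^p matter).\<close>

definition bop :: "real \<Rightarrow> ((nat \<Rightarrow> complex) \<Rightarrow> (nat \<Rightarrow> complex)) \<Rightarrow> bool" where
  "bop p T \<longleftrightarrow> (\<forall>x\<in>lp p. T x \<in> lp p)
     \<and> (\<forall>x\<in>lp p. \<forall>y\<in>lp p. T (vadd x y) = vadd (T x) (T y))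
     \<and> (\<forall>c. \<forall>x\<in>lp p. T (vsmul c x) = vsmul c (T x))
     \<and> (\<exists>C. \<forall>x\<in>lp p. lpnorm p (T x) \<le> C * lpnorm p x)"

definition opnorm :: "real \<Rightarrow> ((nat \<Rightarrow> complex) \<Rightarrow> (nat \<Rightarrow> complex)) \<Rightarrow> real" where
  "opnorm p T = Sup {lpnorm p (T x) | x. x \<in> lp p \<and> lpnorm p x \<le> 1}"

definition bop21 :: "real \<Rightarrow> ((nat \<Rightarrow> complex) \<times> (nat \<Rightarrow> complex) \<Rightarrow> (nat \<Rightarrow> complex)) \<Rightarrow> bool" where
  "bop21 p S \<longleftrightarrow> (\<forall>z\<in>lp2 p. S z \<in> lp p)
     \<and> (\<forall>z\<in>lp2 p. \<forall>w\<in>lp2 p. S (padd z w) = vadd (S z) (S w))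
     \<and> (\<forall>c. \<forall>z\<in>lp2 p. S (psmul c z) = vsmul c (S z))
     \<and> (\<exists>C. \<forall>z\<in>lp2 p. lpnorm p (S z) \<le> C * lp2norm p z)"

definition opnorm21 :: "real \<Rightarrow> ((nat \<Rightarrow> complex) \<times> (nat \<Rightarrow> complex) \<Rightarrow> (nat \<Rightarrow> complex)) \<Rightarrow> real" where
  "opnorm21 p S = Sup {lpnorm p (S z) | z. z \<in> lp2 p \<and> lp2norm p z \<le> 1}"

definition bop12 :: "real \<Rightarrow> ((nat \<Rightarrow> complex) \<Rightarrow> (nat \<Rightarrow> complex) \<times> (nat \<Rightarrow> complex)) \<Rightarrow> bool" where
  "bop12 p R \<longleftrightarrow> (\<forall>x\<in>lp p. R x \<in> lp2 p)
     \<and> (\<forall>x\<in>lp p. \<forall>y\<in>lp p. R (vadd x y) = padd (R x) (R y))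
     \<and> (\<forall>c. \<forall>x\<in>lp p. R (vsmul c x) = psmul c (R x))
     \<and> (\<exists>C. \<forall>x\<in>lp p. lp2norm p (R x) \<le> C * lpnorm p x)"

definition opnorm12 :: "real \<Rightarrow> ((nat \<Rightarrow> complex) \<Rightarrow> (nat \<Rightarrow> complex) \<times> (nat \<Rightarrow> complex)) \<Rightarrow> real" where
  "opnorm12 p R = Sup {lp2norm p (R x) | x. x \<in> lp p \<and> lpnorm p x \<le> 1}"

definition inv_pair where
  "inv_pair p S Sinv \<longleftrightarrow> bop21 p S \<and> bop12 p Sinv
     \<and> (\<forall>z\<in>lp2 p. Sinv (S z) = z) \<and> (\<forall>x\<in>lp p. S (Sinv x) = x)"

text \<open>Compact operators: images of bounded sequences have Cauchy subsequences
  (l^p is complete, so this is relative compactness of the image of the unit ball).\<close>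

definition cpt_op :: "real \<Rightarrow> ((nat \<Rightarrow> complex) \<Rightarrow> (nat \<Rightarrow> complex)) \<Rightarrow> bool" where
  "cpt_op p T \<longleftrightarrow> bop p T \<and>
     (\<forall>x. (\<forall>n. x n \<in> lp p \<and> lpnorm p (x n) \<le> 1) \<longrightarrow>
        (\<exists>r::nat \<Rightarrow> nat. strict_mono r \<and> (\<forall>e>0. \<exists>N. \<forall>m\<ge>N. \<forall>n\<ge>N.
            lpnorm p (vsub (T (x (r m))) (T (x (r n)))) < e)))"

definition calkin_norm :: "real \<Rightarrow> ((nat \<Rightarrow> complex) \<Rightarrow> (nat \<Rightarrow> complex)) \<Rightarrow> real" where
  "calkin_norm p T = Inf {opnorm p (\<lambda>x. vadd (T x) (K x)) | K. cpt_op p K}"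

definition ess_eq where
  "ess_eq p T U \<longleftrightarrow> cpt_op p (\<lambda>x. vsub (T x) (U x))"

text \<open>C(M) for compact M in R^d, with R^d embedded in nat => real (coordinates >= d vanish).
  Elements are canonical representatives vanishing off M.\<close>

definition CM :: "(nat \<Rightarrow> real) set \<Rightarrow> ((nat \<Rightarrow> real) \<Rightarrow> complex) set" where
  "CM M = {h. continuous_on M h \<and> (\<forall>z. z \<notin> M \<longrightarrow> h z = 0)}"

definition supnorm :: "(nat \<Rightarrow> real) set \<Rightarrow> ((nat \<Rightarrow> real) \<Rightarrow> complex) \<Rightarrow> real" where
  "supnorm M h = Sup ((\<lambda>z. cmod (h z)) ` M)"

definition oneM :: "(nat \<Rightarrow> real) set \<Rightarrow> (nat \<Rightarrow> real) \<Rightarrow> complex" where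
  "oneM M = (\<lambda>z. if z \<in> M then 1 else 0)"

definition fadd :: "((nat \<Rightarrow> real) \<Rightarrow> complex) \<Rightarrow> ((nat \<Rightarrow> real) \<Rightarrow> complex) \<Rightarrow> (nat \<Rightarrow> real) \<Rightarrow> complex" where
  "fadd f g = (\<lambda>z. f z + g z)"

definition fmul :: "((nat \<Rightarrow> real) \<Rightarrow> complex) \<Rightarrow> ((nat \<Rightarrow> real) \<Rightarrow> complex) \<Rightarrow> (nat \<Rightarrow> real) \<Rightarrow> complex" where
  "fmul f g = (\<lambda>z. f z * g z)"

definition fsmul :: "complex \<Rightarrow> ((nat \<Rightarrow> real) \<Rightarrow> complex) \<Rightarrow> (nat \<Rightarrow> real) \<Rightarrow> complex" where
  "fsmul c f = (\<lambda>z. c * f z)"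

type_synonym rep = "((nat \<Rightarrow> real) \<Rightarrow> complex) \<Rightarrow> (nat \<Rightarrow> complex) \<Rightarrow> (nat \<Rightarrow> complex)"

definition unital_iso :: "real \<Rightarrow> (nat \<Rightarrow> real) set \<Rightarrow> rep \<Rightarrow> bool" where
  "unital_iso p M \<eta> \<longleftrightarrow> (\<forall>h\<in>CM M. bop p (\<eta> h))
     \<and> (\<forall>f\<in>CM M. \<forall>g\<in>CM M. \<forall>x\<in>lp p. \<eta> (fadd f g) x = vadd (\<eta> f x) (\<eta> g x))
     \<and> (\<forall>c. \<forall>f\<in>CM M. \<forall>x\<in>lp p. \<eta> (fsmul c f) x = vsmul c (\<eta> f x))
     \<and> (\<forall>f\<in>CM M. \<forall>g\<in>CM M. \<forall>x\<in>lp p. \<eta> (fmul f g) x = \<eta> f (\<eta> g x))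
     \<and> (\<forall>x\<in>lp p. \<eta> (oneM M) x = x)
     \<and> (\<exists>c>0. \<exists>C. \<forall>h\<in>CM M. c * supnorm M h \<le> opnorm p (\<eta> h) \<and> opnorm p (\<eta> h) \<le> C * supnorm M h)"

definition calkin_hom :: "real \<Rightarrow> (nat \<Rightarrow> real) set \<Rightarrow> rep \<Rightarrow> bool" where
  "calkin_hom p M \<psi> \<longleftrightarrow> (\<forall>h\<in>CM M. bop p (\<psi> h))
     \<and> (\<forall>f\<in>CM M. \<forall>g\<in>CM M. ess_eq p (\<psi> (fadd f g)) (\<lambda>x. vadd (\<psi> f x) (\<psi> g x)))
     \<and> (\<forall>c. \<forall>f\<in>CM M. ess_eq p (\<psi> (fsmul c f)) (\<lambda>x. vsmul c (\<psi> f x)))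
     \<and> (\<forall>f\<in>CM M. \<forall>g\<in>CM M. ess_eq p (\<psi> (fmul f g)) (\<lambda>x. \<psi> f (\<psi> g x)))
     \<and> ess_eq p (\<psi> (oneM M)) (\<lambda>x. x)"

definition calkin_bdd :: "real \<Rightarrow> (nat \<Rightarrow> real) set \<Rightarrow> rep \<Rightarrow> bool" where
  "calkin_bdd p M \<psi> \<longleftrightarrow> (\<exists>C. \<forall>h\<in>CM M. calkin_norm p (\<psi> h) \<le> C * supnorm M h)"

definition calkin_below :: "real \<Rightarrow> (nat \<Rightarrow> real) set \<Rightarrow> rep \<Rightarrow> bool" where
  "calkin_below p M \<psi> \<longleftrightarrow> (\<exists>c>0. \<forall>h\<in>CM M. c * supnorm M h \<le> calkin_norm p (\<psi> h))"

definition calkin_iso :: "real \<Rightarrow> (nat \<Rightarrow> real) set \<Rightarrow> rep \<Rightarrow> bool" where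
  "calkin_iso p M \<psi> \<longleftrightarrow> calkin_hom p M \<psi> \<and> calkin_bdd p M \<psi> \<and> calkin_below p M \<psi>"

definition calkin_opnorm :: "real \<Rightarrow> (nat \<Rightarrow> real) set \<Rightarrow> rep \<Rightarrow> real" where
  "calkin_opnorm p M \<psi> = Sup {calkin_norm p (\<psi> h) | h. h \<in> CM M \<and> supnorm M h \<le> 1}"

definition similar_sum :: "real \<Rightarrow> (nat \<Rightarrow> real) set \<Rightarrow> real \<Rightarrow> rep \<Rightarrow> bool" where
  "similar_sum p M lam \<eta> \<longleftrightarrow> (\<exists>S Sinv. inv_pair p S Sinv \<and> opnorm21 p S * opnorm12 p Sinv \<le> lam
     \<and> (\<forall>h\<in>CM M. \<forall>x\<in>lp p. \<eta> h x = S (\<eta> h (fst (Sinv x)), \<eta> h (snd (Sinv x)))))"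

end

theory Submission
  imports Defs "HOL-Library.Function_Algebras" "HOL-Library.Nat_Bijection"
begin

text \<open>
  The representation \<open>eta\<close> lives on blocks \<open>L\<^sup>p({1,-1}\<^sup>n)\<close> of \<open>l\<^sup>p\<close>: on the span of the Rademacher
  functions it multiplies the \<open>i\<close>-th one by the value of \<open>h\<close> at a point \<open>z\<^sub>i\<close> of \<open>M\<close>, and on the
  complement it is a scalar. Khintchine's inequality makes it bounded with a constant depending only
  on \<open>p\<close>.

  Given \<open>\<psi>\<close>, take partitions of unity \<open>\<Sum> f\<^sub>i\<^sup>2 = 1\<close> of \<open>M\<close> into small cubes with \<open>\<Sum> f\<^sub>i \<le> 2\<^sup>d\<close> and
  slowly varying diagonal weights \<open>w\<^sub>k\<close> that nearly commute with \<open>\<psi>\<close>. Sending \<open>x\<close> to the functions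
  \<open>\<epsilon> \<mapsto> \<Sum> \<epsilon>\<^sub>i \<psi>(f\<^sub>i) w\<^sub>k x\<close> on the blocks gives a map \<open>J\<close>, and averaging back gives \<open>Q\<close> with
  \<open>Q J = 1\<close>; both intertwine \<open>\<psi>\<close> and \<open>eta\<close> modulo compact operators, because \<open>\<parallel>\<Sum> \<epsilon>\<^sub>i f\<^sub>i\<parallel> \<le> 2\<^sup>d\<close> and
  \<open>f\<^sub>i (h - h(z\<^sub>i))\<close> is small. Since \<open>eta\<close> has infinite multiplicity, an Eilenberg swindle turns this
  essential direct summand into the similarity \<open>S\<close>.
\<close>

section \<open>The space \<open>l\<^sup>p\<close>\<close>

text \<open>The hypothesis on \<psi> controls signed sums of the \<psi>(f_i) independently of the
  number of pieces: modulo compacts such a sum is \<psi> of a single function of sup norm at most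
  \<open>2^d\<close>. Random signs use exactly this, and Khintchine complements the span of the
  Rademacher functions with a constant that does not see how many there are. Since \<psi> is
  controlled only modulo compacts, its bounds become norm bounds only far out in the coordinates.
  This is the purpose of the weights: block k starts so late that its finitely many signed sums and
  commutators obey their essential bounds. A block can serve only finitely many functions, which is
  why countably many test functions are used and the intertwining relations are then extended by
  density. With \<kappa> = \<open>K\<psi> * 2^d\<close> the bounds for J and Q are of order
  \<kappa>, that for the idempotent J Q is of order \<kappa>^2, and both factors of the similarity
  inherit this, so the product is of order \<kappa>^4; the exponent 12 leaves ample room. The
  remaining factor \<open>12100 * RC\<^sup>2\<close> depends on p through the Rademacher constant
  \<open>RC\<close> only.\<close>

lemma vadd_eq: "vadd x y = x + y"
  by (simp add: vadd_def fun_eq_iff)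

lemma vsub_eq: "vsub x y = x - y"
  by (simp add: vsub_def fun_eq_iff)

lemma vsmul_apply [simp]: "vsmul c x n = c * x n"
  by (simp add: vsmul_def)

lemma vsmul_algebra:
  "vsmul c (x + y) = vsmul c x + vsmul c y"
  "vsmul c (x - y) = vsmul c x - vsmul c y"
  "vsmul (a + b) x = vsmul a x + vsmul b x"
  "vsmul (a - b) x = vsmul a x - vsmul b x"
  "vsmul a (vsmul b x) = vsmul (a * b) x"
  by (auto simp: fun_eq_iff algebra_simps)

lemma vsmul_simps [simp]:
  "vsmul 1 x = x" "vsmul 0 x = 0" "vsmul c 0 = 0" "vsmul (-1) x = - x"
  by (auto simp: fun_eq_iff)

lemma sum_fun_apply [simp]: "(sum f A :: 'a \<Rightarrow> 'b::comm_monoid_add) x = (\<Sum>a\<in>A. f a x)"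
  by (induction A rule: infinite_finite_induct) auto

lemma vsmul_sum: "vsmul c (sum f A) = (\<Sum>a\<in>A. vsmul c (f a))"
  by (simp add: fun_eq_iff sum_distrib_left)

text \<open>Vanishing coordinates require the closed half-line. If an endpoint is 0, convexity
  reduces to \<open>s powr p \<le> s\<close> on the unit interval.\<close>

lemma powr_convex_nonneg:
  assumes "1 < (p::real)"
  shows "convex_on {0..} (\<lambda>x. x powr p)"
proof (rule convex_onI)
  fix t x y :: real
  assume t: "0 < t" "t < 1" and xy: "x \<in> {0..}" "y \<in> {0..}"
  have le: "s powr p \<le> s" if "0 < s" "s < 1" for s :: real
    using that assms powr_mono'[of 1 p s] by simp
  show "((1 - t) *\<^sub>R x + t *\<^sub>R y) powr p \<le> (1 - t) * x powr p + t * y powr p"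
  proof (cases "x = 0 \<or> y = 0")
    case True
    thus ?thesis using xy t le[of t] le[of "1 - t"] assms
      by (auto simp: powr_mult intro!: mult_right_mono)
  next
    case False
    thus ?thesis using convex_onD[OF powr_convex[of p], of t x y] xy t assms by auto
  qed
qed simp

text \<open>Jensen's inequality for subprobability weights: the missing mass is put on the extra
  point \<open>None\<close>, where the value is 0.\<close>

lemma weighted_powr_le:
  fixes u :: "'i \<Rightarrow> real"
  assumes "finite A" "1 < p" and w: "\<And>i. i \<in> A \<Longrightarrow> 0 \<le> w i" and w1: "sum w A \<le> 1"
    and u: "\<And>i. i \<in> A \<Longrightarrow> 0 \<le> u i"
  shows "(\<Sum>i\<in>A. w i * u i) powr p \<le> (\<Sum>i\<in>A. w i * u i powr p)"
proof -
  define B where "B = insert None (Some ` A)"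
  define W where "W = case_option (1 - sum w A) w"
  define U where "U = case_option 0 u"
  have fB: "finite B" using assms(1) by (simp add: B_def)
  have inj: "inj_on Some A" by simp
  have sumB: "sum g B = g None + (\<Sum>i\<in>A. g (Some i))" for g :: "'i option \<Rightarrow> real"
    unfolding B_def using assms(1) by (subst sum.insert) (auto simp: sum.reindex)
  have cvx: "convex_on {0..} (\<lambda>x::real. x powr p)"
    using powr_convex_nonneg \<open>1 < p\<close> by blast
  have "(\<lambda>x. x powr p) (\<Sum>i\<in>B. W i *\<^sub>R U i) \<le> (\<Sum>i\<in>B. W i * (U i) powr p)"
    by (rule convex_on_sum[OF fB _ cvx])
       (use w w1 u in \<open>auto simp: sumB W_def U_def split: option.splits\<close>, auto simp: B_def)
  thus ?thesis using \<open>1 < p\<close> by (simp add: sumB W_def U_def)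
qed

text \<open>The \<open>p\<close>-th power of the norm, over an arbitrary index type and with value \<open>\<infinity>\<close> outside \<open>l\<^sup>p\<close>, so that
  Fubini applies without summability side conditions.\<close>

definition en :: "real \<Rightarrow> ('i \<Rightarrow> complex) \<Rightarrow> ennreal" where
  "en p x = (\<integral>\<^sup>+ i. ennreal (cmod (x i) powr p) \<partial>count_space UNIV)"

lemma lp_iff_en: "x \<in> lp p \<longleftrightarrow> en p x < \<infinity>"
proof -
  have "en p x = (\<Sum>i. ennreal (cmod (x i) powr p))"
    by (simp add: en_def nn_integral_count_space_nat)
  moreover have "summable (\<lambda>i. cmod (x i) powr p) \<longleftrightarrow> (\<Sum>i. ennreal (cmod (x i) powr p)) \<noteq> top"
  proof
    assume "summable (\<lambda>i. cmod (x i) powr p)"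
    thus "(\<Sum>i. ennreal (cmod (x i) powr p)) \<noteq> top"
      by (subst suminf_ennreal2) (rule powr_ge_zero, assumption, rule ennreal_neq_top)
  next
    assume "(\<Sum>i. ennreal (cmod (x i) powr p)) \<noteq> top"
    thus "summable (\<lambda>i. cmod (x i) powr p)"
      by (rule summable_suminf_not_top[rotated]) (rule powr_ge_zero)
  qed
  ultimately show ?thesis by (simp add: lp_def less_top)
qed

lemma en_mono: "0 \<le> p \<Longrightarrow> (\<And>i. cmod (x i) \<le> cmod (y i)) \<Longrightarrow> en p x \<le> en p y"
  unfolding en_def by (intro nn_integral_mono) (auto intro!: ennreal_leI powr_mono2)

lemma en_reindex: "bij f \<Longrightarrow> en p (\<lambda>i. x (f i)) = en p x"
  unfolding en_def by (rule nn_integral_bij_count_space[where f="\<lambda>i. ennreal (cmod (x i) powr p)"]) simp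

lemma en_prod: "en p x = (\<integral>\<^sup>+ a. en p (\<lambda>b. x (a, b)) \<partial>count_space UNIV)"
  unfolding en_def by (subst nn_integral_fst_count_space[symmetric]) simp

lemma en_swap:
  fixes x :: "'a::countable \<Rightarrow> 'b \<Rightarrow> complex"
  shows "(\<integral>\<^sup>+ a. en p (\<lambda>b. x a b) \<partial>count_space UNIV) = (\<integral>\<^sup>+ b. en p (\<lambda>a. x a b) \<partial>count_space UNIV)"
  unfolding en_def
  by (subst nn_integral_count_space_nn_integral[symmetric]) auto

lemma en_finite_sum:
  assumes "finite A" "\<And>i. i \<notin> A \<Longrightarrow> x i = 0"
  shows "en p x = ennreal (\<Sum>i\<in>A. cmod (x i) powr p)"
  unfolding en_def using assms
  by (subst nn_integral_count_space'[of A]) (auto simp: sum_ennreal)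

lemma en_zero [simp]: "en p (\<lambda>i. 0) = 0" "en p 0 = 0"
  by (simp_all add: en_def)

lemma en_scale: "en p (\<lambda>i. c * x i) = ennreal (cmod c powr p) * en p x"
  unfolding en_def by (subst nn_integral_cmult[symmetric]) (auto simp: norm_mult powr_mult ennreal_mult)

lemma en_disjoint_sum:
  assumes "finite A" "\<And>i a b. a \<in> A \<Longrightarrow> b \<in> A \<Longrightarrow> x a i \<noteq> 0 \<Longrightarrow> x b i \<noteq> 0 \<Longrightarrow> a = b"
  shows "en p (\<lambda>i. \<Sum>a\<in>A. x a i) = (\<Sum>a\<in>A. en p (x a))"
proof -
  have "ennreal (cmod (\<Sum>a\<in>A. x a i) powr p) = (\<Sum>a\<in>A. ennreal (cmod (x a i) powr p))" for i
  proof (cases "\<exists>a\<in>A. x a i \<noteq> 0")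
    case True
    then obtain a where a: "a \<in> A" "x a i \<noteq> 0" by blast
    have other: "x b i = 0" if "b \<in> A - {a}" for b
      using assms(2)[of a b i] a that by blast
    have "(\<Sum>b\<in>A. x b i) = (\<Sum>b\<in>{a}. x b i)"
      by (rule sum.mono_neutral_right) (use a assms(1) other in auto)
    moreover have "(\<Sum>b\<in>A. ennreal (cmod (x b i) powr p)) = (\<Sum>b\<in>{a}. ennreal (cmod (x b i) powr p))"
      by (rule sum.mono_neutral_right) (use a assms(1) other in auto)
    ultimately show ?thesis by simp
  next
    case False
    thus ?thesis by simp
  qed
  thus ?thesis unfolding en_def by (subst nn_integral_sum[symmetric]) auto
qed

locale lp_space =
  fixes p :: real
  assumes p_gt_1: "1 < p"
begin

abbreviation X :: "(nat \<Rightarrow> complex) set" where "X \<equiv> lp p"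
abbreviation nm :: "(nat \<Rightarrow> complex) \<Rightarrow> real" where "nm \<equiv> lpnorm p"

lemma p_pos: "0 < p" and p_ne0 [simp]: "p \<noteq> 0" and p_ge0 [simp]: "0 \<le> p"
  using p_gt_1 by auto

lemma nm_nonneg [simp]: "0 \<le> nm x"
  by (simp add: lpnorm_def)

lemma nm_powr: "x \<in> X \<Longrightarrow> nm x powr p = (\<Sum>n. cmod (x n) powr p)"
  unfolding lpnorm_def lp_def using p_pos by (simp add: powr_powr suminf_nonneg)

lemma en_eq: "x \<in> X \<Longrightarrow> en p x = ennreal (nm x powr p)"
  by (simp add: nm_powr en_def nn_integral_count_space_nat suminf_ennreal2 lp_def)

lemma en_le_imp:
  assumes "en p y \<le> ennreal (c powr p) * en p x" "x \<in> X" "0 \<le> c"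
  shows "y \<in> X" "nm y \<le> c * nm x"
proof -
  have *: "ennreal (c powr p) * en p x = ennreal ((c * nm x) powr p)"
    using assms by (simp add: en_eq powr_mult ennreal_mult)
  show y: "y \<in> X" using assms(1) unfolding * lp_iff_en by (simp add: le_less_trans)
  have "nm y powr p \<le> (c * nm x) powr p"
    using assms(1) unfolding * en_eq[OF y] by simp
  thus "nm y \<le> c * nm x"
    using assms(3) p_pos by (meson mult_nonneg_nonneg nm_nonneg not_le powr_less_mono2)
qed

lemma en_leI:
  assumes "nm y \<le> c * nm x" "y \<in> X" "x \<in> X" "0 \<le> c"
  shows "en p y \<le> ennreal (c powr p) * en p x"
proof -
  have "nm y powr p \<le> c powr p * nm x powr p"
    using powr_mono2[OF p_ge0 nm_nonneg assms(1)] assms(4) by (simp add: powr_mult)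
  thus ?thesis using assms by (simp add: en_eq flip: ennreal_mult)
qed

lemma nm_en_mono: "en p y \<le> en p x \<Longrightarrow> x \<in> X \<Longrightarrow> nm y \<le> nm x"
  using en_le_imp(2)[of y 1 x] by simp

lemma X_en_mono: "en p y \<le> en p x \<Longrightarrow> x \<in> X \<Longrightarrow> y \<in> X"
  using en_le_imp(1)[of y 1 x] by simp

lemma nm_mono: "(\<And>i. cmod (y i) \<le> cmod (x i)) \<Longrightarrow> x \<in> X \<Longrightarrow> nm y \<le> nm x"
  and X_mono: "(\<And>i. cmod (y i) \<le> cmod (x i)) \<Longrightarrow> x \<in> X \<Longrightarrow> y \<in> X"
  using nm_en_mono X_en_mono en_mono[of p y x] by auto

lemma zero_X [simp]: "0 \<in> X" "(\<lambda>i. 0) \<in> X"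
  by (auto simp: lp_iff_en)

lemma nm_zero [simp]: "nm 0 = 0" "nm (\<lambda>i. 0) = 0"
  by (auto simp: lpnorm_def)

lemma smul_X [simp, intro]: "x \<in> X \<Longrightarrow> vsmul c x \<in> X"
  and nm_smul [simp]: "x \<in> X \<Longrightarrow> nm (vsmul c x) = cmod c * nm x"
proof -
  have e: "en p (vsmul c x) = ennreal (cmod c powr p) * en p x" for c x
    using en_scale[of p c x] by (simp add: vsmul_def)
  show s: "vsmul c x \<in> X" if "x \<in> X" for c x
    using en_le_imp(1)[of "vsmul c x" "cmod c" x] that by (simp add: e)
  assume x: "x \<in> X"
  have "ennreal (nm (vsmul c x) powr p) = ennreal (cmod c powr p) * ennreal (nm x powr p)"
    using e[of c x] en_eq[OF x] en_eq[OF s[OF x]] by simp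
  hence "nm (vsmul c x) powr p = (cmod c * nm x) powr p"
    by (simp add: powr_mult flip: ennreal_mult)
  hence "(nm (vsmul c x) powr p) powr (1/p) = ((cmod c * nm x) powr p) powr (1/p)" by simp
  thus "nm (vsmul c x) = cmod c * nm x" by (simp add: powr_powr)
qed

lemma nm_eq_0: "x \<in> X \<Longrightarrow> nm x = 0 \<Longrightarrow> x = 0"
proof -
  assume x: "x \<in> X" "nm x = 0"
  have s: "summable (\<lambda>n. cmod (x n) powr p)" using x by (simp add: lp_def)
  have "(\<Sum>n. cmod (x n) powr p) = 0" using nm_powr[OF x(1)] x(2) by simp
  hence "\<forall>n. cmod (x n) powr p = 0" using suminf_eq_zero_iff[OF s] by simp
  thus "x = 0" by (auto simp: fun_eq_iff)
qed

lemma coord_le: "x \<in> X \<Longrightarrow> cmod (x i) \<le> nm x"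
proof -
  assume x: "x \<in> X"
  have "cmod (x i) powr p \<le> nm x powr p"
    unfolding nm_powr[OF x] using x sum_le_suminf[of "\<lambda>n. cmod (x n) powr p" "{i}"]
    by (simp add: lp_def)
  thus ?thesis using p_pos by (meson nm_nonneg not_le powr_less_mono2)
qed

text \<open>Minkowski's inequality from convexity. If a and b are the two norms, then pointwise
  (|x_i| + |y_i|) / (a + b) is the mean of |x_i| / a and |y_i| / b with weights a / (a + b) and b /
  (a + b). Summing the p-th powers gives at most 1.\<close>

lemma add_X [simp, intro]: "x \<in> X \<Longrightarrow> y \<in> X \<Longrightarrow> x + y \<in> X"
  and nm_triangle: "x \<in> X \<Longrightarrow> y \<in> X \<Longrightarrow> nm (x + y) \<le> nm x + nm y"
proof -
  assume x: "x \<in> X" and y: "y \<in> X"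
  have "x + y \<in> X \<and> nm (x + y) \<le> nm x + nm y"
  proof (cases "nm x = 0 \<or> nm y = 0")
    case True
    hence "x = 0 \<or> y = 0" using nm_eq_0 x y by blast
    thus ?thesis using x y by auto
  next
    case False
    define a b where "a = nm x" and "b = nm y"
    have ab: "a > 0" "b > 0" using False by (auto simp: a_def b_def less_le)
    have pw: "cmod ((x + y) i) powr p
        \<le> (a + b) powr p * (a / (a + b) * (cmod (x i) powr p / a powr p) + b / (a + b) * (cmod (y i) powr p / b powr p))" for i
    proof -
      let ?w = "\<lambda>t. if t then a / (a + b) else b / (a + b)"
      let ?u = "\<lambda>t. if t then cmod (x i) / a else cmod (y i) / b"
      have "(\<Sum>t\<in>UNIV. ?w t * ?u t) powr p \<le> (\<Sum>t\<in>UNIV. ?w t * ?u t powr p)"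
        by (rule weighted_powr_le) (use ab p_gt_1 in \<open>auto simp: UNIV_bool add_divide_distrib[symmetric]\<close>)
      hence *: "((cmod (x i) + cmod (y i)) / (a + b)) powr p \<le> a / (a + b) * (cmod (x i) / a) powr p + b / (a + b) * (cmod (y i) / b) powr p"
        using ab by (simp add: UNIV_bool add_divide_distrib add.commute)
      have "cmod ((x + y) i) powr p \<le> (cmod (x i) + cmod (y i)) powr p"
        by (intro powr_mono2) (auto intro: norm_triangle_ineq)
      also have "\<dots> = (a + b) powr p * ((cmod (x i) + cmod (y i)) / (a + b)) powr p"
        using ab by (subst powr_mult[symmetric]) auto
      also have "\<dots> \<le> (a + b) powr p * (a / (a + b) * (cmod (x i) / a) powr p + b / (a + b) * (cmod (y i) / b) powr p)"
        by (intro mult_left_mono *) auto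
      finally show ?thesis using ab by (simp add: powr_divide)
    qed
    have sx: "summable (\<lambda>n. cmod (x n) powr p)" and sy: "summable (\<lambda>n. cmod (y n) powr p)"
      using x y by (auto simp: lp_def)
    let ?R = "\<lambda>i. (a + b) powr p * (a / (a + b) * (cmod (x i) powr p / a powr p) + b / (a + b) * (cmod (y i) powr p / b powr p))"
    have sR: "summable ?R"
      by (intro summable_mult summable_add summable_divide sx sy)
    have sxy: "summable (\<lambda>i. cmod ((x + y) i) powr p)"
      by (rule summable_comparison_test[OF _ sR]) (use pw in auto)
    have xyX: "x + y \<in> X" using sxy by (simp add: lp_def)
    have "(\<Sum>i. ?R i) = (a + b) powr p * (a / (a + b) * (a powr p / a powr p) + b / (a + b) * (b powr p / b powr p))"
      using sx sy nm_powr[OF x] nm_powr[OF y]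
      by (subst suminf_mult, intro summable_add summable_mult summable_divide sx sy)
         (subst suminf_add[symmetric], (intro summable_mult summable_divide sx sy)+,
          (subst suminf_mult, intro summable_divide sx sy)+, (subst suminf_divide, intro sx sy)+,
          simp add: a_def b_def)
    also have "\<dots> = (a + b) powr p"
      using ab by (simp add: add_divide_distrib[symmetric])
    finally have "(\<Sum>i. ?R i) = (a + b) powr p" .
    hence "nm (x + y) powr p \<le> (a + b) powr p"
      unfolding nm_powr[OF xyX] using suminf_le[OF pw sxy sR] by simp
    hence "nm (x + y) \<le> a + b"
      using ab p_pos by (meson add_nonneg_nonneg less_imp_le nm_nonneg not_le powr_less_mono2)
    thus ?thesis using xyX by (simp add: a_def b_def)
  qed
  thus "x + y \<in> X" "nm (x + y) \<le> nm x + nm y" by auto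
qed

lemma minus_X [simp, intro]: "x \<in> X \<Longrightarrow> - x \<in> X"
  and nm_minus [simp]: "nm (- x) = nm x"
  by (auto simp: lp_def lpnorm_def)

lemma diff_X [simp, intro]: "x \<in> X \<Longrightarrow> y \<in> X \<Longrightarrow> x - y \<in> X"
  using add_X[of x "-y"] by simp

lemma nm_triangle_diff: "x \<in> X \<Longrightarrow> y \<in> X \<Longrightarrow> nm (x - y) \<le> nm x + nm y"
  using nm_triangle[of x "-y"] by simp

lemma sum_X: "(\<And>a. a \<in> A \<Longrightarrow> x a \<in> X) \<Longrightarrow> sum x A \<in> X"
proof (induction A rule: infinite_finite_induct)
  case (insert a A)
  show ?case unfolding sum.insert[OF insert.hyps]
    by (rule add_X) (rule insert.prems, simp, rule insert.IH, rule insert.prems, simp)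
qed simp_all

lemma nm_sum: "(\<And>a. a \<in> A \<Longrightarrow> x a \<in> X) \<Longrightarrow> nm (sum x A) \<le> (\<Sum>a\<in>A. nm (x a))"
proof (induction A rule: infinite_finite_induct)
  case (insert a A)
  have A: "b \<in> A \<Longrightarrow> x b \<in> X" for b using insert.prems[of b] by blast
  have "nm (x a + sum x A) \<le> nm (x a) + nm (sum x A)"
    by (rule nm_triangle[OF insert.prems sum_X[OF A]]) simp_all
  also have "\<dots> \<le> nm (x a) + (\<Sum>a\<in>A. nm (x a))"
    using insert.IH[OF A] by linarith
  finally show ?case unfolding sum.insert[OF insert.hyps] .
qed simp_all

end

section \<open>Operators and coordinate truncations\<close>

lemmas fun_apply_simps = plus_fun_apply zero_fun_apply minus_apply uminus_apply times_fun_apply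
  one_fun_apply sum_fun_apply vsmul_apply

text \<open>As simp rules, these would eta-expand vectors inside operator arguments.\<close>

declare fun_apply_simps [simp del]

context lp_space
begin

text \<open>\<open>opb c T\<close>: \<open>T\<close> is linear on \<open>X\<close> with norm at most \<open>c\<close>. As in \<open>bop\<close>, only values on \<open>X\<close> matter.\<close>

definition opb :: "real \<Rightarrow> ((nat \<Rightarrow> complex) \<Rightarrow> (nat \<Rightarrow> complex)) \<Rightarrow> bool" where
  "opb c T \<longleftrightarrow> 0 \<le> c \<and> (\<forall>x\<in>X. T x \<in> X) \<and> (\<forall>x\<in>X. \<forall>y\<in>X. T (x + y) = T x + T y)
     \<and> (\<forall>a. \<forall>x\<in>X. T (vsmul a x) = vsmul a (T x)) \<and> (\<forall>x\<in>X. nm (T x) \<le> c * nm x)"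

lemma opbI:
  assumes "0 \<le> c" "\<And>x. x \<in> X \<Longrightarrow> T x \<in> X" "\<And>x y. x \<in> X \<Longrightarrow> y \<in> X \<Longrightarrow> T (x + y) = T x + T y"
    "\<And>a x. x \<in> X \<Longrightarrow> T (vsmul a x) = vsmul a (T x)" "\<And>x. x \<in> X \<Longrightarrow> nm (T x) \<le> c * nm x"
  shows "opb c T"
  using assms unfolding opb_def by blast

lemma opb_nonneg: "opb c T \<Longrightarrow> 0 \<le> c"
  and opb_X: "opb c T \<Longrightarrow> x \<in> X \<Longrightarrow> T x \<in> X"
  and opb_add: "opb c T \<Longrightarrow> x \<in> X \<Longrightarrow> y \<in> X \<Longrightarrow> T (x + y) = T x + T y"
  and opb_smul: "opb c T \<Longrightarrow> x \<in> X \<Longrightarrow> T (vsmul a x) = vsmul a (T x)"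
  and opb_nm: "opb c T \<Longrightarrow> x \<in> X \<Longrightarrow> nm (T x) \<le> c * nm x"
  unfolding opb_def by blast+

lemma bop_iff_opb: "bop p T \<longleftrightarrow> (\<exists>c. opb c T)"
proof
  assume T: "bop p T"
  then obtain C where C: "\<forall>x\<in>X. nm (T x) \<le> C * nm x" unfolding bop_def by blast
  have "opb (max C 0) T"
  proof (rule opbI)
    fix x assume x: "x \<in> X"
    have "C * nm x \<le> max C 0 * nm x" by (intro mult_right_mono) auto
    with C x show "nm (T x) \<le> max C 0 * nm x" by fastforce
  qed (use T in \<open>auto simp: bop_def vadd_eq\<close>)
  thus "\<exists>c. opb c T" ..
qed (auto simp: bop_def opb_def vadd_eq)

lemma opb_bop: "opb c T \<Longrightarrow> bop p T"
  by (auto simp: bop_iff_opb)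

lemma opbI_bop: "bop p T \<Longrightarrow> 0 \<le> c \<Longrightarrow> (\<And>x. x \<in> X \<Longrightarrow> nm (T x) \<le> c * nm x) \<Longrightarrow> opb c T"
  by (auto simp: bop_def opb_def vadd_eq)

lemma opb_zero_arg: "opb c T \<Longrightarrow> T 0 = 0"
  using opb_smul[of c T 0 0] by simp

lemma opb_diff: "opb c T \<Longrightarrow> x \<in> X \<Longrightarrow> y \<in> X \<Longrightarrow> T (x - y) = T x - T y"
  using opb_add[of c T x "- y"] opb_smul[of c T y "-1"] by simp

lemma opb_sum_arg:
  assumes "opb c T" shows "(\<And>a. a \<in> A \<Longrightarrow> x a \<in> X) \<Longrightarrow> T (sum x A) = (\<Sum>a\<in>A. T (x a))"
proof (induction A rule: infinite_finite_induct)
  case (insert a A)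
  have A: "b \<in> A \<Longrightarrow> x b \<in> X" for b using insert.prems[of b] by blast
  show ?case unfolding sum.insert[OF insert.hyps]
    using opb_add[OF assms insert.prems[of a] sum_X[of A x, OF A]] insert.IH[OF A] by simp
qed (simp_all add: opb_zero_arg[OF assms])

lemma opb_mono: "opb c T \<Longrightarrow> c \<le> d \<Longrightarrow> opb d T"
  unfolding opb_def by (meson mult_right_mono nm_nonneg order_trans)

lemma opb_cong: "opb c T \<Longrightarrow> (\<And>x. x \<in> X \<Longrightarrow> S x = T x) \<Longrightarrow> opb c S"
  unfolding opb_def by simp

lemma opb_comp:
  assumes "opb a S" "opb b T" shows "opb (a * b) (\<lambda>x. S (T x))"
proof (rule opbI)
  fix x assume x: "x \<in> X"
  have "nm (S (T x)) \<le> a * nm (T x)" using assms opb_X opb_nm x by blast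
  also have "\<dots> \<le> a * (b * nm x)" using assms opb_nm opb_nonneg x by (intro mult_left_mono) auto
  finally show "nm (S (T x)) \<le> a * b * nm x" by simp
qed (use assms in \<open>auto simp: opb_nonneg opb_X opb_add opb_smul\<close>)

lemma opb_comp_le: "opb a S \<Longrightarrow> opb b T \<Longrightarrow> a * b \<le> c \<Longrightarrow> opb c (\<lambda>x. S (T x))"
  using opb_comp opb_mono by blast

lemma opb_plus:
  assumes "opb a S" "opb b T" shows "opb (a + b) (\<lambda>x. S x + T x)"
proof (rule opbI)
  fix x assume x: "x \<in> X"
  have "nm (S x + T x) \<le> nm (S x) + nm (T x)" using assms opb_X x by (intro nm_triangle) auto
  also have "\<dots> \<le> a * nm x + b * nm x" using assms opb_nm x by (intro add_mono) auto
  finally show "nm (S x + T x) \<le> (a + b) * nm x" by (simp add: algebra_simps)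
qed (use assms in \<open>auto simp: opb_nonneg opb_X opb_add opb_smul vsmul_algebra\<close>)

lemma opb_scale:
  assumes "opb a S" shows "opb (cmod k * a) (\<lambda>x. vsmul k (S x))"
proof (rule opbI)
  fix x assume x: "x \<in> X"
  have "cmod k * nm (S x) \<le> cmod k * (a * nm x)" using assms opb_nm x by (intro mult_left_mono) auto
  thus "nm (vsmul k (S x)) \<le> cmod k * a * nm x" using opb_X[OF assms x] by simp
qed (use assms in \<open>auto simp: opb_nonneg opb_X opb_add opb_smul vsmul_algebra mult.commute\<close>)

lemma opb_uminus: "opb a S \<Longrightarrow> opb a (\<lambda>x. - S x)"
  using opb_scale[of a S "-1"] by simp

lemma opb_minus_op: "opb a S \<Longrightarrow> opb b T \<Longrightarrow> opb (a + b) (\<lambda>x. S x - T x)"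
  using opb_plus[of a S b "\<lambda>x. - T x"] opb_uminus[of b T] by simp

lemma opb_id: "opb 1 (\<lambda>x. x)"
  by (rule opbI) auto

lemma opb_0: "opb 0 (\<lambda>x. 0)"
  by (rule opbI) auto

lemma opb_sum:
  assumes "\<And>i. i \<in> A \<Longrightarrow> opb (c i) (T i)" shows "opb (sum c A) (\<lambda>x. \<Sum>i\<in>A. T i x)"
  using assms
proof (induction A rule: infinite_finite_induct)
  case (insert a A)
  have "opb (c a + sum c A) (\<lambda>x. T a x + (\<Sum>i\<in>A. T i x))"
    by (rule opb_plus) (use insert in auto)
  thus ?case unfolding sum.insert[OF insert.hyps] .
qed (use opb_0 in simp_all)

lemma bop_X: "bop p T \<Longrightarrow> x \<in> X \<Longrightarrow> T x \<in> X"
  by (auto simp: bop_iff_opb opb_X)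

lemma bop_add: "bop p T \<Longrightarrow> x \<in> X \<Longrightarrow> y \<in> X \<Longrightarrow> T (x + y) = T x + T y"
  by (auto simp: bop_iff_opb opb_add)

lemma bop_smul: "bop p T \<Longrightarrow> x \<in> X \<Longrightarrow> T (vsmul a x) = vsmul a (T x)"
  by (auto simp: bop_iff_opb opb_smul)

lemma bop_diff: "bop p T \<Longrightarrow> x \<in> X \<Longrightarrow> y \<in> X \<Longrightarrow> T (x - y) = T x - T y"
  by (auto simp: bop_iff_opb opb_diff)

lemma bop_sum_arg: "bop p T \<Longrightarrow> (\<And>a. a \<in> A \<Longrightarrow> x a \<in> X) \<Longrightarrow> T (sum x A) = (\<Sum>a\<in>A. T (x a))"
  unfolding bop_iff_opb using opb_sum_arg by blast

lemma bop_cong: "bop p T \<Longrightarrow> (\<And>x. x \<in> X \<Longrightarrow> S x = T x) \<Longrightarrow> bop p S"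
  unfolding bop_iff_opb using opb_cong by blast

lemma bop_comp: "bop p S \<Longrightarrow> bop p T \<Longrightarrow> bop p (\<lambda>x. S (T x))"
  unfolding bop_iff_opb using opb_comp by blast

lemma bop_plus [intro]: "bop p S \<Longrightarrow> bop p T \<Longrightarrow> bop p (\<lambda>x. S x + T x)"
  unfolding bop_iff_opb using opb_plus by blast

lemma bop_minus_op [intro]: "bop p S \<Longrightarrow> bop p T \<Longrightarrow> bop p (\<lambda>x. S x - T x)"
  unfolding bop_iff_opb using opb_minus_op by blast

lemma bop_scale [intro]: "bop p S \<Longrightarrow> bop p (\<lambda>x. vsmul k (S x))"
  unfolding bop_iff_opb using opb_scale by blast

lemma bop_id [intro, simp]: "bop p (\<lambda>x. x)"
  using opb_id opb_bop by blast

lemma bop_0 [intro, simp]: "bop p (\<lambda>x. 0)"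
  using opb_0 opb_bop by blast

lemma bop_sum: "(\<And>i. i \<in> A \<Longrightarrow> bop p (T i)) \<Longrightarrow> bop p (\<lambda>x. \<Sum>i\<in>A. T i x)"
  unfolding bop_iff_opb using opb_sum[of A _ T] by metis


section \<open>Diagonal weights, coordinate truncations and unit vectors\<close>

definition dg :: "(nat \<Rightarrow> real) \<Rightarrow> (nat \<Rightarrow> complex) \<Rightarrow> nat \<Rightarrow> complex" where
  "dg w x = (\<lambda>i. of_real (w i) * x i)"

definition lo :: "nat \<Rightarrow> (nat \<Rightarrow> complex) \<Rightarrow> nat \<Rightarrow> complex" where
  "lo n = dg (\<lambda>i. if i < n then 1 else 0)"

definition hi :: "nat \<Rightarrow> (nat \<Rightarrow> complex) \<Rightarrow> nat \<Rightarrow> complex" where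
  "hi n = dg (\<lambda>i. if i < n then 0 else 1)"

definition ub :: "nat \<Rightarrow> nat \<Rightarrow> complex" where
  "ub m = (\<lambda>i. if i = m then 1 else 0)"

lemma dg_apply: "dg w x i = of_real (w i) * x i" by (simp add: dg_def)
lemma lo_apply: "lo n x i = (if i < n then x i else 0)" by (simp add: lo_def dg_apply)
lemma hi_apply: "hi n x i = (if i < n then 0 else x i)" by (simp add: hi_def dg_apply)

lemmas pt = fun_apply_simps dg_apply lo_apply hi_apply

lemma opb_dg:
  assumes "\<And>i. \<bar>w i\<bar> \<le> 1" shows "opb 1 (dg w)"
proof -
  have m: "cmod (dg w x i) \<le> cmod (x i)" for x i
    using mult_right_mono[OF assms, of "cmod (x i)" i] by (simp add: norm_mult dg_apply)
  show ?thesis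
    by (rule opbI) (auto simp: fun_eq_iff pt algebra_simps intro: X_mono[OF m] nm_mono[OF m])
qed

lemma opb_lo: "opb 1 (lo n)" and opb_hi: "opb 1 (hi n)"
  unfolding lo_def hi_def by (rule opb_dg; simp)+

lemma bop_lo [intro, simp]: "bop p (lo n)" and bop_hi [intro, simp]: "bop p (hi n)"
  using opb_lo opb_hi opb_bop by blast+

lemma lo_X [simp, intro]: "x \<in> X \<Longrightarrow> lo n x \<in> X" and hi_X [simp, intro]: "x \<in> X \<Longrightarrow> hi n x \<in> X"
  using opb_X opb_lo opb_hi by blast+

lemma nm_lo: "x \<in> X \<Longrightarrow> nm (lo n x) \<le> nm x" and nm_hi: "x \<in> X \<Longrightarrow> nm (hi n x) \<le> nm x"
  using opb_nm[OF opb_lo] opb_nm[OF opb_hi] by auto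

lemma lo_plus_hi: "lo n x + hi n x = x"
  by (auto simp: fun_eq_iff pt)

lemma nm_le_lo_hi: "x \<in> X \<Longrightarrow> nm x \<le> nm (lo n x) + nm (hi n x)"
  using nm_triangle[of "lo n x" "hi n x"] by (simp add: lo_plus_hi)

lemma hi_hi: "m \<le> n \<Longrightarrow> hi m (hi n x) = hi n x" "m \<le> n \<Longrightarrow> hi n (hi m x) = hi n x"
  by (auto simp: fun_eq_iff pt)

lemma ub_X [simp]: "ub m \<in> X" and nm_ub [simp]: "nm (ub m) = 1"
proof -
  have e: "en p (ub m) = 1"
    by (subst en_finite_sum[of "{m}"]) (auto simp: ub_def)
  show x: "ub m \<in> X" by (simp add: lp_iff_en e)
  have "nm (ub m) powr p = 1" using en_eq[OF x] e by (simp add: ennreal_eq_1)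
  hence "(nm (ub m) powr p) powr (1/p) = 1" by simp
  thus "nm (ub m) = 1" by (simp add: powr_powr)
qed

lemma lo_Suc: "lo (Suc m) x = lo m x + vsmul (x m) (ub m)"
  by (auto simp: fun_eq_iff ub_def pt less_Suc_eq)

lemma nm_hi_small:
  assumes "x \<in> X" "0 < e" shows "\<exists>N. \<forall>n\<ge>N. nm (hi n x) < e"
proof -
  have s: "summable (\<lambda>n. cmod (x n) powr p)" using assms by (simp add: lp_def)
  obtain N where N: "\<And>n. n \<ge> N \<Longrightarrow> norm (\<Sum>i. cmod (x (i + n)) powr p) < e powr p"
    using suminf_exist_split[OF _ s, of "e powr p"] assms by auto
  have "nm (hi n x) < e" if "n \<ge> N" for n
  proof -
    let ?f = "\<lambda>i. cmod (hi n x i) powr p"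
    have sf: "summable ?f" using hi_X[OF assms(1)] by (simp add: lp_def)
    have "nm (hi n x) powr p = suminf ?f" by (rule nm_powr) (use assms in auto)
    also have "\<dots> = (\<Sum>i. ?f (i + n)) + sum ?f {..<n}" by (rule suminf_split_initial_segment[OF sf])
    also have "\<dots> = (\<Sum>i. cmod (x (i + n)) powr p)" by (simp add: pt)
    also have "\<dots> < e powr p" using N[OF that] by simp
    finally show ?thesis using assms p_pos by (meson less_imp_le not_le powr_mono2)
  qed
  thus ?thesis by blast
qed

lemma nm_lo_hi_powr:
  assumes "x \<in> X" "y \<in> X"
  shows "nm (lo m x + hi m y) powr p = nm (lo m x) powr p + nm (hi m y) powr p"
proof -
  have s: "summable (\<lambda>n. cmod (lo m x n) powr p)" "summable (\<lambda>n. cmod (hi m y n) powr p)"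
    using lo_X[OF assms(1), of m] hi_X[OF assms(2), of m] by (auto simp: lp_def)
  have "nm (lo m x + hi m y) powr p = (\<Sum>n. cmod ((lo m x + hi m y) n) powr p)"
    by (rule nm_powr) (use assms in auto)
  also have "\<dots> = (\<Sum>n. cmod (lo m x n) powr p + cmod (hi m y n) powr p)"
    by (rule suminf_cong) (auto simp: pt)
  also have "\<dots> = (\<Sum>n. cmod (lo m x n) powr p) + (\<Sum>n. cmod (hi m y n) powr p)"
    by (rule suminf_add[OF s, symmetric])
  finally show ?thesis using assms by (simp only: nm_powr[OF lo_X] nm_powr[OF hi_X])
qed

text \<open>A functional that stays large on all tails takes the value \<open>M\<close> on a sum of \<open>M\<close> disjoint
  bounded blocks, whose norm grows only like \<open>M powr (1/p)\<close>.\<close>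

lemma functional_tail:
  fixes \<phi> :: "(nat \<Rightarrow> complex) \<Rightarrow> complex"
  assumes add: "\<And>x y. x \<in> X \<Longrightarrow> y \<in> X \<Longrightarrow> \<phi> (x + y) = \<phi> x + \<phi> y"
    and sm: "\<And>a x. x \<in> X \<Longrightarrow> \<phi> (vsmul a x) = a * \<phi> x"
    and bd: "\<And>x. x \<in> X \<Longrightarrow> cmod (\<phi> x) \<le> c * nm x"
    and e: "0 < e"
  shows "\<exists>N. \<forall>x\<in>X. cmod (\<phi> (hi N x)) \<le> e * nm x"
proof (rule ccontr)
  assume neg: "\<not> ?thesis"
  \<comment> \<open>A vector violating the bound beyond \<open>N\<close> is cut off where its tail
    has become negligible and then scaled so that \<phi> takes the value 1 on it.\<close>
  have step: "\<exists>m u. u \<in> X \<and> hi N u = u \<and> hi m u = 0 \<and> \<phi> u = 1 \<and> nm u \<le> 1 / e" for N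
  proof -
    have "\<not> (\<forall>x\<in>X. cmod (\<phi> (hi N x)) \<le> e * nm x)" using neg by blast
    then obtain x where x: "x \<in> X" "e * nm x < cmod (\<phi> (hi N x))" by (auto simp: not_le)
    define y where "y = hi N x"
    have y: "y \<in> X" using x by (simp add: y_def)
    have g: "0 < (cmod (\<phi> y) - e * nm x) / (\<bar>c\<bar> + 1)" using x by (simp add: y_def)
    obtain m0 where m0: "\<And>n. n \<ge> m0 \<Longrightarrow> nm (hi n y) < (cmod (\<phi> y) - e * nm x) / (\<bar>c\<bar> + 1)"
      using nm_hi_small[OF y g] by blast
    define m where "m = max m0 N"
    define v where "v = lo m y"
    have v: "v \<in> X" using y by (simp add: v_def)
    have "cmod (\<phi> (hi m y)) \<le> (\<bar>c\<bar> + 1) * nm (hi m y)"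
    proof -
      have "c * nm (hi m y) \<le> (\<bar>c\<bar> + 1) * nm (hi m y)" by (intro mult_right_mono) auto
      thus ?thesis using bd[OF hi_X[OF y], of m] by linarith
    qed
    also have "\<dots> < cmod (\<phi> y) - e * nm x"
      using m0[of m] by (simp add: m_def pos_less_divide_eq mult.commute)
    finally have small: "cmod (\<phi> (hi m y)) < cmod (\<phi> y) - e * nm x" .
    have "\<phi> y = \<phi> v + \<phi> (hi m y)"
      unfolding v_def using add[OF lo_X[OF y] hi_X[OF y], of m m] by (simp add: lo_plus_hi)
    hence "cmod (\<phi> y) \<le> cmod (\<phi> v) + cmod (\<phi> (hi m y))" using norm_triangle_ineq by metis
    with small have b: "e * nm x < cmod (\<phi> v)" by linarith
    have "nm v \<le> nm x" unfolding v_def y_def using nm_lo[OF hi_X[OF x(1)]] nm_hi[OF x(1)] order_trans by blast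
    hence "e * nm v \<le> e * nm x" using e by simp
    with b have b': "e * nm v < cmod (\<phi> v)" by linarith
    have pos: "0 < cmod (\<phi> v)" using b e mult_nonneg_nonneg[of e "nm x"] by (smt (verit) nm_nonneg)
    let ?u = "vsmul (1 / \<phi> v) v"
    have "nm ?u = nm v / cmod (\<phi> v)" using v by (simp add: norm_divide)
    also have "\<dots> \<le> 1 / e" using b' pos e by (simp add: field_simps)
    finally have "nm ?u \<le> 1 / e" .
    moreover have "\<phi> ?u = 1" using sm[OF v] pos by simp
    moreover have "hi N ?u = ?u" "hi m ?u = 0" by (auto simp: v_def y_def fun_eq_iff pt m_def)
    ultimately show ?thesis using v by blast
  qed
  have build: "\<exists>m v. v \<in> X \<and> hi m v = 0 \<and> \<phi> v = of_nat M \<and> nm v powr p \<le> real M * (1 / e) powr p" for M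
  proof (induction M)
    case 0
    have "hi 0 0 = 0" by (simp add: fun_eq_iff pt)
    thus ?case using sm[of 0 0] by (intro exI[of _ 0] exI[of _ "0"]) simp
  next
    case (Suc M)
    then obtain m v where v: "v \<in> X" "hi m v = 0" "\<phi> v = of_nat M" "nm v powr p \<le> real M * (1 / e) powr p" by blast
    obtain m' u where u: "u \<in> X" "hi m u = u" "hi m' u = 0" "\<phi> u = 1" "nm u \<le> 1 / e" using step by blast
    have lov: "lo m v = v" using lo_plus_hi[of m v] v by simp
    have "nm (v + u) powr p = nm v powr p + nm u powr p"
      using nm_lo_hi_powr[OF v(1) u(1), of m] lov u(2) by simp
    also have "\<dots> \<le> real M * (1 / e) powr p + (1 / e) powr p"
      by (intro add_mono v powr_mono2 u) auto
    finally have "nm (v + u) powr p \<le> real (Suc M) * (1 / e) powr p" by (simp add: algebra_simps)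
    moreover have "hi (max m m') (v + u) = 0"
    proof (rule ext)
      fix i show "hi (max m m') (v + u) i = 0 i"
        using fun_cong[OF v(2), of i] fun_cong[OF u(3), of i] by (auto simp: pt split: if_splits)
    qed
    moreover have "\<phi> (v + u) = of_nat (Suc M)" using add v u by simp
    ultimately show ?case using v u by blast
  qed
  define C where "C = \<bar>c\<bar>"
  \<comment> \<open>Comparing M <= C * nm v with the growth of \<open>nm v powr p\<close>, which is
    only linear in M, bounds M^(p-1). As 1 < p, this fails for large M.\<close>
  have M: "real M powr (p - 1) \<le> (C / e) powr p" if "M > 0" for M
  proof -
    obtain v where v: "v \<in> X" "\<phi> v = of_nat M" "nm v powr p \<le> real M * (1 / e) powr p" using build by blast
    have "real M \<le> C * nm v" using bd[OF v(1)] v(2) mult_right_mono[of c C "nm v", OF abs_ge_self[of c, folded C_def] nm_nonneg] by simp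
    hence "real M powr p \<le> (C * nm v) powr p" by (intro powr_mono2) auto
    also have "\<dots> \<le> C powr p * (real M * (1 / e) powr p)"
      using v(3) by (simp add: powr_mult C_def mult_left_mono)
    finally have "real M powr p \<le> real M * (C / e) powr p"
      using e by (simp add: powr_mult powr_divide C_def field_simps)
    moreover have "real M powr p = real M * real M powr (p - 1)"
      using that by (simp add: powr_diff)
    ultimately show ?thesis using that by simp
  qed
  obtain M :: nat where M': "real M > ((C / e) powr p + 1) powr (1 / (p - 1))" using reals_Archimedean2 by blast
  have "((C / e) powr p + 1) powr (1 / (p - 1)) > 0" using powr_ge_zero[of "C / e" p] by (metis add_nonneg_pos less_numeral_extra(1) powr_gt_zero order_less_irrefl)
  with M' have pos: "M > 0" by (metis less_trans of_nat_0_less_iff)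
  have "(((C / e) powr p + 1) powr (1 / (p - 1))) powr (p - 1) < real M powr (p - 1)"
    using M' p_gt_1 by (intro powr_less_mono2) auto
  hence "(C / e) powr p + 1 < real M powr (p - 1)"
    using p_gt_1 powr_ge_zero[of "C / e" p] by (simp add: powr_powr)
  with M[OF pos] show False by simp
qed

text \<open>Each coordinate of \<open>T x\<close> is a bounded functional of x, so
  \<open>functional_tail\<close> settles one coordinate at a time. Here 1 < p is essential: on l^1
  the functional summing all coordinates does not become small on tails.\<close>

lemma lo_op_hi_small:
  assumes T: "bop p T" and "0 < e"
  shows "\<exists>N. \<forall>n\<ge>N. opb e (\<lambda>x. lo m (T (hi n x)))"
proof -
  have *: "\<exists>N. \<forall>n\<ge>N. \<forall>x\<in>X. nm (lo m (T (hi n x))) \<le> e * nm x"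
    using \<open>0 < e\<close>
  proof (induction m arbitrary: e)
    case 0
    have "lo 0 x = 0" for x by (simp add: fun_eq_iff pt)
    thus ?case using 0 by (auto simp: mult_nonneg_nonneg)
  next
    case (Suc m)
    obtain N1 where N1: "\<And>n x. n \<ge> N1 \<Longrightarrow> x \<in> X \<Longrightarrow> nm (lo m (T (hi n x))) \<le> e / 2 * nm x"
      using Suc.IH[of "e / 2"] Suc.prems by auto
    obtain c where c: "opb c T" using T bop_iff_opb by blast
    have "\<exists>N. \<forall>x\<in>X. cmod (T (hi N x) m) \<le> e / 2 * nm x"
    proof (rule functional_tail[of "\<lambda>x. T x m" c])
      fix x assume x: "x \<in> X"
      show "cmod (T x m) \<le> c * nm x"
        using coord_le[OF opb_X[OF c x], of m] opb_nm[OF c x] by linarith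
    qed (use Suc.prems c in \<open>auto simp: opb_add opb_smul pt\<close>)
    then obtain N2 where N2: "\<And>x. x \<in> X \<Longrightarrow> cmod (T (hi N2 x) m) \<le> e / 2 * nm x" by blast
    have "nm (lo (Suc m) (T (hi n x))) \<le> e * nm x" if n: "n \<ge> max N1 N2" and x: "x \<in> X" for n x
    proof -
      have TX: "T (hi n x) \<in> X" using c opb_X x by auto
      have "nm (lo (Suc m) (T (hi n x))) \<le> nm (lo m (T (hi n x))) + nm (vsmul (T (hi n x) m) (ub m))"
        unfolding lo_Suc by (rule nm_triangle) (use TX in auto)
      also have "nm (vsmul (T (hi n x) m) (ub m)) = cmod (T (hi n x) m)" by simp
      also have "cmod (T (hi n x) m) \<le> e / 2 * nm (hi n x)"
        using N2[OF hi_X[OF x], of n] n by (simp add: hi_hi)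
      also have "\<dots> \<le> e / 2 * nm x" using nm_hi[OF x] Suc.prems by (intro mult_left_mono) auto
      finally show ?thesis using N1[of n x] n x by simp
    qed
    thus ?case by blast
  qed
  have "opb e (\<lambda>x. lo m (T (hi n x)))" if "\<forall>x\<in>X. nm (lo m (T (hi n x))) \<le> e * nm x" for n
    by (rule opbI_bop) (use that assms(2) bop_comp[OF bop_lo bop_comp[OF T bop_hi]] in auto)
  with * show ?thesis by blast
qed

text \<open>Only the finitely many vectors \<open>T (ub i)\<close> with i < m are involved, and each
  of them has small tails.\<close>

lemma hi_op_lo_small:
  assumes T: "bop p T" and "0 < e"
  shows "\<exists>N. \<forall>n\<ge>N. opb e (\<lambda>x. hi n (T (lo m x)))"
proof -
  obtain c where c: "opb c T" using T bop_iff_opb by blast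
  have *: "\<exists>N. \<forall>n\<ge>N. \<forall>x\<in>X. nm (hi n (T (lo m x))) \<le> e * nm x"
    using \<open>0 < e\<close>
  proof (induction m arbitrary: e)
    case 0
    have "lo 0 x = 0" "hi n 0 = 0" for x n by (simp_all add: fun_eq_iff pt)
    thus ?case using 0 opb_zero_arg[OF c] by (auto simp: mult_nonneg_nonneg)
  next
    case (Suc m)
    obtain N1 where N1: "\<And>n x. n \<ge> N1 \<Longrightarrow> x \<in> X \<Longrightarrow> nm (hi n (T (lo m x))) \<le> e / 2 * nm x"
      using Suc.IH[of "e / 2"] Suc.prems by auto
    obtain N2 where N2: "\<And>n. n \<ge> N2 \<Longrightarrow> nm (hi n (T (ub m))) < e / 2"
      using nm_hi_small[OF opb_X[OF c ub_X], of "e / 2" m] Suc.prems by auto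
    have "nm (hi n (T (lo (Suc m) x))) \<le> e * nm x" if n: "n \<ge> max N1 N2" and x: "x \<in> X" for n x
    proof -
      have eq: "hi n (T (lo (Suc m) x)) = hi n (T (lo m x)) + vsmul (x m) (hi n (T (ub m)))"
        unfolding lo_Suc using x
        by (simp add: opb_add[OF c] opb_smul[OF c] opb_add[OF opb_hi] opb_smul[OF opb_hi] opb_X[OF c])
      have "nm (hi n (T (lo (Suc m) x))) \<le> nm (hi n (T (lo m x))) + nm (vsmul (x m) (hi n (T (ub m))))"
        unfolding eq by (rule nm_triangle) (use x opb_X[OF c] in auto)
      also have "nm (vsmul (x m) (hi n (T (ub m)))) = cmod (x m) * nm (hi n (T (ub m)))"
        using opb_X[OF c] by simp
      also have "\<dots> \<le> nm x * (e / 2)"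
        using N2[of n] n coord_le[OF x] by (intro mult_mono) auto
      finally show ?thesis using N1[of n x] n x by (simp add: mult.commute)
    qed
    thus ?case by blast
  qed
  have "opb e (\<lambda>x. hi n (T (lo m x)))" if "\<forall>x\<in>X. nm (hi n (T (lo m x))) \<le> e * nm x" for n
    by (rule opbI_bop) (use that assms(2) bop_comp[OF bop_hi bop_comp[OF T bop_lo]] in auto)
  with * show ?thesis by blast
qed

end

section \<open>Compact operators\<close>

text \<open>The diagonal argument in topological form: a countable product of closed discs is
  compact and metrizable, hence sequentially compact.\<close>

lemma bounded_coordinates_subseq:
  fixes y :: "nat \<Rightarrow> nat \<Rightarrow> complex"
  assumes "\<And>n i. cmod (y n i) \<le> c"
  obtains l r where "strict_mono (r :: nat \<Rightarrow> nat)" "\<And>i. (\<lambda>n. y (r n) i) \<longlonglongrightarrow> l i"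
proof -
  define K where "K = (Pi\<^sub>E UNIV (\<lambda>i::nat. cball (0::complex) c))"
  have "compactin (product_topology (\<lambda>i::nat. euclidean) UNIV) K"
    unfolding K_def compactin_PiE by auto
  hence "compact K" by (simp add: euclidean_product_topology)
  hence "seq_compact K" by (rule compact_imp_seq_compact)
  moreover have "\<forall>n. y n \<in> K" using assms by (auto simp: K_def)
  ultimately obtain l r where l: "strict_mono r" "(y \<circ> r) \<longlonglongrightarrow> l"
    unfolding seq_compact_def by blast
  have "(\<lambda>n. y (r n) i) \<longlonglongrightarrow> l i" for i
  proof -
    have "isCont (\<lambda>f :: nat \<Rightarrow> complex. f i) l"
      using continuous_on_product_coordinates[of i] continuous_on_eq_continuous_at[OF open_UNIV] by blast
    from isCont_tendsto_compose[OF this l(2)] show ?thesis by simp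
  qed
  with l(1) show ?thesis using that by blast
qed

context lp_space
begin

text \<open>Compactness in \<open>l\<^sup>p\<close> means that the tails of the image of the unit ball are uniformly small.\<close>

definition cpt :: "((nat \<Rightarrow> complex) \<Rightarrow> (nat \<Rightarrow> complex)) \<Rightarrow> bool" where
  "cpt T \<longleftrightarrow> bop p T \<and> (\<forall>e>0. \<exists>N. opb e (\<lambda>x. hi N (T x)))"

lemma cptI:
  assumes "bop p T" "\<And>e. 0 < e \<Longrightarrow> \<exists>N. \<forall>x\<in>X. nm (hi N (T x)) \<le> e * nm x"
  shows "cpt T"
  unfolding cpt_def
proof (intro conjI allI impI)
  fix e :: real assume e: "0 < e"
  then obtain N where "\<forall>x\<in>X. nm (hi N (T x)) \<le> e * nm x" using assms by blast
  thus "\<exists>N. opb e (\<lambda>x. hi N (T x))"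
    using opbI_bop[OF bop_comp[OF bop_hi assms(1)]] e by (intro exI[of _ N]) auto
qed fact

lemma cpt_bop: "cpt T \<Longrightarrow> bop p T"
  by (simp add: cpt_def)

lemma cpt_hi_small:
  assumes "cpt T" "0 < e" shows "\<exists>N. \<forall>n\<ge>N. opb e (\<lambda>x. hi n (T x))"
proof -
  obtain N where N: "opb e (\<lambda>x. hi N (T x))" using assms cpt_def by blast
  have "opb e (\<lambda>x. hi n (T x))" if "n \<ge> N" for n
    using opb_comp[OF opb_hi[of n] N] that by (simp add: hi_hi)
  thus ?thesis by blast
qed

lemma nm_lo_le_sum: "x \<in> X \<Longrightarrow> nm (lo n x) \<le> (\<Sum>i<n. cmod (x i))"
proof (induction n)
  case 0
  have "lo 0 x = 0" by (simp add: fun_eq_iff pt)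
  thus ?case by simp
next
  case (Suc n)
  have "nm (lo (Suc n) x) \<le> nm (lo n x) + nm (vsmul (x n) (ub n))"
    unfolding lo_Suc by (rule nm_triangle) (use Suc.prems in auto)
  thus ?case using Suc by simp
qed

text \<open>Otherwise there are unit-ball vectors \<open>u N\<close> whose images keep mass e beyond
  coordinate N. Along a subsequence the images are Cauchy, so all late ones are close to one fixed
  vector, whose tails tend to 0.\<close>

lemma cpt_op_imp_cpt:
  assumes "cpt_op p T" shows "cpt T"
proof (rule cptI)
  show T: "bop p T" using assms by (simp add: cpt_op_def)
  fix e :: real assume e: "0 < e"
  show "\<exists>N. \<forall>x\<in>X. nm (hi N (T x)) \<le> e * nm x"
  proof (rule ccontr)
    assume neg: "\<not> ?thesis"
    have "\<exists>u. u \<in> X \<and> nm u \<le> 1 \<and> e < nm (hi N (T u))" for N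
    proof -
      have "\<not> (\<forall>x\<in>X. nm (hi N (T x)) \<le> e * nm x)" using neg by blast
      then obtain x where x: "x \<in> X" "e * nm x < nm (hi N (T x))" by (auto simp: not_le)
      have "nm x \<noteq> 0"
      proof
        assume 0: "nm x = 0"
        obtain c where c: "opb c (\<lambda>x. hi N (T x))" using bop_comp[OF bop_hi T] bop_iff_opb by blast
        show False using opb_nm[OF c x(1)] x(2) 0 by simp
      qed
      hence pos: "0 < nm x" by (simp add: less_le)
      let ?u = "vsmul (of_real (1 / nm x)) x"
      have "hi N (T ?u) = vsmul (of_real (1 / nm x)) (hi N (T x))"
        using bop_smul[OF bop_comp[OF bop_hi T] x(1)] .
      hence eq: "nm (hi N (T ?u)) = nm (hi N (T x)) / nm x"
        using x(1) pos bop_X[OF T x(1)] by (simp add: norm_divide)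
      have "e < nm (hi N (T ?u))" unfolding eq using x(2) pos by (simp add: pos_less_divide_eq)
      moreover have "nm ?u = 1" using x(1) pos by (simp add: norm_divide)
      ultimately show ?thesis using x(1) by (intro exI[of _ ?u]) auto
    qed
    then obtain u where u: "\<And>N. u N \<in> X" "\<And>N. nm (u N) \<le> 1" "\<And>N. e < nm (hi N (T (u N)))" by metis
    obtain r where r: "strict_mono (r :: nat \<Rightarrow> nat)"
      "\<And>e. e > 0 \<Longrightarrow> \<exists>N. \<forall>m\<ge>N. \<forall>n\<ge>N. nm (T (u (r m)) - T (u (r n))) < e"
      using assms u unfolding cpt_op_def vsub_eq by blast
    obtain M where M: "\<And>m n. m \<ge> M \<Longrightarrow> n \<ge> M \<Longrightarrow> nm (T (u (r m)) - T (u (r n))) < e / 2"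
      using r(2)[of "e / 2"] e by auto
    define y where "y = T (u (r M))"
    have y: "y \<in> X" unfolding y_def using bop_X[OF T] u by blast
    obtain N' where N': "\<And>n. n \<ge> N' \<Longrightarrow> nm (hi n y) < e / 2" using nm_hi_small[OF y, of "e / 2"] e by auto
    define m where "m = max M N'"
    have rm: "r m \<ge> N'" using seq_suble[OF r(1), of m] by (simp add: m_def)
    have Tm: "T (u (r m)) \<in> X" using bop_X[OF T] u by blast
    have "hi (r m) (T (u (r m))) = hi (r m) (T (u (r m)) - y) + hi (r m) y"
      by (simp add: fun_eq_iff pt)
    hence "nm (hi (r m) (T (u (r m)))) \<le> nm (hi (r m) (T (u (r m)) - y)) + nm (hi (r m) y)"
      using nm_triangle[of "hi (r m) (T (u (r m)) - y)" "hi (r m) y"] Tm y by auto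
    also have "nm (hi (r m) (T (u (r m)) - y)) \<le> nm (T (u (r m)) - y)" using Tm y by (intro nm_hi) auto
    also have "\<dots> < e / 2" using M[of m M] by (simp add: y_def m_def)
    also have "nm (hi (r m) y) < e / 2" using N' rm by blast
    finally show False using u(3)[of "r m"] by simp
  qed
qed

text \<open>A subsequence of the images converges in each coordinate. The first N coordinates then
  become Cauchy in norm, and beyond N the difference of two images is at most e/4 times the norm of
  a difference of two unit-ball vectors, which is at most 2.\<close>

lemma cpt_imp_cpt_op:
  assumes "cpt T" shows "cpt_op p T"
  unfolding cpt_op_def vsub_eq
proof (intro conjI allI impI)
  show T: "bop p T" using assms by (simp add: cpt_def)
  then obtain c where c: "opb c T" using bop_iff_opb by blast
  fix x :: "nat \<Rightarrow> nat \<Rightarrow> complex" assume x: "\<forall>n. x n \<in> X \<and> nm (x n) \<le> 1"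
  have TX: "T (x n) \<in> X" for n using c x opb_X by blast
  have bd: "cmod (T (x n) i) \<le> c" for n i
  proof -
    have "cmod (T (x n) i) \<le> c * nm (x n)" using coord_le[OF TX] opb_nm[OF c] x order_trans by blast
    also have "\<dots> \<le> c * 1" using x opb_nonneg[OF c] by (intro mult_left_mono) auto
    finally show ?thesis by simp
  qed
  obtain l r where r: "strict_mono (r :: nat \<Rightarrow> nat)" "\<And>i. (\<lambda>n. T (x (r n)) i) \<longlonglongrightarrow> l i"
    by (rule bounded_coordinates_subseq[of "\<lambda>n. T (x n)" c]) (use bd in auto)
  have "\<exists>N. \<forall>m\<ge>N. \<forall>n\<ge>N. nm (T (x (r m)) - T (x (r n))) < e" if e: "0 < e" for e
  proof -
    obtain N where N: "opb (e / 4) (\<lambda>x. hi N (T x))" using assms e unfolding cpt_def by (meson divide_pos_pos zero_less_numeral)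
    have "(\<lambda>m. \<Sum>i<N. cmod (T (x (r m)) i - l i)) \<longlonglongrightarrow> (\<Sum>i<N. cmod (l i - l i))"
      by (intro tendsto_sum tendsto_norm tendsto_diff r tendsto_const)
    hence "(\<lambda>m. \<Sum>i<N. cmod (T (x (r m)) i - l i)) \<longlonglongrightarrow> 0" by simp
    hence "\<forall>\<^sub>F m in sequentially. (\<Sum>i<N. cmod (T (x (r m)) i - l i)) < e / 4"
      using e by (intro order_tendstoD) auto
    then obtain M where M: "\<And>m. m \<ge> M \<Longrightarrow> (\<Sum>i<N. cmod (T (x (r m)) i - l i)) < e / 4"
      by (auto simp: eventually_sequentially)
    have "nm (T (x (r m)) - T (x (r n))) < e" if mn: "m \<ge> M" "n \<ge> M" for m n
    proof -
      let ?d = "T (x (r m)) - T (x (r n))"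
      have dX: "?d \<in> X" using TX by auto
      have "nm (lo N ?d) \<le> (\<Sum>i<N. cmod (?d i))" by (rule nm_lo_le_sum[OF dX])
      also have "\<dots> \<le> (\<Sum>i<N. cmod (T (x (r m)) i - l i) + cmod (T (x (r n)) i - l i))"
      proof (rule sum_mono)
        fix i
        have "?d i = (T (x (r m)) i - l i) - (T (x (r n)) i - l i)" by (simp add: pt)
        thus "cmod (?d i) \<le> cmod (T (x (r m)) i - l i) + cmod (T (x (r n)) i - l i)"
          using norm_triangle_ineq4 by metis
      qed
      also have "\<dots> < e / 4 + e / 4" unfolding sum.distrib by (intro add_strict_mono M mn)
      finally have 1: "nm (lo N ?d) < e / 2" by simp
      have xx: "x (r m) - x (r n) \<in> X" using x by auto
      have "nm (x (r m) - x (r n)) \<le> nm (x (r m)) + nm (x (r n))" using x by (intro nm_triangle_diff) auto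
      also have "\<dots> \<le> 2" using x by (metis add_mono one_add_one)
      finally have "e / 4 * nm (x (r m) - x (r n)) \<le> e / 4 * 2" using e by (intro mult_left_mono) auto
      hence 2: "nm (hi N ?d) \<le> e / 2"
        using opb_nm[OF N xx] opb_diff[OF c, of "x (r m)" "x (r n)"] x by simp
      show ?thesis using 1 2 nm_le_lo_hi[OF dX, of N] by linarith
    qed
    thus ?thesis by blast
  qed
  with r(1) show "\<exists>r. strict_mono (r :: nat \<Rightarrow> nat) \<and> (\<forall>e>0. \<exists>N. \<forall>m\<ge>N. \<forall>n\<ge>N. nm (T (x (r m)) - T (x (r n))) < e)" by blast
qed

lemma cpt_op_iff: "cpt_op p T \<longleftrightarrow> cpt T"
  using cpt_op_imp_cpt cpt_imp_cpt_op by blast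

lemma cpt_cong: "cpt T \<Longrightarrow> (\<And>x. x \<in> X \<Longrightarrow> S x = T x) \<Longrightarrow> cpt S"
proof (rule cptI)
  assume T: "cpt T" and eq: "\<And>x. x \<in> X \<Longrightarrow> S x = T x"
  show "bop p S" by (rule bop_cong[OF cpt_bop[OF T] eq])
  fix e :: real assume "0 < e"
  then obtain N where N: "opb e (\<lambda>x. hi N (T x))" using T cpt_def by blast
  show "\<exists>N. \<forall>x\<in>X. nm (hi N (S x)) \<le> e * nm x"
    using opb_nm[OF N] eq by (intro exI[of _ N]) simp
qed

lemma cpt_limit:
  assumes T: "bop p T" and "\<And>e. 0 < e \<Longrightarrow> \<exists>K. cpt K \<and> opb e (\<lambda>x. T x - K x)"
  shows "cpt T"
proof (rule cptI[OF T])
  fix e :: real assume e: "0 < e"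
  then obtain K where K: "cpt K" "opb (e / 2) (\<lambda>x. T x - K x)" using assms(2)[of "e / 2"] by auto
  obtain N where N: "opb (e / 2) (\<lambda>x. hi N (K x))" using K(1) e unfolding cpt_def by (meson half_gt_zero)
  have "opb (1 * (e / 2) + e / 2) (\<lambda>x. hi N (T x - K x) + hi N (K x))"
    by (intro opb_plus opb_comp[OF opb_hi] K N)
  hence "opb e (\<lambda>x. hi N (T x))" by (rule opb_cong[OF opb_mono]) (auto simp: fun_eq_iff pt)
  thus "\<exists>N. \<forall>x\<in>X. nm (hi N (T x)) \<le> e * nm x" using opb_nm by blast
qed

lemma cpt_0: "cpt (\<lambda>x. 0)"
proof (rule cptI)
  have "hi 0 0 = 0" by (simp add: fun_eq_iff pt)
  thus "0 < e \<Longrightarrow> \<exists>N. \<forall>x\<in>X. nm (hi N 0) \<le> e * nm x" for e by (intro exI[of _ 0]) auto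
qed simp

lemma cpt_comp_right:
  assumes "cpt T" "bop p S" shows "cpt (\<lambda>x. T (S x))"
proof (rule cptI)
  obtain c where c: "opb c S" using assms bop_iff_opb by blast
  fix e :: real assume e: "0 < e"
  obtain N where N: "opb (e / (c + 1)) (\<lambda>x. hi N (T x))"
    using assms(1) e opb_nonneg[OF c] unfolding cpt_def by (meson add_nonneg_pos divide_pos_pos zero_less_one)
  have "e / (c + 1) * c \<le> e" using e opb_nonneg[OF c] by (simp add: field_simps)
  with opb_comp_le[OF N c] have "opb e (\<lambda>x. hi N (T (S x)))" by blast
  thus "\<exists>N. \<forall>x\<in>X. nm (hi N (T (S x))) \<le> e * nm x" using opb_nm by blast
qed (rule bop_comp[OF cpt_bop[OF assms(1)] assms(2)])

lemma cpt_add: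
  assumes "cpt S" "cpt T" shows "cpt (\<lambda>x. S x + T x)"
proof (rule cptI)
  fix e :: real assume e: "0 < e"
  obtain N1 where N1: "\<And>n. n \<ge> N1 \<Longrightarrow> opb (e / 2) (\<lambda>x. hi n (S x))" using cpt_hi_small[OF assms(1), of "e / 2"] e by auto
  obtain N2 where N2: "\<And>n. n \<ge> N2 \<Longrightarrow> opb (e / 2) (\<lambda>x. hi n (T x))" using cpt_hi_small[OF assms(2), of "e / 2"] e by auto
  have "opb (e / 2 + e / 2) (\<lambda>x. hi (max N1 N2) (S x) + hi (max N1 N2) (T x))"
    by (intro opb_plus N1 N2) auto
  hence "opb e (\<lambda>x. hi (max N1 N2) (S x + T x))" by (rule opb_cong[OF opb_mono]) (auto simp: fun_eq_iff pt)
  thus "\<exists>N. \<forall>x\<in>X. nm (hi N (S x + T x)) \<le> e * nm x" using opb_nm by blast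
qed (use assms bop_plus cpt_bop in blast)

lemma cpt_finite_rank: "bop p S \<Longrightarrow> cpt (\<lambda>x. S (lo m x))"
proof (rule cptI)
  assume S: "bop p S"
  show "bop p (\<lambda>x. S (lo m x))" using bop_comp[OF S bop_lo] .
  fix e :: real assume "0 < e"
  then obtain N where N: "opb e (\<lambda>x. hi N (S (lo m x)))" using hi_op_lo_small[OF S] by blast
  show "\<exists>N. \<forall>x\<in>X. nm (hi N (S (lo m x))) \<le> e * nm x"
    using opb_nm[OF N] by (intro exI[of _ N]) blast
qed

text \<open>Truncation replaces T by \<open>lo N\<close> after T up to a small norm error, and S
  composed with \<open>lo N\<close> has finite rank.\<close>

lemma cpt_comp_left:
  assumes "bop p S" "cpt T" shows "cpt (\<lambda>x. S (T x))"
proof (rule cpt_limit)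
  show "bop p (\<lambda>x. S (T x))" by (rule bop_comp[OF assms(1) cpt_bop[OF assms(2)]])
  obtain c where c: "opb c S" using assms bop_iff_opb by blast
  fix e :: real assume e: "0 < e"
  obtain N where N: "opb (e / (c + 1)) (\<lambda>x. hi N (T x))"
    using assms(2) e opb_nonneg[OF c] unfolding cpt_def by (meson add_nonneg_pos divide_pos_pos zero_less_one)
  have K: "cpt (\<lambda>x. S (lo N (T x)))"
    by (rule cpt_comp_right[OF cpt_finite_rank[OF assms(1)] cpt_bop[OF assms(2)]])
  have "c * (e / (c + 1)) \<le> e" using e opb_nonneg[OF c] by (simp add: field_simps)
  with opb_comp_le[OF c N] have h: "opb e (\<lambda>x. S (hi N (T x)))" by blast
  have "S (T x) - S (lo N (T x)) = S (hi N (T x))" if "x \<in> X" for x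
    using opb_add[OF c, of "lo N (T x)" "hi N (T x)"] bop_X[OF cpt_bop[OF assms(2)] that] by (simp add: lo_plus_hi)
  hence "opb e (\<lambda>x. S (T x) - S (lo N (T x)))" by (rule opb_cong[OF h])
  with K show "\<exists>K. cpt K \<and> opb e (\<lambda>x. S (T x) - K x)" by blast
qed

lemma cpt_scale: "cpt T \<Longrightarrow> cpt (\<lambda>x. vsmul k (T x))"
  using cpt_comp_left[OF bop_scale[OF bop_id]] .

lemma cpt_diff: "cpt S \<Longrightarrow> cpt T \<Longrightarrow> cpt (\<lambda>x. S x - T x)"
  using cpt_add[OF _ cpt_scale[of T "-1"]] by simp

lemma cpt_sum: "(\<And>i. i \<in> A \<Longrightarrow> cpt (T i)) \<Longrightarrow> cpt (\<lambda>x. \<Sum>i\<in>A. T i x)"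
proof (induction A rule: infinite_finite_induct)
  case (insert a A)
  have "cpt (\<lambda>x. T a x + (\<Sum>i\<in>A. T i x))"
    by (rule cpt_add) (use insert in auto)
  thus ?case unfolding sum.insert[OF insert.hyps] .
qed (use cpt_0 in simp_all)

text \<open>The counterpart of \<open>cpt_hi_small\<close> for tails of the argument. After T is cut
  to finitely many output coordinates this is \<open>lo_op_hi_small\<close>, so it again rests on 1
  < p.\<close>

lemma cpt_op_hi_small:
  assumes "cpt T" "0 < e" shows "\<exists>N. \<forall>n\<ge>N. opb e (\<lambda>x. T (hi n x))"
proof -
  obtain m where m: "opb (e / 2) (\<lambda>x. hi m (T x))" using assms unfolding cpt_def by (meson half_gt_zero)
  obtain N where N: "\<And>n. n \<ge> N \<Longrightarrow> opb (e / 2) (\<lambda>x. lo m (T (hi n x)))"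
    using lo_op_hi_small[OF cpt_bop[OF assms(1)], of "e / 2" m] assms by auto
  have "opb e (\<lambda>x. T (hi n x))" if "n \<ge> N" for n
  proof -
    have "opb (e / 2 + e / 2 * 1) (\<lambda>x. lo m (T (hi n x)) + hi m (T (hi n x)))"
      using opb_plus[OF N[OF that] opb_comp[OF m opb_hi]] .
    thus ?thesis by (simp add: lo_plus_hi)
  qed
  thus ?thesis by blast
qed

text \<open>Boundedness of both sides is built in, which makes this a congruence for composition;
  compactness of the difference alone would not.\<close>

definition ess :: "((nat \<Rightarrow> complex) \<Rightarrow> (nat \<Rightarrow> complex)) \<Rightarrow> ((nat \<Rightarrow> complex) \<Rightarrow> (nat \<Rightarrow> complex)) \<Rightarrow> bool" where
  "ess T U \<longleftrightarrow> bop p T \<and> bop p U \<and> cpt (\<lambda>x. T x - U x)"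

lemma essD: "ess T U \<Longrightarrow> cpt (\<lambda>x. T x - U x)" "ess T U \<Longrightarrow> bop p T" "ess T U \<Longrightarrow> bop p U"
  by (auto simp: ess_def)

lemma ess_eqI: "bop p T \<Longrightarrow> bop p U \<Longrightarrow> ess_eq p T U \<Longrightarrow> ess T U"
  by (simp add: ess_def ess_eq_def cpt_op_iff vsub_eq)

lemma ess_eq_if_ess: "ess T U \<Longrightarrow> ess_eq p T U"
  by (simp add: ess_def ess_eq_def cpt_op_iff vsub_eq)

lemma ess_refl: "bop p T \<Longrightarrow> ess T T"
  using cpt_0 by (simp add: ess_def)

lemma ess_of_eq: "bop p U \<Longrightarrow> (\<And>x. x \<in> X \<Longrightarrow> T x = U x) \<Longrightarrow> ess T U"
  unfolding ess_def using bop_cong[of U T] cpt_cong[OF cpt_0, of "\<lambda>x. T x - U x"] by auto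

lemma ess_sym: "ess T U \<Longrightarrow> ess U T"
  unfolding ess_def using cpt_scale[of "\<lambda>x. T x - U x" "-1"] by simp

lemma ess_trans: "ess T U \<Longrightarrow> ess U V \<Longrightarrow> ess T V"
  unfolding ess_def using cpt_add[of "\<lambda>x. T x - U x" "\<lambda>x. U x - V x"] by simp

lemma ess_plus: "ess T U \<Longrightarrow> ess T' U' \<Longrightarrow> ess (\<lambda>x. T x + T' x) (\<lambda>x. U x + U' x)"
  unfolding ess_def using cpt_add[of "\<lambda>x. T x - U x" "\<lambda>x. T' x - U' x"] bop_plus by (simp add: algebra_simps)

lemma ess_scale: "ess T U \<Longrightarrow> ess (\<lambda>x. vsmul k (T x)) (\<lambda>x. vsmul k (U x))"
  unfolding ess_def using cpt_scale[of "\<lambda>x. T x - U x" k] bop_scale by (simp add: vsmul_algebra)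

lemma ess_minus: "ess T U \<Longrightarrow> ess T' U' \<Longrightarrow> ess (\<lambda>x. T x - T' x) (\<lambda>x. U x - U' x)"
  using ess_plus[OF _ ess_scale[of T' U' "-1"], of T U] by simp

lemma ess_comp:
  assumes "ess T U" "ess T' U'" shows "ess (\<lambda>x. T (T' x)) (\<lambda>x. U (U' x))"
proof -
  have "cpt (\<lambda>x. T (T' x - U' x) + (T (U' x) - U (U' x)))"
    using cpt_add[OF cpt_comp_left[OF essD(2)[OF assms(1)] essD(1)[OF assms(2)]]
        cpt_comp_right[OF essD(1)[OF assms(1)] essD(3)[OF assms(2)]]] .
  hence "cpt (\<lambda>x. T (T' x) - U (U' x))"
    by (rule cpt_cong) (use assms in \<open>simp add: ess_def bop_diff bop_X\<close>)
  thus ?thesis using bop_comp[OF essD(2)[OF assms(1)] essD(2)[OF assms(2)]]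
      bop_comp[OF essD(3)[OF assms(1)] essD(3)[OF assms(2)]] unfolding ess_def by blast
qed

lemma ess_comp_left: "bop p S \<Longrightarrow> ess T U \<Longrightarrow> ess (\<lambda>x. S (T x)) (\<lambda>x. S (U x))"
  using ess_comp[OF ess_refl] .

lemma ess_comp_right: "ess T U \<Longrightarrow> bop p S \<Longrightarrow> ess (\<lambda>x. T (S x)) (\<lambda>x. U (S x))"
  using ess_comp[OF _ ess_refl] .

lemma ess_sum: "(\<And>i. i \<in> A \<Longrightarrow> ess (T i) (U i)) \<Longrightarrow> ess (\<lambda>x. \<Sum>i\<in>A. T i x) (\<lambda>x. \<Sum>i\<in>A. U i x)"
  unfolding ess_def using bop_sum[of A T] bop_sum[of A U] cpt_sum[of A "\<lambda>i x. T i x - U i x"]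
  by (simp add: sum_subtractf)

lemma cpt_ess: "cpt T \<Longrightarrow> ess S T \<Longrightarrow> cpt S"
  using cpt_add[of T "\<lambda>x. S x - T x"] by (simp add: ess_def)

end

section \<open>Calkin norm and quasicentral weights\<close>

context lp_space
begin

lemma opnorm_le:
  assumes "opb c T" shows "opnorm p T \<le> c"
  unfolding opnorm_def
proof (rule cSup_least)
  have "nm (T 0) \<in> {nm (T x) |x. x \<in> X \<and> nm x \<le> 1}" by (rule CollectI, rule exI[of _ 0]) simp
  thus "{nm (T x) |x. x \<in> X \<and> nm x \<le> 1} \<noteq> {}" by blast
  fix t assume "t \<in> {nm (T x) |x. x \<in> X \<and> nm x \<le> 1}"
  then obtain x where x: "x \<in> X" "nm x \<le> 1" "t = nm (T x)" by blast
  have "nm (T x) \<le> c * nm x" using opb_nm[OF assms x(1)] .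
  also have "\<dots> \<le> c * 1" using x opb_nonneg[OF assms] by (intro mult_left_mono) auto
  finally show "t \<le> c" using x by simp
qed

lemma opnorm_upper:
  assumes "bop p T" "x \<in> X" "nm x \<le> 1" shows "nm (T x) \<le> opnorm p T"
proof -
  obtain c where c: "opb c T" using assms bop_iff_opb by blast
  have "bdd_above {nm (T x) |x. x \<in> X \<and> nm x \<le> 1}"
  proof (rule bdd_aboveI)
    fix t assume "t \<in> {nm (T x) |x. x \<in> X \<and> nm x \<le> 1}"
    then obtain x where x: "x \<in> X" "nm x \<le> 1" "t = nm (T x)" by blast
    have "nm (T x) \<le> c * nm x" using opb_nm[OF c x(1)] .
    also have "\<dots> \<le> c * 1" using x opb_nonneg[OF c] by (intro mult_left_mono) auto
    finally show "t \<le> c" using x by simp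
  qed
  thus ?thesis unfolding opnorm_def using assms by (intro cSup_upper) auto
qed

lemma opnorm_nonneg: "bop p T \<Longrightarrow> 0 \<le> opnorm p T"
  using order_trans[OF nm_nonneg opnorm_upper[of T 0]] by simp

lemma opb_opnorm:
  assumes "bop p T" shows "opb (opnorm p T) T"
proof (rule opbI_bop[OF assms opnorm_nonneg[OF assms]])
  fix x assume x: "x \<in> X"
  show "nm (T x) \<le> opnorm p T * nm x"
  proof (cases "nm x = 0")
    case True
    obtain c where c: "opb c T" using assms bop_iff_opb by blast
    show ?thesis using opb_nm[OF c x] True by simp
  next
    case False
    hence pos: "0 < nm x" by (simp add: less_le)
    have "nm (T (vsmul (of_real (1 / nm x)) x)) \<le> opnorm p T"
      by (rule opnorm_upper[OF assms]) (use x pos in \<open>auto simp: norm_divide\<close>)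
    hence "nm (T x) / nm x \<le> opnorm p T"
      using bop_smul[OF assms x] bop_X[OF assms x] pos by (simp add: norm_divide)
    thus ?thesis using pos by (simp add: pos_divide_le_eq)
  qed
qed

lemma calkin_norm_le:
  assumes "bop p T" "cpt K" "opb c (\<lambda>x. T x + K x)" shows "calkin_norm p T \<le> c"
proof -
  have "calkin_norm p T \<le> opnorm p (\<lambda>x. T x + K x)"
    unfolding calkin_norm_def vadd_eq cpt_op_iff
  proof (rule cInf_lower)
    show "bdd_below {opnorm p (\<lambda>x. T x + K x) |K. cpt K}"
      using opnorm_nonneg bop_plus[OF assms(1) cpt_bop] by (intro bdd_belowI[of _ 0]) blast
  qed (use assms in blast)
  also have "\<dots> \<le> c" by (rule opnorm_le[OF assms(3)])
  finally show ?thesis .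
qed

lemma calkin_norm_le_opnorm: "bop p T \<Longrightarrow> calkin_norm p T \<le> opnorm p T"
  using calkin_norm_le[OF _ cpt_0] opb_opnorm by simp

lemma calkin_norm_obtain:
  assumes "bop p T" "calkin_norm p T \<le> c" "0 < e"
  obtains K where "cpt K" "opb (c + e) (\<lambda>x. T x + K x)"
proof -
  have "Inf {opnorm p (\<lambda>x. T x + K x) |K. cpt K} < c + e"
    using assms unfolding calkin_norm_def vadd_eq cpt_op_iff by linarith
  then obtain t where "t \<in> {opnorm p (\<lambda>x. T x + K x) |K. cpt K}" "t < c + e"
    using cInf_lessD[of "{opnorm p (\<lambda>x. T x + K x) |K. cpt K}"] cpt_0 by blast
  then obtain K where K: "cpt K" "opnorm p (\<lambda>x. T x + K x) < c + e" by blast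
  have "opb (c + e) (\<lambda>x. T x + K x)"
    by (rule opb_mono[OF opb_opnorm]) (use K bop_plus[OF assms(1) cpt_bop[OF K(1)]] in auto)
  with K that show ?thesis by blast
qed

lemma calkin_norm_ge:
  assumes "bop p T" "\<And>K r. cpt K \<Longrightarrow> opb r (\<lambda>x. T x + K x) \<Longrightarrow> c \<le> r"
  shows "c \<le> calkin_norm p T"
  unfolding calkin_norm_def vadd_eq cpt_op_iff
proof (rule cInf_greatest)
  show "{opnorm p (\<lambda>x. T x + K x) |K. cpt K} \<noteq> {}" using cpt_0 by blast
  fix t assume "t \<in> {opnorm p (\<lambda>x. T x + K x) |K. cpt K}"
  then obtain K where K: "cpt K" "t = opnorm p (\<lambda>x. T x + K x)" by blast
  show "c \<le> t" unfolding K(2)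
    by (rule assms(2)[OF K(1) opb_opnorm[OF bop_plus[OF assms(1) cpt_bop[OF K(1)]]]])
qed

text \<open>A bounded separated sequence of eigenvectors survives compact perturbation: a compact
  operator sends two of the vectors to nearly equal images, so on their difference the perturbed
  operator still acts almost as the scalar k.\<close>

lemma eigen_calkin_lower:
  assumes "ess T U" and u: "\<And>j::nat. u j \<in> X" "\<And>j. nm (u j) \<le> C"
    and sep: "0 < s" "\<And>i j. i \<noteq> j \<Longrightarrow> s \<le> nm (u i - u j)"
    and eig: "\<And>j. U (u j) = vsmul k (u j)"
  shows "cmod k \<le> calkin_norm p T"
proof (rule calkin_norm_ge)
  show T: "bop p T" using assms(1) by (rule essD)
  fix K r assume K: "cpt K" and r: "opb r (\<lambda>x. T x + K x)"
  \<comment> \<open>Both compact errors are collected here, so that T + K equals U + K'.\<close>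
  define K' where "K' = (\<lambda>x. (T x - U x) + K x)"
  have K': "cpt K'" unfolding K'_def by (rule cpt_add[OF essD(1)[OF assms(1)] K])
  obtain b where b: "opb b K'" using cpt_bop[OF K'] bop_iff_opb by blast
  have U: "bop p U" using assms(1) by (rule essD)
  show "cmod k \<le> r"
  proof (rule ccontr)
    assume "\<not> cmod k \<le> r"
    hence g: "0 < cmod k - r" by simp
    define C' where "C' = C + 1"
    have C': "0 < C'" using order_trans[OF nm_nonneg u(2)[of 0]] by (simp add: C'_def)
    define v where "v j = vsmul (of_real (1 / C')) (u j)" for j
    have vX: "v j \<in> X" for j using u[of j] by (simp add: v_def)
    have nv: "nm (v j) \<le> 1" for j
    proof -
      have "nm (v j) = nm (u j) / C'" using u[of j] C' by (simp add: v_def norm_divide)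
      also have "\<dots> \<le> 1" using u(2)[of j] C' by (simp add: pos_divide_le_eq C'_def)
      finally show ?thesis .
    qed
    have "0 < (cmod k - r) * s / C'" using g sep C' by simp
    then obtain q N where q: "strict_mono (q :: nat \<Rightarrow> nat)"
      "\<And>m n. m \<ge> N \<Longrightarrow> n \<ge> N \<Longrightarrow> nm (K' (v (q m)) - K' (v (q n))) < (cmod k - r) * s / C'"
      using cpt_imp_cpt_op[OF K'] nv vX unfolding cpt_op_def vsub_eq by metis
    define i j where "i = q N" and "j = q (Suc N)"
    have ij: "i \<noteq> j" using q(1) unfolding i_def j_def by (metis n_not_Suc_n strict_mono_eq)
    have dX: "u i - u j \<in> X" using u by auto
    have "K' (v i) - K' (v j) = vsmul (of_real (1 / C')) (K' (u i - u j))"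
      using u by (simp add: v_def opb_smul[OF b] opb_diff[OF b] vsmul_algebra)
    hence "nm (K' (u i - u j)) / C' < (cmod k - r) * s / C'"
      using q(2)[of N "Suc N"] C' opb_X[OF b dX] by (simp add: i_def j_def norm_divide)
    hence small: "nm (K' (u i - u j)) < (cmod k - r) * s" using C' by (simp add: divide_less_cancel)
    have eq: "vsmul k (u i - u j) = (T (u i - u j) + K (u i - u j)) - K' (u i - u j)"
      using eig u by (simp add: K'_def bop_diff[OF U] vsmul_algebra)
    have "cmod k * nm (u i - u j) = nm (vsmul k (u i - u j))" using dX by simp
    also have "\<dots> \<le> nm (T (u i - u j) + K (u i - u j)) + nm (K' (u i - u j))"
      unfolding eq by (rule nm_triangle_diff) (use opb_X[OF r dX] opb_X[OF b dX] in auto)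
    also have "\<dots> < r * nm (u i - u j) + (cmod k - r) * s"
      using opb_nm[OF r dX] small by linarith
    finally have "(cmod k - r) * nm (u i - u j) < (cmod k - r) * s" by (simp add: algebra_simps)
    with g sep(2)[OF ij] show False by (simp add: mult_less_cancel_left_pos)
  qed
qed

text \<open>A compact operator dies on the tails of its argument and of its image, so a bound modulo
  compacts becomes a norm bound behind a sufficiently late cut, on either side.\<close>

lemma ess_bound_hi:
  assumes T: "bop p T" and K: "cpt K" and c: "opb c (\<lambda>x. T x + K x)" and e: "0 < e"
  shows "\<exists>N. \<forall>n\<ge>N. opb (c + e) (\<lambda>x. T (hi n x)) \<and> opb (c + e) (\<lambda>x. hi n (T x))"
proof -
  obtain N1 where N1: "\<And>n. n \<ge> N1 \<Longrightarrow> opb e (\<lambda>x. K (hi n x))" using cpt_op_hi_small[OF K e] by blast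
  obtain N2 where N2: "\<And>n. n \<ge> N2 \<Longrightarrow> opb e (\<lambda>x. hi n (K x))" using cpt_hi_small[OF K e] by blast
  have "opb (c + e) (\<lambda>x. T (hi n x)) \<and> opb (c + e) (\<lambda>x. hi n (T x))" if n: "n \<ge> max N1 N2" for n
  proof
    have "opb (c * 1 + e) (\<lambda>x. (T (hi n x) + K (hi n x)) - K (hi n x))"
      by (rule opb_minus_op[OF opb_comp[OF c opb_hi] N1]) (use n in simp)
    thus "opb (c + e) (\<lambda>x. T (hi n x))" by simp
    have "opb (1 * c + e) (\<lambda>x. hi n (T x + K x) - hi n (K x))"
      by (rule opb_minus_op[OF opb_comp[OF opb_hi c] N2]) (use n in simp)
    hence "opb (c + e) (\<lambda>x. hi n (T x + K x) - hi n (K x))" by simp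
    thus "opb (c + e) (\<lambda>x. hi n (T x))" by (rule opb_cong) (auto simp: fun_eq_iff pt)
  qed
  thus ?thesis by blast
qed

section \<open>Coordinate blocks, almost tridiagonal operators and quasicentral weights\<close>

definition blk :: "nat \<Rightarrow> nat \<Rightarrow> (nat \<Rightarrow> complex) \<Rightarrow> nat \<Rightarrow> complex" where
  "blk a b x = hi a (lo b x)"

lemma blk_apply: "blk a b x i = (if a \<le> i \<and> i < b then x i else 0)"
  by (simp add: blk_def pt)

lemma opb_blk: "opb 1 (blk a b)"
  unfolding blk_def using opb_comp[OF opb_hi opb_lo] by simp

lemma blk_X [simp]: "x \<in> X \<Longrightarrow> blk a b x \<in> X"
  by (simp add: blk_def)

text \<open>Distinct blocks have disjoint supports, so p-th powers of norms add up in the range as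
  well as in the domain, and the sum over all blocks is bounded by c instead of c times their
  number. It is used with the pairs (j, j+1) and (j+1, j).\<close>

lemma block_diagonal_bound:
  assumes M: "strict_mono M" and T: "opb c T" and x: "x \<in> X" and A: "finite A"
    and f: "inj_on f A" and g: "inj_on g A"
  shows "nm (\<Sum>j\<in>A. blk (M (f j)) (M (Suc (f j))) (T (blk (M (g j)) (M (Suc (g j))) x))) \<le> c * nm x"
proof -
  define B where "B j = blk (M j) (M (Suc j))" for j
  have uniq: "a = b" if "B a y i \<noteq> 0" "B b z i \<noteq> 0" for a b y z i
  proof -
    have "M a \<le> i" "i < M (Suc a)" "M b \<le> i" "i < M (Suc b)"
      using that unfolding B_def blk_apply by presburger+
    hence "M a < M (Suc b)" "M b < M (Suc a)" by linarith+
    hence "a < Suc b" "b < Suc a" using strict_mono_less[OF M] by blast+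
    thus ?thesis by simp
  qed
  have dis: "en p (\<lambda>i. \<Sum>j\<in>A. B (h j) (y j) i) = (\<Sum>j\<in>A. en p (B (h j) (y j)))"
    if "inj_on h A" for h and y :: "_ \<Rightarrow> nat \<Rightarrow> complex"
  proof (rule en_disjoint_sum[OF A])
    fix i a b assume "a \<in> A" "b \<in> A" "B (h a) (y a) i \<noteq> 0" "B (h b) (y b) i \<noteq> 0"
    with uniq[of "h a" "y a" i "h b" "y b"] that show "a = b" by (auto dest: inj_onD)
  qed
  have eqf: "(\<Sum>j\<in>A. B (h j) (y j)) = (\<lambda>i. \<Sum>j\<in>A. B (h j) (y j) i)" for h and y :: "_ \<Rightarrow> nat \<Rightarrow> complex"
    by (simp add: fun_eq_iff pt)
  have 1: "en p (B (f j) (T (B (g j) x))) \<le> ennreal (c powr p) * en p (B (g j) x)" for j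
    by (rule en_leI) (use x T opb_X[OF opb_blk] opb_X[OF T] opb_nonneg opb_nm[OF opb_comp[OF opb_blk T]] in \<open>auto simp: B_def\<close>)
  have "en p (\<Sum>j\<in>A. B (f j) (T (B (g j) x))) = (\<Sum>j\<in>A. en p (B (f j) (T (B (g j) x))))"
    unfolding eqf by (rule dis[OF f])
  also have "\<dots> \<le> (\<Sum>j\<in>A. ennreal (c powr p) * en p (B (g j) x))" by (intro sum_mono 1)
  also have "\<dots> = ennreal (c powr p) * (\<Sum>j\<in>A. en p (B (g j) x))" by (simp add: sum_distrib_left)
  also have "(\<Sum>j\<in>A. en p (B (g j) x)) = en p (\<lambda>i. \<Sum>j\<in>A. B (g j) x i)" by (rule dis[OF g, symmetric])
  also have "\<dots> \<le> en p x"
  proof (rule en_mono)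
    fix i
    show "cmod (\<Sum>j\<in>A. B (g j) x i) \<le> cmod (x i)"
    proof (cases "\<exists>j\<in>A. B (g j) x i \<noteq> 0")
      case True
      then obtain j where j: "j \<in> A" "B (g j) x i \<noteq> 0" by blast
      have "(\<Sum>j\<in>A. B (g j) x i) = (\<Sum>j\<in>{j}. B (g j) x i)"
      proof (rule sum.mono_neutral_right)
        show "\<forall>k\<in>A - {j}. B (g k) x i = 0" using uniq j g by (metis Diff_iff inj_onD singletonI)
      qed (use j A in auto)
      thus ?thesis by (simp add: B_def blk_apply)
    qed simp
  qed simp
  finally have "en p (\<Sum>j\<in>A. B (f j) (T (B (g j) x))) \<le> ennreal (c powr p) * en p x"
    by (simp add: mult_left_mono)
  from en_le_imp(2)[OF this x opb_nonneg[OF T]] show ?thesis by (simp add: B_def)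
qed

lemma lo_add: "lo n (x + y) = lo n x + lo n y" and hi_add: "hi n (x + y) = hi n x + hi n y"
  by (auto simp: fun_eq_iff pt)

text \<open>For the projection R = \<open>lo m1\<close> one has R T - T R = R T (1 - R) - (1 - R) T
  R. Cutting further at m0 and m2 leaves one corner of each product between neighbouring blocks; the
  four discarded corners cost \<delta> each.\<close>

lemma commutator_lo_split:
  assumes T: "opb c T" and x: "x \<in> X" and d: "0 \<le> \<delta>" and ord: "m0 < m1" "m1 < m2"
    and h: "opb \<delta> (\<lambda>x. hi m1 (T (lo m0 x)))" "opb \<delta> (\<lambda>x. hi m2 (T (lo m1 x)))"
    and l: "opb \<delta> (\<lambda>x. lo m0 (T (hi m1 x)))" "opb \<delta> (\<lambda>x. lo m1 (T (hi m2 x)))"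
  shows "nm ((lo m1 (T x) - T (lo m1 x)) - (blk m0 m1 (T (blk m1 m2 x)) - blk m1 m2 (T (blk m0 m1 x)))) \<le> 4 * \<delta> * nm x"
proof -
  note TX = opb_X[OF T]
  have s1: "T x = T (lo m1 x) + T (hi m1 x)"
    using opb_add[OF T, of "lo m1 x" "hi m1 x"] x by (simp add: lo_plus_hi)
  have b1: "hi m1 x = blk m1 m2 x + hi m2 x" "lo m1 x = blk m0 m1 x + lo m0 x"
    using ord by (auto simp: fun_eq_iff pt blk_apply)
  have b2: "lo m1 y = blk m0 m1 y + lo m0 y" "hi m1 y = blk m1 m2 y + hi m2 y" for y
    using ord by (auto simp: fun_eq_iff pt blk_apply)
  have c1: "lo m1 (T x) - T (lo m1 x) = lo m1 (T (hi m1 x)) - hi m1 (T (lo m1 x))"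
  proof -
    have "lo m1 (T x) = lo m1 (T (lo m1 x)) + lo m1 (T (hi m1 x))"
      by (subst s1) (auto simp: fun_eq_iff pt)
    moreover have "T (lo m1 x) = lo m1 (T (lo m1 x)) + hi m1 (T (lo m1 x))" by (simp add: lo_plus_hi)
    ultimately show ?thesis by (metis (no_types) add_diff_cancel_left)
  qed
  have t1: "T (hi m1 x) = T (blk m1 m2 x) + T (hi m2 x)"
    by (subst b1(1)) (rule opb_add[OF T], use x in auto)
  have t2: "T (lo m1 x) = T (blk m0 m1 x) + T (lo m0 x)"
    by (subst b1(2)) (rule opb_add[OF T], use x in auto)
  have bl: "blk m1 m2 x = hi m1 (lo m2 x)" "blk m0 m1 x = lo m1 (hi m0 x)"
    by (auto simp: fun_eq_iff pt blk_apply)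
  define r where "r = (lo m1 (T (hi m2 x)) + lo m0 (T (hi m1 (lo m2 x)))) - (hi m1 (T (lo m0 x)) + hi m2 (T (lo m1 (hi m0 x))))"
  have "lo m1 (T (hi m1 x)) = blk m0 m1 (T (blk m1 m2 x)) + lo m0 (T (blk m1 m2 x)) + lo m1 (T (hi m2 x))"
    unfolding t1 lo_add b2(1)[of "T (blk m1 m2 x)"] by simp
  moreover have "hi m1 (T (lo m1 x)) = blk m1 m2 (T (blk m0 m1 x)) + hi m2 (T (blk m0 m1 x)) + hi m1 (T (lo m0 x))"
    unfolding t2 hi_add b2(2)[of "T (blk m0 m1 x)"] by simp
  ultimately have req: "(lo m1 (T x) - T (lo m1 x)) - (blk m0 m1 (T (blk m1 m2 x)) - blk m1 m2 (T (blk m0 m1 x))) = r"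
    unfolding c1 r_def using bl by simp
  have n: "nm (lo m1 (T (hi m2 x))) \<le> \<delta> * nm x" "nm (hi m1 (T (lo m0 x))) \<le> \<delta> * nm x"
    using opb_nm[OF l(2) x] opb_nm[OF h(1) x] by auto
  have n1: "nm (lo m0 (T (hi m1 (lo m2 x)))) \<le> \<delta> * nm x"
    using opb_nm[OF l(1) lo_X[OF x]] mult_left_mono[OF nm_lo[OF x] d] order_trans by blast
  have n2: "nm (hi m2 (T (lo m1 (hi m0 x)))) \<le> \<delta> * nm x"
    using opb_nm[OF h(2) hi_X[OF x]] mult_left_mono[OF nm_hi[OF x] d] order_trans by blast
  have "nm r \<le> nm (lo m1 (T (hi m2 x)) + lo m0 (T (hi m1 (lo m2 x)))) + nm (hi m1 (T (lo m0 x)) + hi m2 (T (lo m1 (hi m0 x))))"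
    unfolding r_def by (rule nm_triangle_diff) (use x TX in auto)
  also have "\<dots> \<le> (\<delta> * nm x + \<delta> * nm x) + (\<delta> * nm x + \<delta> * nm x)"
    by (intro add_mono order_trans[OF nm_triangle] n n1 n2) (use x TX in auto)
  finally show ?thesis unfolding req by simp
qed

lemma common_bound:
  assumes "finite F" "\<And>T. T \<in> F \<Longrightarrow> bop p T"
  shows "\<exists>c. \<forall>T\<in>F. opb c T"
  using assms
proof (induction F)
  case (insert T F)
  then obtain c where c: "\<forall>T\<in>F. opb c T" by auto
  obtain d where d: "opb d T" using insert.prems bop_iff_opb by blast
  have "\<forall>S\<in>insert T F. opb (max c d) S" using c d opb_mono by (metis insert_iff max.cobounded1 max.cobounded2)
  thus ?case by blast
qed auto

lemma eventually_all_finite: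
  assumes "finite F" "\<And>T. T \<in> F \<Longrightarrow> \<exists>N::nat. \<forall>n\<ge>N. P T n"
  shows "\<exists>N. \<forall>n\<ge>N. \<forall>T\<in>F. P T n"
  using eventually_ball_finite[OF assms(1), of "\<lambda>n T. P T n" sequentially] assms(2)
  by (simp add: eventually_sequentially)

text \<open>The weight is the average of projections \<open>lo (M j)\<close> along a sequence so sparse that each operator is
  almost block tridiagonal; the commutators with the single projections then have almost disjoint
  supports and ranges, and averaging makes them small.\<close>

lemma quasicentral_weight:
  assumes F: "finite F" "\<And>T. T \<in> F \<Longrightarrow> bop p T" and e: "0 < e"
  shows "\<exists>n1\<ge>n0. \<exists>w. (\<forall>i. 0 \<le> w i \<and> w i \<le> 1) \<and> (\<forall>i<n0. w i = 1) \<and> (\<forall>i\<ge>n1. w i = 0)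
    \<and> (\<forall>T\<in>F. opb e (\<lambda>x. dg w (T x) - T (dg w x)))"
proof -
  obtain c' where c': "\<forall>T\<in>F. opb c' T" using common_bound[OF F] by blast
  define c where "c = max c' 0"
  have c: "opb c T" if "T \<in> F" for T using c' that opb_mono by (auto simp: c_def)
  have c0: "0 \<le> c" by (simp add: c_def)
  \<comment> \<open>The two off-diagonal families each sum to at most c in norm, so averaging over N
    projections leaves 2c / N, which this choice keeps below e / 2.\<close>
  obtain N :: nat where N: "real N > 4 * c / e" using reals_Archimedean2 by blast
  have "0 \<le> 4 * c / e" using c0 e by simp
  with N have N0: "N > 0" by (metis le_less_trans of_nat_0_less_iff)
  \<comment> \<open>The four discarded corners of every commutator then cost 4 * \<delta> = e / 2,
    and averaging does not increase this.\<close>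
  define \<delta> where "\<delta> = e / 8"
  have d: "0 < \<delta>" using e by (simp add: \<delta>_def)
  have "\<exists>m'>m. \<forall>T\<in>F. opb \<delta> (\<lambda>x. hi m' (T (lo m x))) \<and> opb \<delta> (\<lambda>x. lo m (T (hi m' x)))" for m
  proof -
    have "\<exists>N. \<forall>n\<ge>N. \<forall>T\<in>F. opb \<delta> (\<lambda>x. hi n (T (lo m x)))"
      by (rule eventually_all_finite[OF F(1) hi_op_lo_small[OF F(2) d]])
    then obtain N1 where N1: "\<And>n T. n \<ge> N1 \<Longrightarrow> T \<in> F \<Longrightarrow> opb \<delta> (\<lambda>x. hi n (T (lo m x)))" by blast
    have "\<exists>N. \<forall>n\<ge>N. \<forall>T\<in>F. opb \<delta> (\<lambda>x. lo m (T (hi n x)))"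
      by (rule eventually_all_finite[OF F(1) lo_op_hi_small[OF F(2) d]])
    then obtain N2 where N2: "\<And>n T. n \<ge> N2 \<Longrightarrow> T \<in> F \<Longrightarrow> opb \<delta> (\<lambda>x. lo m (T (hi n x)))" by blast
    show ?thesis by (rule exI[of _ "N1 + N2 + m + 1"]) (simp add: N1 N2)
  qed
  then obtain nx where nx: "\<And>m. m < nx m" "\<And>m T. T \<in> F \<Longrightarrow> opb \<delta> (\<lambda>x. hi (nx m) (T (lo m x)))"
    "\<And>m T. T \<in> F \<Longrightarrow> opb \<delta> (\<lambda>x. lo m (T (hi (nx m) x)))" by metis
  define M where "M j = (nx ^^ j) n0" for j
  have MS: "M (Suc j) = nx (M j)" for j by (simp add: M_def)
  have M: "strict_mono M" by (rule strict_monoI_Suc) (simp add: MS nx)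
  \<comment> \<open>Only M 1, ..., M N are averaged. \<open>M 0 = n0\<close> and
    \<open>M (Suc N)\<close> serve as outer neighbours of the first and the last cut.\<close>
  define w where "w i = (\<Sum>j<N. if i < M (Suc j) then 1 else 0) / real N" for i
  have dgw: "dg w x = vsmul (of_real (1 / real N)) (\<Sum>j<N. lo (M (Suc j)) x)" for x
    by (auto simp: fun_eq_iff pt w_def sum_distrib_left sum_distrib_right sum_divide_distrib intro!: sum.cong)
  have w01: "0 \<le> w i \<and> w i \<le> 1" for i
  proof -
    have "(\<Sum>j<N. if i < M (Suc j) then 1 else (0::real)) \<le> (\<Sum>j<N. 1)" by (intro sum_mono) auto
    thus ?thesis using N0 by (auto simp: w_def sum_nonneg)
  qed
  have w1: "w i = 1" if "i < n0" for i
  proof -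
    have "i < M (Suc j)" for j
      using that strict_mono_less_eq[OF M, of 0 "Suc j"] by (simp add: M_def)
    thus ?thesis using N0 by (simp add: w_def)
  qed
  have w0: "w i = 0" if "i \<ge> M (Suc N)" for i
  proof -
    have "\<not> i < M (Suc j)" if "j < N" for j
      using that \<open>i \<ge> M (Suc N)\<close> strict_mono_less_eq[OF M, of "Suc j" "Suc N"] by simp
    thus ?thesis by (simp add: w_def)
  qed
  have com: "opb e (\<lambda>x. dg w (T x) - T (dg w x))" if T: "T \<in> F" for T
  proof (rule opbI_bop)
    have bdg: "bop p (dg w)" by (rule opb_bop[OF opb_dg]) (use w01 in auto)
    show "bop p (\<lambda>x. dg w (T x) - T (dg w x))"
      by (rule bop_minus_op[OF bop_comp[OF bdg F(2)[OF T]] bop_comp[OF F(2)[OF T] bdg]])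
    fix x assume x: "x \<in> X"
    note TX = opb_X[OF c[OF T]]
    define a where "a j = blk (M j) (M (Suc j)) (T (blk (M (Suc j)) (M (Suc (Suc j))) x))" for j
    define b where "b j = blk (M (Suc j)) (M (Suc (Suc j))) (T (blk (M j) (M (Suc j)) x))" for j
    define k where "k j = lo (M (Suc j)) (T x) - T (lo (M (Suc j)) x)" for j
    have aX: "a j \<in> X" and bX: "b j \<in> X" and kX: "k j \<in> X" for j
      using x TX by (auto simp: a_def b_def k_def)
    have na: "nm (\<Sum>j<N. a j) \<le> c * nm x" unfolding a_def
      by (rule block_diagonal_bound[OF M c[OF T] x, of "{..<N}" "\<lambda>j. j" Suc]) auto
    have nb: "nm (\<Sum>j<N. b j) \<le> c * nm x" unfolding b_def
      by (rule block_diagonal_bound[OF M c[OF T] x, of "{..<N}" Suc "\<lambda>j. j"]) auto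
    have nk: "nm (k j - (a j - b j)) \<le> 4 * \<delta> * nm x" for j
      unfolding k_def a_def b_def
      by (rule commutator_lo_split[OF c[OF T] x]) (use d nx T in \<open>auto simp: MS\<close>)
    have eq: "dg w (T x) - T (dg w x) = vsmul (of_real (1 / real N)) (\<Sum>j<N. k j)"
      using x TX by (simp add: dgw opb_smul[OF c[OF T]] opb_sum_arg[OF c[OF T]] k_def sum_subtractf vsmul_algebra sum_X)
    have "(\<Sum>j<N. k j) = ((\<Sum>j<N. a j) - (\<Sum>j<N. b j)) + (\<Sum>j<N. k j - (a j - b j))"
      by (simp add: sum_subtractf)
    hence "nm (\<Sum>j<N. k j) \<le> nm ((\<Sum>j<N. a j) - (\<Sum>j<N. b j)) + nm (\<Sum>j<N. k j - (a j - b j))"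
      using nm_triangle[OF diff_X[OF sum_X[of "{..<N}" a, OF aX] sum_X[of "{..<N}" b, OF bX]]
          sum_X[of "{..<N}" "\<lambda>j. k j - (a j - b j)", OF diff_X[OF kX diff_X[OF aX bX]]]] by simp
    also have "\<dots> \<le> (c * nm x + c * nm x) + real N * (4 * \<delta> * nm x)"
    proof (rule add_mono)
      show "nm ((\<Sum>j<N. a j) - (\<Sum>j<N. b j)) \<le> c * nm x + c * nm x"
        using nm_triangle_diff[OF sum_X[of "{..<N}" a, OF aX] sum_X[of "{..<N}" b, OF bX]] na nb by linarith
      have "nm (\<Sum>j<N. k j - (a j - b j)) \<le> (\<Sum>j<N. nm (k j - (a j - b j)))"
        by (rule nm_sum) (use aX bX kX in auto)
      also have "\<dots> \<le> (\<Sum>j<N. 4 * \<delta> * nm x)" by (intro sum_mono nk)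
      finally show "nm (\<Sum>j<N. k j - (a j - b j)) \<le> real N * (4 * \<delta> * nm x)" by simp
    qed
    finally have S: "nm (\<Sum>j<N. k j) \<le> (2 * c + real N * (4 * \<delta>)) * nm x" by (simp add: algebra_simps)
    have "nm (dg w (T x) - T (dg w x)) = nm (\<Sum>j<N. k j) / real N"
      unfolding eq using sum_X[of "{..<N}" k] kX by (simp add: norm_divide)
    also have "\<dots> \<le> (2 * c + real N * (4 * \<delta>)) * nm x / real N" using S N0 by (simp add: divide_right_mono)
    also have "\<dots> = (2 * c / real N + e / 2) * nm x" using N0 by (simp add: \<delta>_def field_simps)
    also have "\<dots> \<le> e * nm x"
    proof (rule mult_right_mono)
      have "4 * c < e * real N" using N e by (simp add: field_simps)
      hence "2 * c / real N \<le> e / 2" using N0 by (simp add: field_simps)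
      thus "2 * c / real N + e / 2 \<le> e" by simp
    qed simp
    finally show "nm (dg w (T x) - T (dg w x)) \<le> e * nm x" .
  qed (use e in simp)
  have "n0 \<le> M (Suc N)" using strict_mono_less_eq[OF M, of 0 "Suc N"] by (simp add: M_def)
  thus ?thesis using w01 w1 w0 com by blast
qed

end

section \<open>Rademacher sums and Khintchine's inequality\<close>

text \<open>The numbers \<open>e < 2^n\<close> encode the sign vectors of length \<open>n\<close> by their bits.\<close>

definition sg :: "nat \<Rightarrow> nat \<Rightarrow> real" where
  "sg i e = (if bit e i then -1 else 1)"

text \<open>The i-th Rademacher coefficient: an expectation over uniformly distributed sign
  vectors.\<close>

definition co :: "nat \<Rightarrow> nat \<Rightarrow> (nat \<Rightarrow> complex) \<Rightarrow> complex" where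
  "co n i g = (\<Sum>e<2^n. of_real (sg i e) * g e) / 2^n"

lemma abs_sg [simp]: "\<bar>sg i e\<bar> = 1" "sg i e * sg i e = 1"
  by (auto simp: sg_def)

lemma sum_lessThan_double:
  fixes g :: "nat \<Rightarrow> 'a::comm_monoid_add"
  shows "(\<Sum>e<2^Suc n. g e) = (\<Sum>e<2^n. g e) + (\<Sum>e<2^n. g (e + 2^n))"
proof -
  have "(\<Sum>e<2^Suc n. g e) = (\<Sum>e\<in>{0..<2^n}. g e) + (\<Sum>e\<in>{0+2^n..<2^n+2^n}. g e)"
    by (simp add: lessThan_atLeast0 sum.atLeastLessThan_concat mult_2)
  also have "(\<Sum>e\<in>{0+2^n..<2^n+2^n}. g e) = (\<Sum>e\<in>{0..<2^n}. g (e + 2^n))"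
    by (rule sum.shift_bounds_nat_ivl)
  finally show ?thesis by (simp add: lessThan_atLeast0)
qed

lemma sg_shift:
  assumes "e < 2^n"
  shows "i < n \<Longrightarrow> sg i (e + 2^n) = sg i e" "sg n (e + 2^n) = -1" "sg n e = 1"
proof -
  show "sg i (e + 2^n) = sg i e" if "i < n"
  proof -
    have "(2::nat)^n = 2^(n - i) * 2^i" using that by (simp flip: power_add)
    hence "(e + 2^n) div 2^i = e div 2^i + 2^(n - i)" by simp
    moreover have "even ((2::nat)^(n - i))" using that by simp
    ultimately show ?thesis by (simp add: sg_def bit_iff_odd)
  qed
  show "sg n (e + 2^n) = -1" "sg n e = 1" using assms by (auto simp: sg_def bit_iff_odd)
qed

lemma sg_orthogonal:
  "i < n \<Longrightarrow> j < n \<Longrightarrow> (\<Sum>e<2^n. sg i e * sg j e) = (if i = j then 2^n else 0)"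
proof (induction n)
  case (Suc n)
  have "(\<Sum>e<2^Suc n. sg i e * sg j e) = (\<Sum>e<2^n. sg i e * sg j e + sg i (e + 2^n) * sg j (e + 2^n))"
    by (simp only: sum_lessThan_double sum.distrib)
  also have "\<dots> = (if i = j then 2^Suc n else 0)"
  proof (cases "i = n \<or> j = n")
    case True
    thus ?thesis using Suc.prems by (auto simp: sg_shift less_Suc_eq)
  next
    case False
    hence "i < n" "j < n" using Suc.prems by auto
    thus ?thesis using Suc.IH by (simp add: sg_shift flip: sum_distrib_left)
  qed
  finally show ?case .
qed simp

text \<open>The subgaussian estimate cosh a <= exp (a^2), not sharp but sufficient: quadratic bounds
  for exp handle |a| <= 1, and beyond that |a| <= a^2.\<close>

lemma exp_add_exp_minus_le: "exp a + exp (- a) \<le> 2 * exp (a\<^sup>2)" for a :: real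
proof -
  have *: "exp a + exp (- a) \<le> 2 * exp (a\<^sup>2)" if a: "0 \<le> a" for a :: real
  proof (cases "a \<le> 1")
    case True
    have 1: "exp a \<le> 1 + a + a\<^sup>2" using exp_bound[OF a True] .
    have "1 \<le> (1 + a) * (1 - a + a\<^sup>2)" using a by (simp add: algebra_simps power2_eq_square)
    also have "\<dots> \<le> exp a * (1 - a + a\<^sup>2)"
    proof (rule mult_right_mono)
      have "0 \<le> (1 - a)" using True by simp
      thus "0 \<le> 1 - a + a\<^sup>2" by simp
    qed simp
    finally have "exp (- a) \<le> 1 - a + a\<^sup>2" by (simp add: exp_minus field_simps)
    with 1 exp_ge_add_one_self[of "a\<^sup>2"] show ?thesis by linarith
  next
    case False
    hence "a \<le> a\<^sup>2" by (simp add: power2_eq_square)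
    hence "exp a \<le> exp (a\<^sup>2)" "exp (- a) \<le> exp (a\<^sup>2)" using a by auto
    thus ?thesis by linarith
  qed
  show ?thesis using *[of a] *[of "- a"] by (cases "0 \<le> a") auto
qed

text \<open>Independence of the signs: the exponential moment of a Rademacher sum factorises, and
  the induction splits off the last sign.\<close>

lemma sg_exp_moment: "(\<Sum>e<2^n. exp (\<Sum>i<n. a i * sg i e)) \<le> 2^n * exp (\<Sum>i<n. (a i)\<^sup>2)"
proof (induction n)
  case (Suc n)
  have s: "(\<Sum>i<n. a i * sg i (e + 2^n)) = (\<Sum>i<n. a i * sg i e)" if "e < 2^n" for e
    using that by (intro sum.cong) (auto simp: sg_shift)
  have "(\<Sum>e<2^Suc n. exp (\<Sum>i<Suc n. a i * sg i e))
      = (\<Sum>e<2^n. exp (\<Sum>i<n. a i * sg i e) * exp (a n)) + (\<Sum>e<2^n. exp (\<Sum>i<n. a i * sg i e) * exp (- a n))"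
    by (subst sum_lessThan_double, intro arg_cong2[where f="(+)"] sum.cong) (auto simp: s sg_shift exp_add exp_diff exp_minus divide_inverse)
  also have "\<dots> = (\<Sum>e<2^n. exp (\<Sum>i<n. a i * sg i e)) * (exp (a n) + exp (- a n))"
    by (simp add: sum_distrib_right distrib_left)
  also have "\<dots> \<le> (2^n * exp (\<Sum>i<n. (a i)\<^sup>2)) * (2 * exp ((a n)\<^sup>2))"
    by (intro mult_mono Suc.IH exp_add_exp_minus_le) (auto simp: add_nonneg_nonneg)
  finally show ?case by (simp add: exp_add)
qed simp

lemma powr_le_exp:
  fixes t :: real assumes "0 \<le> t" "0 < r" shows "t powr r \<le> r powr r * exp t"
proof (cases "t = 0")
  case False
  hence t: "0 < t" using assms by simp
  have "ln (t / r) \<le> t / r - 1" using t assms by (intro ln_le_minus_one) auto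
  hence "r * ln (t / r) \<le> r * (t / r)" using assms by (intro mult_left_mono) auto
  hence "(t / r) powr r \<le> exp t" using t assms by (simp add: powr_def)
  hence "r powr r * (t / r) powr r \<le> r powr r * exp t" by (intro mult_left_mono) auto
  thus ?thesis using t assms by (simp add: powr_divide)
qed simp

text \<open>Power moments are dominated by exponential moments of s and -s, and for coefficients of
  l^2 norm at most 1 the latter are at most exp 1.\<close>

lemma khintchine_real:
  assumes "0 < r" "(\<Sum>i<n. (a i)\<^sup>2) \<le> 1"
  shows "(\<Sum>e<2^n. \<bar>\<Sum>i<n. a i * sg i e\<bar> powr r) \<le> 2^n * (2 * r powr r * exp 1)"
proof -
  have pt: "\<bar>s\<bar> powr r \<le> r powr r * (exp s + exp (- s))" for s :: real
  proof -
    have "\<bar>s\<bar> powr r \<le> r powr r * exp \<bar>s\<bar>" using assms by (intro powr_le_exp) auto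
    also have "\<dots> \<le> r powr r * (exp s + exp (- s))" by (intro mult_left_mono) (auto simp: abs_if)
    finally show ?thesis .
  qed
  have neg: "(\<Sum>i<n. - a i * sg i e) = - (\<Sum>i<n. a i * sg i e)" for e by (simp add: sum_negf)
  have "(\<Sum>e<2^n. \<bar>\<Sum>i<n. a i * sg i e\<bar> powr r)
      \<le> (\<Sum>e<2^n. r powr r * (exp (\<Sum>i<n. a i * sg i e) + exp (- (\<Sum>i<n. a i * sg i e))))"
    by (intro sum_mono pt)
  also have "\<dots> = r powr r * ((\<Sum>e<2^n. exp (\<Sum>i<n. a i * sg i e)) + (\<Sum>e<2^n. exp (\<Sum>i<n. - a i * sg i e)))"
    unfolding neg by (simp only: distrib_left sum.distrib sum_distrib_left)
  also have "\<dots> \<le> r powr r * (2^n * exp (\<Sum>i<n. (a i)\<^sup>2) + 2^n * exp (\<Sum>i<n. (- a i)\<^sup>2))"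
    by (intro mult_left_mono add_mono sg_exp_moment) auto
  also have "\<dots> \<le> r powr r * (2^n * exp 1 + 2^n * exp 1)"
    using assms by (intro mult_left_mono add_mono) auto
  finally show ?thesis by (simp add: algebra_simps)
qed

text \<open>The real and the imaginary part contribute \<open>2 * r powr r * exp 1\<close> each;
  \<open>2 powr r\<close> is the price of splitting a complex modulus into them.\<close>

definition Kh :: "real \<Rightarrow> real" where
  "Kh r = 2 powr r * (4 * r powr r * exp 1)"

lemma Kh_pos: "0 < r \<Longrightarrow> 0 < Kh r"
  by (simp add: Kh_def)

lemma khintchine:
  fixes a :: "nat \<Rightarrow> complex"
  assumes r: "0 < r" and a: "(\<Sum>i<n. (cmod (a i))\<^sup>2) \<le> 1"
  shows "(\<Sum>e<2^n. cmod (\<Sum>i<n. a i * of_real (sg i e)) powr r) \<le> 2^n * Kh r"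
proof -
  define u where "u e = (\<Sum>i<n. Re (a i) * sg i e)" for e
  define v where "v e = (\<Sum>i<n. Im (a i) * sg i e)" for e
  have "(\<Sum>i<n. (Re (a i))\<^sup>2) \<le> (\<Sum>i<n. (cmod (a i))\<^sup>2)" "(\<Sum>i<n. (Im (a i))\<^sup>2) \<le> (\<Sum>i<n. (cmod (a i))\<^sup>2)"
    by (intro sum_mono; simp add: cmod_power2)+
  with a have "(\<Sum>i<n. (Re (a i))\<^sup>2) \<le> 1" "(\<Sum>i<n. (Im (a i))\<^sup>2) \<le> 1" by linarith+
  hence uv: "(\<Sum>e<2^n. \<bar>u e\<bar> powr r) \<le> 2^n * (2 * r powr r * exp 1)" "(\<Sum>e<2^n. \<bar>v e\<bar> powr r) \<le> 2^n * (2 * r powr r * exp 1)"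
    unfolding u_def v_def by (intro khintchine_real r; simp)+
  have "cmod (\<Sum>i<n. a i * of_real (sg i e)) powr r \<le> 2 powr r * (\<bar>u e\<bar> powr r + \<bar>v e\<bar> powr r)" for e
  proof -
    have "cmod (\<Sum>i<n. a i * of_real (sg i e)) \<le> \<bar>u e\<bar> + \<bar>v e\<bar>"
      using cmod_le[of "\<Sum>i<n. a i * of_real (sg i e)"] by (simp add: u_def v_def)
    also have "\<dots> \<le> 2 * max \<bar>u e\<bar> \<bar>v e\<bar>" by simp
    finally have "cmod (\<Sum>i<n. a i * of_real (sg i e)) powr r \<le> (2 * max \<bar>u e\<bar> \<bar>v e\<bar>) powr r"
      using r by (intro powr_mono2) auto
    also have "\<dots> = 2 powr r * max \<bar>u e\<bar> \<bar>v e\<bar> powr r" by (simp add: powr_mult)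
    also have "\<dots> \<le> 2 powr r * (\<bar>u e\<bar> powr r + \<bar>v e\<bar> powr r)" by (intro mult_left_mono) (auto simp: max_def)
    finally show ?thesis .
  qed
  hence "(\<Sum>e<2^n. cmod (\<Sum>i<n. a i * of_real (sg i e)) powr r) \<le> (\<Sum>e<2^n. 2 powr r * (\<bar>u e\<bar> powr r + \<bar>v e\<bar> powr r))"
    by (intro sum_mono)
  also have "\<dots> = 2 powr r * ((\<Sum>e<2^n. \<bar>u e\<bar> powr r) + (\<Sum>e<2^n. \<bar>v e\<bar> powr r))"
    by (simp only: distrib_left sum.distrib sum_distrib_left)
  also have "\<dots> \<le> 2 powr r * (2^n * (2 * r powr r * exp 1) + 2^n * (2 * r powr r * exp 1))"
    by (intro mult_left_mono add_mono uv) auto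
  finally show ?thesis by (simp add: Kh_def algebra_simps)
qed

text \<open>The dual half of Khintchine's inequality, obtained from Young's inequality by pairing \<open>g\<close>
  with its own Rademacher projection.\<close>

lemma rademacher_coeff_lower:
  fixes g :: "nat \<Rightarrow> complex"
  assumes p: "1 < p" and q: "q = p / (p - 1)" and t: "t = (2 * Kh q) powr (1 / q)"
    and A: "A = sqrt (\<Sum>i<n. (cmod (co n i g))\<^sup>2)"
  shows "2^n * A powr p \<le> 2 * t powr p / p * (\<Sum>e<2^n. cmod (g e) powr p)"
proof (cases "A = 0")
  case True
  thus ?thesis using p by (simp add: sum_nonneg)
next
  case False
  have q1: "1 < q" and pq: "1 / p + 1 / q = 1" using p by (auto simp: q field_simps)
  have A0: "0 < A" using False by (simp add: A less_le sum_nonneg)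
  have t0: "0 < t" using Kh_pos[of q] q1 by (simp add: t)
  have A2: "(\<Sum>i<n. (cmod (co n i g))\<^sup>2) = A\<^sup>2" by (simp add: A sum_nonneg)
  \<comment> \<open>Conjugate coefficients, normalised in l^2: pairing g with the Rademacher sum S
    they define yields \<open>A\<close> times the number of sign vectors, and Khintchine bounds S in
    the dual exponent q.\<close>
  define b where "b i = cnj (co n i g) / of_real A" for i
  have b1: "(\<Sum>i<n. (cmod (b i))\<^sup>2) \<le> 1"
    using A0 A2 by (simp add: b_def norm_divide power_divide flip: sum_divide_distrib)
  define S where "S e = (\<Sum>i<n. b i * of_real (sg i e))" for e
  have "of_real A * 2^n = (\<Sum>e<2^n. g e * S e)"
  proof -
    have "(\<Sum>e<2^n. g e * S e) = (\<Sum>i<n. b i * (\<Sum>e<2^n. of_real (sg i e) * g e))"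
      unfolding S_def sum_distrib_left by (subst sum.swap) (simp add: algebra_simps)
    also have "\<dots> = (\<Sum>i<n. b i * (2^n * co n i g))" by (simp add: co_def)
    also have "\<dots> = (\<Sum>i<n. of_real ((cmod (co n i g))\<^sup>2) * (2^n / of_real A))"
      by (intro sum.cong refl, subst complex_norm_square) (simp add: b_def mult_ac)
    also have "\<dots> = of_real (A\<^sup>2) * (2^n / of_real A)"
      unfolding A2[symmetric] of_real_sum by (simp only: sum_distrib_right)
    also have "\<dots> = of_real A * 2^n" using A0 by (simp add: power2_eq_square)
    finally show ?thesis by simp
  qed
  hence "A * 2^n = cmod (\<Sum>e<2^n. g e * S e)" using A0
    by (metis abs_of_pos norm_mult norm_numeral norm_of_real norm_power)
  also have "\<dots> \<le> (\<Sum>e<2^n. cmod (g e) * cmod (S e))" by (rule order_trans[OF norm_sum]) (simp add: norm_mult)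
  finally have "2^n \<le> (\<Sum>e<2^n. cmod (g e) / A * cmod (S e))"
    using A0 by (simp add: field_simps flip: sum_divide_distrib)
  also have "\<dots> \<le> (\<Sum>e<2^n. t powr p / (p * A powr p) * cmod (g e) powr p + 1 / (q * t powr q) * cmod (S e) powr q)"
  proof (rule sum_mono)
    fix e
    have "(t * (cmod (g e) / A)) * (cmod (S e) / t) \<le> (t * (cmod (g e) / A)) powr p / p + (cmod (S e) / t) powr q / q"
      using A0 t0 p q1 pq by (intro Youngs_inequality) auto
    thus "cmod (g e) / A * cmod (S e) \<le> t powr p / (p * A powr p) * cmod (g e) powr p + 1 / (q * t powr q) * cmod (S e) powr q"
      using A0 t0 by (simp add: powr_mult powr_divide mult.commute)
  qed
  also have "\<dots> = t powr p / (p * A powr p) * (\<Sum>e<2^n. cmod (g e) powr p) + 1 / (q * t powr q) * (\<Sum>e<2^n. cmod (S e) powr q)"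
    by (simp add: sum.distrib sum_distrib_left)
  also have "\<dots> \<le> t powr p / (p * A powr p) * (\<Sum>e<2^n. cmod (g e) powr p) + 1 / (q * t powr q) * (2^n * Kh q)"
    unfolding S_def using q1 t0 by (intro add_left_mono mult_left_mono khintchine b1) auto
  \<comment> \<open>The parameter t of Young's inequality was chosen for this line: the dual term is
    at most half of the left-hand side and is absorbed there.\<close>
  also have "1 / (q * t powr q) * (2^n * Kh q) \<le> 2^n / 2"
  proof -
    have "t powr q = 2 * Kh q" using q1 Kh_pos[of q] by (simp add: t powr_powr)
    thus ?thesis using q1 Kh_pos[of q] by (simp add: field_simps)
  qed
  finally have "2^n / 2 \<le> t powr p / (p * A powr p) * (\<Sum>e<2^n. cmod (g e) powr p)" by linarith
  thus ?thesis using A0 p by (simp add: field_simps)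
qed

text \<open>Khintchine from both sides meets in the l^2 norm of the coefficients, where a multiplier
  bounded by s is trivially bounded by s. The constant does not depend on the number n of signs; all
  coefficients 1 give the Rademacher projection.\<close>

lemma rademacher_multiplier:
  assumes p: "1 < (p::real)"
  shows "\<exists>C\<ge>1. \<forall>n g c s. 0 \<le> s \<longrightarrow> (\<forall>i<n. cmod (c i) \<le> s) \<longrightarrow>
    (\<Sum>e<2^n. cmod (\<Sum>i<n. c i * co n i g * of_real (sg i e)) powr p) \<le> (C * s) powr p * (\<Sum>e<2^n. cmod (g e) powr p)"
proof -
  define q where "q = p / (p - 1)"
  define t where "t = (2 * Kh q) powr (1 / q)"
  define D where "D = Kh p * (2 * t powr p / p)"
  define C where "C = max 1 (D powr (1 / p))"
  have D0: "0 \<le> D" using p Kh_pos[of p] by (simp add: D_def)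
  have DC: "D \<le> C powr p"
  proof -
    have "D = (D powr (1 / p)) powr p" using D0 p by (simp add: powr_powr)
    also have "\<dots> \<le> C powr p" using p by (intro powr_mono2) (auto simp: C_def)
    finally show ?thesis .
  qed
  have main: "(\<Sum>e<2^n. cmod (\<Sum>i<n. c i * co n i g * of_real (sg i e)) powr p) \<le> (C * s) powr p * (\<Sum>e<2^n. cmod (g e) powr p)"
    if s: "0 \<le> s" "\<And>i. i < n \<Longrightarrow> cmod (c i) \<le> s" for n g c s
  proof -
    define A where "A = sqrt (\<Sum>i<n. (cmod (co n i g))\<^sup>2)"
    have A2: "(\<Sum>i<n. (cmod (co n i g))\<^sup>2) = A\<^sup>2" by (simp add: A_def sum_nonneg)
    have A0: "0 \<le> A" by (simp add: A_def sum_nonneg)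
    have low: "2^n * A powr p \<le> 2 * t powr p / p * (\<Sum>e<2^n. cmod (g e) powr p)"
      by (rule rademacher_coeff_lower[OF p q_def t_def A_def])
    have up: "(\<Sum>e<2^n. cmod (\<Sum>i<n. c i * co n i g * of_real (sg i e)) powr p) \<le> 2^n * Kh p * (s * A) powr p"
    proof (cases "s * A = 0")
      case True
      have "c i * co n i g = 0" if i: "i < n" for i
      proof (cases "s = 0")
        case True thus ?thesis using s(2)[OF i] by simp
      next
        case False
        hence "A = 0" using True by simp
        hence "(\<Sum>i<n. (cmod (co n i g))\<^sup>2) = 0" using A2 by simp
        thus ?thesis using i by (subst (asm) sum_nonneg_eq_0_iff) auto
      qed
      hence "(\<Sum>i<n. c i * co n i g * of_real (sg i e)) = 0" for e by (intro sum.neutral) auto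
      thus ?thesis using p True Kh_pos[of p] by simp
    next
      case False
      hence sA: "0 < s * A" using s A0 by (simp add: less_le)
      define b where "b i = c i * co n i g / of_real (s * A)" for i
      have "(\<Sum>i<n. (cmod (b i))\<^sup>2) \<le> (\<Sum>i<n. (cmod (co n i g))\<^sup>2 / A\<^sup>2)"
      proof (rule sum_mono)
        fix i assume "i \<in> {..<n}"
        hence "(cmod (c i))\<^sup>2 \<le> s\<^sup>2" using s by (intro power_mono) auto
        hence "(cmod (c i))\<^sup>2 * (cmod (co n i g))\<^sup>2 / (s\<^sup>2 * A\<^sup>2) \<le> s\<^sup>2 * (cmod (co n i g))\<^sup>2 / (s\<^sup>2 * A\<^sup>2)"
          by (intro divide_right_mono mult_right_mono) auto
        thus "(cmod (b i))\<^sup>2 \<le> (cmod (co n i g))\<^sup>2 / A\<^sup>2"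
          using sA by (cases "s = 0") (simp_all add: b_def norm_mult norm_divide power_mult_distrib power_divide)
      qed
      also have "\<dots> = 1" using A2 sA by (cases "A = 0") (simp_all flip: sum_divide_distrib)
      finally have b1: "(\<Sum>i<n. (cmod (b i))\<^sup>2) \<le> 1" .
      have eq: "c i * co n i g = of_real (s * A) * b i" for i using sA by (cases "s = 0"; cases "A = 0") (simp_all add: b_def)
      have "cmod (\<Sum>i<n. c i * co n i g * of_real (sg i e)) powr p
          = (s * A) powr p * cmod (\<Sum>i<n. b i * of_real (sg i e)) powr p" for e
      proof -
        have "(\<Sum>i<n. c i * co n i g * of_real (sg i e)) = of_real (s * A) * (\<Sum>i<n. b i * of_real (sg i e))"
          unfolding eq sum_distrib_left by (simp add: mult.assoc)
        hence "cmod (\<Sum>i<n. c i * co n i g * of_real (sg i e)) = (s * A) * cmod (\<Sum>i<n. b i * of_real (sg i e))"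
          using sA by (metis abs_of_pos norm_mult norm_of_real)
        thus ?thesis using sA by (simp add: powr_mult)
      qed
      hence "(\<Sum>e<2^n. cmod (\<Sum>i<n. c i * co n i g * of_real (sg i e)) powr p)
          = (s * A) powr p * (\<Sum>e<2^n. cmod (\<Sum>i<n. b i * of_real (sg i e)) powr p)"
        by (simp add: sum_distrib_left)
      also have "\<dots> \<le> (s * A) powr p * (2^n * Kh p)"
        using p by (intro mult_left_mono khintchine b1) auto
      finally show ?thesis by (simp add: mult_ac)
    qed
    also have "2^n * Kh p * (s * A) powr p = Kh p * s powr p * (2^n * A powr p)"
      using s A0 by (simp add: powr_mult)
    also have "\<dots> \<le> Kh p * s powr p * (2 * t powr p / p * (\<Sum>e<2^n. cmod (g e) powr p))"
      using Kh_pos[of p] p by (intro mult_left_mono low) auto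
    also have "\<dots> = D * (s powr p * (\<Sum>e<2^n. cmod (g e) powr p))" by (simp add: D_def)
    also have "\<dots> \<le> C powr p * (s powr p * (\<Sum>e<2^n. cmod (g e) powr p))"
      by (intro mult_right_mono DC) (auto simp: sum_nonneg)
    finally show ?thesis using s by (simp add: powr_mult C_def)
  qed
  have "1 \<le> C" by (simp add: C_def)
  with main show ?thesis by blast
qed

lemma co_sg: "i < n \<Longrightarrow> co n i (\<lambda>e. \<Sum>j<n. c j * of_real (sg j e)) = c i"
proof -
  assume i: "i < n"
  have "(\<Sum>e<2^n. of_real (sg i e) * (\<Sum>j<n. c j * of_real (sg j e)))
      = (\<Sum>j<n. c j * of_real (\<Sum>e<2^n. sg i e * sg j e))"
    unfolding sum_distrib_left of_real_sum by (subst sum.swap) (simp add: algebra_simps)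
  also have "\<dots> = (\<Sum>j<n. if j = i then c j * 2^n else 0)"
    using i by (intro sum.cong) (auto simp: sg_orthogonal)
  also have "\<dots> = c i * 2^n" using i by simp
  finally show ?thesis by (simp add: co_def)
qed

lemma co_add: "co n i (\<lambda>e. f e + g e) = co n i f + co n i g"
  by (simp add: co_def distrib_left sum.distrib add_divide_distrib)

lemma co_scale: "co n i (\<lambda>e. k * g e) = k * co n i g"
  by (simp add: co_def sum_distrib_left mult_ac)

lemma co_cong: "(\<And>e. e < 2^n \<Longrightarrow> f e = g e) \<Longrightarrow> co n i f = co n i g"
  by (simp add: co_def)

section \<open>Rademacher blocks inside \<open>l\<^sup>p\<close>\<close>

text \<open>A coordinate \<open>tri k m e\<close> of \<open>l\<^sup>p\<close> belongs to the \<open>m\<close>-th copy of the \<open>k\<close>-th block; inside it \<open>e\<close> is a sign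
  vector if \<open>e < 2^n k\<close>, and the remaining coordinates are idle.\<close>

definition tri :: "nat \<Rightarrow> nat \<Rightarrow> nat \<Rightarrow> nat" where
  "tri k m e = prod_encode (k, prod_encode (m, e))"

definition mk :: "(nat \<Rightarrow> nat \<Rightarrow> nat \<Rightarrow> complex) \<Rightarrow> nat \<Rightarrow> complex" where
  "mk y = (\<lambda>N. y (fst (prod_decode N)) (fst (prod_decode (snd (prod_decode N)))) (snd (prod_decode (snd (prod_decode N)))))"

definition fib :: "(nat \<Rightarrow> complex) \<Rightarrow> nat \<Rightarrow> nat \<Rightarrow> nat \<Rightarrow> complex" where
  "fib x k m = (\<lambda>e. x (tri k m e))"

lemma mk_tri [simp]: "mk y (tri k m e) = y k m e"
  by (simp add: mk_def tri_def)

lemma fib_mk [simp]: "fib (mk y) k m = y k m"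
  by (simp add: fib_def)

lemma tri_cases: obtains k m e where "N = tri k m e"
  by (metis tri_def prod_decode_inverse surj_pair)

lemma tri_ext: "(\<And>k m e. x (tri k m e) = y (tri k m e)) \<Longrightarrow> x = y"
  by (rule ext) (metis tri_cases)

lemma bij_tri: "bij (\<lambda>(k, m, e). tri k m e)"
proof (rule bijI)
  show "inj (\<lambda>(k, m, e). tri k m e)" by (auto simp: inj_def tri_def)
  show "surj (\<lambda>(k, m, e). tri k m e)"
  proof (rule surjI)
    fix N show "(\<lambda>(k, m, e). tri k m e) (let (k, r) = prod_decode N in (k, prod_decode r)) = N"
      by (auto simp: tri_def split: prod.splits) (metis prod_decode_inverse)
  qed
qed

lemma en_tri: "en p x = (\<integral>\<^sup>+ k. \<integral>\<^sup>+ m. en p (fib x k m) \<partial>count_space UNIV \<partial>count_space UNIV)"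
proof -
  have "en p x = en p (\<lambda>t. x ((\<lambda>(k, m, e). tri k m e) t))" by (rule en_reindex[OF bij_tri, symmetric])
  also have "\<dots> = (\<integral>\<^sup>+ k. \<integral>\<^sup>+ m. en p (\<lambda>e. x (tri k m e)) \<partial>count_space UNIV \<partial>count_space UNIV)"
    by (subst en_prod, subst en_prod) simp
  finally show ?thesis by (simp add: fib_def)
qed

lemma nn_integral_count_space_prod_encode:
  "(\<integral>\<^sup>+ m. f m \<partial>count_space UNIV) = (\<integral>\<^sup>+ l. \<integral>\<^sup>+ m. f (prod_encode (l, m)) \<partial>count_space UNIV \<partial>count_space UNIV)"
proof -
  have "bij prod_encode" by (rule bij_prod_encode)
  hence "(\<integral>\<^sup>+ m. f m \<partial>count_space UNIV) = (\<integral>\<^sup>+ t. f (prod_encode t) \<partial>count_space UNIV)"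
    by (rule nn_integral_bij_count_space[symmetric])
  also have "\<dots> = (\<integral>\<^sup>+ l. \<integral>\<^sup>+ m. f (prod_encode (l, m)) \<partial>count_space UNIV \<partial>count_space UNIV)"
    by (rule nn_integral_fst_count_space[symmetric])
  finally show ?thesis .
qed

lemma nn_integral_count_space_even_odd:
  fixes f :: "nat \<Rightarrow> ennreal"
  shows "(\<integral>\<^sup>+ m. f m \<partial>count_space UNIV) = (\<integral>\<^sup>+ m. f (2 * m) \<partial>count_space UNIV) + (\<integral>\<^sup>+ m. f (2 * m + 1) \<partial>count_space UNIV)"
proof -
  let ?b = "\<lambda>(b, m::nat). 2 * m + of_bool b"
  have "bij ?b"
  proof (rule bijI)
    show "inj ?b" by (auto simp: inj_def of_bool_def split: if_splits) presburger+
    show "surj ?b" by (rule surjI[of _ "\<lambda>m. (odd m, m div 2)"]) (auto simp: of_bool_def)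
  qed
  hence "(\<integral>\<^sup>+ m. f m \<partial>count_space UNIV) = (\<integral>\<^sup>+ t. f (?b t) \<partial>count_space UNIV)"
    by (rule nn_integral_bij_count_space[symmetric])
  also have "\<dots> = (\<integral>\<^sup>+ b. \<integral>\<^sup>+ m. f (?b (b, m)) \<partial>count_space UNIV \<partial>count_space UNIV)"
    by (rule nn_integral_fst_count_space[symmetric])
  also have "\<dots> = (\<integral>\<^sup>+ m. f (2 * m) \<partial>count_space UNIV) + (\<integral>\<^sup>+ m. f (2 * m + 1) \<partial>count_space UNIV)"
    by (simp add: nn_integral_count_space_finite UNIV_bool)
  finally show ?thesis .
qed

lemma en_ge_finite_sum: "finite A \<Longrightarrow> ennreal (\<Sum>i\<in>A. cmod (x i) powr p) \<le> en p x"
proof -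
  assume A: "finite A"
  have "ennreal (\<Sum>i\<in>A. cmod (x i) powr p) = en p (\<lambda>i. if i \<in> A then x i else 0)"
    by (subst en_finite_sum[OF A]) auto
  also have "\<dots> \<le> en p x" unfolding en_def by (intro nn_integral_mono) auto
  finally show ?thesis .
qed

locale lp_blocks = lp_space +
  fixes n :: "nat \<Rightarrow> nat"
begin

text \<open>The bound variable \<open>n\<close> shadows the block sizes of the locale, so the
  constant depends on p alone. This is what makes the final \<lambda> uniform in d and M.\<close>

definition RC :: real where
  "RC = (SOME C. C \<ge> 1 \<and> (\<forall>n g c s. 0 \<le> s \<longrightarrow> (\<forall>i<n. cmod (c i) \<le> s) \<longrightarrow>
    (\<Sum>e<2^n. cmod (\<Sum>i<n. c i * co n i g * of_real (sg i e)) powr p) \<le> (C * s) powr p * (\<Sum>e<2^n. cmod (g e) powr p)))"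

lemma RC_ge_1: "1 \<le> RC"
  and RC_bound: "0 \<le> s \<Longrightarrow> (\<And>i. i < N \<Longrightarrow> cmod (c i) \<le> s) \<Longrightarrow>
    (\<Sum>e<2^N. cmod (\<Sum>i<N. c i * co N i g * of_real (sg i e)) powr p) \<le> (RC * s) powr p * (\<Sum>e<2^N. cmod (g e) powr p)"
  using someI_ex[OF rademacher_multiplier[OF p_gt_1]] unfolding RC_def[symmetric] by blast+

text \<open>In every copy of every block: project onto the Rademacher functions and multiply the
  i-th coefficient by \<open>c k i\<close>. With all coefficients 1 it is the Rademacher projection
  itself.\<close>

definition mul :: "(nat \<Rightarrow> nat \<Rightarrow> complex) \<Rightarrow> (nat \<Rightarrow> complex) \<Rightarrow> nat \<Rightarrow> complex" where
  "mul c x = mk (\<lambda>k m e. if e < 2^n k then \<Sum>i<n k. c k i * co (n k) i (fib x k m) * of_real (sg i e) else 0)"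

lemma en_fib_mul:
  assumes "0 \<le> s" "\<And>i. i < n k \<Longrightarrow> cmod (c k i) \<le> s"
  shows "en p (fib (mul c x) k m) \<le> ennreal ((RC * s) powr p) * en p (fib x k m)"
proof -
  have "en p (fib (mul c x) k m) = ennreal (\<Sum>e<2^n k. cmod (fib (mul c x) k m e) powr p)"
    by (rule en_finite_sum) (auto simp: mul_def)
  also have "(\<Sum>e<2^n k. cmod (fib (mul c x) k m e) powr p) \<le> (RC * s) powr p * (\<Sum>e<2^n k. cmod (fib x k m e) powr p)"
    using RC_bound[OF assms(1), of "n k" "c k" "fib x k m"] assms(2) by (simp add: mul_def)
  finally have "en p (fib (mul c x) k m) \<le> ennreal ((RC * s) powr p * (\<Sum>e<2^n k. cmod (fib x k m e) powr p))"
    by (simp add: ennreal_leI)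
  also have "\<dots> = ennreal ((RC * s) powr p) * ennreal (\<Sum>e<2^n k. cmod (fib x k m e) powr p)"
    by (simp add: ennreal_mult sum_nonneg)
  also have "\<dots> \<le> ennreal ((RC * s) powr p) * en p (fib x k m)"
    by (intro mult_left_mono en_ge_finite_sum) auto
  finally show ?thesis by simp
qed

lemma fib_add: "fib (x + y) k m = (\<lambda>e. fib x k m e + fib y k m e)"
  and fib_smul: "fib (vsmul a x) k m = (\<lambda>e. a * fib x k m e)"
  by (auto simp: fib_def fun_apply_simps)

lemma mul_add: "mul c (x + y) = mul c x + mul c y"
  by (rule tri_ext) (simp add: mul_def fun_apply_simps fib_add co_add distrib_left distrib_right sum.distrib)

lemma mul_smul: "mul c (vsmul a x) = vsmul a (mul c x)"
  by (rule tri_ext) (auto simp: mul_def fun_apply_simps fib_smul co_scale sum_distrib_left mult_ac)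

lemma opb_mul:
  assumes "0 \<le> s" "\<And>k i. i < n k \<Longrightarrow> cmod (c k i) \<le> s"
  shows "opb (RC * s) (mul c)"
proof -
  have e: "en p (mul c x) \<le> ennreal ((RC * s) powr p) * en p x" for x
  proof -
    have "en p (mul c x) \<le> (\<integral>\<^sup>+ k. \<integral>\<^sup>+ m. ennreal ((RC * s) powr p) * en p (fib x k m) \<partial>count_space UNIV \<partial>count_space UNIV)"
      unfolding en_tri[of p "mul c x"] by (intro nn_integral_mono en_fib_mul assms)
    also have "\<dots> = ennreal ((RC * s) powr p) * en p x" by (simp add: nn_integral_cmult en_tri[of p x])
    finally show ?thesis .
  qed
  have s: "0 \<le> RC * s" using RC_ge_1 assms(1) by simp
  show ?thesis by (rule opbI) (use s mul_add mul_smul en_le_imp[OF e _ s] in auto)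
qed

lemma co_mul: "i < n k \<Longrightarrow> co (n k) i (fib (mul c x) k m) = c k i * co (n k) i (fib x k m)"
  using co_sg[of i "n k" "\<lambda>j. c k j * co (n k) j (fib x k m)"]
    co_cong[of "n k" "fib (mul c x) k m" "\<lambda>e. \<Sum>j<n k. c k j * co (n k) j (fib x k m) * of_real (sg j e)" i]
  by (simp add: mul_def)

text \<open>The factor that turns counting measure on the sign vectors into probability measure, as
  \<open>nf_powr\<close> shows.\<close>

definition nf :: "nat \<Rightarrow> real" where "nf k = 2 powr (- real (n k) / p)"

lemma nf_pos: "0 < nf k" by (simp add: nf_def)

lemma nf_powr: "nf k powr p = 1 / 2^n k"
proof -
  have "nf k powr p = 2 powr (- real (n k) / p * p)" unfolding nf_def by (rule powr_powr)
  also have "- real (n k) / p * p = - real (n k)" by simp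
  finally show ?thesis by (simp add: powr_minus powr_realpow field_simps)
qed

definition Gs :: "(nat \<Rightarrow> nat \<Rightarrow> 'a \<Rightarrow> nat \<Rightarrow> complex) \<Rightarrow> nat \<Rightarrow> nat \<Rightarrow> 'a \<Rightarrow> nat \<Rightarrow> complex" where
  "Gs G k e x = (\<Sum>i<n k. vsmul (of_real (sg i e)) (G k i x))"

text \<open>An l^p-valued random sum for each k, realised in block k: the sign vector is the
  position within a copy and the coordinate m of the value selects the copy. The argument has an
  arbitrary type so that a difference of two such maps at fixed points is again of this form, with
  argument \<open>()\<close>.\<close>

definition Jop :: "(nat \<Rightarrow> nat \<Rightarrow> 'a \<Rightarrow> nat \<Rightarrow> complex) \<Rightarrow> 'a \<Rightarrow> nat \<Rightarrow> complex" where
  "Jop G x = mk (\<lambda>k m e. if e < 2^n k then of_real (nf k) * Gs G k e x m else 0)"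

lemma en_Jop: "en p (Jop G x) = (\<integral>\<^sup>+ k. ennreal (1 / 2^n k) * (\<Sum>e<2^n k. en p (Gs G k e x)) \<partial>count_space UNIV)"
proof -
  have "(\<integral>\<^sup>+ m. en p (fib (Jop G x) k m) \<partial>count_space UNIV) = ennreal (1 / 2^n k) * (\<Sum>e<2^n k. en p (Gs G k e x))" for k
  proof -
    have "en p (fib (Jop G x) k m) = (\<Sum>e<2^n k. ennreal (1 / 2^n k) * ennreal (cmod (Gs G k e x m) powr p))" for m
    proof -
      have "en p (fib (Jop G x) k m) = ennreal (\<Sum>e<2^n k. cmod (fib (Jop G x) k m e) powr p)"
        by (rule en_finite_sum) (auto simp: Jop_def)
      also have "\<dots> = ennreal (\<Sum>e<2^n k. 1 / 2^n k * cmod (Gs G k e x m) powr p)"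
        using nf_pos[of k] by (simp add: Jop_def norm_mult powr_mult nf_powr)
      also have "\<dots> = (\<Sum>e<2^n k. ennreal (1 / 2^n k * cmod (Gs G k e x m) powr p))"
        by (rule sum_ennreal[symmetric]) auto
      finally show ?thesis by (subst (asm) ennreal_mult) auto
    qed
    hence "(\<integral>\<^sup>+ m. en p (fib (Jop G x) k m) \<partial>count_space UNIV) = (\<Sum>e<2^n k. ennreal (1 / 2^n k) * en p (Gs G k e x))"
      by (simp add: nn_integral_sum nn_integral_cmult en_def)
    thus ?thesis by (simp add: sum_distrib_left)
  qed
  thus ?thesis unfolding en_tri[of p "Jop G x"] by simp
qed

lemma Jop_add:
  "(\<And>k i. i < n k \<Longrightarrow> G k i z = G k i x + G k i y) \<Longrightarrow> Jop G z = Jop G x + Jop G y"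
  by (rule tri_ext) (simp add: Jop_def Gs_def fun_apply_simps distrib_left sum.distrib)

lemma Jop_smul:
  "(\<And>k i. i < n k \<Longrightarrow> G k i z = vsmul a (G k i x)) \<Longrightarrow> Jop G z = vsmul a (Jop G x)"
  by (rule tri_ext) (simp add: Jop_def Gs_def fun_apply_simps sum_distrib_left mult_ac)

lemma Jop_diff: "Jop G x - Jop H y = Jop (\<lambda>k i _. G k i x - H k i y) ()"
  by (rule tri_ext) (simp add: Jop_def Gs_def fun_apply_simps right_diff_distrib sum_subtractf)

lemma co_Jop: "i < n k \<Longrightarrow> co (n k) i (fib (Jop G x) k m) = of_real (nf k) * G k i x m"
  using co_sg[of i "n k" "\<lambda>j. of_real (nf k) * G k j x m"]
    co_cong[of "n k" "fib (Jop G x) k m" "\<lambda>e. \<Sum>j<n k. of_real (nf k) * G k j x m * of_real (sg j e)" i]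
  by (simp add: Jop_def Gs_def fun_apply_simps sum_distrib_left mult_ac)

lemma mul_Jop: "mul c (Jop G x) = Jop (\<lambda>k i x. vsmul (c k i) (G k i x)) x"
  by (rule tri_ext) (simp add: mul_def Jop_def[of "\<lambda>k i x. vsmul (c k i) (G k i x)"] co_Jop Gs_def
      fun_apply_simps sum_distrib_left mult_ac)

section \<open>Single blocks and the recovery of vectors from Rademacher coefficients\<close>

definition proj :: "nat \<Rightarrow> (nat \<Rightarrow> complex) \<Rightarrow> nat \<Rightarrow> complex" where
  "proj k x = mk (\<lambda>k' m e. if k' = k then x (tri k m e) else 0)"

lemma fib_proj: "fib (proj k x) k' m = (if k' = k then fib x k m else (\<lambda>e. 0))"
  by (auto simp: proj_def fib_def)

lemma en_proj: "en p (proj k x) = (\<integral>\<^sup>+ m. en p (fib x k m) \<partial>count_space UNIV)"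
proof -
  have "en p (proj k x) = (\<integral>\<^sup>+ k'. (\<integral>\<^sup>+ m. en p (fib x k m) \<partial>count_space UNIV) * indicator {k} k' \<partial>count_space UNIV)"
    unfolding en_tri[of p "proj k x"] by (intro nn_integral_cong) (auto simp: fib_proj indicator_def)
  thus ?thesis by (simp add: nn_integral_cmult one_ennreal_def[symmetric])
qed

lemma en_eq_sum_proj: "en p x = (\<integral>\<^sup>+ k. en p (proj k x) \<partial>count_space UNIV)"
  by (simp add: en_proj en_tri[of p x])

lemma opb_proj: "opb 1 (proj k)"
proof -
  have e: "cmod (proj k x N) \<le> cmod (x N)" for x N
    by (rule tri_cases[of N]) (auto simp: proj_def)
  show ?thesis
  proof (rule opbI)
    show "proj k (x + y) = proj k x + proj k y" for x y
      by (rule tri_ext) (simp add: proj_def fun_apply_simps)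
    show "proj k (vsmul a x) = vsmul a (proj k x)" for a x
      by (rule tri_ext) (simp add: proj_def fun_apply_simps)
  qed (use X_mono[OF e] nm_mono[OF e] in auto)
qed

definition cf :: "nat \<Rightarrow> nat \<Rightarrow> (nat \<Rightarrow> complex) \<Rightarrow> nat \<Rightarrow> complex" where
  "cf k i y = (\<lambda>m. co (n k) i (fib y k m))"

lemma cf_add: "cf k i (x + y) = cf k i x + cf k i y"
  and cf_smul: "cf k i (vsmul a x) = vsmul a (cf k i x)"
  and cf_mul: "i < n k \<Longrightarrow> cf k i (mul c x) = vsmul (c k i) (cf k i x)"
  and cf_Jop: "i < n k \<Longrightarrow> cf k i (Jop G z) = vsmul (of_real (nf k)) (G k i z)"
  and cf_proj: "cf k i (proj k x) = cf k i x"
  by (auto simp: cf_def fun_eq_iff fib_add fib_smul co_add co_scale co_mul co_Jop fun_apply_simps fib_proj)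

definition rad :: "nat \<Rightarrow> nat \<Rightarrow> (nat \<Rightarrow> complex) \<Rightarrow> nat \<Rightarrow> complex" where
  "rad k e y = (\<Sum>i<n k. vsmul (of_real (sg i e)) (cf k i y))"

text \<open>\<open>rad k e y\<close> lists, over all copies of block k, the value of the Rademacher
  projection of y at the sign vector e. The multiplier bound with s = 1 applies in each
  copy.\<close>

lemma sum_en_rad: "(\<Sum>e<2^n k. en p (rad k e y)) \<le> ennreal (RC powr p) * en p (proj k y)"
proof -
  have "(\<Sum>e<2^n k. en p (rad k e y)) = (\<integral>\<^sup>+ m. (\<Sum>e<2^n k. ennreal (cmod (rad k e y m) powr p)) \<partial>count_space UNIV)"
    unfolding en_def by (rule nn_integral_sum[symmetric]) simp
  also have "\<dots> = (\<integral>\<^sup>+ m. en p (fib (mul (\<lambda>_ _. 1) y) k m) \<partial>count_space UNIV)"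
  proof (rule nn_integral_cong)
    fix m
    have "en p (fib (mul (\<lambda>_ _. 1) y) k m) = ennreal (\<Sum>e<2^n k. cmod (fib (mul (\<lambda>_ _. 1) y) k m e) powr p)"
      by (rule en_finite_sum) (auto simp: mul_def)
    also have "\<dots> = (\<Sum>e<2^n k. ennreal (cmod (rad k e y m) powr p))"
      by (subst sum_ennreal[symmetric]) (auto simp: mul_def rad_def cf_def fun_apply_simps mult.commute)
    finally show "(\<Sum>e<2^n k. ennreal (cmod (rad k e y m) powr p)) = en p (fib (mul (\<lambda>_ _. 1) y) k m)" by simp
  qed
  also have "\<dots> \<le> (\<integral>\<^sup>+ m. ennreal ((RC * 1) powr p) * en p (fib y k m) \<partial>count_space UNIV)"
    by (intro nn_integral_mono en_fib_mul) auto
  also have "\<dots> = ennreal (RC powr p) * en p (proj k y)" by (simp add: nn_integral_cmult en_proj)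
  finally show ?thesis .
qed

lemma cf_X:
  assumes "y \<in> X" shows "cf k i y \<in> X"
proof -
  have "en p (cf k i y) \<le> (\<integral>\<^sup>+ m. en p (fib y k m) \<partial>count_space UNIV)"
    unfolding en_def[of p "cf k i y"]
  proof (rule nn_integral_mono)
    fix m
    have "cmod (cf k i y m) \<le> (\<Sum>e<2^n k. cmod (fib y k m e)) / 2^n k"
      unfolding cf_def co_def norm_divide
      by (rule order_trans[OF divide_right_mono[OF norm_sum]]) (auto simp: norm_mult norm_power)
    also have "\<dots> = (\<Sum>e<2^n k. 1 / 2^n k * cmod (fib y k m e))" by (simp add: sum_divide_distrib)
    finally have "cmod (cf k i y m) powr p \<le> (\<Sum>e<2^n k. 1 / 2^n k * cmod (fib y k m e)) powr p"
      by (intro powr_mono2) auto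
    also have "\<dots> \<le> (\<Sum>e<2^n k. 1 / 2^n k * cmod (fib y k m e) powr p)"
      by (rule weighted_powr_le) (use p_gt_1 in auto)
    also have "\<dots> \<le> (\<Sum>e<2^n k. cmod (fib y k m e) powr p)"
      by (intro sum_mono mult_left_le_one_le) auto
    finally have "ennreal (cmod (cf k i y m) powr p) \<le> ennreal (\<Sum>e<2^n k. cmod (fib y k m e) powr p)" by (rule ennreal_leI)
    also have "\<dots> \<le> en p (fib y k m)" by (rule en_ge_finite_sum) simp
    finally show "ennreal (cmod (cf k i y m) powr p) \<le> en p (fib y k m)" .
  qed
  also have "\<dots> = en p (proj k y)" by (simp add: en_proj)
  finally show ?thesis using X_en_mono opb_X[OF opb_proj assms] by blast
qed

text \<open>A left inverse to the k-th block of \<open>Jop\<close> as soon as the \<open>B i\<close>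
  recombine its coefficient vectors; \<open>1 / nf k\<close> undoes the normalisation.\<close>

definition Qk :: "nat \<Rightarrow> (nat \<Rightarrow> (nat \<Rightarrow> complex) \<Rightarrow> nat \<Rightarrow> complex) \<Rightarrow> (nat \<Rightarrow> complex) \<Rightarrow> nat \<Rightarrow> complex" where
  "Qk k B y = vsmul (of_real (1 / nf k)) (\<Sum>i<n k. B i (cf k i y))"

text \<open>Orthogonality of the signs turns the diagonal sum into an average of products of two
  signed sums. Thus only signed sums of the \<open>B i\<close> have to be bounded, never the single
  \<open>B i\<close>.\<close>

lemma Qk_average:
  assumes B: "\<And>i. i < n k \<Longrightarrow> bop p (B i)" and y: "y \<in> X"
  shows "Qk k B y = vsmul (of_real (1 / nf k / 2^n k)) (\<Sum>e<2^n k. \<Sum>i<n k. vsmul (of_real (sg i e)) (B i (rad k e y)))"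
proof -
  have b: "B i (rad k e y) = (\<Sum>j<n k. vsmul (of_real (sg j e)) (B i (cf k j y)))" if "i < n k" for i e
    unfolding rad_def using B[OF that] cf_X[OF y] by (subst bop_sum_arg) (auto simp: bop_smul)
  have "(\<Sum>e<2^n k. \<Sum>i<n k. vsmul (of_real (sg i e)) (B i (rad k e y)))
      = (\<Sum>e<2^n k. \<Sum>i<n k. \<Sum>j<n k. vsmul (of_real (sg i e * sg j e)) (B i (cf k j y)))"
    by (simp add: b vsmul_sum vsmul_algebra)
  also have "\<dots> = (\<Sum>i<n k. \<Sum>e<2^n k. \<Sum>j<n k. vsmul (of_real (sg i e * sg j e)) (B i (cf k j y)))"
    by (rule sum.swap)
  also have "\<dots> = (\<Sum>i<n k. \<Sum>j<n k. \<Sum>e<2^n k. vsmul (of_real (sg i e * sg j e)) (B i (cf k j y)))"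
    by (intro sum.cong refl sum.swap)
  also have "\<dots> = (\<Sum>i<n k. \<Sum>j<n k. vsmul (of_real (\<Sum>e<2^n k. sg i e * sg j e)) (B i (cf k j y)))"
    by (intro sum.cong refl) (auto simp: fun_eq_iff fun_apply_simps sum_distrib_right)
  also have "\<dots> = (\<Sum>i<n k. \<Sum>j<n k. if j = i then vsmul (2^n k) (B i (cf k i y)) else 0)"
    by (intro sum.cong refl) (auto simp: sg_orthogonal)
  also have "\<dots> = vsmul (2^n k) (\<Sum>i<n k. B i (cf k i y))" by (simp add: vsmul_sum)
  finally show ?thesis by (simp add: Qk_def vsmul_algebra)
qed


text \<open>Jensen over the sign vectors in \<open>Qk_average\<close>, then \<beta> for the signed
  sum of the \<open>B i\<close> and \<open>RC\<close> for the Rademacher projection of y.\<close>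

lemma Qk_bound:
  assumes B: "\<And>i. i < n k \<Longrightarrow> bop p (B i)"
    and \<beta>: "\<And>e. e < 2^n k \<Longrightarrow> opb \<beta> (\<lambda>x. \<Sum>i<n k. vsmul (of_real (sg i e)) (B i x))"
    and y: "y \<in> X"
  shows "Qk k B y \<in> X" "nm (Qk k B y) \<le> \<beta> * RC * nm (proj k y)"
proof -
  define N where "N = (2::real)^n k"
  have N: "0 < N" by (simp add: N_def)
  have R: "rad k e y \<in> X" for e unfolding rad_def by (rule sum_X) (use cf_X[OF y] in auto)
  have \<beta>0: "0 \<le> \<beta>" using opb_nonneg[OF \<beta>[of 0]] by simp
  define Z where "Z e = (\<Sum>i<n k. vsmul (of_real (sg i e)) (B i (rad k e y)))" for e
  have Z: "Z e \<in> X" "nm (Z e) \<le> \<beta> * nm (rad k e y)" if "e < 2^n k" for e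
    using opb_X[OF \<beta>[OF that] R] opb_nm[OF \<beta>[OF that] R] by (auto simp: Z_def)
  have Q: "Qk k B y = vsmul (of_real (1 / nf k / 2^n k)) (\<Sum>e<2^n k. Z e)"
    unfolding Z_def by (rule Qk_average[OF B y])
  have S: "(\<Sum>e<2^n k. Z e) \<in> X" by (rule sum_X) (use Z in auto)
  show "Qk k B y \<in> X" unfolding Q using S by auto
  have pX: "proj k y \<in> X" using opb_X[OF opb_proj y] .
  have "nm (\<Sum>e<2^n k. Z e) \<le> (\<Sum>e<2^n k. nm (Z e))" by (rule nm_sum) (use Z in auto)
  also have "\<dots> \<le> (\<Sum>e<2^n k. \<beta> * nm (rad k e y))" by (intro sum_mono Z) auto
  finally have "nm (\<Sum>e<2^n k. Z e) / N \<le> (\<Sum>e<2^n k. 1 / N * (\<beta> * nm (rad k e y)))"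
    using N by (simp add: divide_right_mono flip: sum_divide_distrib)
  hence "(nm (\<Sum>e<2^n k. Z e) / N) powr p \<le> (\<Sum>e<2^n k. 1 / N * (\<beta> * nm (rad k e y))) powr p"
    using N by (intro powr_mono2) auto
  also have "\<dots> \<le> (\<Sum>e<2^n k. 1 / N * (\<beta> * nm (rad k e y)) powr p)"
    by (rule weighted_powr_le) (use p_gt_1 N \<beta>0 in \<open>auto simp: N_def\<close>)
  also have "\<dots> = \<beta> powr p / N * (\<Sum>e<2^n k. nm (rad k e y) powr p)"
    using \<beta>0 by (simp add: powr_mult sum_distrib_left)
  also have "\<dots> \<le> \<beta> powr p / N * ((RC * nm (proj k y)) powr p)"
  proof (rule mult_left_mono)
    have "ennreal (\<Sum>e<2^n k. nm (rad k e y) powr p) = (\<Sum>e<2^n k. en p (rad k e y))"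
      by (simp add: en_eq[OF R] sum_nonneg)
    also have "\<dots> \<le> ennreal (RC powr p) * en p (proj k y)" by (rule sum_en_rad)
    also have "\<dots> = ennreal ((RC * nm (proj k y)) powr p)"
      using RC_ge_1 by (simp add: en_eq[OF pX] powr_mult ennreal_mult)
    finally show "(\<Sum>e<2^n k. nm (rad k e y) powr p) \<le> (RC * nm (proj k y)) powr p" by simp
  qed (use N in auto)
  finally have "(nm (\<Sum>e<2^n k. Z e) / N) powr p \<le> \<beta> powr p / N * ((RC * nm (proj k y)) powr p)" .
  hence "(1 / nf k) powr p * (nm (\<Sum>e<2^n k. Z e) / N) powr p \<le> (1 / nf k) powr p * (\<beta> powr p / N * ((RC * nm (proj k y)) powr p))"
    by (intro mult_left_mono) auto
  moreover have "(1 / nf k) powr p = N" using nf_pos[of k] by (simp add: powr_divide nf_powr N_def)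
  moreover have "nm (Qk k B y) = 1 / nf k * (nm (\<Sum>e<2^n k. Z e) / N)"
    unfolding Q using S nf_pos[of k] by (simp add: norm_divide norm_mult norm_power N_def)
  hence "nm (Qk k B y) powr p = (1 / nf k) powr p * (nm (\<Sum>e<2^n k. Z e) / N) powr p"
    by (simp only: powr_mult)
  moreover have "N * (\<beta> powr p / N * ((RC * nm (proj k y)) powr p)) = (\<beta> * RC * nm (proj k y)) powr p"
    using N \<beta>0 RC_ge_1 by (simp add: powr_mult)
  ultimately have "nm (Qk k B y) powr p \<le> (\<beta> * RC * nm (proj k y)) powr p" by metis
  thus "nm (Qk k B y) \<le> \<beta> * RC * nm (proj k y)"
    using \<beta>0 RC_ge_1 p_pos by (smt (verit) mult_nonneg_nonneg nm_nonneg powr_less_mono2)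
qed

end

section \<open>Block decay and compactness\<close>

context lp_blocks
begin

definition tlb :: "nat \<Rightarrow> (nat \<Rightarrow> complex) \<Rightarrow> nat \<Rightarrow> complex" where
  "tlb M x = mk (\<lambda>k m e. if k < M then 0 else x (tri k m e))"

lemma tri_ge: "k \<le> tri k m e"
  unfolding tri_def by (rule le_prod_encode_1)

text \<open>All coordinates of block k are at least k, so what remains after dropping the blocks
  below M lives on coordinates from M on.\<close>

lemma opb_tlb: "opb 1 (tlb M)" and nm_tlb_le_hi: "x \<in> X \<Longrightarrow> nm (tlb M x) \<le> nm (hi M x)"
proof -
  have e: "cmod (tlb M x N) \<le> cmod (hi M x N)" for x N
  proof (rule tri_cases[of N])
    fix k m e assume "N = tri k m e"
    thus "cmod (tlb M x N) \<le> cmod (hi M x N)" using tri_ge[of k m e] by (auto simp: tlb_def pt)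
  qed
  show le: "nm (tlb M x) \<le> nm (hi M x)" if "x \<in> X" for x using nm_mono[OF e] that by auto
  show "opb 1 (tlb M)"
  proof (rule opbI)
    show "tlb M (x + y) = tlb M x + tlb M y" for x y
      by (rule tri_ext) (simp add: tlb_def fun_apply_simps)
    show "tlb M (vsmul a x) = vsmul a (tlb M x)" for a x
      by (rule tri_ext) (simp add: tlb_def fun_apply_simps)
    show "tlb M x \<in> X" if "x \<in> X" for x using X_mono[OF e] that by auto
    show "nm (tlb M x) \<le> 1 * nm x" if "x \<in> X" for x using le[OF that] nm_hi[OF that, of M] by linarith
  qed simp
qed

lemma head_plus_tlb: "(\<Sum>k<M. proj k x) + tlb M x = x"
proof (rule tri_ext)
  fix k m e
  have "(\<Sum>j<M. proj j x (tri k m e)) = (\<Sum>j<M. if j = k then x (tri k m e) else 0)"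
    by (intro sum.cong) (auto simp: proj_def)
  thus "((\<Sum>k<M. proj k x) + tlb M x) (tri k m e) = x (tri k m e)"
    by (simp add: fun_apply_simps tlb_def)
qed

lemma tlb_eq: "tlb M x = x - (\<Sum>k<M. proj k x)"
  using head_plus_tlb[of x M] by (simp add: eq_diff_eq add.commute)

lemma mul_proj: "mul c (proj k x) = proj k (mul c x)"
proof (rule tri_ext)
  fix k' m e
  show "mul c (proj k x) (tri k' m e) = proj k (mul c x) (tri k' m e)"
    by (simp add: mul_def proj_def[of k "mk _"] fib_proj co_def)
qed

lemma en_proj_Jop: "en p (proj k (Jop G x)) = ennreal (1 / 2^n k) * (\<Sum>e<2^n k. en p (Gs G k e x))"
proof -
  define H where "H k' i y = (if k' = k then G k' i y else 0)" for k' i y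
  have "proj k (Jop G x) = Jop H x"
    by (rule tri_ext) (auto simp: proj_def Jop_def Gs_def H_def fun_apply_simps)
  moreover have "Gs H k' e x = (if k' = k then Gs G k e x else 0)" for k' e
    by (auto simp: Gs_def H_def)
  ultimately have "en p (proj k (Jop G x)) = (\<integral>\<^sup>+ k'. ennreal (1 / 2^n k) * (\<Sum>e<2^n k. en p (Gs G k e x)) * indicator {k} k' \<partial>count_space UNIV)"
    by (simp only: en_Jop) (intro nn_integral_cong, auto simp: indicator_def)
  thus ?thesis by (simp add: nn_integral_cmult one_ennreal_def[symmetric])
qed

lemma en_Gs_average_le:
  assumes "\<And>e. e < 2^n k \<Longrightarrow> en p (Gs G k e x) \<le> b"
  shows "ennreal (1 / 2^n k) * (\<Sum>e<2^n k. en p (Gs G k e x)) \<le> b"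
proof -
  have "ennreal (1 / 2^n k) * (\<Sum>e<2^n k. en p (Gs G k e x)) \<le> ennreal (1 / 2^n k) * (\<Sum>e<(2::nat)^n k. b)"
    using assms by (intro mult_left_mono sum_mono) auto
  also have "\<dots> = (ennreal (1 / 2^n k) * ennreal (2^n k)) * b"
    by (simp add: mult.assoc ennreal_power flip: ennreal_numeral)
  also have "ennreal (1 / 2^n k) * ennreal (2^n k) = 1" by (simp flip: ennreal_mult)
  finally show ?thesis by simp
qed

lemma half_power_tail:
  fixes C e :: real
  assumes "0 < e" shows "\<exists>M::nat. C / 2^M < e"
proof -
  have "(\<lambda>M. C * (1/2)^M) \<longlonglongrightarrow> C * 0" by (intro tendsto_mult_left LIMSEQ_power_zero) auto
  hence "\<forall>\<^sub>F M in sequentially. C * (1/2)^M < e" using assms by (intro order_tendstoD) auto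
  thus ?thesis by (auto simp: eventually_sequentially power_one_over)
qed

lemma geometric_tail_le:
  fixes C t :: real
  assumes "0 \<le> C" "0 \<le> t"
  shows "(\<Sum>k=M..<N. C / 2^k * t) \<le> 2 * C / 2^M * t"
proof -
  have "(\<Sum>k=M..<N. C / 2^k * t) \<le> 2 * C / 2^M * t - (if M \<le> N then 2 * C / 2^N * t else 0)"
  proof (cases "M \<le> N")
    case True
    hence "(\<Sum>k=M..<N. C / 2^k * t) = 2 * C / 2^M * t - 2 * C / 2^N * t"
      by (induction N rule: dec_induct) auto
    thus ?thesis using True by simp
  qed (use assms in simp)
  also have "\<dots> \<le> 2 * C / 2^M * t" using assms by simp
  finally show ?thesis .
qed

text \<open>Geometric decay makes F a norm limit of its finite heads. Each block consists of
  infinitely many copies and has infinite dimension, so compactness of the single blocks is a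
  separate hypothesis.\<close>

lemma cpt_of_block_decay_range:
  assumes F: "bop p F" and blk: "\<And>k. cpt (\<lambda>x. proj k (F x))"
    and dec: "\<And>k x. k \<ge> k0 \<Longrightarrow> x \<in> X \<Longrightarrow> nm (proj k (F x)) \<le> C / 2^k * nm x"
  shows "cpt F"
proof (rule cpt_limit[OF F])
  fix e :: real assume e: "0 < e"
  obtain M0 :: nat where M0: "2 * C / 2^M0 < e" using half_power_tail[OF e] by blast
  define M where "M = max k0 M0"
  \<comment> \<open>No sign of C is assumed; it follows from the decay bound at a unit
    vector.\<close>
  have "0 \<le> C / 2^k0" using order_trans[OF nm_nonneg dec[of k0 "ub 0"]] by simp
  hence "0 \<le> C / 2^k0 * 2^k0" by (intro mult_nonneg_nonneg) auto
  hence C0: "0 \<le> C" by simp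
  have "2 * C / 2^M \<le> 2 * C / 2^M0" using C0 by (intro divide_left_mono) (auto simp: M_def)
  with M0 have M: "2 * C / 2^M < e" by linarith
  have K: "cpt (\<lambda>x. \<Sum>k<M. proj k (F x))" by (rule cpt_sum) (rule blk)
  have "opb e (\<lambda>x. tlb M (F x))"
  proof (rule opbI_bop[OF bop_comp[OF opb_bop[OF opb_tlb] F]])
    fix x assume x: "x \<in> X"
    have FX: "F x \<in> X" using bop_X[OF F x] .
    have part: "nm (\<Sum>k=M..<N. proj k (F x)) \<le> 2 * C / 2^M * nm x" for N
    proof -
      have "nm (\<Sum>k=M..<N. proj k (F x)) \<le> (\<Sum>k=M..<N. nm (proj k (F x)))"
        by (rule nm_sum) (use opb_X[OF opb_proj FX] in auto)
      also have "\<dots> \<le> (\<Sum>k=M..<N. C / 2^k * nm x)" by (intro sum_mono dec x) (auto simp: M_def)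
      also have "\<dots> \<le> 2 * C / 2^M * nm x" by (rule geometric_tail_le[OF C0 nm_nonneg])
      finally show ?thesis .
    qed
    \<comment> \<open>The infinite sum of late blocks is cut at \<open>N'\<close>, where the tail of
      the fixed vector \<open>F x\<close> has norm below \<epsilon>; the finite part is a geometric
      sum.\<close>
    have "nm (tlb M (F x)) \<le> 2 * C / 2^M * nm x + \<epsilon>" if eps: "0 < \<epsilon>" for \<epsilon>
    proof -
      obtain N where N: "\<And>j. j \<ge> N \<Longrightarrow> nm (hi j (F x)) < \<epsilon>" using nm_hi_small[OF FX eps] by blast
      define N' where "N' = max M N"
      have "(\<Sum>k<N'. proj k (F x)) = (\<Sum>k<M. proj k (F x)) + (\<Sum>k=M..<N'. proj k (F x))"
        by (simp add: N'_def lessThan_atLeast0 sum.atLeastLessThan_concat)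
      hence "tlb M (F x) = (\<Sum>k=M..<N'. proj k (F x)) + tlb N' (F x)"
        by (simp add: tlb_eq)
      hence "nm (tlb M (F x)) \<le> nm (\<Sum>k=M..<N'. proj k (F x)) + nm (tlb N' (F x))"
        using nm_triangle[OF sum_X opb_X[OF opb_tlb FX], of "{M..<N'}" "\<lambda>k. proj k (F x)" N'] opb_X[OF opb_proj FX] by simp
      also have "nm (tlb N' (F x)) \<le> \<epsilon>" using nm_tlb_le_hi[OF FX, of N'] N[of N'] by (simp add: N'_def)
      finally show ?thesis using part[of N'] by simp
    qed
    hence "nm (tlb M (F x)) \<le> 2 * C / 2^M * nm x" by (rule field_le_epsilon)
    also have "\<dots> \<le> e * nm x" using M by (intro mult_right_mono) auto
    finally show "nm (tlb M (F x)) \<le> e * nm x" .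
  qed (use e in simp)
  hence "opb e (\<lambda>x. F x - (\<Sum>k<M. proj k (F x)))"
  proof (rule opb_cong)
    fix x
    show "F x - (\<Sum>k<M. proj k (F x)) = tlb M (F x)"
      by (simp add: tlb_eq)
  qed
  with K show "\<exists>K. cpt K \<and> opb e (\<lambda>x. F x - K x)" by blast
qed

text \<open>The mirror image with blocks in the domain, needed for Q as the previous lemma is for J.
  The cut is now made in x, and the remainder is controlled by boundedness of F.\<close>

lemma cpt_of_block_decay_domain:
  assumes F: "bop p F" and blk: "\<And>k. cpt (\<lambda>x. F (proj k x))"
    and dec: "\<And>k x. k \<ge> k0 \<Longrightarrow> x \<in> X \<Longrightarrow> nm (F (proj k x)) \<le> C / 2^k * nm x"
  shows "cpt F"
proof (rule cpt_limit[OF F])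
  fix e :: real assume e: "0 < e"
  obtain b where b: "opb b F" using F bop_iff_opb by blast
  obtain M0 :: nat where M0: "2 * C / 2^M0 < e" using half_power_tail[OF e] by blast
  define M where "M = max k0 M0"
  have "0 \<le> C / 2^k0" using order_trans[OF nm_nonneg dec[of k0 "ub 0"]] by simp
  hence "0 \<le> C / 2^k0 * 2^k0" by (intro mult_nonneg_nonneg) auto
  hence C0: "0 \<le> C" by simp
  have "2 * C / 2^M \<le> 2 * C / 2^M0" using C0 by (intro divide_left_mono) (auto simp: M_def)
  with M0 have M: "2 * C / 2^M < e" by linarith
  have K: "cpt (\<lambda>x. \<Sum>k<M. F (proj k x))" by (rule cpt_sum) (rule blk)
  have "opb e (\<lambda>x. F (tlb M x))"
  proof (rule opbI_bop[OF bop_comp[OF F opb_bop[OF opb_tlb]]])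
    fix x assume x: "x \<in> X"
    note PX = opb_X[OF opb_proj x]
    have part: "nm (\<Sum>k=M..<N. F (proj k x)) \<le> 2 * C / 2^M * nm x" for N
    proof -
      have "nm (\<Sum>k=M..<N. F (proj k x)) \<le> (\<Sum>k=M..<N. nm (F (proj k x)))"
        by (rule nm_sum) (use bop_X[OF F PX] in auto)
      also have "\<dots> \<le> (\<Sum>k=M..<N. C / 2^k * nm x)" by (intro sum_mono dec x) (auto simp: M_def)
      also have "\<dots> \<le> 2 * C / 2^M * nm x" by (rule geometric_tail_le[OF C0 nm_nonneg])
      finally show ?thesis .
    qed
    have "nm (F (tlb M x)) \<le> 2 * C / 2^M * nm x + \<epsilon>" if eps: "0 < \<epsilon>" for \<epsilon>
    proof -
      have b1: "0 < \<epsilon> / (b + 1)" using eps opb_nonneg[OF b] by simp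
      obtain N where N: "\<And>j. j \<ge> N \<Longrightarrow> nm (hi j x) < \<epsilon> / (b + 1)" using nm_hi_small[OF x b1] by blast
      define N' where "N' = max M N"
      have "(\<Sum>k<N'. proj k x) = (\<Sum>k<M. proj k x) + (\<Sum>k=M..<N'. proj k x)"
        by (simp add: N'_def lessThan_atLeast0 sum.atLeastLessThan_concat)
      hence t: "tlb M x = (\<Sum>k=M..<N'. proj k x) + tlb N' x"
        by (simp add: tlb_eq)
      have SX: "(\<Sum>k=M..<N'. proj k x) \<in> X" by (rule sum_X) (rule PX)
      have TX: "tlb N' x \<in> X" using opb_X[OF opb_tlb x] .
      have "F (tlb M x) = (\<Sum>k=M..<N'. F (proj k x)) + F (tlb N' x)"
        unfolding t opb_add[OF b SX TX] by (subst opb_sum_arg[OF b PX]) simp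
      hence "nm (F (tlb M x)) \<le> nm (\<Sum>k=M..<N'. F (proj k x)) + nm (F (tlb N' x))"
        using nm_triangle[OF sum_X bop_X[OF F TX], of "{M..<N'}" "\<lambda>k. F (proj k x)"] bop_X[OF F PX] by simp
      also have "nm (F (tlb N' x)) \<le> \<epsilon>"
      proof -
        have "nm (F (tlb N' x)) \<le> b * nm (tlb N' x)" by (rule opb_nm[OF b TX])
        also have "\<dots> \<le> b * (\<epsilon> / (b + 1))"
          using nm_tlb_le_hi[OF x, of N'] N[of N'] opb_nonneg[OF b] by (intro mult_left_mono) (auto simp: N'_def)
        also have "\<dots> \<le> \<epsilon>" using eps opb_nonneg[OF b] by (simp add: field_simps)
        finally show ?thesis .
      qed
      finally show ?thesis using part[of N'] by simp
    qed
    hence "nm (F (tlb M x)) \<le> 2 * C / 2^M * nm x" by (rule field_le_epsilon)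
    also have "\<dots> \<le> e * nm x" using M by (intro mult_right_mono) auto
    finally show "nm (F (tlb M x)) \<le> e * nm x" .
  qed (use e in simp)
  hence "opb e (\<lambda>x. F x - (\<Sum>k<M. F (proj k x)))"
  proof (rule opb_cong)
    fix x assume x: "x \<in> X"
    have SX: "(\<Sum>k<M. proj k x) \<in> X" by (rule sum_X) (rule opb_X[OF opb_proj x])
    have "F x = F ((\<Sum>k<M. proj k x) + tlb M x)" by (simp add: head_plus_tlb)
    also have "\<dots> = (\<Sum>k<M. F (proj k x)) + F (tlb M x)"
      unfolding opb_add[OF b SX opb_X[OF opb_tlb x]] by (subst opb_sum_arg[OF b opb_X[OF opb_proj x]]) simp
    finally show "F x - (\<Sum>k<M. F (proj k x)) = F (tlb M x)" by simp
  qed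
  with K show "\<exists>K. cpt K \<and> opb e (\<lambda>x. F x - K x)" by blast
qed

lemma Qk_add:
  assumes "\<And>i. i < n k \<Longrightarrow> bop p (B i)" "x \<in> X" "y \<in> X"
  shows "Qk k B (x + y) = Qk k B x + Qk k B y"
  using assms cf_X by (simp add: Qk_def cf_add bop_add sum.distrib vsmul_algebra)

lemma Qk_smul:
  assumes "\<And>i. i < n k \<Longrightarrow> bop p (B i)" "x \<in> X"
  shows "Qk k B (vsmul a x) = vsmul a (Qk k B x)"
  using assms cf_X by (simp add: Qk_def cf_smul bop_smul vsmul_algebra mult.commute flip: vsmul_sum)

lemma Qk_proj: "Qk k B (proj k x) = Qk k B x"
  by (simp add: Qk_def cf_proj)

lemma Qk_proj_ne: "(\<And>i. i < n k \<Longrightarrow> bop p (B i)) \<Longrightarrow> k \<noteq> j \<Longrightarrow> Qk k B (proj j x) = 0"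
proof -
  assume B: "\<And>i. i < n k \<Longrightarrow> bop p (B i)" and ne: "k \<noteq> j"
  have "cf k i (proj j x) = 0" for i using ne by (simp add: cf_def fun_eq_iff fun_apply_simps fib_proj co_def)
  moreover have "B i 0 = 0" if "i < n k" for i using bop_smul[OF B[OF that], of 0 0] by simp
  ultimately show ?thesis by (simp add: Qk_def)
qed

lemma Qk_mul:
  "(\<And>i. i < n k \<Longrightarrow> bop p (B i)) \<Longrightarrow> y \<in> X \<Longrightarrow> Qk k B (mul c y) = Qk k (\<lambda>i x. vsmul (c k i) (B i x)) y"
  by (simp add: Qk_def cf_mul bop_smul cf_X)

lemma Qk_Jop:
  assumes "\<And>i. i < n k \<Longrightarrow> bop p (B i)" "\<And>i. i < n k \<Longrightarrow> G k i x \<in> X"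
  shows "Qk k B (Jop G x) = (\<Sum>i<n k. B i (G k i x))"
  using assms nf_pos[of k] by (simp add: Qk_def cf_Jop bop_smul vsmul_algebra flip: vsmul_sum)

text \<open>A crude bound by the sum of the norms. It grows with N, but only its existence is used:
  for qualitative boundedness and for deciding how small commutators must be.\<close>

lemma opb_signed_sum:
  assumes B: "\<And>i. i < N \<Longrightarrow> bop p (B i)"
  shows "\<exists>\<beta>. \<forall>e. opb \<beta> (\<lambda>x. \<Sum>i<N. vsmul (of_real (sg i e)) (B i x))"
proof -
  obtain c where c: "\<And>i. i < N \<Longrightarrow> opb (c i) (B i)" using B unfolding bop_iff_opb by metis
  have "opb (\<Sum>i<N. c i) (\<lambda>x. \<Sum>i<N. vsmul (of_real (sg i e)) (B i x))" for e
  proof (rule opb_sum)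
    fix i assume "i \<in> {..<N}"
    hence "opb (cmod (of_real (sg i e)) * c i) (\<lambda>x. vsmul (of_real (sg i e)) (B i x))" using c by (intro opb_scale) auto
    thus "opb (c i) (\<lambda>x. vsmul (of_real (sg i e)) (B i x))" by simp
  qed
  thus ?thesis by blast
qed

lemma bop_Qk: "(\<And>i. i < n k \<Longrightarrow> bop p (B i)) \<Longrightarrow> bop p (Qk k B)"
proof -
  assume B: "\<And>i. i < n k \<Longrightarrow> bop p (B i)"
  obtain \<beta> where \<beta>: "\<And>e. opb \<beta> (\<lambda>x. \<Sum>i<n k. vsmul (of_real (sg i e)) (B i x))" using opb_signed_sum[of "n k" B, OF B] by blast
  have "opb (\<beta> * RC) (Qk k B)"
  proof (rule opbI)
    show c: "0 \<le> \<beta> * RC" using opb_nonneg[OF \<beta>] RC_ge_1 by simp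
    fix x assume x: "x \<in> X"
    show "Qk k B x \<in> X" by (rule Qk_bound(1)[OF B \<beta> x])
    have "nm (Qk k B x) \<le> \<beta> * RC * nm (proj k x)" by (rule Qk_bound(2)[OF B \<beta> x])
    also have "\<dots> \<le> \<beta> * RC * nm x" using opb_nm[OF opb_proj x] c by (intro mult_left_mono) auto
    finally show "nm (Qk k B x) \<le> \<beta> * RC * nm x" .
  qed (use Qk_add[OF B] Qk_smul[OF B] in auto)
  thus ?thesis by (rule opb_bop)
qed

end

section \<open>The dilation built from block data\<close>

text \<open>The weights \<open>w k\<close> form a partition of unity on the coordinates and \<open>D k\<close> equals 1 on the support of
  \<open>w k\<close>; the last assumption makes \<open>Q\<close> an exact left inverse of \<open>J\<close>.\<close>

locale dilation_data = lp_blocks +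
  fixes A B :: "nat \<Rightarrow> nat \<Rightarrow> (nat \<Rightarrow> complex) \<Rightarrow> nat \<Rightarrow> complex"
    and w D :: "nat \<Rightarrow> nat \<Rightarrow> real" and \<gamma> \<tau> :: "nat \<Rightarrow> nat" and L :: real
  assumes A_bop: "i < n k \<Longrightarrow> bop p (A k i)" and B_bop: "i < n k \<Longrightarrow> bop p (B k i)"
    and w_nonneg: "0 \<le> w k i" and w_sum: "(\<Sum>k<m. w k i) \<le> 1" and w_one: "(\<Sum>k<i+2. w k i) = 1"
    and D_nonneg: "0 \<le> D k i" and D_le: "D k i \<le> 1" and D_sum: "(\<Sum>k<m. D k i) \<le> 3"
    and w_supp: "w k i \<noteq> 0 \<Longrightarrow> i < \<tau> k \<and> D k i = 1"
    and D_supp: "D k i \<noteq> 0 \<Longrightarrow> i < \<tau> k \<and> \<gamma> k \<le> i \<and> k \<le> i + 1"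
    and L_nonneg: "0 \<le> L"
    and A_bound: "e < 2^n k \<Longrightarrow> x \<in> X \<Longrightarrow>
        nm (\<Sum>i<n k. vsmul (of_real (sg i e)) (A k i (dg (w k) x))) \<le> L * nm (dg (w k) x)"
    and B_bound: "e < 2^n k \<Longrightarrow> opb L (\<lambda>x. \<Sum>i<n k. vsmul (of_real (sg i e)) (hi (\<gamma> k) (B k i x)))"
    and BA: "x \<in> X \<Longrightarrow> dg (D k) (\<Sum>i<n k. B k i (A k i (dg (w k) x))) = dg (w k) x"
begin

definition J :: "(nat \<Rightarrow> complex) \<Rightarrow> nat \<Rightarrow> complex" where
  "J = Jop (\<lambda>k i x. A k i (dg (w k) x))"

text \<open>\<open>D k i\<close> vanishes for k > i + 1, so the sum over all blocks is finite in
  every coordinate and raises no convergence question.\<close>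

definition Q :: "(nat \<Rightarrow> complex) \<Rightarrow> nat \<Rightarrow> complex" where
  "Q y = (\<lambda>i. \<Sum>k<i+2. of_real (D k i) * Qk k (B k) y i)"

lemma w_le: "w k i \<le> 1"
proof -
  have "w k i = (\<Sum>j\<in>{k}. w j i)" by simp
  also have "\<dots> \<le> (\<Sum>j<Suc k. w j i)" by (rule sum_mono2) (auto simp: w_nonneg)
  finally show ?thesis using w_sum[of i "Suc k"] by linarith
qed

lemma opb_w: "opb 1 (dg (w k))" and opb_D: "opb 1 (dg (D k))"
  by (rule opb_dg; simp add: w_nonneg w_le D_nonneg D_le)+

lemma w_X: "x \<in> X \<Longrightarrow> dg (w k) x \<in> X"
  using opb_X[OF opb_w] by auto

lemma AwX: "i < n k \<Longrightarrow> x \<in> X \<Longrightarrow> A k i (dg (w k) x) \<in> X"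
  using bop_X[OF A_bop] w_X by blast

text \<open>For a weight between 0 and 1 the p-th power is at most the weight, and the weights at
  each coordinate sum to at most 1.\<close>

lemma sum_en_w: "(\<integral>\<^sup>+ k. en p (dg (w k) x) \<partial>count_space UNIV) \<le> en p x"
proof -
  have "(\<integral>\<^sup>+ k. en p (dg (w k) x) \<partial>count_space UNIV) = (\<integral>\<^sup>+ i. en p (\<lambda>k. dg (w k) x i) \<partial>count_space UNIV)"
    by (rule en_swap)
  also have "\<dots> \<le> en p x"
    unfolding en_def[of p x]
  proof (rule nn_integral_mono)
    fix i
    have "en p (\<lambda>k. dg (w k) x i) = (\<Sum>k. ennreal (cmod (dg (w k) x i) powr p))"
      by (simp add: en_def nn_integral_count_space_nat)
    also have "\<dots> \<le> (\<Sum>k. ennreal (cmod (x i) powr p) * ennreal (w k i))"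
    proof (intro suminf_le allI)
      fix k
      have "(w k i) powr p \<le> (w k i) powr 1" if "w k i > 0" using that w_le[of k i] p_gt_1 by (intro powr_mono') auto
      hence "(w k i) powr p \<le> w k i" using w_nonneg[of k i] by (cases "w k i = 0") auto
      hence "cmod (dg (w k) x i) powr p \<le> cmod (x i) powr p * w k i"
        using w_nonneg[of k i] by (simp add: dg_apply norm_mult powr_mult mult.commute[of "cmod (x i) powr p"] mult_right_mono)
      thus "ennreal (cmod (dg (w k) x i) powr p) \<le> ennreal (cmod (x i) powr p) * ennreal (w k i)"
        using w_nonneg[of k i] by (simp add: ennreal_leI flip: ennreal_mult)
    qed auto
    also have "\<dots> = ennreal (cmod (x i) powr p) * (\<Sum>k. ennreal (w k i))" by (rule ennreal_suminf_cmult)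
    also have "(\<Sum>k. ennreal (w k i)) \<le> 1"
    proof (rule suminf_le_const)
      show "(\<Sum>k<m. ennreal (w k i)) \<le> 1" for m
        using w_sum[of i m] by (simp add: w_nonneg sum_ennreal)
    qed simp
    finally show "en p (\<lambda>k. dg (w k) x i) \<le> ennreal (cmod (x i) powr p)"
      by (simp add: mult_left_mono)
  qed
  finally show ?thesis .
qed

lemma Gs_J: "Gs (\<lambda>k i x. A k i (dg (w k) x)) k e x = (\<Sum>i<n k. vsmul (of_real (sg i e)) (A k i (dg (w k) x)))"
  by (simp add: Gs_def)

lemma Gs_J_X: "x \<in> X \<Longrightarrow> Gs (\<lambda>k i x. A k i (dg (w k) x)) k e x \<in> X"
  unfolding Gs_J by (rule sum_X) (use AwX in auto)

lemma opb_J: "opb L J"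
proof -
  have e: "en p (J x) \<le> ennreal (L powr p) * en p x" if x: "x \<in> X" for x
  proof -
    have "en p (J x) \<le> (\<integral>\<^sup>+ k. ennreal (L powr p) * en p (dg (w k) x) \<partial>count_space UNIV)"
      unfolding J_def en_Jop
    proof (intro nn_integral_mono en_Gs_average_le)
      fix k e :: nat assume "e < 2^n k"
      thus "en p (Gs (\<lambda>k i x. A k i (dg (w k) x)) k e x) \<le> ennreal (L powr p) * en p (dg (w k) x)"
        using A_bound[of e k x] x Gs_J_X[OF x, of k e] w_X[OF x] L_nonneg unfolding Gs_J by (intro en_leI) auto
    qed
    also have "\<dots> = ennreal (L powr p) * (\<integral>\<^sup>+ k. en p (dg (w k) x) \<partial>count_space UNIV)" by (simp add: nn_integral_cmult)
    also have "\<dots> \<le> ennreal (L powr p) * en p x" by (intro mult_left_mono sum_en_w) auto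
    finally show ?thesis .
  qed
  show ?thesis
  proof (rule opbI)
    fix x y assume xy: "x \<in> X" "y \<in> X"
    show "J (x + y) = J x + J y" unfolding J_def
      by (rule Jop_add) (use xy w_X bop_add[OF A_bop] opb_add[OF opb_w] in auto)
  next
    fix a x assume x: "x \<in> X"
    show "J (vsmul a x) = vsmul a (J x)" unfolding J_def
      by (rule Jop_smul) (use x w_X bop_smul[OF A_bop] opb_smul[OF opb_w] in auto)
  qed (use en_le_imp[OF e _ L_nonneg] L_nonneg in auto)
qed

text \<open>The operators \<open>B k i\<close> have the uniform signed-sum bound only after
  truncation at \<open>\<gamma> k\<close>. As \<open>D k\<close> vanishes below
  \<open>\<gamma> k\<close>, the truncated version may replace the full one inside Q.\<close>

definition V :: "nat \<Rightarrow> (nat \<Rightarrow> complex) \<Rightarrow> nat \<Rightarrow> complex" where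
  "V k = Qk k (\<lambda>i x. hi (\<gamma> k) (B k i x))"

lemma hiB_bop: "i < n k \<Longrightarrow> bop p (\<lambda>x. hi (\<gamma> k) (B k i x))"
  by (rule bop_comp[OF bop_hi B_bop])

lemma V_bound: "y \<in> X \<Longrightarrow> V k y \<in> X" "y \<in> X \<Longrightarrow> nm (V k y) \<le> L * RC * nm (proj k y)"
  unfolding V_def by (rule Qk_bound[OF hiB_bop B_bound]; simp)+

lemma D_V: "of_real (D k i) * Qk k (B k) y i = of_real (D k i) * V k y i"
proof (cases "D k i = 0")
  case False
  hence "\<gamma> k \<le> i" using D_supp by blast
  thus ?thesis by (simp add: V_def Qk_def fun_apply_simps hi_apply)
qed simp

text \<open>At each coordinate the numbers \<open>D k i / 3\<close> are subprobability weights, so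
  Jensen applies and the overlap of the blocks costs only a factor 3.\<close>

lemma en_Q:
  assumes y: "y \<in> X"
  shows "en p (Q y) \<le> ennreal ((3 * (L * RC)) powr p) * en p y"
proof -
  have LR: "0 \<le> L * RC" using L_nonneg RC_ge_1 by simp
  have pt: "ennreal (cmod (Q y i) powr p) \<le> ennreal (3 powr p) * (\<Sum>k. ennreal (cmod (V k y i) powr p))" for i
  proof -
    have "cmod (Q y i) \<le> (\<Sum>k<i+2. D k i * cmod (V k y i))"
      unfolding Q_def D_V by (rule order_trans[OF norm_sum]) (simp add: norm_mult D_nonneg)
    also have "\<dots> = 3 * (\<Sum>k<i+2. (D k i / 3) * cmod (V k y i))" by (simp add: sum_distrib_left)
    finally have "cmod (Q y i) powr p \<le> (3 * (\<Sum>k<i+2. (D k i / 3) * cmod (V k y i))) powr p"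
      by (intro powr_mono2) auto
    also have "\<dots> = 3 powr p * (\<Sum>k<i+2. (D k i / 3) * cmod (V k y i)) powr p"
      by (rule powr_mult)
    also have "\<dots> \<le> 3 powr p * (\<Sum>k<i+2. (D k i / 3) * cmod (V k y i) powr p)"
      using D_sum[of i "i+2"] p_gt_1
      by (intro mult_left_mono weighted_powr_le) (auto simp: D_nonneg simp flip: sum_divide_distrib)
    also have "\<dots> \<le> 3 powr p * (\<Sum>k<i+2. cmod (V k y i) powr p)"
    proof (intro mult_left_mono sum_mono)
      fix k show "D k i / 3 * cmod (V k y i) powr p \<le> cmod (V k y i) powr p"
        using D_nonneg[of k i] D_le[of k i] by (intro mult_left_le_one_le) auto
    qed simp
    finally have "ennreal (cmod (Q y i) powr p) \<le> ennreal (3 powr p * (\<Sum>k<i+2. cmod (V k y i) powr p))" by (rule ennreal_leI)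
    also have "\<dots> = ennreal (3 powr p) * (\<Sum>k<i+2. ennreal (cmod (V k y i) powr p))"
      by (simp add: ennreal_mult sum_nonneg sum_ennreal)
    also have "\<dots> \<le> ennreal (3 powr p) * (\<Sum>k. ennreal (cmod (V k y i) powr p))"
      by (intro mult_left_mono sum_le_suminf) auto
    finally show ?thesis .
  qed
  have "en p (Q y) \<le> (\<integral>\<^sup>+ i. ennreal (3 powr p) * (\<Sum>k. ennreal (cmod (V k y i) powr p)) \<partial>count_space UNIV)"
    unfolding en_def by (intro nn_integral_mono pt)
  also have "\<dots> = ennreal (3 powr p) * (\<integral>\<^sup>+ i. en p (\<lambda>k. V k y i) \<partial>count_space UNIV)"
    by (simp add: nn_integral_cmult en_def nn_integral_count_space_nat)
  also have "(\<integral>\<^sup>+ i. en p (\<lambda>k. V k y i) \<partial>count_space UNIV) = (\<integral>\<^sup>+ k. en p (V k y) \<partial>count_space UNIV)"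
    by (rule en_swap)
  also have "\<dots> \<le> (\<integral>\<^sup>+ k. ennreal ((L * RC) powr p) * en p (proj k y) \<partial>count_space UNIV)"
    by (intro nn_integral_mono en_leI V_bound y LR opb_X[OF opb_proj y])
  also have "\<dots> = ennreal ((L * RC) powr p) * en p y"
    by (simp add: nn_integral_cmult en_eq_sum_proj[of y])
  finally have "en p (Q y) \<le> ennreal (3 powr p) * (ennreal ((L * RC) powr p) * en p y)"
    by (simp add: mult_left_mono)
  also have "\<dots> = ennreal ((3 * (L * RC)) powr p) * en p y"
    using LR by (simp add: powr_mult ennreal_mult mult.assoc)
  finally show ?thesis .
qed

lemma QkB_add: "x \<in> X \<Longrightarrow> y \<in> X \<Longrightarrow> Qk k (B k) (x + y) = Qk k (B k) x + Qk k (B k) y"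
  and QkB_smul: "x \<in> X \<Longrightarrow> Qk k (B k) (vsmul a x) = vsmul a (Qk k (B k) x)"
  and QkB_mul: "x \<in> X \<Longrightarrow> Qk k (B k) (mul c x) = Qk k (\<lambda>i x. vsmul (c k i) (B k i x)) x"
  and QkB_proj_ne: "k \<noteq> j \<Longrightarrow> Qk k (B k) (proj j x) = 0"
  by (rule Qk_add[OF B_bop] Qk_smul[OF B_bop] Qk_mul[OF B_bop] Qk_proj_ne[OF B_bop]; assumption)+

lemma opb_Q: "opb (3 * (L * RC)) Q"
proof (rule opbI)
  show c: "0 \<le> 3 * (L * RC)" using L_nonneg RC_ge_1 by simp
  fix x assume x: "x \<in> X"
  show "Q x \<in> X" "nm (Q x) \<le> 3 * (L * RC) * nm x" using en_le_imp[OF en_Q[OF x] x c] by auto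
  show "Q (vsmul a x) = vsmul a (Q x)" for a
    unfolding Q_def QkB_smul[OF x] fun_eq_iff vsmul_apply sum_distrib_left
    by (intro allI sum.cong refl) (simp add: mult_ac)
  fix y assume y: "y \<in> X"
  show "Q (x + y) = Q x + Q y"
    unfolding Q_def QkB_add[OF x y] fun_eq_iff plus_fun_apply distrib_left sum.distrib by simp
qed

lemma QJ: "x \<in> X \<Longrightarrow> Q (J x) = x"
proof
  fix i assume x: "x \<in> X"
  have "of_real (D k i) * Qk k (B k) (J x) i = of_real (w k i) * x i" for k
  proof -
    have "Qk k (B k) (J x) = (\<Sum>i<n k. B k i (A k i (dg (w k) x)))"
      unfolding J_def by (rule Qk_Jop[OF B_bop]) (use AwX x in auto)
    hence "of_real (D k i) * Qk k (B k) (J x) i = dg (D k) (\<Sum>i<n k. B k i (A k i (dg (w k) x))) i"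
      by (simp add: dg_apply)
    thus ?thesis unfolding BA[OF x] by (simp add: dg_apply)
  qed
  hence "Q (J x) i = (\<Sum>k<i+2. of_real (w k i)) * x i"
    unfolding Q_def by (simp only: sum_distrib_right)
  also have "(\<Sum>k<i+2. complex_of_real (w k i)) = 1" using w_one[of i] by (metis of_real_1 of_real_sum)
  finally show "Q (J x) i = x i" by simp
qed

lemma J_range: "mul (\<lambda>_ _. 1) (J x) = J x"
  unfolding J_def mul_Jop by simp

lemma Q_mul: "y \<in> X \<Longrightarrow> Q (mul (\<lambda>_ _. 1) y) = Q y"
  using QkB_mul[of y _ "\<lambda>_ _. 1"] by (simp add: Q_def)

lemma Q_proj: "Q (proj k y) = dg (D k) (Qk k (B k) y)"
proof
  fix i
  have "Q (proj k y) i = (\<Sum>j<i+2. if j = k then of_real (D k i) * Qk k (B k) y i else 0)"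
    unfolding Q_def
  proof (rule sum.cong)
    fix j
    show "of_real (D j i) * Qk j (B j) (proj k y) i = (if j = k then of_real (D k i) * Qk k (B k) y i else 0)"
      using QkB_proj_ne[of j k y] by (auto simp: Qk_proj fun_apply_simps)
  qed simp
  also have "\<dots> = of_real (D k i) * Qk k (B k) y i" using D_supp[of k i] by (cases "D k i = 0") auto
  finally show "Q (proj k y) i = dg (D k) (Qk k (B k) y) i" by (simp add: dg_apply)
qed

text \<open>A single block of J sees x only through \<open>w k\<close>, which has finite support, so
  it has finite rank.\<close>

lemma cpt_proj_J: "cpt (\<lambda>x. proj k (J x))"
proof -
  define S where "S = Jop (\<lambda>k' i z. if k' = k then A k i z else 0)"
  have AB: "i < n k \<Longrightarrow> bop p (A k i)" for i by (rule A_bop)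
  obtain \<beta> where \<beta>: "\<And>e. opb \<beta> (\<lambda>x. \<Sum>i<n k. vsmul (of_real (sg i e)) (A k i x))" using opb_signed_sum[of "n k" "A k", OF AB] by blast
  have "en p (S z) \<le> ennreal (\<beta> powr p) * en p z" if z: "z \<in> X" for z
  proof -
    have "en p (S z) \<le> (\<integral>\<^sup>+ k'. ennreal (\<beta> powr p) * en p z * indicator {k} k' \<partial>count_space UNIV)"
      unfolding S_def en_Jop
    proof (intro nn_integral_mono en_Gs_average_le)
      fix k' e :: nat
      show "en p (Gs (\<lambda>k' i z. if k' = k then A k i z else 0) k' e z) \<le> ennreal (\<beta> powr p) * en p z * indicator {k} k'"
      proof (cases "k' = k")
        case True
        hence g: "Gs (\<lambda>k' i z. if k' = k then A k i z else 0) k' e z = (\<Sum>i<n k. vsmul (of_real (sg i e)) (A k i z))"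
          by (simp add: Gs_def)
        show ?thesis unfolding g using True opb_nm[OF \<beta> z] opb_X[OF \<beta> z] z opb_nonneg[OF \<beta>] by (simp add: en_leI)
      next
        case False
        hence "Gs (\<lambda>k' i z. if k' = k then A k i z else 0) k' e z = 0" by (simp add: Gs_def)
        thus ?thesis by simp
      qed
    qed
    thus ?thesis by (simp add: nn_integral_cmult one_ennreal_def[symmetric])
  qed
  note e = this
  have S: "opb \<beta> S"
  proof (rule opbI)
    fix x y assume "x \<in> X" "y \<in> X"
    thus "S (x + y) = S x + S y" unfolding S_def by (intro Jop_add) (auto simp: bop_add[OF AB])
  next
    fix a x assume "x \<in> X"
    thus "S (vsmul a x) = vsmul a (S x)" unfolding S_def by (intro Jop_smul) (auto simp: bop_smul[OF AB])
  qed (use en_le_imp[OF e _ opb_nonneg[OF \<beta>]] opb_nonneg[OF \<beta>] in auto)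
  have "cpt (\<lambda>x. S (dg (w k) (lo (\<tau> k) x)))"
    by (rule cpt_finite_rank[OF bop_comp[OF opb_bop[OF S] opb_bop[OF opb_w]]])
  thus ?thesis
  proof (rule cpt_cong)
    fix x
    have "dg (w k) (lo (\<tau> k) x) = dg (w k) x" using w_supp[of k] by (auto simp: fun_eq_iff dg_apply lo_apply)
    thus "proj k (J x) = S (dg (w k) (lo (\<tau> k) x))"
      unfolding S_def J_def by (intro tri_ext) (auto simp: proj_def Jop_def Gs_def fun_apply_simps)
  qed
qed

text \<open>Every single block of J is compact, so the quantitative estimate is needed for late
  blocks only, and decay along the blocks yields compactness of the whole defect.\<close>

lemma J_intertwines:
  assumes T: "bop p T" and c: "\<And>k i. i < n k \<Longrightarrow> cmod (c k i) \<le> s" "0 \<le> s"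
    and est: "\<And>k e x. k \<ge> k0 \<Longrightarrow> e < 2^n k \<Longrightarrow> x \<in> X \<Longrightarrow>
      nm (\<Sum>i<n k. vsmul (of_real (sg i e)) (A k i (dg (w k) (T x)) - vsmul (c k i) (A k i (dg (w k) x)))) \<le> C / 2^k * nm x"
  shows "ess (\<lambda>x. J (T x)) (\<lambda>x. mul c (J x))"
proof -
  have m: "bop p (mul c)" by (rule opb_bop[OF opb_mul[of s]]) (use c in auto)
  have bJ: "bop p J" using opb_bop[OF opb_J] .
  have b1: "bop p (\<lambda>x. J (T x))" and b2: "bop p (\<lambda>x. mul c (J x))"
    by (rule bop_comp[OF bJ T], rule bop_comp[OF m bJ])
  let ?F = "\<lambda>x. J (T x) - mul c (J x)"
  have "cpt ?F"
  proof (rule cpt_of_block_decay_range[where C = C and ?k0.0 = k0])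
    show F: "bop p ?F" using bop_minus_op[OF b1 b2] .
    show "cpt (\<lambda>x. proj k (?F x))" for k
    proof -
      have "cpt (\<lambda>x. proj k (J (T x)) - mul c (proj k (J x)))"
        by (rule cpt_diff[OF cpt_comp_right[OF cpt_proj_J T] cpt_comp_left[OF m cpt_proj_J]])
      thus ?thesis
        by (rule cpt_cong) (use bop_X[OF b1] bop_X[OF b2] in \<open>auto simp: mul_proj opb_diff[OF opb_proj]\<close>)
    qed
    fix k x assume k: "k \<ge> k0" and x: "x \<in> X"
    define H where "H = (\<lambda>k i (_::unit). A k i (dg (w k) (T x)) - vsmul (c k i) (A k i (dg (w k) x)))"
    have eq: "?F x = Jop H ()"
      unfolding J_def mul_Jop Jop_diff H_def ..
    have C0: "0 \<le> C / 2^k" using order_trans[OF nm_nonneg est[OF k, of 0 "ub 0"]] by simp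
    have "en p (proj k (?F x)) \<le> ennreal ((C / 2^k) powr p) * en p x"
      unfolding eq en_proj_Jop
    proof (rule en_Gs_average_le, rule en_leI)
      fix e :: nat assume e: "e < 2^n k"
      show "nm (Gs H k e ()) \<le> C / 2^k * nm x" using est[OF k e x] by (simp add: Gs_def H_def)
      show "Gs H k e () \<in> X" unfolding Gs_def H_def
        by (rule sum_X) (use AwX x bop_X[OF T x] in auto)
    qed (use x C0 in auto)
    from en_le_imp(2)[OF this x C0] show "nm (proj k (?F x)) \<le> C / 2^k * nm x" .
  qed
  with b1 b2 show ?thesis unfolding ess_def by blast
qed

text \<open>Here a single block is compact because \<open>D k\<close> has finite support in the
  range; the decay is used on the domain side.\<close>

lemma Q_intertwines:
  assumes T: "bop p T" and c: "\<And>k i. i < n k \<Longrightarrow> cmod (c k i) \<le> s" "0 \<le> s"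
    and est: "\<And>k y. k \<ge> k0 \<Longrightarrow> y \<in> X \<Longrightarrow>
      nm (T (dg (D k) (Qk k (B k) y)) - dg (D k) (Qk k (\<lambda>i x. vsmul (c k i) (B k i x)) y)) \<le> C / 2^k * nm y"
  shows "ess (\<lambda>y. T (Q y)) (\<lambda>y. Q (mul c y))"
proof -
  have m: "bop p (mul c)" by (rule opb_bop[OF opb_mul[of s]]) (use c in auto)
  have bQ: "bop p Q" using opb_bop[OF opb_Q] .
  have b1: "bop p (\<lambda>y. T (Q y))" and b2: "bop p (\<lambda>y. Q (mul c y))"
    by (rule bop_comp[OF T bQ], rule bop_comp[OF bQ m])
  let ?F = "\<lambda>y. T (Q y) - Q (mul c y)"
  have cQ: "cpt (\<lambda>y. Q (proj k y))" for k
  proof -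
    have "cpt (\<lambda>x. lo (\<tau> k) x)" using cpt_finite_rank[OF bop_id] .
    from cpt_comp_right[OF this bop_comp[OF opb_bop[OF opb_D] bop_Qk[of k "B k", OF B_bop]]]
    have "cpt (\<lambda>y. lo (\<tau> k) (dg (D k) (Qk k (B k) y)))" by simp
    thus ?thesis
      by (rule cpt_cong) (use D_supp[of k] in \<open>auto simp: Q_proj fun_eq_iff lo_apply dg_apply\<close>)
  qed
  have "cpt ?F"
  proof (rule cpt_of_block_decay_domain[where C = C and ?k0.0 = k0])
    show F: "bop p ?F" using bop_minus_op[OF b1 b2] .
    show "cpt (\<lambda>x. ?F (proj k x))" for k
      unfolding mul_proj
      by (rule cpt_diff[OF cpt_comp_left[OF T cQ] cpt_comp_right[OF cQ m]])
    fix k x assume k: "k \<ge> k0" and x: "x \<in> X"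
    have "Q (mul c (proj k x)) = dg (D k) (Qk k (\<lambda>i x. vsmul (c k i) (B k i x)) x)"
      unfolding mul_proj Q_proj using QkB_mul[OF x] by simp
    thus "nm (?F (proj k x)) \<le> C / 2^k * nm x"
      using est[OF k x] by (simp add: Q_proj)
  qed
  with b1 b2 show ?thesis unfolding ess_def by blast
qed

end

section \<open>Construction of the block data\<close>

context lp_blocks
begin

lemma Qk_comp:
  assumes T: "bop p T" and B: "\<And>i. i < n k \<Longrightarrow> bop p (B i)" and y: "y \<in> X"
  shows "T (Qk k B y) = Qk k (\<lambda>i x. T (B i x)) y"
proof -
  have BX: "i \<in> {..<n k} \<Longrightarrow> B i (cf k i y) \<in> X" for i using bop_X[OF B cf_X[OF y]] by auto
  have "T (vsmul c (\<Sum>i<n k. B i (cf k i y))) = vsmul c (\<Sum>i<n k. T (B i (cf k i y)))" for c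
    using bop_smul[OF T sum_X[of "{..<n k}" "\<lambda>i. B i (cf k i y)", OF BX]]
      bop_sum_arg[OF T, of "{..<n k}" "\<lambda>i. B i (cf k i y)", OF BX] by simp
  thus ?thesis by (simp add: Qk_def)
qed

lemma Qk_diff: "Qk k (\<lambda>i x. F i x - G i x) y = Qk k F y - Qk k G y"
  by (simp add: Qk_def sum_subtractf vsmul_algebra)

lemma dg_hi: "(\<And>i. w i \<noteq> 0 \<Longrightarrow> m \<le> i) \<Longrightarrow> dg w (hi m x) = dg w x"
  and hi_dg: "(\<And>i. w i \<noteq> 0 \<Longrightarrow> m \<le> i) \<Longrightarrow> hi m (dg w x) = dg w x"
proof -
  assume w: "\<And>i. w i \<noteq> 0 \<Longrightarrow> m \<le> i"
  have "w i = 0" if "i < m" for i using w[of i] that by auto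
  thus "dg w (hi m x) = dg w x" "hi m (dg w x) = dg w x" by (auto simp: fun_eq_iff pt)
qed

lemma commutator_diff:
  assumes T: "bop p T" and w: "w = (\<lambda>i. u i - v i)" and u: "\<And>i. \<bar>u i\<bar> \<le> 1" and v: "\<And>i. \<bar>v i\<bar> \<le> 1"
    and cu: "opb a (\<lambda>x. dg u (T x) - T (dg u x))" and cv: "opb b (\<lambda>x. dg v (T x) - T (dg v x))"
  shows "opb (a + b) (\<lambda>x. dg w (T x) - T (dg w x))"
proof (rule opb_cong[OF opb_minus_op[OF cu cv]])
  fix x assume x: "x \<in> X"
  have d: "dg w y = dg u y - dg v y" for y by (simp add: w fun_eq_iff pt left_diff_distrib)
  show "dg w (T x) - T (dg w x) = (dg u (T x) - T (dg u x)) - (dg v (T x) - T (dg v x))"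
    unfolding d using bop_diff[OF T opb_X[OF opb_dg x] opb_X[OF opb_dg x], of u v] u v by simp
qed

text \<open>Each block has one index more than the partition. For \<open>k \<ge> 2\<close> the pair of operators at this extra
  index cancels the compact defect of \<open>\<Sum> a\<^sub>i a\<^sub>i = 1\<close>, so that no Neumann series is needed. For \<open>k < 2\<close> the
  weight \<open>D k\<close> reaches down to coordinate 0, where the essential bounds give nothing; these blocks
  carry the identity instead, which is harmless because their weights have finite support.\<close>

lemma block_dilation:
  fixes \<nu> :: "nat \<Rightarrow> nat" and a :: "nat \<Rightarrow> nat \<Rightarrow> (nat \<Rightarrow> complex) \<Rightarrow> nat \<Rightarrow> complex"
  assumes n: "\<And>k. n k = Suc (\<nu> k)" and L: "0 \<le> L"
    and aB: "\<And>k i. i < \<nu> k \<Longrightarrow> bop p (a k i)" and T: "\<And>j. bop p (T j)"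
    and unit: "\<And>k. cpt (\<lambda>x. (\<Sum>i<\<nu> k. a k i (a k i x)) - x)"
    and aess: "\<And>k e. \<exists>K. cpt K \<and> opb L (\<lambda>x. (\<Sum>i<\<nu> k. vsmul (of_real (sg i e)) (a k i x)) + K x)"
    and comm1: "\<And>k j e. j \<le> k \<Longrightarrow> \<exists>K. cpt K \<and> opb (L / 2^k)
      (\<lambda>x. (\<Sum>i<\<nu> k. vsmul (of_real (sg i e)) (a k i (T j x) - vsmul (\<kappa> j k i) (a k i x))) + K x)"
    and comm2: "\<And>k j e. j \<le> k \<Longrightarrow> \<exists>K. cpt K \<and> opb (L / 2^k)
      (\<lambda>x. (\<Sum>i<\<nu> k. vsmul (of_real (sg i e)) (T j (a k i x) - vsmul (\<kappa> j k i) (a k i x))) + K x)"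
    and chi: "\<And>j. \<exists>s\<ge>0. \<forall>k i. cmod (\<kappa> j k i) \<le> s"
  shows "\<exists>J Q. opb (L + 2) J \<and> opb (3 * ((L + 2) * RC)) Q \<and> (\<forall>x\<in>X. Q (J x) = x)
    \<and> (\<forall>x. mul (\<lambda>_ _. 1) (J x) = J x) \<and> (\<forall>y\<in>X. Q (mul (\<lambda>_ _. 1) y) = Q y)
    \<and> (\<forall>j. ess (\<lambda>x. J (T j x)) (\<lambda>x. mul (\<kappa> j) (J x)) \<and> ess (\<lambda>y. T j (Q y)) (\<lambda>y. Q (mul (\<kappa> j) y)))"
proof -
  define SA where "SA k e x = (\<Sum>i<\<nu> k. vsmul (of_real (sg i e)) (a k i x))" for k e x
  define C1 where "C1 k j e x = (\<Sum>i<\<nu> k. vsmul (of_real (sg i e)) (a k i (T j x) - vsmul (\<kappa> j k i) (a k i x)))" for k j e x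
  define C2 where "C2 k j e x = (\<Sum>i<\<nu> k. vsmul (of_real (sg i e)) (T j (a k i x) - vsmul (\<kappa> j k i) (a k i x)))" for k j e x
  define Kk where "Kk k x = (\<Sum>i<\<nu> k. a k i (a k i x)) - x" for k x
  have Kc: "cpt (Kk k)" for k unfolding Kk_def by (rule unit)
  have bSA: "bop p (SA k e)" for k e unfolding SA_def by (rule bop_sum[OF bop_scale]) (use aB in auto)
  have bC1: "bop p (C1 k j e)" for k j e unfolding C1_def
    by (rule bop_sum[OF bop_scale[OF bop_minus_op[OF bop_comp[OF aB T] bop_scale[OF aB]]]]) auto
  have bC2: "bop p (C2 k j e)" for k j e unfolding C2_def
    by (rule bop_sum[OF bop_scale[OF bop_minus_op[OF bop_comp[OF T aB] bop_scale[OF aB]]]]) auto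
  have L1: "L / 2^k + 1 / 2^k = (L + 1) / 2^k" for k by (simp add: add_divide_distrib)

  \<comment> \<open>Behind a cut depending on k the essential bounds become norm bounds, with slack
    1 here and \<open>1 / 2^k\<close> for the commutators. Each block involves only finitely many
    sign vectors and only the operators \<open>T j\<close> with j <= k.\<close>
  have ev1: "\<exists>N. \<forall>m\<ge>N. \<forall>e\<in>{..<2^n k}. opb (L + 1) (\<lambda>x. SA k e (hi m x)) \<and> opb (L + 1) (\<lambda>x. hi m (SA k e x))" for k
  proof (rule eventually_all_finite)
    fix e assume "e \<in> {..<(2::nat)^n k}"
    obtain K where K: "cpt K" "opb L (\<lambda>x. SA k e x + K x)" using aess unfolding SA_def by blast
    show "\<exists>N. \<forall>m\<ge>N. opb (L + 1) (\<lambda>x. SA k e (hi m x)) \<and> opb (L + 1) (\<lambda>x. hi m (SA k e x))"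
      by (rule ess_bound_hi[OF bSA K]) simp
  qed simp
  have ev2: "\<exists>N. \<forall>m\<ge>N. \<forall>t\<in>{..k} \<times> {..<2^n k}. opb ((L + 1) / 2^k) (\<lambda>x. C1 k (fst t) (snd t) (hi m x))
      \<and> opb ((L + 1) / 2^k) (\<lambda>x. hi m (C2 k (fst t) (snd t) x))" for k
  proof (rule eventually_all_finite)
    fix t assume "t \<in> {..k} \<times> {..<(2::nat)^n k}"
    hence j: "fst t \<le> k" by auto
    obtain K where K: "cpt K" "opb (L / 2^k) (\<lambda>x. C1 k (fst t) (snd t) x + K x)" using comm1[OF j] unfolding C1_def by blast
    obtain K' where K': "cpt K'" "opb (L / 2^k) (\<lambda>x. C2 k (fst t) (snd t) x + K' x)" using comm2[OF j] unfolding C2_def by blast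
    obtain N1 where N1: "\<forall>m\<ge>N1. opb (L / 2^k + 1 / 2^k) (\<lambda>x. C1 k (fst t) (snd t) (hi m x))"
      using ess_bound_hi[OF bC1 K, of "1 / 2^k"] by auto
    obtain N2 where N2: "\<forall>m\<ge>N2. opb (L / 2^k + 1 / 2^k) (\<lambda>x. hi m (C2 k (fst t) (snd t) x))"
      using ess_bound_hi[OF bC2 K', of "1 / 2^k"] by auto
    show "\<exists>N. \<forall>m\<ge>N. opb ((L + 1) / 2^k) (\<lambda>x. C1 k (fst t) (snd t) (hi m x)) \<and> opb ((L + 1) / 2^k) (\<lambda>x. hi m (C2 k (fst t) (snd t) x))"
      using N1 N2 unfolding L1 by (intro exI[of _ "max N1 N2"]) simp
  qed simp
  \<comment> \<open>The size \<open>1 / 4^k\<close> is chosen because \<open>Bx\<close> multiplies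
    this defect by \<open>2^k\<close> and must still be of size \<open>1 / 2^k\<close>.\<close>
  have ev3: "\<exists>N. \<forall>m\<ge>N. opb (1 / 4^k) (\<lambda>x. Kk k (hi m x))" for k
    by (rule cpt_op_hi_small[OF Kc]) simp
  obtain N1 where N1: "\<And>k m e. m \<ge> N1 k \<Longrightarrow> e < 2^n k \<Longrightarrow> opb (L + 1) (\<lambda>x. SA k e (hi m x)) \<and> opb (L + 1) (\<lambda>x. hi m (SA k e x))"
    using ev1 by (metis lessThan_iff)
  have "\<forall>k. \<exists>N. \<forall>m\<ge>N. \<forall>j\<le>k. \<forall>e<2^n k. opb ((L + 1) / 2^k) (\<lambda>x. C1 k j e (hi m x)) \<and> opb ((L + 1) / 2^k) (\<lambda>x. hi m (C2 k j e x))"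
    using ev2 by fastforce
  then obtain N2 where N2: "\<And>k m j e. m \<ge> N2 k \<Longrightarrow> j \<le> k \<Longrightarrow> e < 2^n k \<Longrightarrow> opb ((L + 1) / 2^k) (\<lambda>x. C1 k j e (hi m x)) \<and> opb ((L + 1) / 2^k) (\<lambda>x. hi m (C2 k j e x))"
    by metis
  obtain N3 where N3: "\<And>k m. m \<ge> N3 k \<Longrightarrow> opb (1 / 4^k) (\<lambda>x. Kk k (hi m x))" using ev3 by metis
  define N where "N k = max (N1 k) (max (N2 k) (N3 k))" for k
  have F1: "opb (L + 1) (\<lambda>x. SA k e (hi m x))" "opb (L + 1) (\<lambda>x. hi m (SA k e x))" if "m \<ge> N k" "e < 2^n k" for k m e
    using N1[of k m e] that by (auto simp: N_def)
  have F2: "opb ((L + 1) / 2^k) (\<lambda>x. C1 k j e (hi m x))" "opb ((L + 1) / 2^k) (\<lambda>x. hi m (C2 k j e x))"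
    if "m \<ge> N k" "e < 2^n k" "j \<le> k" for k m e j
    using N2[of k m j e] that by (auto simp: N_def)
  have F3: "opb (1 / 4^k) (\<lambda>x. Kk k (hi m x))" if "m \<ge> N k" for k m
    using N3[of k m] that by (auto simp: N_def)

  define A where "A k i = (if k < 2 then if i < \<nu> k then (\<lambda>x. 0) else (\<lambda>x. x)
      else if i < \<nu> k then a k i else (\<lambda>x. vsmul (1 / 2^k) x))" for k i
  \<comment> \<open>The scalar \<open>1 / 2^k\<close> at the extra index of A and the scalar here
    multiply to -1, which gives the cancellation, while the operator at the extra index is small on
    either side.\<close>
  define Bx where "Bx k x = vsmul (- (2^k)) (Kk k (hi (N k) x))" for k x
  define B where "B k i = (if k < 2 then if i < \<nu> k then (\<lambda>x. 0) else (\<lambda>x. x)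
      else if i < \<nu> k then a k i else Bx k)" for k i
  have Bx: "opb (1 / 2^k) (Bx k)" for k
  proof -
    have "opb (cmod (- (2^k)) * (1 / 4^k)) (Bx k)" unfolding Bx_def by (rule opb_scale[OF F3]) simp
    moreover have "cmod (- (2^k)) * (1 / 4^k) = 1 / 2^k"
      by (simp add: norm_power field_simps flip: power_mult_distrib)
    ultimately show ?thesis by simp
  qed
  have A_bop: "bop p (A k i)" and B_bop: "bop p (B k i)" if "i < n k" for k i
    using aB[of i k] opb_bop[OF Bx] bop_scale[OF bop_id] by (auto simp: A_def B_def)
  have "\<forall>k. \<exists>c. \<forall>e. opb c (\<lambda>x. \<Sum>i<n k. vsmul (of_real (sg i e)) (A k i x)) \<and> opb c (\<lambda>x. \<Sum>i<n k. vsmul (of_real (sg i e)) (B k i x))"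
  proof
    fix k
    obtain c1 where c1: "\<And>e. opb c1 (\<lambda>x. \<Sum>i<n k. vsmul (of_real (sg i e)) (A k i x))" using opb_signed_sum[of "n k" "A k", OF A_bop] by blast
    obtain c2 where c2: "\<And>e. opb c2 (\<lambda>x. \<Sum>i<n k. vsmul (of_real (sg i e)) (B k i x))" using opb_signed_sum[of "n k" "B k", OF B_bop] by blast
    show "\<exists>c. \<forall>e. opb c (\<lambda>x. \<Sum>i<n k. vsmul (of_real (sg i e)) (A k i x)) \<and> opb c (\<lambda>x. \<Sum>i<n k. vsmul (of_real (sg i e)) (B k i x))"
      using opb_mono[OF c1, of "max c1 c2"] opb_mono[OF c2, of "max c1 c2"] by (intro exI[of _ "max c1 c2"]) auto
  qed
  from choice[OF this] obtain Lc where Lc: "\<And>k e. opb (Lc k) (\<lambda>x. \<Sum>i<n k. vsmul (of_real (sg i e)) (A k i x))"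
    "\<And>k e. opb (Lc k) (\<lambda>x. \<Sum>i<n k. vsmul (of_real (sg i e)) (B k i x))" by blast
  have Lc0: "0 \<le> Lc k" for k using opb_nonneg[OF Lc(1)] .
  \<comment> \<open>The cut-off \<open>E k\<close> below enters the weights w and D of blocks up to
    k + 1 only. Its commutators are made small against the crude bounds of all these blocks; the
    range up to k + 3 leaves some room.\<close>
  define Mx where "Mx k = 1 + (\<Sum>i\<le>k+3. Lc i)" for k
  have Mx1: "1 \<le> Mx k" for k using Lc0 by (simp add: Mx_def sum_nonneg)
  define \<epsilon> where "\<epsilon> k = 1 / (2^k * Mx k)" for k
  have eps0: "0 < \<epsilon> k" for k using Mx1[of k] by (simp add: \<epsilon>_def)
  have Lceps: "Lc i * \<epsilon> k \<le> 1 / 2^k" if "i \<le> k + 3" for i k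
  proof -
    have "Lc i \<le> (\<Sum>i\<le>k+3. Lc i)" using that by (intro member_le_sum) (auto simp: Lc0)
    hence "Lc i / Mx k \<le> 1" using Mx1[of k] by (simp add: Mx_def)
    hence "Lc i / Mx k / 2^k \<le> 1 / 2^k" by (intro divide_right_mono) auto
    thus ?thesis by (simp add: \<epsilon>_def mult.commute)
  qed

  \<comment> \<open>The pair q holds the end of the support and the weight itself, for level k and
    an initial segment of length n0 on which the weight must be 1.\<close>
  define qP where "qP = (\<lambda>(k, n0) q. n0 \<le> fst q \<and> (\<forall>i. 0 \<le> snd q i \<and> snd q i \<le> 1) \<and> (\<forall>i<n0. snd q i = 1) \<and> (\<forall>i\<ge>fst q. snd q i = 0)
    \<and> (\<forall>j\<le>k+3. opb (\<epsilon> k) (\<lambda>x. dg (snd q) (T j x) - T j (dg (snd q) x))))"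
  have "\<forall>t. \<exists>q. qP t q"
  proof (rule allI, clarify)
    fix k n0 :: nat
    have "\<exists>n1\<ge>n0. \<exists>w. (\<forall>i. 0 \<le> w i \<and> w i \<le> 1) \<and> (\<forall>i<n0. w i = 1) \<and> (\<forall>i\<ge>n1. w i = 0)
      \<and> (\<forall>S\<in>T ` {..k+3}. opb (\<epsilon> k) (\<lambda>x. dg w (S x) - S (dg w x)))"
      by (rule quasicentral_weight) (use T eps0 in auto)
    then obtain n1 w where *: "n0 \<le> n1" "\<forall>i. 0 \<le> w i \<and> w i \<le> 1" "\<forall>i<n0. w i = 1" "\<forall>i\<ge>n1. w i = 0"
      "\<forall>S\<in>T ` {..k+3}. opb (\<epsilon> k) (\<lambda>x. dg w (S x) - S (dg w x))" by blast
    show "\<exists>q. qP (k, n0) q" by (rule exI[of _ "(n1, w)"]) (use * in \<open>auto simp: qP_def\<close>)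
  qed
  from choice[OF this] obtain q0 where q0: "\<And>t. qP t (q0 t)" by blast
  define q where "q k n0 = q0 (k, n0)" for k n0
  have qP: "qP (k, n0) (q k n0)" for k n0 unfolding q_def by (rule q0)
  have q: "\<And>k n0. n0 \<le> fst (q k n0)" "\<And>k n0 i. 0 \<le> snd (q k n0) i \<and> snd (q k n0) i \<le> 1"
    "\<And>k n0 i. i < n0 \<Longrightarrow> snd (q k n0) i = 1" "\<And>k n0 i. i \<ge> fst (q k n0) \<Longrightarrow> snd (q k n0) i = 0"
    "\<And>k n0 j. j \<le> k + 3 \<Longrightarrow> opb (\<epsilon> k) (\<lambda>x. dg (snd (q k n0)) (T j x) - T j (dg (snd (q k n0)) x))"
    using qP by (auto simp: qP_def)
  \<comment> \<open>\<open>\<alpha> (Suc k)\<close> passes the support of the k-th weight, increases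
    strictly, and is at least \<open>N (k + 2)\<close>. The shift by two gives
    \<open>N k \<le> \<alpha> (k - 1)\<close> for k >= 2, and \<open>\<alpha> (k - 1)\<close> is the
    coordinate from which \<open>D k\<close> lives.\<close>
  define \<alpha> where "\<alpha> = rec_nat 0 (\<lambda>k r. max (fst (q k r)) (max (Suc r) (N (Suc (Suc k)))))"
  have \<alpha>0: "\<alpha> 0 = 0" and \<alpha>S: "\<alpha> (Suc k) = max (fst (q k (\<alpha> k))) (max (Suc (\<alpha> k)) (N (Suc (Suc k))))" for k
    by (simp_all add: \<alpha>_def)
  have \<alpha>mono: "strict_mono \<alpha>" by (rule strict_monoI_Suc) (simp add: \<alpha>S)
  have \<alpha>le: "i \<le> j \<Longrightarrow> \<alpha> i \<le> \<alpha> j" for i j using strict_mono_less_eq[OF \<alpha>mono] by simp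
  have \<alpha>ge: "k \<le> \<alpha> k" for k using seq_suble[OF \<alpha>mono] .
  have \<alpha>N: "N k \<le> \<alpha> (k - 1)" if k2: "2 \<le> k" for k
  proof -
    obtain k' where "k = Suc (Suc k')" using k2 by (metis Suc_le_D numeral_2_eq_2 le_Suc_ex plus_nat.simps)
    thus ?thesis by (simp add: \<alpha>S)
  qed
  \<comment> \<open>Taking \<open>E 0 = 0\<close> instead of a genuine weight makes the partial sums
    of w telescope to \<open>E m\<close> exactly.\<close>
  define E where "E k = (if k = 0 then (\<lambda>_. 0) else snd (q k (\<alpha> k)))" for k
  have E01: "0 \<le> E k i \<and> E k i \<le> 1" for k i using q(2) by (auto simp: E_def)
  have E1: "E k i = 1" if "i < \<alpha> k" for k i using that q(3) by (cases k) (auto simp: E_def \<alpha>0)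
  have E0: "E k i = 0" if "\<alpha> (Suc k) \<le> i" for k i using that q(4)[of k "\<alpha> k" i] by (auto simp: E_def \<alpha>S)
  have E00: "E 0 i = 0" for i by (simp add: E_def)
  have Ecom: "opb (\<epsilon> k) (\<lambda>x. dg (E k) (T j x) - T j (dg (E k) x))" if j: "j \<le> k + 3" for k j
  proof (cases "k = 0")
    case True
    have z: "dg (E k) y = 0" for y by (simp add: True E_def fun_eq_iff pt)
    have "T j 0 = 0" using bop_smul[OF T, of 0 j 0] by simp
    thus ?thesis using opb_mono[OF opb_0, of "\<epsilon> k"] eps0[of k] by (simp add: z)
  next
    case False
    thus ?thesis using q(5)[OF j] by (simp add: E_def)
  qed
  have Emono: "E k i \<le> E (Suc k) i" for k i
  proof (cases "i < \<alpha> (Suc k)")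
    case True thus ?thesis using E1[OF True] E01 by simp
  next
    case False thus ?thesis using E0[of k i] E01 by simp
  qed
  define w where "w k i = E (Suc k) i - E k i" for k i
  \<comment> \<open>For k >= 1 this is w (k-1) + w k + w (k+1): equal to 1 wherever
    \<open>w k\<close> lives, and with sum over k at most 3. For k = 0 truncated subtraction leaves
    E 2 = w 0 + w 1.\<close>
  define D where "D k i = E (k + 2) i - E (k - 1) i" for k i
  have wsum: "(\<Sum>k<m. w k i) = E m i" for m i
    by (induction m) (simp_all add: w_def E00)
  have wge: "\<alpha> k \<le> i" if "w k i \<noteq> 0" for k i
  proof (rule ccontr)
    assume "\<not> \<alpha> k \<le> i"
    hence "E k i = 1" "E (Suc k) i = 1" using E1[of i k] E1[of i "Suc k"] \<alpha>le[of k "Suc k"] by auto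
    thus False using that by (simp add: w_def)
  qed
  have wlt: "i < \<alpha> (k + 2)" if "w k i \<noteq> 0" for k i
  proof (rule ccontr)
    assume "\<not> i < \<alpha> (k + 2)"
    hence "E (Suc k) i = 0" "E k i = 0" using E0[of "Suc k" i] E0[of k i] \<alpha>le[of "Suc k" "k + 2"] by auto
    thus False using that by (simp add: w_def)
  qed
  have wD: "D k i = 1" if "w k i \<noteq> 0" for k i
  proof -
    have "E (k + 2) i = 1" by (rule E1[OF wlt[OF that]])
    moreover have "E (k - 1) i = 0" using wge[OF that] E0[of "k - 1" i] E00 by (cases k) auto
    ultimately show ?thesis by (simp add: D_def)
  qed
  have Ekm: "E (k - 1) i \<le> E (k + 2) i" for k i
  proof -
    have "mono (\<lambda>k. E k i)" by (rule incseq_SucI) (rule Emono)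
    thus ?thesis by (rule monoD) simp
  qed
  have D01: "0 \<le> D k i" "D k i \<le> 1" for k i
    using Ekm[of k i] E01[of "k + 2" i] E01[of "k - 1" i] by (auto simp: D_def)
  have Dge: "\<alpha> (k - 1) \<le> i" if "D k i \<noteq> 0" for k i
  proof (rule ccontr)
    assume "\<not> \<alpha> (k - 1) \<le> i"
    moreover have "\<alpha> (k - 1) \<le> \<alpha> (k + 2)" by (rule \<alpha>le) simp
    ultimately have "i < \<alpha> (k - 1)" "i < \<alpha> (k + 2)" by linarith+
    hence "E (k - 1) i = 1" "E (k + 2) i = 1" using E1 by blast+
    thus False using that by (simp add: D_def)
  qed
  have Dlt: "i < \<alpha> (k + 3)" if "D k i \<noteq> 0" for k i
  proof (rule ccontr)
    assume "\<not> i < \<alpha> (k + 3)"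
    moreover have "\<alpha> (Suc (k - 1)) \<le> \<alpha> (k + 3)" "\<alpha> (Suc (k + 2)) \<le> \<alpha> (k + 3)" by (rule \<alpha>le, simp)+
    ultimately have "\<alpha> (Suc (k - 1)) \<le> i" "\<alpha> (Suc (k + 2)) \<le> i" by linarith+
    hence "E (k + 2) i = 0" "E (k - 1) i = 0" using E0 by blast+
    thus False using that by (simp add: D_def)
  qed
  have Dsum: "(\<Sum>k<m. D k i) \<le> E (m + 1) i + E m i + E (m - 1) i" for m i
  proof (induction m)
    case 0
    show ?case using E01[of 1 i] E01[of 0 i] by simp
  next
    case (Suc m)
    thus ?case by (simp add: D_def)
  qed

  have wdg: "\<bar>w k i\<bar> \<le> 1" for k i
    using Emono[of k i] E01[of k i] E01[of "Suc k" i] by (auto simp: w_def)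
  have Ddg: "\<bar>D k i\<bar> \<le> 1" for k i using D01 by simp
  have Edg: "\<bar>E k i\<bar> \<le> 1" for k i using E01 by simp
  have wX: "dg (w k) x \<in> X" "nm (dg (w k) x) \<le> nm x" if "x \<in> X" for k x
    using opb_X[OF opb_dg[OF wdg] that] opb_nm[OF opb_dg[OF wdg] that] by auto
  have hiw: "hi m (dg (w k) x) = dg (w k) x" if "m \<le> \<alpha> k" for k m x
    using hi_dg[of "w k" m x] wge that order_trans by blast
  have \<gamma>0: "hi (\<alpha> (k - 1)) x = x" if "k < 2" for k x
  proof -
    have "k - 1 = 0" using that by simp
    thus ?thesis by (simp add: \<alpha>0 fun_eq_iff pt)
  qed

  interpret dilation_data p n A B w D "\<lambda>k. \<alpha> (k - 1)" "\<lambda>k. \<alpha> (k + 3)" "L + 2"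
  proof
    show "0 \<le> w k i" for k i using Emono by (simp add: w_def)
    show "(\<Sum>k<m. w k i) \<le> 1" for m i using wsum E01 by simp
    show "(\<Sum>k<i + 2. w k i) = 1" for i
      using wsum[of i "i + 2"] E1[of i "i + 2"] \<alpha>ge[of "i + 2"] by simp
    show "(\<Sum>k<m. D k i) \<le> 3" for m i
      using Dsum[of i m] E01[of "m + 1" i] E01[of m i] E01[of "m - 1" i] by linarith
    show "w k i \<noteq> 0 \<Longrightarrow> i < \<alpha> (k + 3) \<and> D k i = 1" for k i
      using wlt[of k i] wD[of k i] \<alpha>le[of "k + 2" "k + 3"] by auto
    show "D k i \<noteq> 0 \<Longrightarrow> i < \<alpha> (k + 3) \<and> \<alpha> (k - 1) \<le> i \<and> k \<le> i + 1" for k i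
      using Dlt[of k i] Dge[of k i] \<alpha>ge[of "k - 1"] by linarith
    show "nm (\<Sum>i<n k. vsmul (of_real (sg i e)) (A k i (dg (w k) x))) \<le> (L + 2) * nm (dg (w k) x)"
      if e: "e < 2^n k" and x: "x \<in> X" for e k x
    proof (cases "k < 2")
      case True
      have "(\<Sum>i<n k. vsmul (of_real (sg i e)) (A k i (dg (w k) x))) = vsmul (of_real (sg (\<nu> k) e)) (dg (w k) x)"
        using True by (simp add: n A_def)
      thus ?thesis using wX[OF x, of k] L by (simp add: mult_right_le_one_le algebra_simps mult_nonneg_nonneg)
    next
      case False
      hence Nk: "N k \<le> \<alpha> k" using \<alpha>N[of k] \<alpha>le[of "k - 1" k] by simp
      have eq: "(\<Sum>i<n k. vsmul (of_real (sg i e)) (A k i (dg (w k) x)))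
          = SA k e (hi (\<alpha> k) (dg (w k) x)) + vsmul (of_real (sg (\<nu> k) e) / 2^k) (dg (w k) x)"
        using False by (simp add: n A_def SA_def hiw vsmul_algebra)
      have sX: "SA k e (hi (\<alpha> k) (dg (w k) x)) \<in> X" using opb_X[OF F1(1)[OF Nk e] wX(1)[OF x]] .
      have "nm (vsmul (of_real (sg (\<nu> k) e) / 2^k) (dg (w k) x)) = 1 / 2^k * nm (dg (w k) x)"
        using wX[OF x] by (simp add: norm_divide norm_power)
      also have "\<dots> \<le> 1 * nm (dg (w k) x)" by (intro mult_right_mono) auto
      finally have 2: "nm (vsmul (of_real (sg (\<nu> k) e) / 2^k) (dg (w k) x)) \<le> nm (dg (w k) x)" by simp
      have "nm (SA k e (hi (\<alpha> k) (dg (w k) x))) \<le> (L + 1) * nm (dg (w k) x)"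
        using opb_nm[OF F1(1)[OF Nk e] wX(1)[OF x]] .
      with 2 show ?thesis unfolding eq
        using nm_triangle[OF sX smul_X[OF wX(1)[OF x]], of "of_real (sg (\<nu> k) e) / 2^k" k] by (simp add: algebra_simps)
    qed
    show "opb (L + 2) (\<lambda>x. \<Sum>i<n k. vsmul (of_real (sg i e)) (hi (\<alpha> (k - 1)) (B k i x)))" if e: "e < 2^n k" for e k
    proof (cases "k < 2")
      case True
      have eq: "(\<Sum>i<n k. vsmul (of_real (sg i e)) (hi (\<alpha> (k - 1)) (B k i x))) = vsmul (of_real (sg (\<nu> k) e)) x" for x
        unfolding \<gamma>0[OF True] using True by (simp add: n B_def)
      have "opb (cmod (of_real (sg (\<nu> k) e)) * 1) (\<lambda>x. vsmul (of_real (sg (\<nu> k) e)) x)" by (rule opb_scale[OF opb_id])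
      thus ?thesis unfolding eq using L by (elim opb_mono) simp
    next
      case False
      hence Nk: "N k \<le> \<alpha> (k - 1)" using \<alpha>N[of k] by simp
      have hs: "hi m (SA k e x) = (\<Sum>i<\<nu> k. vsmul (of_real (sg i e)) (hi m (a k i x)))" for m x
        by (simp add: SA_def fun_eq_iff pt)
      have eq: "(\<Sum>i<n k. vsmul (of_real (sg i e)) (hi (\<alpha> (k - 1)) (B k i x)))
          = hi (\<alpha> (k - 1)) (SA k e x) + vsmul (of_real (sg (\<nu> k) e)) (hi (\<alpha> (k - 1)) (Bx k x))" for x
        using False by (simp add: n B_def hs)
      have "opb ((L + 1) + cmod (of_real (sg (\<nu> k) e)) * (1 * (1 / 2^k)))
          (\<lambda>x. hi (\<alpha> (k - 1)) (SA k e x) + vsmul (of_real (sg (\<nu> k) e)) (hi (\<alpha> (k - 1)) (Bx k x)))"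
        by (rule opb_plus[OF F1(2)[OF Nk e] opb_scale[OF opb_comp[OF opb_hi Bx]]])
      thus ?thesis unfolding eq by (elim opb_mono) simp
    qed
    show "dg (D k) (\<Sum>i<n k. B k i (A k i (dg (w k) x))) = dg (w k) x" if x: "x \<in> X" for k x
    proof -
      have DW: "dg (D k) (dg (w k) x) = dg (w k) x" using wD[of k] by (auto simp: fun_eq_iff dg_apply)
      have "(\<Sum>i<n k. B k i (A k i (dg (w k) x))) = dg (w k) x"
      proof (cases "k < 2")
        case True
        thus ?thesis by (simp add: n A_def B_def)
      next
        case False
        define y where "y = dg (w k) x"
        have y: "y \<in> X" using wX[OF x] by (simp add: y_def)
        have "N k \<le> \<alpha> k" using False \<alpha>N[of k] \<alpha>le[of "k - 1" k] by simp
        hence h: "hi (N k) y = y" unfolding y_def by (rule hiw)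
        have "Bx k (vsmul (1 / 2^k) y) = vsmul (1 / 2^k) (Bx k y)" by (rule opb_smul[OF Bx y])
        also have "\<dots> = - Kk k y" by (simp add: Bx_def h vsmul_algebra)
        finally have "(\<Sum>i<n k. B k i (A k i y)) = (\<Sum>i<\<nu> k. a k i (a k i y)) - Kk k y"
          using False by (simp add: n A_def B_def)
        thus ?thesis by (simp add: Kk_def y_def)
      qed
      thus ?thesis by (simp add: DW)
    qed
  qed (use A_bop B_bop D01 L in auto)

  have wcom: "opb (\<epsilon> (Suc k) + \<epsilon> k) (\<lambda>x. dg (w k) (T j x) - T j (dg (w k) x))" if "j \<le> k" for k j
    by (rule commutator_diff[OF T _ Edg Edg Ecom Ecom]) (use that in \<open>auto simp: w_def\<close>)
  have Dcom: "opb (\<epsilon> (k + 2) + \<epsilon> (k - 1)) (\<lambda>x. dg (D k) (T j x) - T j (dg (D k) x))" if "j \<le> k" for k j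
    by (rule commutator_diff[OF T _ Edg Edg Ecom Ecom]) (use that in \<open>auto simp: D_def\<close>)

  have ess: "ess (\<lambda>x. J (T j x)) (\<lambda>x. mul (\<kappa> j) (J x)) \<and> ess (\<lambda>y. T j (Q y)) (\<lambda>y. Q (mul (\<kappa> j) y))" for j
  proof
    obtain s where s: "0 \<le> s" "\<And>k i. cmod (\<kappa> j k i) \<le> s" using chi[of j] by blast
    obtain t where t: "opb t (T j)" using T bop_iff_opb by blast
    have t0: "0 \<le> t" using opb_nonneg[OF t] .
    show "ess (\<lambda>x. J (T j x)) (\<lambda>x. mul (\<kappa> j) (J x))"
    proof (rule J_intertwines[OF T s(2) s(1), where C = "2 + (L + 1) + t + s" and ?k0.0 = "max j 2"])
      fix k e x assume k: "max j 2 \<le> k" and e: "e < (2::nat)^n k" and x: "x \<in> X"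
      have Nk: "N k \<le> \<alpha> k" using k \<alpha>N[of k] \<alpha>le[of "k - 1" k] by simp
      define y where "y = dg (w k) x"
      have y: "y \<in> X" "nm y \<le> nm x" using wX[OF x] by (auto simp: y_def)
      define c where "c = dg (w k) (T j x) - T j y"
      have c: "c \<in> X" "nm c \<le> (\<epsilon> (Suc k) + \<epsilon> k) * nm x"
        using opb_X[OF wcom x] opb_nm[OF wcom x] k by (auto simp: c_def y_def)
      note TX = opb_X[OF t]
      \<comment> \<open>The weight is moved past \<open>T j\<close>. Its commutator c is paid for by
        \<epsilon> against the crude bound \<open>Lc k\<close>, the partition part becomes
        \<open>C1\<close> on a tail, and the extra index carries the factor
        \<open>1 / 2^k\<close>.\<close>
      have split: "A k i (dg (w k) (T j x)) - vsmul (\<kappa> j k i) (A k i y) = A k i c + (A k i (T j y) - vsmul (\<kappa> j k i) (A k i y))"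
        if "i < n k" for i
        using bop_add[OF A_bop[OF that] c(1) TX[OF y(1)]] by (simp add: c_def)
      have e1: "(\<Sum>i<n k. vsmul (of_real (sg i e)) (A k i (T j y) - vsmul (\<kappa> j k i) (A k i y)))
          = C1 k j e (hi (\<alpha> k) y) + vsmul (of_real (sg (\<nu> k) e) / 2^k) (T j y - vsmul (\<kappa> j k (\<nu> k)) y)"
        using k by (simp add: n A_def C1_def y_def hiw vsmul_algebra mult.commute)
      have "(\<Sum>i<n k. vsmul (of_real (sg i e)) (A k i (dg (w k) (T j x)) - vsmul (\<kappa> j k i) (A k i (dg (w k) x))))
          = (\<Sum>i<n k. vsmul (of_real (sg i e)) (A k i c)) + (\<Sum>i<n k. vsmul (of_real (sg i e)) (A k i (T j y) - vsmul (\<kappa> j k i) (A k i y)))"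
        unfolding sum.distrib[symmetric] vsmul_algebra(1)[symmetric] using split by (intro sum.cong refl) (simp add: y_def add_diff_eq)
      also have "\<dots> = (\<Sum>i<n k. vsmul (of_real (sg i e)) (A k i c)) + (C1 k j e (hi (\<alpha> k) y) + vsmul (of_real (sg (\<nu> k) e) / 2^k) (T j y - vsmul (\<kappa> j k (\<nu> k)) y))"
        unfolding e1 ..
      finally have eq: "(\<Sum>i<n k. vsmul (of_real (sg i e)) (A k i (dg (w k) (T j x)) - vsmul (\<kappa> j k i) (A k i (dg (w k) x)))) = \<dots>" .
      have X1: "(\<Sum>i<n k. vsmul (of_real (sg i e)) (A k i c)) \<in> X" using opb_X[OF Lc(1) c(1)] .
      have jk: "j \<le> k" using k by simp
      have X2: "C1 k j e (hi (\<alpha> k) y) \<in> X" using opb_X[OF F2(1)[OF Nk e jk] y(1)] .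
      have X3: "T j y - vsmul (\<kappa> j k (\<nu> k)) y \<in> X" using TX[OF y(1)] y(1) by auto
      have n1: "nm (\<Sum>i<n k. vsmul (of_real (sg i e)) (A k i c)) \<le> 2 / 2^k * nm x"
      proof -
        have "nm (\<Sum>i<n k. vsmul (of_real (sg i e)) (A k i c)) \<le> Lc k * nm c" by (rule opb_nm[OF Lc(1) c(1)])
        also have "\<dots> \<le> Lc k * ((\<epsilon> (Suc k) + \<epsilon> k) * nm x)" by (intro mult_left_mono c Lc0)
        also have "\<dots> = (Lc k * \<epsilon> (Suc k) + Lc k * \<epsilon> k) * nm x" by (simp add: algebra_simps)
        also have "\<dots> \<le> (1 / 2^Suc k + 1 / 2^k) * nm x" by (intro mult_right_mono add_mono Lceps) auto
        also have "\<dots> \<le> 2 / 2^k * nm x" by (intro mult_right_mono) (auto simp: field_simps)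
        finally show ?thesis .
      qed
      have n2: "nm (C1 k j e (hi (\<alpha> k) y)) \<le> (L + 1) / 2^k * nm x"
        using opb_nm[OF F2(1)[OF Nk e jk] y(1)] mult_left_mono[OF y(2), of "(L + 1) / 2^k"] L by simp
      have n3: "nm (vsmul (of_real (sg (\<nu> k) e) / 2^k) (T j y - vsmul (\<kappa> j k (\<nu> k)) y)) \<le> (t + s) / 2^k * nm x"
      proof -
        have "nm (T j y - vsmul (\<kappa> j k (\<nu> k)) y) \<le> nm (T j y) + nm (vsmul (\<kappa> j k (\<nu> k)) y)"
          by (rule nm_triangle_diff[OF TX[OF y(1)] smul_X[OF y(1)]])
        also have "\<dots> \<le> t * nm x + s * nm x"
        proof (rule add_mono)
          show "nm (T j y) \<le> t * nm x" using opb_nm[OF t y(1)] mult_left_mono[OF y(2) t0] by linarith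
          show "nm (vsmul (\<kappa> j k (\<nu> k)) y) \<le> s * nm x" using y s by (simp add: mult_mono)
        qed
        finally have "nm (T j y - vsmul (\<kappa> j k (\<nu> k)) y) / 2^k \<le> (t * nm x + s * nm x) / 2^k" by (intro divide_right_mono) auto
        thus ?thesis using X3 by (simp add: norm_divide norm_power distrib_right)
      qed
      have "nm (\<Sum>i<n k. vsmul (of_real (sg i e)) (A k i (dg (w k) (T j x)) - vsmul (\<kappa> j k i) (A k i (dg (w k) x))))
          \<le> 2 / 2^k * nm x + ((L + 1) / 2^k * nm x + (t + s) / 2^k * nm x)"
        unfolding eq
        by (rule order_trans[OF nm_triangle[OF X1 add_X[OF X2 smul_X[OF X3]]]],
            rule add_mono[OF n1], rule order_trans[OF nm_triangle[OF X2 smul_X[OF X3]]], rule add_mono[OF n2 n3])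
      thus "nm (\<Sum>i<n k. vsmul (of_real (sg i e)) (A k i (dg (w k) (T j x)) - vsmul (\<kappa> j k i) (A k i (dg (w k) x))))
          \<le> (2 + (L + 1) + t + s) / 2^k * nm x"
        by (simp add: add_divide_distrib distrib_right)
    qed
    show "ess (\<lambda>y. T j (Q y)) (\<lambda>y. Q (mul (\<kappa> j) y))"
    proof (rule Q_intertwines[OF T s(2) s(1), where C = "3 * RC + (L + 1 + t + s) * RC" and ?k0.0 = "max j 2"])
      fix k y assume k: "max j 2 \<le> k" and y: "y \<in> X"
      have jk: "j \<le> k" and k2: "\<not> k < 2" using k by auto
      have Nk: "N k \<le> \<alpha> (k - 1)" using k \<alpha>N[of k] by simp
      define v where "v = Qk k (B k) y"
      have v: "v \<in> X" unfolding v_def by (rule Qk_bound(1)[OF B_bop Lc(2) y])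
      have "nm v \<le> Lc k * RC * nm (proj k y)" unfolding v_def by (rule Qk_bound(2)[OF B_bop Lc(2) y])
      also have "\<dots> \<le> Lc k * RC * nm y" using opb_nm[OF opb_proj y] Lc0[of k] RC_ge_1 by (intro mult_left_mono) auto
      finally have nv: "nm v \<le> Lc k * RC * nm y" .
      \<comment> \<open>The failure of \<open>B k\<close> to intertwine. It is small only on tails,
        which suffices because \<open>D k\<close> vanishes below \<open>\<alpha> (k - 1)\<close>;
        hence the truncated version \<open>G'\<close>.\<close>
      define G where "G i x = T j (B k i x) - vsmul (\<kappa> j k i) (B k i x)" for i x
      have Gb: "bop p (G i)" if "i < n k" for i unfolding G_def
        by (rule bop_minus_op[OF bop_comp[OF T B_bop[OF that]] bop_scale[OF B_bop[OF that]]])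
      define G' where "G' i x = hi (\<alpha> (k - 1)) (G i x)" for i x
      have G'b: "bop p (G' i)" if "i < n k" for i unfolding G'_def by (rule bop_comp[OF bop_hi Gb[OF that]])
      have Tv: "T j v = Qk k (\<lambda>i x. T j (B k i x)) y" unfolding v_def by (rule Qk_comp[OF T B_bop y])
      define c where "c = dg (D k) (T j v) - T j (dg (D k) v)"
      have DX: "x \<in> X \<Longrightarrow> dg (D k) x \<in> X" "x \<in> X \<Longrightarrow> nm (dg (D k) x) \<le> nm x" for x
        using opb_X[OF opb_dg[OF Ddg]] opb_nm[OF opb_dg[OF Ddg]] by auto
      have c: "c \<in> X" "nm c \<le> (\<epsilon> (k + 2) + \<epsilon> (k - 1)) * nm v"
        using opb_X[OF Dcom[OF jk] v] opb_nm[OF Dcom[OF jk] v] by (auto simp: c_def)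
      have gg: "hi (\<alpha> (k - 1)) (Qk k G y) = Qk k G' y" unfolding G'_def by (rule Qk_comp[OF bop_hi Gb y])
      have "dg (D k) (Qk k G y) = dg (D k) (hi (\<alpha> (k - 1)) (Qk k G y))" using dg_hi[of "D k" "\<alpha> (k - 1)"] Dge by metis
      hence DG: "dg (D k) (Qk k G y) = dg (D k) (Qk k G' y)" unfolding gg .
      have "dg (D k) (Qk k G y) = dg (D k) (T j v) - dg (D k) (Qk k (\<lambda>i x. vsmul (\<kappa> j k i) (B k i x)) y)"
        unfolding Tv G_def Qk_diff by (simp add: fun_eq_iff pt right_diff_distrib)
      hence eq: "T j (dg (D k) v) - dg (D k) (Qk k (\<lambda>i x. vsmul (\<kappa> j k i) (B k i x)) y) = dg (D k) (Qk k G' y) - c"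
        unfolding DG[symmetric] by (simp add: c_def)
      have Gbd: "opb ((L + 1 + t + s) / 2^k) (\<lambda>x. \<Sum>i<n k. vsmul (of_real (sg i e)) (G' i x))" if e: "e < 2^n k" for e
      proof -
        have hs: "hi m (C2 k j e x) = (\<Sum>i<\<nu> k. vsmul (of_real (sg i e)) (hi m (T j (a k i x) - vsmul (\<kappa> j k i) (a k i x))))" for m x
          by (simp add: C2_def fun_eq_iff pt)
        have eq: "(\<Sum>i<n k. vsmul (of_real (sg i e)) (G' i x)) = hi (\<alpha> (k - 1)) (C2 k j e x)
            + vsmul (of_real (sg (\<nu> k) e)) (hi (\<alpha> (k - 1)) (T j (Bx k x) - vsmul (\<kappa> j k (\<nu> k)) (Bx k x)))" for x
          using k2 by (simp add: n G'_def G_def B_def hs)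
        have ts: "opb (t + cmod (\<kappa> j k (\<nu> k)) * 1) (\<lambda>x. T j x - vsmul (\<kappa> j k (\<nu> k)) x)"
          by (rule opb_minus_op[OF t opb_scale[OF opb_id]])
        have ts': "opb (t + s) (\<lambda>x. T j x - vsmul (\<kappa> j k (\<nu> k)) x)" by (rule opb_mono[OF ts]) (use s in simp)
        have "opb ((L + 1) / 2^k + cmod (of_real (sg (\<nu> k) e)) * (1 * ((t + s) * (1 / 2^k))))
          (\<lambda>x. hi (\<alpha> (k - 1)) (C2 k j e x)
            + vsmul (of_real (sg (\<nu> k) e)) (hi (\<alpha> (k - 1)) (T j (Bx k x) - vsmul (\<kappa> j k (\<nu> k)) (Bx k x))))"
          by (rule opb_plus[OF F2(2)[OF Nk e jk] opb_scale[OF opb_comp[OF opb_hi opb_comp[OF ts' Bx]]]])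
        thus ?thesis unfolding eq by (elim opb_mono) (simp add: add_divide_distrib)
      qed
      have QX: "Qk k G' y \<in> X" by (rule Qk_bound(1)[OF G'b Gbd y])
      have "nm (Qk k G' y) \<le> (L + 1 + t + s) / 2^k * RC * nm (proj k y)" by (rule Qk_bound(2)[OF G'b Gbd y])
      also have "\<dots> \<le> (L + 1 + t + s) / 2^k * RC * nm y"
        using opb_nm[OF opb_proj y] L t0 s RC_ge_1 by (intro mult_left_mono) auto
      finally have nq: "nm (Qk k G' y) \<le> (L + 1 + t + s) / 2^k * RC * nm y" .
      have nc: "nm c \<le> 3 / 2^k * RC * nm y"
      proof -
        have "nm c \<le> (\<epsilon> (k + 2) + \<epsilon> (k - 1)) * (Lc k * RC * nm y)"
          using c(2) mult_left_mono[OF nv, of "\<epsilon> (k + 2) + \<epsilon> (k - 1)"] eps0[of "k + 2"] eps0[of "k - 1"] by linarith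
        also have "\<dots> = (Lc k * \<epsilon> (k + 2) + Lc k * \<epsilon> (k - 1)) * (RC * nm y)" by (simp add: algebra_simps)
        also have "\<dots> \<le> (1 / 2^(k + 2) + 1 / 2^(k - 1)) * (RC * nm y)"
          using RC_ge_1 by (intro mult_right_mono add_mono Lceps) auto
        also have "1 / 2^(k + 2) + 1 / 2^(k - 1) \<le> 3 / (2::real)^k"
          using k2 by (cases k) (auto simp: field_simps)
        finally show ?thesis using RC_ge_1 by (simp add: mult_right_mono mult.assoc)
      qed
      have "nm (T j (dg (D k) v) - dg (D k) (Qk k (\<lambda>i x. vsmul (\<kappa> j k i) (B k i x)) y)) \<le> nm (dg (D k) (Qk k G' y)) + nm c"
        unfolding eq by (rule nm_triangle_diff[OF DX(1)[OF QX] c(1)])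
      also have "\<dots> \<le> (L + 1 + t + s) / 2^k * RC * nm y + 3 / 2^k * RC * nm y"
        using DX(2)[OF QX] nq nc by linarith
      also have "\<dots> = (3 * RC + (L + 1 + t + s) * RC) / 2^k * nm y" by (simp add: field_simps)
      finally show "nm (T j (dg (D k) (Qk k (B k) y)) - dg (D k) (Qk k (\<lambda>i x. vsmul (\<kappa> j k i) (B k i x)) y))
          \<le> (3 * RC + (L + 1 + t + s) * RC) / 2^k * nm y" by (simp add: v_def)
    qed
  qed
  show ?thesis
    by (rule exI[of _ J], rule exI[of _ Q]) (use opb_J opb_Q QJ J_range Q_mul ess in auto)
qed

end

section \<open>Partitions of unity on a compact subset of \<open>\<real>\<^sup>d\<close>\<close>

definition tent :: "real \<Rightarrow> real" where "tent t = max 0 (1 - \<bar>t\<bar>)"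

lemma tent_nonneg: "0 \<le> tent t" and tent_le: "tent t \<le> 1" and tent_supp: "tent t \<noteq> 0 \<Longrightarrow> \<bar>t\<bar> < 1"
  by (auto simp: tent_def)

text \<open>Only the two integers next to s contribute. The bound 2 for the square roots, taken once
  per coordinate, is the origin of \<open>2^d\<close>.\<close>

lemma tent_sum:
  assumes I: "finite I" "\<lfloor>s\<rfloor> \<in> I" "\<lfloor>s\<rfloor> + 1 \<in> I"
  shows "(\<Sum>t\<in>I. tent (s - of_int t)) = 1" "(\<Sum>t\<in>I. sqrt (tent (s - of_int t))) \<le> 2"
proof -
  have z: "tent (s - of_int t) = 0" if "t \<notin> {\<lfloor>s\<rfloor>, \<lfloor>s\<rfloor> + 1}" for t
  proof (rule ccontr)
    assume "tent (s - of_int t) \<noteq> 0"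
    hence "\<bar>s - of_int t\<bar> < 1" by (rule tent_supp)
    hence "t = \<lfloor>s\<rfloor> \<or> t = \<lfloor>s\<rfloor> + 1" by linarith
    thus False using that by simp
  qed
  have r: "sum g I = g \<lfloor>s\<rfloor> + g (\<lfloor>s\<rfloor> + 1)" if "\<And>t. t \<notin> {\<lfloor>s\<rfloor>, \<lfloor>s\<rfloor> + 1} \<Longrightarrow> g t = 0" for g :: "int \<Rightarrow> real"
  proof -
    have "sum g I = sum g {\<lfloor>s\<rfloor>, \<lfloor>s\<rfloor> + 1}" by (rule sum.mono_neutral_right) (use I that in auto)
    thus ?thesis by simp
  qed
  have "\<bar>s - of_int \<lfloor>s\<rfloor>\<bar> = s - of_int \<lfloor>s\<rfloor>" "\<bar>s - of_int (\<lfloor>s\<rfloor> + 1)\<bar> = 1 - (s - of_int \<lfloor>s\<rfloor>)" by linarith+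
  moreover have "0 \<le> s - of_int \<lfloor>s\<rfloor>" "s - of_int \<lfloor>s\<rfloor> \<le> 1" by linarith+
  ultimately have "tent (s - of_int \<lfloor>s\<rfloor>) + tent (s - of_int (\<lfloor>s\<rfloor> + 1)) = 1" unfolding tent_def by simp
  thus "(\<Sum>t\<in>I. tent (s - of_int t)) = 1" using r[of "\<lambda>t. tent (s - of_int t)", OF z] by simp
  show "(\<Sum>t\<in>I. sqrt (tent (s - of_int t))) \<le> 2"
  proof -
    have "sqrt (tent t) \<le> 1" for t using tent_le[of t] by simp
    from add_mono[OF this this] show ?thesis
      using r[of "\<lambda>t. sqrt (tent (s - of_int t))"] z by simp
  qed
qed

text \<open>The metric sums the coordinate distances, truncated at 1, with weights (1/2)^n, and
  these weights add up to 2.\<close>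

lemma dist_fun_le:
  fixes x y :: "nat \<Rightarrow> real"
  assumes "\<And>i. \<bar>x i - y i\<bar> \<le> c"
  shows "dist x y \<le> 2 * c"
proof (rule field_le_epsilon)
  fix e :: real assume "0 < e"
  then obtain N where N: "(1/2::real)^N < e" using real_arch_pow_inv[of e "1/2"] by auto
  have "Max {dist (x (from_nat n)) (y (from_nat n)) |n. n \<le> N} \<le> c"
  proof (rule Max.boundedI)
    have eq: "{dist (x (from_nat n)) (y (from_nat n)) |n. n \<le> N} = (\<lambda>n. dist (x (from_nat n)) (y (from_nat n))) ` {..N}" by auto
    show "finite {dist (x (from_nat n)) (y (from_nat n)) |n. n \<le> N}" unfolding eq by simp
    show "{dist (x (from_nat n)) (y (from_nat n)) |n. n \<le> N} \<noteq> {}" unfolding eq by simp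
  qed (use assms in \<open>auto simp: dist_real_def\<close>)
  thus "dist x y \<le> 2 * c + e" using dist_fun_le_dist_first_terms[of x y N] N by linarith
qed

text \<open>Products of square roots of tents on the grid of mesh 2^-m, so that the squares sum to
  1. Two points in one support differ by at most 2 / 2^m per coordinate; the remaining coordinates
  vanish on M, and \<open>dist_fun_le\<close> doubles the bound.\<close>

lemma cube_partition:
  fixes M :: "(nat \<Rightarrow> real) set"
  assumes M: "compact M" "M \<noteq> {}" and d: "\<forall>z\<in>M. \<forall>i\<ge>d. z i = 0"
  shows "\<exists>\<nu> f z. (\<forall>i<\<nu>. f i \<in> CM M) \<and> (\<forall>i::nat. z i \<in> M) \<and> (\<forall>x\<in>M. (\<Sum>i<\<nu>. f i x * f i x) = 1)
    \<and> (\<forall>x\<in>M. (\<Sum>i<\<nu>. cmod (f i x)) \<le> 2^d) \<and> (\<forall>i<\<nu>. \<forall>x\<in>M. f i x \<noteq> 0 \<longrightarrow> dist x (z i) \<le> 4 / 2^m)"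
proof -
  have "\<exists>R. \<forall>x\<in>M. \<bar>x i\<bar> \<le> R" for i
  proof -
    have "compact ((\<lambda>x. x i) ` M)"
      by (rule compact_continuous_image[OF continuous_on_subset[OF continuous_on_product_coordinates] M(1)]) simp
    hence "bounded ((\<lambda>x. x i) ` M)" by (rule compact_imp_bounded)
    thus ?thesis by (auto simp: bounded_real)
  qed
  then obtain R where R: "\<And>i x. x \<in> M \<Longrightarrow> \<bar>x i\<bar> \<le> R i" by metis
  \<comment> \<open>The margin makes the interval contain the floor of every scaled coordinate
    together with its successor.\<close>
  define I where "I i = {- \<lceil>2^m * R i\<rceil> - 2 .. \<lceil>2^m * R i\<rceil> + 2}" for i
  have Ifl: "\<lfloor>2^m * x i\<rfloor> \<in> I i" "\<lfloor>2^m * x i\<rfloor> + 1 \<in> I i" if "x \<in> M" for x i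
  proof -
    have "\<bar>2^m * x i\<bar> \<le> 2^m * R i" using R[OF that, of i] by (simp add: abs_mult)
    hence "2^m * x i \<le> 2^m * R i" "- (2^m * R i) \<le> 2^m * x i" by linarith+
    thus "\<lfloor>2^m * x i\<rfloor> \<in> I i" "\<lfloor>2^m * x i\<rfloor> + 1 \<in> I i" unfolding I_def atLeastAtMost_iff by linarith+
  qed
  define V where "V = Pi\<^sub>E {..<d} I"
  have V: "finite V" unfolding V_def by (rule finite_PiE) (auto simp: I_def)
  define \<nu> where "\<nu> = card V"
  obtain g where g: "bij_betw g {..<\<nu>} V"
    using ex_bij_betw_nat_finite[OF V] by (auto simp: \<nu>_def lessThan_atLeast0)
  define F where "F v x = (\<Prod>i<d. sqrt (tent (2^m * x i - of_int (v i))))" for v :: "nat \<Rightarrow> int" and x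
  define f where "f i x = (if x \<in> M then complex_of_real (F (g i) x) else 0)" for i x
  \<comment> \<open>The sample point is taken in the support of the piece. If the piece vanishes on
    M, any point of M will do, since the distance condition is then vacuous.\<close>
  define z where "z i = (if \<exists>x\<in>M. F (g i) x \<noteq> 0 then SOME x. x \<in> M \<and> F (g i) x \<noteq> 0 else SOME x. x \<in> M)" for i
  have F0: "0 \<le> F v x" for v x unfolding F_def by (rule prod_nonneg) (simp add: tent_nonneg)
  have FF: "F v x * F v x = (\<Prod>i<d. tent (2^m * x i - of_int (v i)))" for v x
    by (simp add: F_def tent_nonneg flip: prod.distrib)
  have reidx: "(\<Sum>i<\<nu>. h (g i)) = (\<Sum>v\<in>V. h v)" for h :: "(nat \<Rightarrow> int) \<Rightarrow> real"
    by (rule sum.reindex_bij_betw[OF g])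
  have fin: "finite (I i)" for i by (simp add: I_def)
  have "f i \<in> CM M" for i
  proof -
    have "continuous_on M (\<lambda>x. complex_of_real (F (g i) x))"
      unfolding F_def tent_def
      by (intro continuous_intros continuous_on_subset[OF continuous_on_product_coordinates]) auto
    hence "continuous_on M (f i)" by (rule continuous_on_eq) (simp add: f_def)
    thus ?thesis by (simp add: CM_def f_def)
  qed
  moreover have zM: "z i \<in> M" for i
  proof (cases "\<exists>x\<in>M. F (g i) x \<noteq> 0")
    case True
    hence "\<exists>x. x \<in> M \<and> F (g i) x \<noteq> 0" by blast
    from someI_ex[OF this] True show ?thesis by (simp add: z_def)
  next
    case False
    have "\<exists>x. x \<in> M" using M(2) by blast
    from someI_ex[OF this] show ?thesis unfolding z_def if_not_P[OF False] .
  qed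
  moreover have "(\<Sum>i<\<nu>. f i x * f i x) = 1" if x: "x \<in> M" for x
  proof -
    have "(\<Sum>i<\<nu>. f i x * f i x) = of_real (\<Sum>i<\<nu>. F (g i) x * F (g i) x)" using x by (simp add: f_def)
    also have "(\<Sum>i<\<nu>. F (g i) x * F (g i) x) = (\<Sum>v\<in>V. \<Prod>i<d. tent (2^m * x i - of_int (v i)))"
      using reidx[of "\<lambda>v. F v x * F v x"] by (simp add: FF)
    also have "\<dots> = (\<Prod>i<d. \<Sum>t\<in>I i. tent (2^m * x i - of_int t))"
      unfolding V_def by (rule prod_sum_PiE[symmetric]) (auto simp: fin)
    also have "\<dots> = 1" using tent_sum(1)[OF fin Ifl[OF x]] by simp
    finally show ?thesis by simp
  qed
  moreover have "(\<Sum>i<\<nu>. cmod (f i x)) \<le> 2^d" if x: "x \<in> M" for x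
  proof -
    have "(\<Sum>i<\<nu>. cmod (f i x)) = (\<Sum>i<\<nu>. F (g i) x)" using x F0 by (simp add: f_def)
    also have "\<dots> = (\<Sum>v\<in>V. \<Prod>i<d. sqrt (tent (2^m * x i - of_int (v i))))"
      using reidx[of "\<lambda>v. F v x"] by (simp add: F_def)
    also have "\<dots> = (\<Prod>i<d. \<Sum>t\<in>I i. sqrt (tent (2^m * x i - of_int t)))"
      unfolding V_def by (rule prod_sum_PiE[symmetric]) (auto simp: fin)
    also have "\<dots> \<le> (\<Prod>i<d. 2)"
      by (intro prod_mono conjI sum_nonneg tent_sum(2)[OF fin Ifl[OF x]]) (simp add: tent_nonneg)
    finally show ?thesis by simp
  qed
  moreover have "dist x (z i) \<le> 4 / 2^m" if x: "x \<in> M" and ne: "f i x \<noteq> 0" for i x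
  proof -
    have Fx: "F (g i) x \<noteq> 0" using ne x by (auto simp: f_def)
    hence ex: "\<exists>x\<in>M. F (g i) x \<noteq> 0" using x by blast
    hence "\<exists>x. x \<in> M \<and> F (g i) x \<noteq> 0" by blast
    from someI_ex[OF this] have Fz: "F (g i) (z i) \<noteq> 0" unfolding z_def if_P[OF ex] by blast
    have near: "\<bar>2^m * y j - of_int (g i j)\<bar> < 1" if "F (g i) y \<noteq> 0" "j < d" for y j
    proof (rule tent_supp)
      show "tent (2^m * y j - of_int (g i j)) \<noteq> 0"
        using that by (auto simp: F_def)
    qed
    have "\<bar>x j - z i j\<bar> \<le> 2 / 2^m" for j
    proof (cases "j < d")
      case True
      have "\<bar>2^m * x j - 2^m * z i j\<bar> \<le> 2" using near[OF Fx True] near[OF Fz True] by linarith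
      hence "2^m * \<bar>x j - z i j\<bar> \<le> 2" by (simp add: abs_mult flip: right_diff_distrib)
      thus ?thesis by (simp add: field_simps)
    next
      case False
      hence "x j = 0" "z i j = 0" using d x zM[of i] by auto
      thus ?thesis by simp
    qed
    from dist_fun_le[OF this] show ?thesis by simp
  qed
  ultimately show ?thesis by blast
qed

lemma CM_uniform:
  assumes M: "compact M" and h: "h \<in> CM M" and e: "0 < e"
  shows "\<exists>\<delta>>0. \<forall>x\<in>M. \<forall>y\<in>M. dist x y < \<delta> \<longrightarrow> cmod (h x - h y) < e"
proof -
  have "uniformly_continuous_on M h" using h M by (intro compact_uniformly_continuous) (auto simp: CM_def)
  thus ?thesis using e unfolding uniformly_continuous_on_def dist_complex_def[of "h _"]
    by (metis dist_commute dist_norm)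
qed

lemma fmul_CM: "f \<in> CM M \<Longrightarrow> g \<in> CM M \<Longrightarrow> fmul f g \<in> CM M"
  by (auto simp: CM_def fmul_def intro!: continuous_intros)

lemma fadd_CM: "f \<in> CM M \<Longrightarrow> g \<in> CM M \<Longrightarrow> fadd f g \<in> CM M"
  by (auto simp: CM_def fadd_def intro!: continuous_intros)

lemma fsmul_CM: "f \<in> CM M \<Longrightarrow> fsmul c f \<in> CM M"
  by (auto simp: CM_def fsmul_def intro!: continuous_intros)

lemma zero_CM: "(\<lambda>x. 0) \<in> CM M"
  by (auto simp: CM_def)

lemma oneM_CM: "oneM M \<in> CM M"
proof -
  have "continuous_on M (oneM M)" by (rule continuous_on_eq[of _ "\<lambda>x. 1"]) (auto simp: oneM_def)
  thus ?thesis by (simp add: CM_def oneM_def)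
qed

text \<open>The test functions \<open>hs\<close> are the squares of all partition functions; the blocks are chosen fine
  enough that the first \<open>k\<close> test functions oscillate by at most \<open>2\<^sup>-\<^sup>k\<close> on the supports of the
  \<open>k\<close>-th partition.\<close>

lemma block_partition:
  fixes M :: "(nat \<Rightarrow> real) set"
  assumes M: "compact M" "M \<noteq> {}" and d: "\<forall>z\<in>M. \<forall>i\<ge>d. z i = 0"
  obtains \<nu> :: "nat \<Rightarrow> nat" and f :: "nat \<Rightarrow> nat \<Rightarrow> (nat \<Rightarrow> real) \<Rightarrow> complex" and z :: "nat \<Rightarrow> nat \<Rightarrow> nat \<Rightarrow> real"
      and hs :: "nat \<Rightarrow> (nat \<Rightarrow> real) \<Rightarrow> complex" where "\<And>k i. i < \<nu> k \<Longrightarrow> f k i \<in> CM M" "\<And>k i. z k i \<in> M"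
    "\<And>k x. x \<in> M \<Longrightarrow> (\<Sum>i<\<nu> k. f k i x * f k i x) = 1"
    "\<And>k x. x \<in> M \<Longrightarrow> (\<Sum>i<\<nu> k. cmod (f k i x)) \<le> 2^d"
    "\<And>j. hs j \<in> CM M"
    "\<And>k j i x. j \<le> k \<Longrightarrow> i < \<nu> k \<Longrightarrow> x \<in> M \<Longrightarrow> f k i x \<noteq> 0 \<Longrightarrow> cmod (hs j x - hs j (z k i)) \<le> 1 / 2^k"
    "\<And>h e. h \<in> CM M \<Longrightarrow> 0 < e \<Longrightarrow> \<exists>k0. \<forall>k\<ge>k0. \<forall>i<\<nu> k. \<forall>x\<in>M. f k i x \<noteq> 0 \<longrightarrow> cmod (h x - h (z k i)) < e"
    "\<And>h e. h \<in> CM M \<Longrightarrow> 0 < e \<Longrightarrow> \<exists>S c. finite S \<and> (\<forall>x\<in>M. cmod (h x - (\<Sum>j\<in>S. c j * hs j x)) \<le> e)"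
proof -
  define P where "P = (\<lambda>m (\<nu>, f, z). (\<forall>i<\<nu>. f i \<in> CM M) \<and> (\<forall>i::nat. z i \<in> M) \<and> (\<forall>x\<in>M. (\<Sum>i<\<nu>. f i x * f i x) = 1)
    \<and> (\<forall>x\<in>M. (\<Sum>i<\<nu>. cmod (f i x)) \<le> 2^d) \<and> (\<forall>i<\<nu>. \<forall>x\<in>M. f i x \<noteq> 0 \<longrightarrow> dist x (z i) \<le> 4 / 2^m))"
  have "\<forall>m. \<exists>t. P m t"
  proof
    fix m
    obtain \<nu> f z where "P m (\<nu>, f, z)" using cube_partition[of M d m, OF M d] unfolding P_def by auto
    thus "\<exists>t. P m t" by blast
  qed
  from choice[OF this] obtain t where t: "\<And>m. P m (t m)" by blast
  define \<nu>' f' z' where "\<nu>' m = fst (t m)" and "f' m = fst (snd (t m))" and "z' m = snd (snd (t m))" for m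
  have Pm: "P m (\<nu>' m, f' m, z' m)" for m using t[of m] by (simp add: \<nu>'_def f'_def z'_def)
  have p1: "i < \<nu>' m \<Longrightarrow> f' m i \<in> CM M" and p2: "z' m i \<in> M" and p3: "x \<in> M \<Longrightarrow> (\<Sum>i<\<nu>' m. f' m i x * f' m i x) = 1"
    and p4: "x \<in> M \<Longrightarrow> (\<Sum>i<\<nu>' m. cmod (f' m i x)) \<le> 2^d"
    and p5: "i < \<nu>' m \<Longrightarrow> x \<in> M \<Longrightarrow> f' m i x \<noteq> 0 \<Longrightarrow> dist x (z' m i) \<le> 4 / 2^m" for m i x
    using Pm[of m] unfolding P_def by auto
  have osc: "\<exists>m0. \<forall>m\<ge>m0. \<forall>i<\<nu>' m. \<forall>x\<in>M. f' m i x \<noteq> 0 \<longrightarrow> cmod (h x - h (z' m i)) < e"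
    if h: "h \<in> CM M" and e: "0 < e" for h e
  proof -
    obtain \<delta> where \<delta>: "0 < \<delta>" "\<And>x y. x \<in> M \<Longrightarrow> y \<in> M \<Longrightarrow> dist x y < \<delta> \<Longrightarrow> cmod (h x - h y) < e"
      using CM_uniform[OF M(1) h e] by blast
    obtain m0 where m0: "(1/2::real)^m0 < \<delta> / 4" using real_arch_pow_inv[of "\<delta> / 4" "1/2"] \<delta> by auto
    have "4 / 2^m < \<delta>" if "m \<ge> m0" for m
    proof -
      have "(1/2::real)^m \<le> (1/2)^m0" using that by (intro power_decreasing) auto
      thus ?thesis using m0 by (simp add: power_one_over)
    qed
    thus ?thesis using \<delta>(2) p2 p5 by (intro exI[of _ m0]) (meson le_less_trans)
  qed
  define hs where "hs j = (case prod_decode j of (m, i) \<Rightarrow> if i < \<nu>' m then fmul (f' m i) (f' m i) else (\<lambda>x. 0))" for j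
  have hsC: "hs j \<in> CM M" for j using p1 by (auto simp: hs_def fmul_CM zero_CM split: prod.splits)
  \<comment> \<open>The test functions are fixed before the blocks are chosen, so there is no
    circularity: block k takes a partition fine enough for the first k + 1 of them, and m >= k keeps
    the mesh tending to 0.\<close>
  have "\<forall>k. \<exists>m\<ge>k. \<forall>j\<le>k. \<forall>i<\<nu>' m. \<forall>x\<in>M. f' m i x \<noteq> 0 \<longrightarrow> cmod (hs j x - hs j (z' m i)) < 1 / 2^k"
  proof
    fix k
    have "\<exists>m0. \<forall>m\<ge>m0. \<forall>j\<in>{..k}. \<forall>i<\<nu>' m. \<forall>x\<in>M. f' m i x \<noteq> 0 \<longrightarrow> cmod (hs j x - hs j (z' m i)) < 1 / 2^k"
      using eventually_ball_finite[of "{..k}" "\<lambda>m j. \<forall>i<\<nu>' m. \<forall>x\<in>M. f' m i x \<noteq> 0 \<longrightarrow> cmod (hs j x - hs j (z' m i)) < 1 / 2^k" sequentially]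
        osc[OF hsC, of "1 / 2^k"] unfolding eventually_sequentially by auto
    then obtain m0 where "\<forall>m\<ge>m0. \<forall>j\<in>{..k}. \<forall>i<\<nu>' m. \<forall>x\<in>M. f' m i x \<noteq> 0 \<longrightarrow> cmod (hs j x - hs j (z' m i)) < 1 / 2^k" by blast
    thus "\<exists>m\<ge>k. \<forall>j\<le>k. \<forall>i<\<nu>' m. \<forall>x\<in>M. f' m i x \<noteq> 0 \<longrightarrow> cmod (hs j x - hs j (z' m i)) < 1 / 2^k"
      by (intro exI[of _ "max k m0"]) auto
  qed
  from choice[OF this] obtain \<sigma> where \<sigma>: "\<And>k. \<sigma> k \<ge> k"
    "\<And>k j i x. j \<le> k \<Longrightarrow> i < \<nu>' (\<sigma> k) \<Longrightarrow> x \<in> M \<Longrightarrow> f' (\<sigma> k) i x \<noteq> 0 \<Longrightarrow> cmod (hs j x - hs j (z' (\<sigma> k) i)) < 1 / 2^k"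
    by blast
  \<comment> \<open>h is approximated by its sampled version, the sum of the h(z_i) f_i^2. Since
    |f_i|^2 <= 2^d |f_i| and the |f_i| sum to at most 2^d, an oscillation below
    \<open>e / 4^d\<close> suffices.\<close>
  have dense: "\<exists>S c. finite S \<and> (\<forall>x\<in>M. cmod (h x - (\<Sum>j\<in>S. c j * hs j x)) \<le> e)" if h: "h \<in> CM M" and e: "0 < e" for h e
  proof -
    obtain m where m: "\<And>i x. i < \<nu>' m \<Longrightarrow> x \<in> M \<Longrightarrow> f' m i x \<noteq> 0 \<Longrightarrow> cmod (h x - h (z' m i)) < e / 4^d"
      using osc[OF h, of "e / 4^d"] e by auto
    define S where "S = (\<lambda>i. prod_encode (m, i)) ` {..<\<nu>' m}"
    define c where "c j = h (z' m (snd (prod_decode j)))" for j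
    have inj: "inj_on (\<lambda>i. prod_encode (m, i)) {..<\<nu>' m}" by (auto simp: inj_on_def)
    have "cmod (h x - (\<Sum>j\<in>S. c j * hs j x)) \<le> e" if x: "x \<in> M" for x
    proof -
      have "(\<Sum>j\<in>S. c j * hs j x) = (\<Sum>i<\<nu>' m. h (z' m i) * (f' m i x * f' m i x))"
        unfolding S_def by (subst sum.reindex[OF inj]) (simp add: c_def hs_def fmul_def)
      moreover have "h x = (\<Sum>i<\<nu>' m. h x * (f' m i x * f' m i x))" using p3[OF x] by (simp flip: sum_distrib_left)
      ultimately have "h x - (\<Sum>j\<in>S. c j * hs j x) = (\<Sum>i<\<nu>' m. (h x - h (z' m i)) * (f' m i x * f' m i x))"
        by (simp add: left_diff_distrib sum_subtractf)
      also have "cmod \<dots> \<le> (\<Sum>i<\<nu>' m. e / 4^d * (2^d * cmod (f' m i x)))"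
      proof (rule sum_norm_le)
        fix i assume i: "i \<in> {..<\<nu>' m}"
        have "cmod (f' m i x) \<le> (\<Sum>i<\<nu>' m. cmod (f' m i x))" using i by (intro member_le_sum) auto
        hence "cmod (f' m i x) \<le> 2^d" using p4[OF x, of m] by linarith
        hence "cmod (f' m i x * f' m i x) \<le> 2^d * cmod (f' m i x)" by (simp add: norm_mult mult_right_mono)
        moreover have "cmod (h x - h (z' m i)) \<le> e / 4^d" if "f' m i x \<noteq> 0" using m[of i x] i x that by simp
        ultimately show "cmod ((h x - h (z' m i)) * (f' m i x * f' m i x)) \<le> e / 4^d * (2^d * cmod (f' m i x))"
        proof (cases "f' m i x = 0")
          case False
          have "cmod (h x - h (z' m i)) * cmod (f' m i x * f' m i x) \<le> e / 4^d * (2^d * cmod (f' m i x))"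
            by (rule mult_mono) (use False e \<open>cmod (f' m i x * f' m i x) \<le> 2^d * cmod (f' m i x)\<close>
                \<open>f' m i x \<noteq> 0 \<Longrightarrow> cmod (h x - h (z' m i)) \<le> e / 4^d\<close> in auto)
          thus ?thesis by (simp only: norm_mult[of "h x - _"])
        qed simp
      qed
      also have "\<dots> = e / 4^d * (2^d * (\<Sum>i<\<nu>' m. cmod (f' m i x)))" by (simp only: sum_distrib_left)
      also have "\<dots> \<le> e / 4^d * (2^d * 2^d)" using e p4[OF x, of m] by (intro mult_left_mono) auto
      also have "\<dots> = e" by (simp flip: power_mult_distrib)
      finally show ?thesis .
    qed
    thus ?thesis by (intro exI[of _ S] exI[of _ c]) (simp add: S_def)
  qed
  show ?thesis
  proof (rule that[of "\<lambda>k. \<nu>' (\<sigma> k)" "\<lambda>k. f' (\<sigma> k)" "\<lambda>k. z' (\<sigma> k)" hs])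
    fix h and e :: real assume "h \<in> CM M" "0 < e"
    then obtain m0 where "\<forall>m\<ge>m0. \<forall>i<\<nu>' m. \<forall>x\<in>M. f' m i x \<noteq> 0 \<longrightarrow> cmod (h x - h (z' m i)) < e" using osc by blast
    thus "\<exists>k0. \<forall>k\<ge>k0. \<forall>i<\<nu>' (\<sigma> k). \<forall>x\<in>M. f' (\<sigma> k) i x \<noteq> 0 \<longrightarrow> cmod (h x - h (z' (\<sigma> k) i)) < e"
      using \<sigma>(1) by (intro exI[of _ m0]) (meson order_trans)
  qed (use p1 p2 p3 p4 hsC \<sigma>(2) dense in \<open>auto intro: less_imp_le\<close>)
qed

section \<open>The representation \<open>eta\<close>\<close>

locale eta_rep = lp_blocks +
  fixes M :: "(nat \<Rightarrow> real) set" and z :: "nat \<Rightarrow> nat \<Rightarrow> nat \<Rightarrow> real"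
  assumes M: "compact M" "M \<noteq> {}" and zM: "z k i \<in> M"
begin

lemma bdd_CM: "h \<in> CM M \<Longrightarrow> bdd_above ((\<lambda>x. cmod (h x)) ` M)"
proof -
  assume "h \<in> CM M"
  hence "continuous_on M (\<lambda>x. cmod (h x))" by (auto simp: CM_def intro: continuous_on_norm)
  hence "compact ((\<lambda>x. cmod (h x)) ` M)" using M(1) by (rule compact_continuous_image)
  thus ?thesis by (intro bounded_imp_bdd_above compact_imp_bounded)
qed

lemma supnorm_upper: "h \<in> CM M \<Longrightarrow> x \<in> M \<Longrightarrow> cmod (h x) \<le> supnorm M h"
  unfolding supnorm_def using bdd_CM by (intro cSup_upper) auto

lemma supnorm_least: "(\<And>x. x \<in> M \<Longrightarrow> cmod (h x) \<le> c) \<Longrightarrow> supnorm M h \<le> c"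
  unfolding supnorm_def using M(2) by (intro cSup_least) auto

lemma supnorm_nonneg: "h \<in> CM M \<Longrightarrow> 0 \<le> supnorm M h"
  using supnorm_upper M(2) by (meson ex_in_conv norm_ge_zero order_trans)

definition dgc :: "(nat \<Rightarrow> complex) \<Rightarrow> (nat \<Rightarrow> complex) \<Rightarrow> nat \<Rightarrow> complex" where
  "dgc c x = mk (\<lambda>k m e. c k * x (tri k m e))"

lemma dgc_tri: "dgc c x (tri k m e) = c k * x (tri k m e)"
  by (simp add: dgc_def)

lemma opb_dgc:
  assumes "0 \<le> s" "\<And>k. cmod (c k) \<le> s" shows "opb s (dgc c)"
proof -
  have e: "cmod (dgc c x N) \<le> cmod (vsmul (of_real s) x N)" for x N
    by (rule tri_cases[of N]) (use assms in \<open>auto simp: dgc_tri fun_apply_simps norm_mult mult_right_mono\<close>)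
  show ?thesis
  proof (rule opbI)
    fix x assume x: "x \<in> X"
    show "dgc c x \<in> X" using X_mono[OF e] x by auto
    show "nm (dgc c x) \<le> s * nm x" using nm_mono[OF e smul_X[OF x]] x assms(1) by simp
    show "dgc c (vsmul a x) = vsmul a (dgc c x)" for a by (rule tri_ext) (simp add: dgc_tri fun_apply_simps)
    show "dgc c (x + y) = dgc c x + dgc c y" for y by (rule tri_ext) (simp add: dgc_tri fun_apply_simps distrib_left)
  qed (use assms in simp)
qed

lemma fib_dgc: "fib (dgc c x) k m = (\<lambda>e. c k * fib x k m e)"
  by (simp add: fib_def dgc_tri)

lemma mul_dgc: "mul c (dgc b x) = mul (\<lambda>k i. c k i * b k) x"
  by (rule tri_ext) (simp add: mul_def fib_dgc co_scale mult_ac)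

lemma dgc_mul: "dgc b (mul c x) = mul (\<lambda>k i. b k * c k i) x"
  by (rule tri_ext) (simp add: mul_def dgc_tri sum_distrib_left mult_ac)

lemma dgc_dgc: "dgc b (dgc c x) = dgc (\<lambda>k. b k * c k) x"
  by (rule tri_ext) (simp add: dgc_tri)

lemma mul_mul: "mul b (mul c x) = mul (\<lambda>k i. b k i * c k i) x"
  by (rule tri_ext) (simp add: mul_def[of b] mul_def[of "\<lambda>k i. b k i * c k i"] co_mul mult_ac)

lemma mul_plus_coeff: "mul b x + mul c x = mul (\<lambda>k i. b k i + c k i) x"
  by (rule tri_ext) (simp add: mul_def fun_apply_simps distrib_right sum.distrib)

text \<open>The scalar \<open>h (z k 0)\<close> acts on the whole block and \<open>mul\<close>
  corrects it on the Rademacher part. A scalar rather than 0 on the complement keeps the map unital,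
  and its being a point evaluation keeps it multiplicative.\<close>

definition eta :: "((nat \<Rightarrow> real) \<Rightarrow> complex) \<Rightarrow> (nat \<Rightarrow> complex) \<Rightarrow> nat \<Rightarrow> complex" where
  "eta h x = dgc (\<lambda>k. h (z k 0)) x + mul (\<lambda>k i. h (z k i) - h (z k 0)) x"

lemma opb_eta:
  assumes h: "h \<in> CM M" shows "opb ((1 + 2 * RC) * supnorm M h) (eta h)"
proof -
  have b: "cmod (h (z k i)) \<le> supnorm M h" for k i using supnorm_upper[OF h zM] .
  have "cmod (h (z k i) - h (z k 0)) \<le> 2 * supnorm M h" for k i
    using norm_triangle_ineq4[of "h (z k i)" "h (z k 0)"] b[of k i] b[of k 0] by linarith
  hence "opb (supnorm M h + RC * (2 * supnorm M h)) (eta h)"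
    unfolding eta_def using b supnorm_nonneg[OF h] by (intro opb_plus opb_dgc opb_mul) auto
  thus ?thesis by (simp add: algebra_simps)
qed

lemma bop_eta: "h \<in> CM M \<Longrightarrow> bop p (eta h)"
  using opb_bop[OF opb_eta] .

lemma eta_fadd: "eta (fadd f g) x = eta f x + eta g x"
  by (rule tri_ext) (simp add: eta_def fadd_def dgc_tri mul_def fun_apply_simps algebra_simps sum.distrib sum_subtractf)

lemma eta_fsmul: "eta (fsmul c f) x = vsmul c (eta f x)"
  by (rule tri_ext) (simp add: eta_def fsmul_def dgc_tri mul_def fun_apply_simps algebra_simps sum_distrib_left)

lemma eta_one: "eta (oneM M) x = x"
  by (rule tri_ext) (simp add: eta_def oneM_def zM dgc_tri mul_def fun_apply_simps)

lemma dgc_add: "dgc c (x + y) = dgc c x + dgc c y"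
  by (rule tri_ext) (simp add: dgc_tri fun_apply_simps distrib_left)

lemma eta_fmul: "eta (fmul f g) x = eta f (eta g x)"
proof -
  have "eta f (eta g x) = dgc (\<lambda>k. f (z k 0) * g (z k 0)) x + (mul (\<lambda>k i. f (z k 0) * (g (z k i) - g (z k 0))) x
     + (mul (\<lambda>k i. (f (z k i) - f (z k 0)) * g (z k 0)) x + mul (\<lambda>k i. (f (z k i) - f (z k 0)) * (g (z k i) - g (z k 0))) x))"
    unfolding eta_def dgc_add mul_add dgc_dgc dgc_mul mul_dgc mul_mul by (simp add: add.assoc)
  also have "\<dots> = eta (fmul f g) x"
    unfolding mul_plus_coeff eta_def fmul_def by (simp add: algebra_simps)
  finally show ?thesis by simp
qed

text \<open>Applied to J, whose range consists of Rademacher sums. The counterpart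
  \<open>mul_one_eta\<close> serves Q, which sees Rademacher coefficients only.\<close>

lemma eta_eq_mul:
  assumes "mul (\<lambda>_ _. 1) v = v" shows "eta h v = mul (\<lambda>k i. h (z k i)) v"
proof -
  have "dgc (\<lambda>k. h (z k 0)) v = mul (\<lambda>k i. h (z k 0)) v"
    using dgc_mul[of "\<lambda>k. h (z k 0)" "\<lambda>_ _. 1" v] assms by simp
  thus ?thesis by (simp add: eta_def mul_plus_coeff)
qed

lemma mul_one_eta: "mul (\<lambda>_ _. 1) (eta h y) = mul (\<lambda>k i. h (z k i)) y"
  by (simp add: eta_def mul_add mul_dgc mul_mul mul_plus_coeff)

text \<open>The i-th Rademacher function of block k tensored with v: an isometric copy of l^p
  consisting of joint eigenvectors for all h. This infinite multiplicity yields the lower bounds in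
  the Calkin algebra.\<close>

definition ei :: "nat \<Rightarrow> nat \<Rightarrow> (nat \<Rightarrow> complex) \<Rightarrow> nat \<Rightarrow> complex" where
  "ei k i v = Jop (\<lambda>k' i' v. if k' = k \<and> i' = i then v else 0) v"

lemma eta_ei: "eta h (ei k i v) = vsmul (h (z k i)) (ei k i v)"
proof -
  have e: "eta h (ei k i v) = mul (\<lambda>k i. h (z k i)) (ei k i v)"
    by (rule eta_eq_mul) (simp add: ei_def mul_Jop)
  show ?thesis unfolding e unfolding ei_def mul_Jop
    by (rule tri_ext) (auto simp: Jop_def Gs_def fun_apply_simps sum_distrib_left mult_ac intro!: sum.cong)
qed

lemma ei_diff: "ei k i v - ei k i v' = ei k i (v - v')"
  by (rule tri_ext) (auto simp: ei_def Jop_def Gs_def fun_apply_simps right_diff_distrib[symmetric] sum_subtractf[symmetric]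
      intro!: sum.cong)

lemma en_ei: "i < n k \<Longrightarrow> en p (ei k i v) = en p v"
proof -
  assume i: "i < n k"
  have g: "Gs (\<lambda>k' i' v. if k' = k \<and> i' = i then v else 0) k' e v = (if k' = k then vsmul (of_real (sg i e)) v else 0)" for k' e
  proof (cases "k' = k")
    case True
    have "(\<Sum>i'<n k. vsmul (of_real (sg i' e)) (if i' = i then v else 0)) = (\<Sum>i'<n k. if i' = i then vsmul (of_real (sg i e)) v else 0)"
      by (intro sum.cong) auto
    thus ?thesis using True i by (simp add: Gs_def)
  qed (simp add: Gs_def)
  have s: "en p (vsmul (of_real (sg i e)) v) = en p v" for e
    by (simp add: en_def fun_apply_simps norm_mult)
  have "en p (ei k i v) = (\<integral>\<^sup>+ k'. en p v * indicator {k} k' \<partial>count_space UNIV)"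
    unfolding ei_def en_Jop
  proof (rule nn_integral_cong)
    fix k'
    have "ennreal (1 / 2^n k) * (\<Sum>e<(2::nat)^n k. en p v) = (ennreal (1 / 2^n k) * ennreal (2^n k)) * en p v"
      by (simp add: mult.assoc ennreal_power flip: ennreal_numeral)
    also have "ennreal (1 / 2^n k) * ennreal (2^n k) = 1" by (simp flip: ennreal_mult)
    finally have *: "ennreal (1 / 2^n k) * (\<Sum>e<(2::nat)^n k. en p v) = en p v" by simp
    show "ennreal (1 / 2^n k') * (\<Sum>e<2^n k'. en p (Gs (\<lambda>k' i' v. if k' = k \<and> i' = i then v else 0) k' e v)) = en p v * indicator {k} k'"
    proof (cases "k' = k")
      case True
      have "(\<Sum>e<2^n k. en p (Gs (\<lambda>k' i' v. if k' = k \<and> i' = i then v else 0) k e v)) = (\<Sum>e<(2::nat)^n k. en p v)"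
        by (intro sum.cong refl) (simp add: g s)
      thus ?thesis using * True by (simp del: sum_constant)
    next
      case False
      thus ?thesis by (simp add: g)
    qed
  qed
  thus ?thesis by (simp add: nn_integral_cmult one_ennreal_def[symmetric])
qed

lemma ei_X: "i < n k \<Longrightarrow> v \<in> X \<Longrightarrow> ei k i v \<in> X" and nm_ei: "i < n k \<Longrightarrow> v \<in> X \<Longrightarrow> nm (ei k i v) = nm v"
proof -
  assume i: "i < n k" and v: "v \<in> X"
  show x: "ei k i v \<in> X" using X_en_mono[of "ei k i v" v] en_ei[OF i] v by simp
  show "nm (ei k i v) = nm v" using nm_en_mono[of "ei k i v" v] nm_en_mono[of v "ei k i v"] en_ei[OF i] v x by simp
qed

lemma nm_ub_diff: "i \<noteq> j \<Longrightarrow> 1 \<le> nm (ub i - ub j)"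
proof -
  assume ij: "i \<noteq> j"
  have "cmod ((ub i - ub j) i) \<le> nm (ub i - ub j)" by (rule coord_le) auto
  thus ?thesis using ij by (simp add: ub_def minus_apply)
qed

section \<open>Splitting the space into infinitely many copies of itself\<close>

definition slot :: "nat \<Rightarrow> (nat \<Rightarrow> complex) \<Rightarrow> nat \<Rightarrow> complex" where
  "slot l y = mk (\<lambda>k m e. y (tri k (prod_encode (l, m)) e))"

definition unslot :: "(nat \<Rightarrow> nat \<Rightarrow> complex) \<Rightarrow> nat \<Rightarrow> complex" where
  "unslot Y = mk (\<lambda>k m e. Y (fst (prod_decode m)) (tri k (snd (prod_decode m)) e))"

lemma slot_tri: "slot l y (tri k m e) = y (tri k (prod_encode (l, m)) e)"
  by (simp add: slot_def)

lemma slot_unslot [simp]: "slot l (unslot Y) = Y l"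
  by (rule tri_ext) (simp add: slot_tri unslot_def)

lemma unslot_slot [simp]: "unslot (\<lambda>l. slot l y) = y"
  by (rule tri_ext) (simp add: slot_tri unslot_def)

lemma slot_ext: "(\<And>l. slot l x = slot l y) \<Longrightarrow> x = y"
proof -
  assume "\<And>l. slot l x = slot l y"
  hence "(\<lambda>l. slot l x) = (\<lambda>l. slot l y)" by (rule ext)
  from arg_cong[OF this, of unslot] show ?thesis by simp
qed

lemma slot_add: "slot l (x + y) = slot l x + slot l y"
  and slot_smul: "slot l (vsmul a x) = vsmul a (slot l x)"
  by (rule tri_ext, simp add: slot_tri fun_apply_simps)+

lemma fib_slot: "fib (slot l y) k m = fib y k (prod_encode (l, m))"
  by (simp add: fib_def slot_tri)

lemma en_slots: "en p y = (\<integral>\<^sup>+ l. en p (slot l y) \<partial>count_space UNIV)"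
proof -
  have "(\<integral>\<^sup>+ l. en p (slot l y) \<partial>count_space UNIV)
     = (\<integral>\<^sup>+ l. \<integral>\<^sup>+ k. \<integral>\<^sup>+ m. en p (fib y k (prod_encode (l, m))) \<partial>count_space UNIV \<partial>count_space UNIV \<partial>count_space UNIV)"
    by (intro nn_integral_cong) (simp only: en_tri[of p "slot _ y"] fib_slot)
  also have "\<dots> = (\<integral>\<^sup>+ k. \<integral>\<^sup>+ l. \<integral>\<^sup>+ m. en p (fib y k (prod_encode (l, m))) \<partial>count_space UNIV \<partial>count_space UNIV \<partial>count_space UNIV)"
    by (rule nn_integral_count_space_nn_integral) auto
  also have "\<dots> = (\<integral>\<^sup>+ k. \<integral>\<^sup>+ m. en p (fib y k m) \<partial>count_space UNIV \<partial>count_space UNIV)"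
    by (intro nn_integral_cong nn_integral_count_space_prod_encode[symmetric])
  finally show ?thesis by (simp add: en_tri[of p y])
qed

lemma slotwise_bound:
  assumes "y \<in> X" "0 \<le> c" "\<And>l. en p (slot l w) \<le> ennreal (c powr p) * en p (slot (\<sigma> l) y)" "inj \<sigma>"
  shows "w \<in> X" "nm w \<le> c * nm y"
proof -
  have "en p w \<le> (\<integral>\<^sup>+ l. ennreal (c powr p) * en p (slot (\<sigma> l) y) \<partial>count_space UNIV)"
    unfolding en_slots[of w] by (intro nn_integral_mono assms)
  also have "\<dots> = ennreal (c powr p) * (\<integral>\<^sup>+ l. en p (slot l y) \<partial>count_space (range \<sigma>))"
  proof -
    have "bij_betw \<sigma> UNIV (range \<sigma>)" using assms(4) by (simp add: bij_betw_def)
    from nn_integral_bij_count_space[OF this, of "\<lambda>l. en p (slot l y)"] show ?thesis by (simp add: nn_integral_cmult)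
  qed
  also have "\<dots> \<le> ennreal (c powr p) * en p y"
    unfolding en_slots[of y]
    by (intro mult_left_mono, subst nn_integral_count_space_indicator) (auto intro!: nn_integral_mono simp: indicator_def)
  finally have "en p w \<le> ennreal (c powr p) * en p y" .
  from en_le_imp[OF this assms(1,2)] show "w \<in> X" "nm w \<le> c * nm y" by auto
qed

lemma opb_slot: "opb 1 (slot l)"
proof (rule opbI)
  fix y assume y: "y \<in> X"
  have "en p (slot l y) \<le> (\<Sum>l'. en p (slot l' y))"
    using sum_le_suminf[of "\<lambda>l'. en p (slot l' y)" "{l}"] by simp
  also have "\<dots> = en p y" by (simp add: en_slots[of y] nn_integral_count_space_nat)
  finally have e: "en p (slot l y) \<le> en p y" .
  show "slot l y \<in> X" "nm (slot l y) \<le> 1 * nm y" using X_en_mono[OF e y] nm_en_mono[OF e y] by auto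
qed (auto simp: slot_add slot_smul)

definition DS :: "((nat \<Rightarrow> complex) \<Rightarrow> nat \<Rightarrow> complex) \<Rightarrow> (nat \<Rightarrow> complex) \<Rightarrow> nat \<Rightarrow> complex" where
  "DS T y = unslot (\<lambda>l. T (slot l y))"

definition shl :: "(nat \<Rightarrow> complex) \<Rightarrow> nat \<Rightarrow> complex" where
  "shl y = unslot (\<lambda>l. slot (Suc l) y)"

definition shr :: "(nat \<Rightarrow> complex) \<Rightarrow> nat \<Rightarrow> complex" where
  "shr y = unslot (\<lambda>l. if l = 0 then 0 else slot (l - 1) y)"

definition in0 :: "(nat \<Rightarrow> complex) \<Rightarrow> nat \<Rightarrow> complex" where
  "in0 x = unslot (\<lambda>l. if l = 0 then x else 0)"

lemma slot_simps [simp]: "slot l (DS T y) = T (slot l y)" "slot l (shl y) = slot (Suc l) y"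
  "slot 0 (shr y) = 0" "slot (Suc l) (shr y) = slot l y" "slot 0 (in0 x) = x" "slot (Suc l) (in0 x) = 0"
  by (simp_all add: DS_def shl_def shr_def in0_def)

lemma opb_DS:
  assumes T: "opb c T" shows "opb c (DS T)"
proof (rule opbI)
  note sX = opb_X[OF opb_slot]
  fix y assume y: "y \<in> X"
  have e: "en p (slot l (DS T y)) \<le> ennreal (c powr p) * en p (slot l y)" for l
    by (simp, rule en_leI) (use opb_nm[OF T] opb_X[OF T] sX[OF y] opb_nonneg[OF T] in auto)
  show "DS T y \<in> X" "nm (DS T y) \<le> c * nm y"
    using slotwise_bound[OF y opb_nonneg[OF T], of "DS T y" "\<lambda>l. l"] e by auto
  show "DS T (vsmul a y) = vsmul a (DS T y)" for a
    by (rule slot_ext) (simp add: slot_smul opb_smul[OF T sX[OF y]])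
  show "DS T (y + x) = DS T y + DS T x" if "x \<in> X" for x
    by (rule slot_ext) (simp add: slot_add opb_add[OF T sX[OF y] sX[OF that]])
qed (use opb_nonneg[OF T] in simp)

lemma opb_shl: "opb 1 shl"
proof (rule opbI)
  fix y assume y: "y \<in> X"
  show "shl y \<in> X" "nm (shl y) \<le> 1 * nm y" using slotwise_bound[OF y, of 1 "shl y" Suc] by auto
  show "shl (vsmul a y) = vsmul a (shl y)" for a by (rule slot_ext) (simp add: slot_smul)
  show "shl (y + x) = shl y + shl x" for x by (rule slot_ext) (simp add: slot_add)
qed simp

lemma slot_zero [simp]: "slot l 0 = 0"
  using slot_smul[of l 0 0] by simp

lemma en_shr: "en p (shr y) = en p y"
proof -
  have "en p (shr y) = (\<Sum>l. en p (slot l (shr y)))" by (simp add: en_slots[of "shr y"] nn_integral_count_space_nat)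
  also have "\<dots> = (\<Sum>l. en p (slot (l + 1) (shr y))) + (\<Sum>l<1. en p (slot l (shr y)))"
    by (rule suminf_offset) simp
  also have "\<dots> = (\<Sum>l. en p (slot l y))" by simp
  also have "\<dots> = en p y" by (simp add: en_slots[of y] nn_integral_count_space_nat)
  finally show ?thesis .
qed

lemma en_in0: "en p (in0 x) = en p x"
proof -
  have "en p (in0 x) = (\<Sum>l. en p (slot l (in0 x)))" by (simp add: en_slots[of "in0 x"] nn_integral_count_space_nat)
  also have "\<dots> = (\<Sum>l. en p (slot (l + 1) (in0 x))) + (\<Sum>l<1. en p (slot l (in0 x)))"
    by (rule suminf_offset) simp
  finally show ?thesis by simp
qed

lemma opb_shr: "opb 1 shr"
proof (rule opbI)
  fix y assume y: "y \<in> X"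
  show "shr y \<in> X" "nm (shr y) \<le> 1 * nm y" using X_en_mono[of "shr y" y] nm_en_mono[of "shr y" y] y by (auto simp: en_shr)
  have s: "slot l (shr w) = (if l = 0 then 0 else slot (l - 1) w)" for l w by (cases l) auto
  show "shr (vsmul a y) = vsmul a (shr y)" for a by (rule slot_ext) (simp add: slot_smul s)
  show "shr (y + x) = shr y + shr x" for x by (rule slot_ext) (simp add: slot_add s)
qed simp

lemma opb_in0: "opb 1 in0"
proof (rule opbI)
  fix y assume y: "y \<in> X"
  show "in0 y \<in> X" "nm (in0 y) \<le> 1 * nm y" using X_en_mono[of "in0 y" y] nm_en_mono[of "in0 y" y] y by (auto simp: en_in0)
  have s: "slot l (in0 w) = (if l = 0 then w else 0)" for l w by (cases l) auto
  show "in0 (vsmul a y) = vsmul a (in0 y)" for a by (rule slot_ext) (simp add: slot_smul s)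
  show "in0 (y + x) = in0 y + in0 x" for x by (rule slot_ext) (simp add: slot_add s)
qed simp

text \<open>The coefficients of \<open>eta\<close> depend on the block k but not on the copy m, so
  copies may be regrouped freely; this is the infinite multiplicity used by the swindle.\<close>

lemma slot_eta: "slot l (eta h y) = eta h (slot l y)"
proof (rule tri_ext)
  fix k m e
  have "fib (slot l y) k m = fib y k (prod_encode (l, m))" by (simp add: fib_def slot_tri)
  thus "slot l (eta h y) (tri k m e) = eta h (slot l y) (tri k m e)"
    by (simp add: slot_tri eta_def fun_apply_simps dgc_tri mul_def)
qed

lemma eta_zero: "eta h 0 = 0"
  by (rule tri_ext) (simp add: eta_def fun_apply_simps dgc_tri mul_def fib_def co_def)

lemma eta_in0: "eta h (in0 x) = in0 (eta h x)"
proof (rule slot_ext)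
  fix l show "slot l (eta h (in0 x)) = slot l (in0 (eta h x))"
    by (cases l) (simp_all add: slot_eta eta_zero)
qed

text \<open>Eigenvectors placed in the copies with index \<open>prod_encode (Suc l, 0)\<close> avoid
  slot 0, the only slot that the swindle changes by J and Q.\<close>

lemma slot_ei: "slot 0 (ei k i (ub (prod_encode (Suc l, 0)))) = 0"
  by (rule tri_ext) (auto simp: slot_tri ei_def Jop_def Gs_def ub_def fun_apply_simps intro!: sum.neutral)

section \<open>Even and odd copies\<close>

definition evn :: "(nat \<Rightarrow> complex) \<Rightarrow> nat \<Rightarrow> complex" where
  "evn y = mk (\<lambda>k m e. y (tri k (2 * m) e))"

definition odn :: "(nat \<Rightarrow> complex) \<Rightarrow> nat \<Rightarrow> complex" where
  "odn y = mk (\<lambda>k m e. y (tri k (2 * m + 1) e))"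

definition joi :: "(nat \<Rightarrow> complex) \<times> (nat \<Rightarrow> complex) \<Rightarrow> nat \<Rightarrow> complex" where
  "joi t = mk (\<lambda>k m e. if even m then fst t (tri k (m div 2) e) else snd t (tri k (m div 2) e))"

lemma joi_simps: "evn (joi t) = fst t" "odn (joi t) = snd t" "joi (evn y, odn y) = y"
proof -
  show "evn (joi t) = fst t" "odn (joi t) = snd t" by (rule tri_ext, simp add: evn_def odn_def joi_def)+
  show "joi (evn y, odn y) = y"
  proof (rule tri_ext)
    fix k m e
    have j: "joi (evn y, odn y) (tri k m e) = y (tri k (if even m then 2 * (m div 2) else 2 * (m div 2) + 1) e)"
      by (simp add: evn_def odn_def joi_def)
    have "(if even m then 2 * (m div 2) else 2 * (m div 2) + 1) = m" by presburger
    thus "joi (evn y, odn y) (tri k m e) = y (tri k m e)" unfolding j by (rule arg_cong)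
  qed
qed

lemma fib_evn: "fib (evn y) k m = fib y k (2 * m)" and fib_odn: "fib (odn y) k m = fib y k (2 * m + 1)"
  by (simp_all add: fib_def evn_def odn_def)

lemma joi_tri: "joi t (tri k m e) = (if even m then fst t (tri k (m div 2) e) else snd t (tri k (m div 2) e))"
  by (simp add: joi_def)

lemma en_even_odd: "en p y = en p (evn y) + en p (odn y)"
proof -
  have "en p y = (\<integral>\<^sup>+ k. ((\<integral>\<^sup>+ m. en p (fib y k (2 * m)) \<partial>count_space UNIV) + (\<integral>\<^sup>+ m. en p (fib y k (2 * m + 1)) \<partial>count_space UNIV)) \<partial>count_space UNIV)"
    unfolding en_tri[of p y] by (intro nn_integral_cong nn_integral_count_space_even_odd)
  also have "\<dots> = en p (evn y) + en p (odn y)"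
    by (subst nn_integral_add) (simp_all only: en_tri[of p "evn y"] en_tri[of p "odn y"] fib_evn fib_odn borel_measurable_count_space)
  finally show ?thesis .
qed

lemma eta_joi: "eta h (joi t) = joi (eta h (fst t), eta h (snd t))"
proof (rule tri_ext)
  fix k m e
  have "fib (joi t) k m = (if even m then fib (fst t) k (m div 2) else fib (snd t) k (m div 2))"
    by (auto simp: fib_def joi_tri)
  thus "eta h (joi t) (tri k m e) = joi (eta h (fst t), eta h (snd t)) (tri k m e)"
    by (simp add: joi_tri eta_def fun_apply_simps dgc_tri mul_def)
qed

end

section \<open>The Eilenberg swindle\<close>

context lp_space
begin

lemma lp2_iff: "t \<in> lp2 p \<longleftrightarrow> fst t \<in> X \<and> snd t \<in> X"
  by (cases t) (simp add: lp2_def)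

lemma nm_le_lp2norm: "nm (fst t) \<le> lp2norm p t" "nm (snd t) \<le> lp2norm p t"
proof -
  have a: "a = (a powr p) powr (1 / p)" if "0 \<le> a" for a :: real using that by (simp add: powr_powr)
  have "(nm (fst t) powr p) powr (1 / p) \<le> lp2norm p t" "(nm (snd t) powr p) powr (1 / p) \<le> lp2norm p t"
    unfolding lp2norm_def using p_pos by (auto intro!: powr_mono2)
  thus "nm (fst t) \<le> lp2norm p t" "nm (snd t) \<le> lp2norm p t" using a[OF nm_nonneg] by metis+
qed

lemma lp2norm_le: "lp2norm p t \<le> nm (fst t) + nm (snd t)"
proof -
  define a b where "a = nm (fst t)" and "b = nm (snd t)"
  have ab: "0 \<le> a" "0 \<le> b" by (auto simp: a_def b_def)
  have "a powr p + b powr p \<le> (a + b) powr p"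
  proof (cases "a + b = 0")
    case True
    hence "a = 0" "b = 0" using ab by auto
    thus ?thesis by simp
  next
    case False
    hence s: "0 < a + b" using ab by simp
    have le: "c powr p \<le> c * (a + b) powr (p - 1)" if "0 \<le> c" "c \<le> a + b" for c
    proof (cases "c = 0")
      case False
      hence "c powr p = c * c powr (p - 1)" using that by (simp add: powr_diff)
      also have "\<dots> \<le> c * (a + b) powr (p - 1)" using that p_gt_1 by (intro mult_left_mono powr_mono2) auto
      finally show ?thesis .
    qed simp
    have "a powr p + b powr p \<le> (a + b) * (a + b) powr (p - 1)"
      using le[of a] le[of b] ab by (simp add: algebra_simps)
    also have "\<dots> = (a + b) powr p" using s by (simp add: powr_diff)
    finally show ?thesis .
  qed
  hence "(a powr p + b powr p) powr (1 / p) \<le> ((a + b) powr p) powr (1 / p)"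
    using p_pos by (intro powr_mono2) auto
  also have "\<dots> = a + b" using ab by (simp add: powr_powr)
  finally show ?thesis by (simp add: lp2norm_def a_def b_def)
qed

lemma lp2norm_nonneg: "0 \<le> lp2norm p t"
  by (simp add: lp2norm_def)

lemma opnorm21_le:
  assumes "0 \<le> c" "\<And>t. t \<in> lp2 p \<Longrightarrow> nm (S t) \<le> c * lp2norm p t"
  shows "opnorm21 p S \<le> c"
  unfolding opnorm21_def
proof (rule cSup_least)
  have "nm (S (0, 0)) \<in> {nm (S t) |t. t \<in> lp2 p \<and> lp2norm p t \<le> 1}"
    by (rule CollectI, rule exI[of _ "(0, 0)"]) (simp add: lp2_iff lp2norm_def)
  thus "{nm (S t) |t. t \<in> lp2 p \<and> lp2norm p t \<le> 1} \<noteq> {}" by blast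
  fix r assume "r \<in> {nm (S t) |t. t \<in> lp2 p \<and> lp2norm p t \<le> 1}"
  then obtain t where t: "t \<in> lp2 p" "lp2norm p t \<le> 1" "r = nm (S t)" by blast
  show "r \<le> c" using assms(2)[OF t(1)] mult_left_mono[OF t(2) assms(1)] t(3) by simp
qed

lemma opnorm12_le:
  assumes "0 \<le> c" "\<And>x. x \<in> X \<Longrightarrow> lp2norm p (R x) \<le> c * nm x"
  shows "0 \<le> opnorm12 p R" "opnorm12 p R \<le> c"
proof -
  have ne: "lp2norm p (R 0) \<in> {lp2norm p (R x) |x. x \<in> X \<and> nm x \<le> 1}"
    by (rule CollectI, rule exI[of _ 0]) simp
  have up: "r \<le> c" if r: "r \<in> {lp2norm p (R x) |x. x \<in> X \<and> nm x \<le> 1}" for r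
  proof -
    obtain x where x: "x \<in> X" "nm x \<le> 1" "r = lp2norm p (R x)" using r by blast
    show ?thesis using assms(2)[OF x(1)] mult_left_mono[OF x(2) assms(1)] x(3) by simp
  qed
  show "opnorm12 p R \<le> c" unfolding opnorm12_def by (rule cSup_least) (use ne up in auto)
  have "lp2norm p (R 0) \<le> opnorm12 p R" unfolding opnorm12_def
    by (rule cSup_upper[OF ne bdd_aboveI[of _ c]]) (rule up)
  thus "0 \<le> opnorm12 p R" using lp2norm_nonneg order_trans by blast
qed

text \<open>S and its inverse are assembled from two inclusions and two projections, and their norms
  are estimated by the triangle inequality; the loss is absorbed in the constant.\<close>

lemma inv_pairI:
  assumes S1: "opb a S1" and S2: "opb b S2" and q1: "opb c q1" and q2: "opb d q2"
    and S: "\<And>t. S t = S1 (fst t) + S2 (snd t)" and R: "\<And>y. R y = (q1 y, q2 y)"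
    and rel: "\<And>x. x \<in> X \<Longrightarrow> q1 (S1 x) = x" "\<And>x. x \<in> X \<Longrightarrow> q2 (S2 x) = x" "\<And>x. x \<in> X \<Longrightarrow> q1 (S2 x) = 0"
      "\<And>x. x \<in> X \<Longrightarrow> q2 (S1 x) = 0" "\<And>x. x \<in> X \<Longrightarrow> S1 (q1 x) + S2 (q2 x) = x"
  shows "inv_pair p S R" "opnorm21 p S * opnorm12 p R \<le> (a + b) * (c + d)"
proof -
  have nS: "nm (S t) \<le> (a + b) * lp2norm p t" if t: "t \<in> lp2 p" for t
  proof -
    have X: "fst t \<in> X" "snd t \<in> X" using t by (auto simp: lp2_iff)
    have "nm (S t) \<le> nm (S1 (fst t)) + nm (S2 (snd t))"
      unfolding S by (rule nm_triangle[OF opb_X[OF S1 X(1)] opb_X[OF S2 X(2)]])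
    also have "\<dots> \<le> a * nm (fst t) + b * nm (snd t)" by (intro add_mono opb_nm[OF S1] opb_nm[OF S2] X)
    also have "\<dots> \<le> a * lp2norm p t + b * lp2norm p t"
      by (intro add_mono mult_left_mono nm_le_lp2norm opb_nonneg[OF S1] opb_nonneg[OF S2])
    finally show ?thesis by (simp add: algebra_simps)
  qed
  have nR: "lp2norm p (R x) \<le> (c + d) * nm x" if x: "x \<in> X" for x
    using lp2norm_le[of "R x"] opb_nm[OF q1 x] opb_nm[OF q2 x] unfolding R by (simp add: algebra_simps)
  have "bop21 p S"
    unfolding bop21_def
  proof (intro conjI ballI allI)
    show "\<exists>C. \<forall>t\<in>lp2 p. nm (S t) \<le> C * lp2norm p t" using nS by blast
  qed (auto simp: S lp2_iff padd_def psmul_def vadd_eq opb_X[OF S1] opb_X[OF S2] opb_add[OF S1] opb_add[OF S2]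
      opb_smul[OF S1] opb_smul[OF S2] vsmul_algebra)
  moreover have "bop12 p R"
    unfolding bop12_def
  proof (intro conjI ballI allI)
    show "\<exists>C. \<forall>x\<in>X. lp2norm p (R x) \<le> C * nm x" using nR by blast
  qed (auto simp: R lp2_iff padd_def psmul_def vadd_eq opb_X[OF q1] opb_X[OF q2] opb_add[OF q1] opb_add[OF q2]
      opb_smul[OF q1] opb_smul[OF q2])
  moreover have "R (S t) = t" if "t \<in> lp2 p" for t
  proof -
    have X: "fst t \<in> X" "snd t \<in> X" using that by (auto simp: lp2_iff)
    show ?thesis unfolding R S
      using X rel by (simp add: opb_add[OF q1 opb_X[OF S1] opb_X[OF S2]] opb_add[OF q2 opb_X[OF S1] opb_X[OF S2]])
  qed
  moreover have "S (R x) = x" if "x \<in> X" for x using rel(5)[OF that] by (simp add: S R)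
  ultimately show "inv_pair p S R" by (simp add: inv_pair_def)
  have ab: "0 \<le> a + b" "0 \<le> c + d" using opb_nonneg[OF S1] opb_nonneg[OF S2] opb_nonneg[OF q1] opb_nonneg[OF q2] by auto
  show "opnorm21 p S * opnorm12 p R \<le> (a + b) * (c + d)"
    by (rule mult_mono[OF opnorm21_le[OF ab(1) nS] opnorm12_le(2)[OF ab(2) nR] ab(1) opnorm12_le(1)[OF ab(2) nR]])
qed

end

context eta_rep
begin

text \<open>Interleaving even and odd copies is an isometry of the l^p-direct sum onto l^p and
  commutes with \<open>eta\<close>, so every constant from 1 on is admissible.\<close>

lemma eta_similar_sum:
  assumes "1 \<le> lam" shows "similar_sum p M lam eta"
proof -
  have e1: "en p (evn y) \<le> en p y" "en p (odn y) \<le> en p y" for y using en_even_odd[of y] by auto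
  have bound: "nm (joi t) \<le> 1 * lp2norm p t \<and> joi t \<in> X" if t: "t \<in> lp2 p" for t
  proof -
    have X: "fst t \<in> X" "snd t \<in> X" using t by (auto simp: lp2_iff)
    have e: "en p (joi t) = ennreal (nm (fst t) powr p + nm (snd t) powr p)"
      using en_even_odd[of "joi t"] by (simp add: joi_simps en_eq X)
    hence x: "joi t \<in> X" by (simp add: lp_iff_en)
    have "nm (joi t) powr p = nm (fst t) powr p + nm (snd t) powr p"
      using en_eq[OF x] e by (subst ennreal_inj[symmetric]) (auto simp del: ennreal_plus)
    hence "(nm (joi t) powr p) powr (1 / p) = lp2norm p t" by (simp add: lp2norm_def)
    hence "nm (joi t) = lp2norm p t" by (simp add: powr_powr)
    thus ?thesis using x by simp
  qed
  define R where "R y = (evn y, odn y)" for y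
  have X: "evn y \<in> X" "odn y \<in> X" if "y \<in> X" for y using X_en_mono[OF e1(1) that] X_en_mono[OF e1(2) that] by auto
  have RX: "R y \<in> lp2 p" if "y \<in> X" for y using X[OF that] by (simp add: R_def lp2_iff)
  have nR: "lp2norm p (R y) \<le> 1 * nm y" if y: "y \<in> X" for y
  proof -
    have "ennreal (nm y powr p) = ennreal (nm (evn y) powr p + nm (odn y) powr p)"
      using en_even_odd[of y] by (simp add: en_eq y X[OF y])
    hence "nm y powr p = nm (evn y) powr p + nm (odn y) powr p"
      by (subst ennreal_inj[symmetric]) (auto simp del: ennreal_plus)
    hence "lp2norm p (R y) = (nm y powr p) powr (1 / p)" by (simp add: lp2norm_def R_def)
    thus ?thesis by (simp add: powr_powr)
  qed
  have jadd: "joi (padd s t) = joi s + joi t" "joi (psmul a t) = vsmul a (joi t)" for s t a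
    by (rule tri_ext, auto simp: joi_tri padd_def psmul_def vadd_eq fun_apply_simps)+
  have radd: "R (x + y) = padd (R x) (R y)" "R (vsmul a x) = psmul a (R x)" for x y a
    by (auto simp: R_def padd_def psmul_def vadd_eq evn_def odn_def fun_apply_simps intro!: tri_ext)
  have "bop21 p joi" unfolding bop21_def vadd_eq using bound jadd by blast
  moreover have "bop12 p R" unfolding bop12_def vadd_eq using RX nR radd by blast
  moreover have "R (joi t) = t" "joi (R y) = y" for t y by (simp_all add: R_def joi_simps)
  ultimately have inv: "inv_pair p joi R" by (simp add: inv_pair_def)
  have le1: "opnorm21 p joi * opnorm12 p R \<le> 1 * 1"
    by (rule mult_mono[OF opnorm21_le opnorm12_le(2)]) (use bound nR opnorm12_le(1)[of 1 R] in auto)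
  have eq: "eta h x = joi (eta h (fst (R x)), eta h (snd (R x)))" for h x
    using eta_joi[of h "R x"] by (simp add: R_def joi_simps)
  have "opnorm21 p joi * opnorm12 p R \<le> lam" using le1 assms by linarith
  with inv eq show ?thesis unfolding similar_sum_def by (intro exI[of _ joi] exI[of _ R] conjI ballI)
qed

lemma eta_calkin_lower:
  assumes h: "h \<in> CM M" and i: "i < n k"
  shows "cmod (h (z k i)) \<le> calkin_norm p (eta h)"
proof (rule eigen_calkin_lower[OF ess_refl[OF bop_eta[OF h]], of "\<lambda>m. ei k i (ub m)" 1 1])
  show "1 \<le> nm (ei k i (ub m) - ei k i (ub m'))" if "m \<noteq> m'" for m m'
    unfolding ei_diff using nm_ub_diff[OF that] by (subst nm_ei[OF i]) auto
qed (auto simp: ei_X[OF i] nm_ei[OF i] eta_ei)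

text \<open>With \<open>P = J Q\<close> and \<open>y\<^sub>l\<close> the slots of \<open>y\<close>, the inverse of \<open>S\<close> sends \<open>y\<close> to
  \<open>(Q y\<^sub>0, ((1 - P) y\<^sub>l + P y\<^sub>l\<^sub>+\<^sub>1)\<^sub>l)\<close>.\<close>

lemma swindle:
  assumes J: "opb j J" and Q: "opb q Q" and QJ: "\<And>x. x \<in> X \<Longrightarrow> Q (J x) = x"
    and eJ: "\<And>h. h \<in> CM M \<Longrightarrow> ess (\<lambda>x. J (\<psi> h x)) (\<lambda>x. eta h (J x))"
    and eQ: "\<And>h. h \<in> CM M \<Longrightarrow> ess (\<lambda>y. \<psi> h (Q y)) (\<lambda>y. Q (eta h y))"
    and \<psi>: "\<And>h. h \<in> CM M \<Longrightarrow> bop p (\<psi> h)"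
    and dens: "\<And>h r. h \<in> CM M \<Longrightarrow> (\<And>k i. i < n k \<Longrightarrow> cmod (h (z k i)) \<le> r) \<Longrightarrow> supnorm M h \<le> r"
  shows "\<exists>S R \<psi>'. inv_pair p S R \<and> calkin_iso p M \<psi>'
    \<and> opnorm21 p S * opnorm12 p R \<le> (j + (1 + j * q + j * q)) * (q + (1 + j * q + j * q))
    \<and> (\<forall>h\<in>CM M. cpt_op p (\<lambda>x. vsub (eta h x) (S (\<psi> h (fst (R x)), \<psi>' h (snd (R x))))))"
proof -
  define P where "P x = J (Q x)" for x
  define W where "W x = x - P x" for x
  have oP: "opb (j * q) P" unfolding P_def by (rule opb_comp[OF J Q])
  have oW: "opb (1 + j * q) W" unfolding W_def by (rule opb_minus_op[OF opb_id oP])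
  note PX = opb_X[OF oP] and WX = opb_X[OF oW] and QX = opb_X[OF Q] and JX = opb_X[OF J] and sX = opb_X[OF opb_slot]
  have QP: "Q (P x) = Q x" if "x \<in> X" for x using QJ[OF QX[OF that]] by (simp add: P_def)
  have QW: "Q (W x) = 0" if "x \<in> X" for x
    using opb_diff[OF Q that PX[OF that]] QP[OF that] by (simp add: W_def)
  have PP: "P (P x) = P x" if "x \<in> X" for x using QP[OF that] by (simp add: P_def)
  have PW: "P (W x) = 0" if "x \<in> X" for x using QW[OF that] opb_zero_arg[OF J] by (simp add: P_def)
  have WP: "W (P x) = 0" if "x \<in> X" for x using PP[OF that] by (simp add: W_def)
  have WW: "W (W x) = W x" if "x \<in> X" for x using PW[OF that] by (simp add: W_def)
  have PJ: "P (J x) = J x" if "x \<in> X" for x using QJ[OF that] by (simp add: P_def)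
  have WJ: "W (J x) = 0" if "x \<in> X" for x using PJ[OF that] by (simp add: W_def)
  have WpP: "W x + P x = x" for x by (simp add: W_def)
  define S1 where "S1 x = in0 (J x)" for x
  define S2 where "S2 u = DS W u + shr (DS P u)" for u
  define q1 where "q1 y = Q (slot 0 y)" for y
  define q2 where "q2 y = DS W y + DS P (shl y)" for y
  have oS1: "opb j S1" unfolding S1_def using opb_comp[OF opb_in0 J] by simp
  have oS2: "opb (1 + j * q + j * q) S2" unfolding S2_def
    using opb_plus[OF opb_DS[OF oW] opb_comp[OF opb_shr opb_DS[OF oP]]] by simp
  have oq1: "opb q q1" unfolding q1_def using opb_comp[OF Q opb_slot] by simp
  have oq2: "opb (1 + j * q + j * q) q2" unfolding q2_def
    using opb_plus[OF opb_DS[OF oW] opb_comp[OF opb_DS[OF oP] opb_shl]] by simp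
  have r1: "q1 (S1 x) = x" if "x \<in> X" for x using QJ[OF that] by (simp add: q1_def S1_def)
  have r3: "q1 (S2 u) = 0" if u: "u \<in> X" for u
    using QW[OF sX[OF u]] by (simp add: q1_def S2_def slot_add)
  have r4: "q2 (S1 x) = 0" if x: "x \<in> X" for x
  proof (rule slot_ext)
    fix l show "slot l (q2 (S1 x)) = slot l 0"
      using WJ[OF x] opb_zero_arg[OF oW] opb_zero_arg[OF oP] by (cases l) (simp_all add: q2_def S1_def slot_add)
  qed
  have r2: "q2 (S2 u) = u" if u: "u \<in> X" for u
  proof (rule slot_ext)
    fix l
    have a: "P (slot (Suc l) (S2 u)) = P (slot l u)"
      using opb_add[OF oP WX[OF sX[OF u]] PX[OF sX[OF u]]] PW[OF sX[OF u]] PP[OF sX[OF u]] by (simp add: S2_def slot_add)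
    have b: "W (slot l (S2 u)) = W (slot l u)"
    proof (cases l)
      case 0 thus ?thesis using WW[OF sX[OF u]] by (simp add: S2_def slot_add)
    next
      case (Suc l')
      thus ?thesis using opb_add[OF oW WX[OF sX[OF u]] PX[OF sX[OF u]]] WW[OF sX[OF u]] WP[OF sX[OF u]] by (simp add: S2_def slot_add)
    qed
    show "slot l (q2 (S2 u)) = slot l u" using a b WpP by (simp add: q2_def slot_add)
  qed
  have r5: "S1 (q1 y) + S2 (q2 y) = y" if y: "y \<in> X" for y
  proof (rule slot_ext)
    fix l
    have w: "W (slot l (q2 y)) = W (slot l y)" for l
      using opb_add[OF oW WX[OF sX[OF y]] PX[OF sX[OF y]]] WW[OF sX[OF y]] WP[OF sX[OF y]] by (simp add: q2_def slot_add)
    have p: "P (slot l (q2 y)) = P (slot (Suc l) y)" for l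
      using opb_add[OF oP WX[OF sX[OF y]] PX[OF sX[OF y]]] PW[OF sX[OF y]] PP[OF sX[OF y]] by (simp add: q2_def slot_add)
    show "slot l (S1 (q1 y) + S2 (q2 y)) = slot l y"
    proof (cases l)
      case 0
      thus ?thesis using w[of 0] WpP[of "slot 0 y"] by (simp add: slot_add S1_def S2_def q1_def P_def[symmetric] add.commute)
    next
      case (Suc l')
      thus ?thesis using w[of l] p[of l'] WpP[of "slot l y"] by (simp add: slot_add S1_def S2_def)
    qed
  qed
  define S where "S t = S1 (fst t) + S2 (snd t)" for t
  define R where "R y = (q1 y, q2 y)" for y
  note ip = inv_pairI[OF oS1 oS2 oq1 oq2 S_def R_def r1 r2 r3 r4 r5]
  \<comment> \<open>The compression of \<open>eta\<close> to the complement. J Q commutes with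
    \<open>eta\<close> only modulo compacts, and infinitely many compact errors, one per slot, need
    not add up to a compact operator. With the compression they are never added: only the corners
    through slot 0 must be compact.\<close>
  define \<psi>' where "\<psi>' h u = q2 (eta h (S2 u))" for h u
  note b = opb_bop[OF oS1] opb_bop[OF oS2] opb_bop[OF oq1] opb_bop[OF oq2]
  have b\<psi>': "bop p (\<psi>' h)" if "h \<in> CM M" for h
    unfolding \<psi>'_def by (rule bop_comp[OF b(4) bop_comp[OF bop_eta[OF that] b(2)]])
  \<comment> \<open>q1 reads slot 0 only, where \<open>S2 u\<close> is W of a vector. Modulo
    compacts Q passes \<open>eta h\<close> as \<open>\<psi> h\<close>, and Q W = 0.\<close>
  have off12: "cpt (\<lambda>u. q1 (eta h (S2 u)))" if h: "h \<in> CM M" for h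
  proof -
    have "cpt (\<lambda>y. Q (eta h y) - \<psi> h (Q y))" using essD(1)[OF ess_sym[OF eQ[OF h]]] .
    from cpt_comp_right[OF this bop_comp[OF opb_bop[OF oW] opb_bop[OF opb_slot]]]
    have "cpt (\<lambda>u. Q (eta h (W (slot 0 u))) - \<psi> h (Q (W (slot 0 u))))" .
    thus ?thesis
    proof (rule cpt_cong)
      fix u assume u: "u \<in> X"
      have "\<psi> h 0 = 0" using bop_smul[OF \<psi>[OF h], of 0 0] by simp
      thus "q1 (eta h (S2 u)) = Q (eta h (W (slot 0 u))) - \<psi> h (Q (W (slot 0 u)))"
        using QW[OF sX[OF u]] by (simp add: q1_def slot_eta S2_def slot_add)
    qed
  qed
  \<comment> \<open>Modulo compacts \<open>eta h\<close> after J is J after \<open>\<psi> h\<close>,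
    and q2 annihilates the range of S1.\<close>
  have off21: "cpt (\<lambda>x. q2 (eta h (S1 x)))" if h: "h \<in> CM M" for h
  proof -
    have "cpt (\<lambda>x. eta h (J x) - J (\<psi> h x))" using essD(1)[OF ess_sym[OF eJ[OF h]]] .
    from cpt_comp_left[OF bop_comp[OF b(4) opb_bop[OF opb_in0]] this]
    have "cpt (\<lambda>x. q2 (in0 (eta h (J x) - J (\<psi> h x))))" .
    thus ?thesis
    proof (rule cpt_cong)
      fix x assume x: "x \<in> X"
      have X1: "eta h (J x) \<in> X" "\<psi> h x \<in> X" using bop_X[OF bop_eta[OF h] JX[OF x]] bop_X[OF \<psi>[OF h] x] by auto
      have "q2 (in0 (eta h (J x) - J (\<psi> h x))) = q2 (in0 (eta h (J x))) - q2 (S1 (\<psi> h x))"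
        using X1 JX opb_X[OF opb_in0] by (simp add: opb_diff[OF opb_in0] opb_diff[OF oq2] S1_def)
      thus "q2 (eta h (S1 x)) = q2 (in0 (eta h (J x) - J (\<psi> h x)))" using r4[OF X1(2)] by (simp add: S1_def eta_in0)
    qed
  qed
  have diag: "cpt (\<lambda>x. q1 (eta h (S1 x)) - \<psi> h x)" if h: "h \<in> CM M" for h
  proof -
    have "cpt (\<lambda>x. eta h (J x) - J (\<psi> h x))" using essD(1)[OF ess_sym[OF eJ[OF h]]] .
    from cpt_comp_left[OF opb_bop[OF Q] this] have "cpt (\<lambda>x. Q (eta h (J x) - J (\<psi> h x)))" .
    thus ?thesis
    proof (rule cpt_cong)
      fix x assume x: "x \<in> X"
      have X1: "eta h (J x) \<in> X" "\<psi> h x \<in> X" using bop_X[OF bop_eta[OF h] JX[OF x]] bop_X[OF \<psi>[OF h] x] by auto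
      show "q1 (eta h (S1 x)) - \<psi> h x = Q (eta h (J x) - J (\<psi> h x))"
        using X1 JX[OF X1(2)] QJ[OF X1(2)] by (simp add: opb_diff[OF Q] q1_def slot_eta S1_def)
    qed
  qed
  have fin: "cpt (\<lambda>x. eta h x - S (\<psi> h (fst (R x)), \<psi>' h (snd (R x))))" if h: "h \<in> CM M" for h
  proof -
    have "cpt (\<lambda>x. S1 (q1 (eta h (S1 (q1 x))) - \<psi> h (q1 x)) + (S2 (q2 (eta h (S1 (q1 x)))) + S1 (q1 (eta h (S2 (q2 x))))))"
      by (rule cpt_add[OF cpt_comp_left[OF b(1) cpt_comp_right[OF diag[OF h] b(3)]]
          cpt_add[OF cpt_comp_left[OF b(2) cpt_comp_right[OF off21[OF h] b(3)]] cpt_comp_left[OF b(1) cpt_comp_right[OF off12[OF h] b(4)]]]])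
    thus ?thesis
    proof (rule cpt_cong)
      fix x assume x: "x \<in> X"
      have X1: "q1 x \<in> X" "q2 x \<in> X" using opb_X[OF oq1 x] opb_X[OF oq2 x] by auto
      have X2: "S1 (q1 x) \<in> X" "S2 (q2 x) \<in> X" using opb_X[OF oS1 X1(1)] opb_X[OF oS2 X1(2)] by auto
      have X3: "eta h (S1 (q1 x)) \<in> X" "eta h (S2 (q2 x)) \<in> X" using bop_X[OF bop_eta[OF h]] X2 by auto
      have X4: "\<psi> h (q1 x) \<in> X" "q1 (eta h (S1 (q1 x))) \<in> X" using bop_X[OF \<psi>[OF h] X1(1)] opb_X[OF oq1 X3(1)] by auto
      have "eta h x = eta h (S1 (q1 x)) + eta h (S2 (q2 x))"
        using r5[OF x] bop_add[OF bop_eta[OF h] X2] by simp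
      also have "\<dots> = (S1 (q1 (eta h (S1 (q1 x)))) + S2 (q2 (eta h (S1 (q1 x))))) + (S1 (q1 (eta h (S2 (q2 x)))) + S2 (q2 (eta h (S2 (q2 x)))))"
        using r5[OF X3(1)] r5[OF X3(2)] by simp
      finally show "eta h x - S (\<psi> h (fst (R x)), \<psi>' h (snd (R x)))
          = S1 (q1 (eta h (S1 (q1 x))) - \<psi> h (q1 x)) + (S2 (q2 (eta h (S1 (q1 x)))) + S1 (q1 (eta h (S2 (q2 x)))))"
        using opb_diff[OF oS1 X4(2) X4(1)] by (simp add: S_def R_def \<psi>'_def)
    qed
  qed
  \<comment> \<open>A compression of a homomorphism is multiplicative up to the product of its
    off-diagonal corners, and one of them is compact.\<close>
  have hom: "ess (\<psi>' (fmul f g)) (\<lambda>x. \<psi>' f (\<psi>' g x))" if f: "f \<in> CM M" and g: "g \<in> CM M" for f g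
  proof -
    have c: "cpt (\<lambda>u. q2 (eta f (S1 (q1 (eta g (S2 u))))))"
      by (rule cpt_comp_right[OF off21[OF f] bop_comp[OF b(3) bop_comp[OF bop_eta[OF g] b(2)]]])
    have "cpt (\<lambda>u. \<psi>' (fmul f g) u - \<psi>' f (\<psi>' g u))"
    proof (rule cpt_cong[OF c])
      fix u assume u: "u \<in> X"
      define y where "y = eta g (S2 u)"
      have y: "y \<in> X" unfolding y_def using bop_X[OF bop_eta[OF g] opb_X[OF oS2 u]] .
      have X1: "S1 (q1 y) \<in> X" "S2 (q2 y) \<in> X" using opb_X[OF oS1 opb_X[OF oq1 y]] opb_X[OF oS2 opb_X[OF oq2 y]] by auto
      have "eta f y = eta f (S1 (q1 y)) + eta f (S2 (q2 y))" using r5[OF y] bop_add[OF bop_eta[OF f] X1] by simp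
      hence "q2 (eta f y) = q2 (eta f (S1 (q1 y))) + q2 (eta f (S2 (q2 y)))"
        using opb_add[OF oq2 bop_X[OF bop_eta[OF f] X1(1)] bop_X[OF bop_eta[OF f] X1(2)]] by simp
      thus "\<psi>' (fmul f g) u - \<psi>' f (\<psi>' g u) = q2 (eta f (S1 (q1 (eta g (S2 u)))))"
        by (simp add: \<psi>'_def eta_fmul y_def)
    qed
    thus ?thesis unfolding ess_def using b\<psi>'[OF fmul_CM[OF f g]] bop_comp[OF b\<psi>'[OF f] b\<psi>'[OF g]] by blast
  qed
  have ih: "calkin_hom p M \<psi>'"
    unfolding calkin_hom_def
  proof (intro conjI ballI allI)
    fix f assume f: "f \<in> CM M"
    show "bop p (\<psi>' f)" by (rule b\<psi>'[OF f])
    fix c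
    show "ess_eq p (\<psi>' (fsmul c f)) (\<lambda>x. vsmul c (\<psi>' f x))"
    proof (rule ess_eq_if_ess, rule ess_of_eq[OF bop_scale[OF b\<psi>'[OF f]]])
      fix x assume x: "x \<in> X"
      show "\<psi>' (fsmul c f) x = vsmul c (\<psi>' f x)"
        unfolding \<psi>'_def eta_fsmul by (rule opb_smul[OF oq2 bop_X[OF bop_eta[OF f] opb_X[OF oS2 x]]])
    qed
  next
    fix f g assume f: "f \<in> CM M" and g: "g \<in> CM M"
    show "ess_eq p (\<psi>' (fmul f g)) (\<lambda>x. \<psi>' f (\<psi>' g x))" by (rule ess_eq_if_ess[OF hom[OF f g]])
    show "ess_eq p (\<psi>' (fadd f g)) (\<lambda>x. vadd (\<psi>' f x) (\<psi>' g x))" unfolding vadd_eq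
    proof (rule ess_eq_if_ess, rule ess_of_eq[OF bop_plus[OF b\<psi>'[OF f] b\<psi>'[OF g]]])
      fix x assume x: "x \<in> X"
      show "\<psi>' (fadd f g) x = \<psi>' f x + \<psi>' g x"
        unfolding \<psi>'_def eta_fadd
        by (rule opb_add[OF oq2 bop_X[OF bop_eta[OF f] opb_X[OF oS2 x]] bop_X[OF bop_eta[OF g] opb_X[OF oS2 x]]])
    qed
  next
    show "ess_eq p (\<psi>' (oneM M)) (\<lambda>x. x)"
      by (rule ess_eq_if_ess, rule ess_of_eq[OF bop_id]) (simp add: \<psi>'_def eta_one r2)
  qed
  have bdd: "calkin_bdd p M \<psi>'"
    unfolding calkin_bdd_def
  proof (intro exI ballI)
    fix h assume h: "h \<in> CM M"
    define s where "s = 1 + j * q + j * q"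
    have o: "opb (s * ((1 + 2 * RC) * supnorm M h * s)) (\<psi>' h)"
      unfolding \<psi>'_def s_def by (rule opb_comp[OF oq2 opb_comp[OF opb_eta[OF h] oS2]])
    have "calkin_norm p (\<psi>' h) \<le> opnorm p (\<psi>' h)" by (rule calkin_norm_le_opnorm[OF b\<psi>'[OF h]])
    also have "\<dots> \<le> s * ((1 + 2 * RC) * supnorm M h * s)" by (rule opnorm_le[OF o])
    finally show "calkin_norm p (\<psi>' h) \<le> ((1 + j * q + j * q) * (1 + 2 * RC) * (1 + j * q + j * q)) * supnorm M h"
      by (simp add: s_def mult_ac)
  qed
  \<comment> \<open>Eigenvectors of \<open>eta\<close> lying off slot 0 are killed by q1, hence
    belong to the range of S2, and q2 carries them to eigenvectors of the compression with the same
    eigenvalues.\<close>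
  have "supnorm M h \<le> calkin_norm p (\<psi>' h)" if h: "h \<in> CM M" for h
  proof (rule dens[OF h])
    fix k i assume i: "i < n k"
    define v where "v l = ei k i (ub (prod_encode (Suc l, 0)))" for l
    have v: "v l \<in> X" "nm (v l) = 1" for l unfolding v_def by (simp_all add: ei_X[OF i] nm_ei[OF i])
    have q0: "q1 (v l) = 0" for l using opb_zero_arg[OF Q] by (simp add: q1_def v_def slot_ei)
    have S2v: "S2 (q2 (v l)) = v l" for l
      using r5[OF v(1), of l] q0[of l] opb_zero_arg[OF oS1] by simp
    define s where "s = 1 + j * q + j * q"
    have s0: "0 < s + 1" using opb_nonneg[OF oS2] by (simp add: s_def)
    show "cmod (h (z k i)) \<le> calkin_norm p (\<psi>' h)"
    proof (rule eigen_calkin_lower[OF ess_refl[OF b\<psi>'[OF h]], of "\<lambda>l. q2 (v l)" s "1 / (s + 1)"])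
      show "q2 (v l) \<in> X" for l using opb_X[OF oq2 v(1)] .
      show "nm (q2 (v l)) \<le> s" for l using opb_nm[OF oq2 v(1)] v(2) by (simp add: s_def)
      show "0 < 1 / (s + 1)" using s0 by simp
      \<comment> \<open>Separation passes to the images: S2 is bounded by s and maps their
        differences back to differences of norm at least 1.\<close>
      show "1 / (s + 1) \<le> nm (q2 (v l) - q2 (v m))" if lm: "l \<noteq> m" for l m
      proof -
        have dX: "q2 (v l) - q2 (v m) \<in> X" using opb_X[OF oq2 v(1)] by auto
        have "1 \<le> nm (v l - v m)"
          unfolding v_def ei_diff using nm_ub_diff[of "prod_encode (Suc l, 0)" "prod_encode (Suc m, 0)"] lm
          by (subst nm_ei[OF i]) auto
        also have "v l - v m = S2 (q2 (v l) - q2 (v m))"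
          using opb_diff[OF oS2 opb_X[OF oq2 v(1)] opb_X[OF oq2 v(1)]] S2v by simp
        also have "nm \<dots> \<le> s * nm (q2 (v l) - q2 (v m))" using opb_nm[OF oS2 dX] by (simp add: s_def)
        also have "\<dots> \<le> (s + 1) * nm (q2 (v l) - q2 (v m))" by (intro mult_right_mono) auto
        finally show ?thesis using s0 by (simp add: pos_divide_le_eq mult.commute)
      qed
      show "\<psi>' h (q2 (v l)) = vsmul (h (z k i)) (q2 (v l))" for l
        using opb_smul[OF oq2 v(1)] S2v[of l] by (simp add: \<psi>'_def v_def eta_ei)
    qed
  qed
  hence "calkin_below p M \<psi>'" unfolding calkin_below_def by (intro exI[of _ 1]) simp
  hence "calkin_iso p M \<psi>'" using ih bdd by (simp add: calkin_iso_def)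
  with ip fin show ?thesis
    unfolding cpt_op_iff vsub_eq by (intro exI[of _ S] exI[of _ R] exI[of _ \<psi>'] conjI ballI)
qed

end

section \<open>Homomorphisms into the Calkin algebra\<close>

locale calkin_rep = eta_rep +
  fixes \<psi> :: rep
  assumes hom: "calkin_hom p M \<psi>" and bdd: "calkin_bdd p M \<psi>"
begin

abbreviation K\<psi> :: real where "K\<psi> \<equiv> calkin_opnorm p M \<psi>"

lemma psi_bop: "h \<in> CM M \<Longrightarrow> bop p (\<psi> h)"
  using hom by (simp add: calkin_hom_def)

lemma psi_fadd: "f \<in> CM M \<Longrightarrow> g \<in> CM M \<Longrightarrow> ess (\<psi> (fadd f g)) (\<lambda>x. \<psi> f x + \<psi> g x)"
  using hom psi_bop fadd_CM by (intro ess_eqI) (auto simp: calkin_hom_def vadd_eq)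

lemma psi_fsmul: "f \<in> CM M \<Longrightarrow> ess (\<psi> (fsmul c f)) (\<lambda>x. vsmul c (\<psi> f x))"
  using hom psi_bop fsmul_CM by (intro ess_eqI) (auto simp: calkin_hom_def)

lemma psi_fmul: "f \<in> CM M \<Longrightarrow> g \<in> CM M \<Longrightarrow> ess (\<psi> (fmul f g)) (\<lambda>x. \<psi> f (\<psi> g x))"
  using hom psi_bop fmul_CM bop_comp by (intro ess_eqI) (auto simp: calkin_hom_def)

lemma psi_one: "ess (\<psi> (oneM M)) (\<lambda>x. x)"
  using hom psi_bop oneM_CM by (intro ess_eqI) (auto simp: calkin_hom_def)

lemma sum_CM: "(\<And>i. i \<in> A \<Longrightarrow> f i \<in> CM M) \<Longrightarrow> (\<lambda>x. \<Sum>i\<in>A. c i * f i x) \<in> CM M"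
  by (auto simp: CM_def intro!: continuous_intros sum.neutral)

lemma psi_sum:
  assumes "finite A" "\<And>i. i \<in> A \<Longrightarrow> f i \<in> CM M"
  shows "ess (\<psi> (\<lambda>x. \<Sum>i\<in>A. c i * f i x)) (\<lambda>x. \<Sum>i\<in>A. vsmul (c i) (\<psi> (f i) x))"
  using assms
proof (induction A)
  case empty
  have "fsmul 0 (\<lambda>x. 0) = (\<lambda>x. 0)" by (simp add: fsmul_def)
  thus ?case using psi_fsmul[OF zero_CM, of 0] by simp
next
  case (insert i A)
  let ?g = "\<lambda>x. \<Sum>i\<in>A. c i * f i x"
  have g: "?g \<in> CM M" by (rule sum_CM) (use insert in auto)
  have fi: "f i \<in> CM M" using insert by auto
  have eq: "(\<lambda>x. \<Sum>i\<in>insert i A. c i * f i x) = fadd (fsmul (c i) (f i)) ?g"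
    using insert.hyps by (simp add: fadd_def fsmul_def)
  have "ess (\<psi> (fadd (fsmul (c i) (f i)) ?g)) (\<lambda>x. vsmul (c i) (\<psi> (f i) x) + (\<Sum>i\<in>A. vsmul (c i) (\<psi> (f i) x)))"
    by (rule ess_trans[OF psi_fadd[OF fsmul_CM[OF fi] g] ess_plus[OF psi_fsmul[OF fi] insert.IH]]) (use insert in auto)
  thus ?case unfolding eq unfolding sum.insert[OF insert.hyps] .
qed

lemma bdd_opnorm: "bdd_above {calkin_norm p (\<psi> h) |h. h \<in> CM M \<and> supnorm M h \<le> 1}"
proof -
  obtain C where C: "\<And>h. h \<in> CM M \<Longrightarrow> calkin_norm p (\<psi> h) \<le> C * supnorm M h" using bdd by (auto simp: calkin_bdd_def)
  show ?thesis
  proof (rule bdd_aboveI[of _ "\<bar>C\<bar>"])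
    fix r assume "r \<in> {calkin_norm p (\<psi> h) |h. h \<in> CM M \<and> supnorm M h \<le> 1}"
    then obtain h where h: "h \<in> CM M" "supnorm M h \<le> 1" "r = calkin_norm p (\<psi> h)" by blast
    have "C * supnorm M h \<le> \<bar>C\<bar> * supnorm M h" using supnorm_nonneg[OF h(1)] by (intro mult_right_mono) auto
    also have "\<dots> \<le> \<bar>C\<bar> * 1" using h(2) by (intro mult_left_mono) auto
    finally show "r \<le> \<bar>C\<bar>" using C[OF h(1)] h(3) by linarith
  qed
qed

lemma calkin_norm_psi_le: "h \<in> CM M \<Longrightarrow> supnorm M h \<le> 1 \<Longrightarrow> calkin_norm p (\<psi> h) \<le> K\<psi>"
  unfolding calkin_opnorm_def by (rule cSup_upper[OF _ bdd_opnorm]) blast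

text \<open>The unit vectors are separated eigenvectors of the identity, so a unital \<psi> cannot
  have smaller norm in the Calkin algebra. This allows additive constants to be absorbed and
  exponents to be raised.\<close>

lemma K_ge_1: "1 \<le> K\<psi>"
proof -
  have "supnorm M (oneM M) \<le> 1" by (rule supnorm_least) (simp add: oneM_def)
  hence "calkin_norm p (\<psi> (oneM M)) \<le> K\<psi>" using calkin_norm_psi_le[OF oneM_CM] by blast
  moreover have "cmod 1 \<le> calkin_norm p (\<psi> (oneM M))"
    by (rule eigen_calkin_lower[OF psi_one, of ub 1 1]) (auto intro: nm_ub_diff)
  ultimately show ?thesis by simp
qed

text \<open>Scaling g to the unit ball costs a compact error, because \<psi> is homogeneous only
  modulo compacts; e is the price of the infimum in the Calkin norm.\<close>

lemma psi_ess_bound: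
  assumes g: "g \<in> CM M" and s: "\<And>x. x \<in> M \<Longrightarrow> cmod (g x) \<le> s" and e: "0 < e"
  shows "\<exists>K. cpt K \<and> opb (K\<psi> * s + e) (\<lambda>x. \<psi> g x + K x)"
proof -
  define t where "t = supnorm M g"
  have ts: "t \<le> s" unfolding t_def by (rule supnorm_least[OF s])
  have t0: "0 \<le> t" unfolding t_def by (rule supnorm_nonneg[OF g])
  have le: "K\<psi> * t \<le> K\<psi> * s" using ts K_ge_1 by simp
  show ?thesis
  proof (cases "t = 0")
    \<comment> \<open>A function of norm 0 cannot be normalised; the linear bound in
      \<open>calkin_bdd\<close> gives Calkin norm at most 0 directly.\<close>
    case True
    obtain C where C: "\<And>h. h \<in> CM M \<Longrightarrow> calkin_norm p (\<psi> h) \<le> C * supnorm M h" using bdd by (auto simp: calkin_bdd_def)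
    have "calkin_norm p (\<psi> g) \<le> 0" using C[OF g] True by (simp add: t_def)
    then obtain K where K: "cpt K" "opb (0 + e) (\<lambda>x. \<psi> g x + K x)" using calkin_norm_obtain[OF psi_bop[OF g] _ e] by blast
    have "0 + e \<le> K\<psi> * s + e" using le True by simp
    thus ?thesis using K opb_mono by blast
  next
    case False
    hence t: "0 < t" using t0 by simp
    define g' where "g' = fsmul (of_real (1 / t)) g"
    have g': "g' \<in> CM M" unfolding g'_def by (rule fsmul_CM[OF g])
    have "supnorm M g' \<le> 1"
      by (rule supnorm_least) (use supnorm_upper[OF g] t in \<open>auto simp: g'_def fsmul_def norm_divide t_def\<close>)
    hence "calkin_norm p (\<psi> g') \<le> K\<psi>" by (rule calkin_norm_psi_le[OF g'])
    then obtain K1 where K1: "cpt K1" "opb (K\<psi> + e / t) (\<lambda>x. \<psi> g' x + K1 x)"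
      using calkin_norm_obtain[OF psi_bop[OF g'], of _ "e / t"] e t by auto
    have D: "cpt (\<lambda>x. \<psi> g' x - vsmul (of_real (1 / t)) (\<psi> g x))" using essD(1)[OF psi_fsmul[OF g]] unfolding g'_def .
    have K: "cpt (\<lambda>x. vsmul (of_real t) (\<psi> g' x - vsmul (of_real (1 / t)) (\<psi> g x)) + vsmul (of_real t) (K1 x))"
      by (rule cpt_add[OF cpt_scale[OF D] cpt_scale[OF K1(1)]])
    have "opb (cmod (of_real t) * (K\<psi> + e / t)) (\<lambda>x. vsmul (of_real t) (\<psi> g' x + K1 x))" by (rule opb_scale[OF K1(2)])
    moreover have "cmod (of_real t) * (K\<psi> + e / t) \<le> K\<psi> * s + e" using t le by (simp add: algebra_simps)
    ultimately have "opb (K\<psi> * s + e) (\<lambda>x. vsmul (of_real t) (\<psi> g' x + K1 x))" by (rule opb_mono)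
    hence "opb (K\<psi> * s + e) (\<lambda>x. \<psi> g x + (vsmul (of_real t) (\<psi> g' x - vsmul (of_real (1 / t)) (\<psi> g x)) + vsmul (of_real t) (K1 x)))"
      by (rule opb_cong) (use t in \<open>simp add: vsmul_algebra\<close>)
    with K show ?thesis by blast
  qed
qed

lemma ess_psi_bound:
  assumes W: "ess W (\<psi> g)" and g: "g \<in> CM M" and s: "\<And>x. x \<in> M \<Longrightarrow> cmod (g x) \<le> s" and e: "0 < e"
  shows "\<exists>K. cpt K \<and> opb (K\<psi> * s + e) (\<lambda>x. W x + K x)"
proof -
  obtain K where K: "cpt K" "opb (K\<psi> * s + e) (\<lambda>x. \<psi> g x + K x)" using psi_ess_bound[OF g s e] by blast
  have "cpt (\<lambda>x. (\<psi> g x - W x) + K x)" by (rule cpt_add[OF essD(1)[OF ess_sym[OF W]] K(1)])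
  moreover have "opb (K\<psi> * s + e) (\<lambda>x. W x + ((\<psi> g x - W x) + K x))" using K(2) by simp
  ultimately show ?thesis by blast
qed

text \<open>F is linear modulo compacts and essentially bounded by the sup norm, so the functions
  with compact value form a closed subspace; it contains the test functions, whose span is dense. F
  itself need be neither linear nor continuous.\<close>

lemma cpt_extend:
  fixes F :: rep
  assumes Fb: "\<And>f. f \<in> CM M \<Longrightarrow> bop p (F f)"
    and add: "\<And>f g. f \<in> CM M \<Longrightarrow> g \<in> CM M \<Longrightarrow> ess (F (fadd f g)) (\<lambda>x. F f x + F g x)"
    and smul: "\<And>f c. f \<in> CM M \<Longrightarrow> ess (F (fsmul c f)) (\<lambda>x. vsmul c (F f x))"
    and small: "\<And>f s. f \<in> CM M \<Longrightarrow> (\<And>x. x \<in> M \<Longrightarrow> cmod (f x) \<le> s) \<Longrightarrow> 0 < s \<Longrightarrow> \<exists>K. cpt K \<and> opb (C * s) (\<lambda>x. F f x + K x)"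
    and gen: "\<And>j. hs j \<in> CM M" "\<And>j. cpt (F (hs j))"
    and dense: "\<And>h e. h \<in> CM M \<Longrightarrow> 0 < e \<Longrightarrow> \<exists>S c. finite S \<and> (\<forall>x\<in>M. cmod (h x - (\<Sum>j\<in>S. c j * hs j x)) \<le> e)"
    and h: "h \<in> CM M"
  shows "cpt (F h)"
proof (rule cpt_limit[OF Fb[OF h]])
  fix e :: real assume e: "0 < e"
  define s where "s = e / (\<bar>C\<bar> + 1)"
  have s: "0 < s" using e by (simp add: s_def)
  obtain S c where S: "finite S" "\<And>x. x \<in> M \<Longrightarrow> cmod (h x - (\<Sum>j\<in>S. c j * hs j x)) \<le> s" using dense[OF h s] by blast
  define g where "g = (\<lambda>x. \<Sum>j\<in>S. c j * hs j x)"
  have gC: "(\<lambda>x. \<Sum>j\<in>A. c j * hs j x) \<in> CM M" for A by (rule sum_CM[OF gen(1)])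
  have "cpt (F (\<lambda>x. \<Sum>j\<in>A. c j * hs j x))" if "finite A" for A using that
  proof (induction A)
    case empty
    have "fsmul 0 (\<lambda>x. 0) = (\<lambda>x. 0)" by (simp add: fsmul_def)
    thus ?case using cpt_ess[OF cpt_0] smul[OF zero_CM, of 0] by simp
  next
    case (insert j A)
    have eq: "(\<lambda>x. \<Sum>i\<in>insert j A. c i * hs i x) = fadd (fsmul (c j) (hs j)) (\<lambda>x. \<Sum>i\<in>A. c i * hs i x)"
      using insert.hyps by (simp add: fadd_def fsmul_def)
    have "cpt (F (fsmul (c j) (hs j)))" by (rule cpt_ess[OF cpt_scale[OF gen(2)] smul[OF gen(1)]])
    from cpt_ess[OF cpt_add[OF this insert.IH] add[OF fsmul_CM[OF gen(1)] gC]] show ?case unfolding eq .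
  qed
  hence Fg: "cpt (F g)" using S(1) by (simp add: g_def)
  have g: "g \<in> CM M" unfolding g_def by (rule gC)
  define r where "r = fadd h (fsmul (-1) g)"
  have r: "r \<in> CM M" unfolding r_def by (rule fadd_CM[OF h fsmul_CM[OF g]])
  have hr: "h = fadd g r" by (simp add: r_def fadd_def fsmul_def)
  have "cmod (r x) \<le> s" if "x \<in> M" for x using S(2)[OF that] by (simp add: r_def fadd_def fsmul_def g_def)
  then obtain K1 where K1: "cpt K1" "opb (C * s) (\<lambda>x. F r x + K1 x)" using small[OF r _ s] by blast
  have D: "cpt (\<lambda>x. F h x - (F g x + F r x))" using essD(1)[OF add[OF g r]] hr by simp
  have "cpt (\<lambda>x. (F g x - K1 x) + (F h x - (F g x + F r x)))" by (rule cpt_add[OF cpt_diff[OF Fg K1(1)] D])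
  moreover have "opb e (\<lambda>x. F h x - ((F g x - K1 x) + (F h x - (F g x + F r x))))"
  proof -
    have "C * s \<le> \<bar>C\<bar> * s" using s by (intro mult_right_mono) auto
    also have "\<dots> \<le> e" using e by (simp add: s_def field_simps)
    finally have "opb e (\<lambda>x. F r x + K1 x)" using opb_mono[OF K1(2)] by blast
    thus ?thesis by (rule opb_cong) (simp add: algebra_simps)
  qed
  ultimately show "\<exists>K. cpt K \<and> opb e (\<lambda>x. F h x - K x)" by blast
qed

text \<open>The intertwining defect is linear modulo compacts and essentially bounded, \<psi> by its
  Calkin norm and \<open>eta\<close> in operator norm, so \<open>cpt_extend\<close> applies to
  it.\<close>

lemma intertwine_extend_left:
  assumes J: "opb j J" and gen: "\<And>i. hs i \<in> CM M" "\<And>i. ess (\<lambda>x. J (\<psi> (hs i) x)) (\<lambda>x. eta (hs i) (J x))"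
    and dense: "\<And>h e. h \<in> CM M \<Longrightarrow> 0 < e \<Longrightarrow> \<exists>S c. finite S \<and> (\<forall>x\<in>M. cmod (h x - (\<Sum>j\<in>S. c j * hs j x)) \<le> e)"
    and h: "h \<in> CM M"
  shows "ess (\<lambda>x. J (\<psi> h x)) (\<lambda>x. eta h (J x))"
proof -
  note bJ = opb_bop[OF J] and JX = opb_X[OF J]
  have b1: "bop p (\<lambda>x. J (\<psi> f x))" and b2: "bop p (\<lambda>x. eta f (J x))" if "f \<in> CM M" for f
    by (rule bop_comp[OF bJ psi_bop[OF that]], rule bop_comp[OF bop_eta[OF that] bJ])
  have "cpt ((\<lambda>f x. J (\<psi> f x) - eta f (J x)) h)"
  proof (rule cpt_extend[of "\<lambda>f x. J (\<psi> f x) - eta f (J x)" "j * (K\<psi> + 1) + (1 + 2 * RC) * j" hs])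
    fix f assume f: "f \<in> CM M"
    show "bop p (\<lambda>x. J (\<psi> f x) - eta f (J x))" by (rule bop_minus_op[OF b1[OF f] b2[OF f]])
    show "ess (\<lambda>x. J (\<psi> (fsmul c f) x) - eta (fsmul c f) (J x)) (\<lambda>x. vsmul c (J (\<psi> f x) - eta f (J x)))" for c
      by (rule ess_trans[OF ess_minus[OF ess_comp_left[OF bJ psi_fsmul[OF f]] ess_refl[OF b2[OF fsmul_CM[OF f]]]] ess_of_eq[OF bop_scale[OF bop_minus_op[OF b1[OF f] b2[OF f]]]]])
         (use bop_X[OF psi_bop[OF f]] in \<open>simp add: opb_smul[OF J] eta_fsmul vsmul_algebra\<close>)
    show "\<exists>K. cpt K \<and> opb ((j * (K\<psi> + 1) + (1 + 2 * RC) * j) * s) (\<lambda>x. (J (\<psi> f x) - eta f (J x)) + K x)"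
      if s: "\<And>x. x \<in> M \<Longrightarrow> cmod (f x) \<le> s" and s0: "0 < s" for s
    proof -
      obtain K where K: "cpt K" "opb (K\<psi> * s + s) (\<lambda>x. \<psi> f x + K x)" using psi_ess_bound[OF f s s0] by blast
      have "supnorm M f \<le> s" by (rule supnorm_least[OF s])
      hence "(1 + 2 * RC) * supnorm M f \<le> (1 + 2 * RC) * s" using RC_ge_1 by (intro mult_left_mono) auto
      from opb_mono[OF opb_eta[OF f] this] have et: "opb ((1 + 2 * RC) * s) (eta f)" .
      have "opb (j * (K\<psi> * s + s) + (1 + 2 * RC) * s * j) (\<lambda>x. J (\<psi> f x + K x) - eta f (J x))"
        by (rule opb_minus_op[OF opb_comp[OF J K(2)] opb_comp[OF et J]])
      hence "opb ((j * (K\<psi> + 1) + (1 + 2 * RC) * j) * s) (\<lambda>x. J (\<psi> f x + K x) - eta f (J x))"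
        by (rule opb_mono) (simp add: algebra_simps)
      hence "opb ((j * (K\<psi> + 1) + (1 + 2 * RC) * j) * s) (\<lambda>x. (J (\<psi> f x) - eta f (J x)) + J (K x))"
        by (rule opb_cong) (use bop_X[OF psi_bop[OF f]] bop_X[OF cpt_bop[OF K(1)]] in \<open>simp add: opb_add[OF J]\<close>)
      with cpt_comp_left[OF bJ K(1)] show ?thesis by blast
    qed
    fix g assume g: "g \<in> CM M"
    show "ess (\<lambda>x. J (\<psi> (fadd f g) x) - eta (fadd f g) (J x)) (\<lambda>x. (J (\<psi> f x) - eta f (J x)) + (J (\<psi> g x) - eta g (J x)))"
      by (rule ess_trans[OF ess_minus[OF ess_comp_left[OF bJ psi_fadd[OF f g]] ess_refl[OF b2[OF fadd_CM[OF f g]]]]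
            ess_of_eq[OF bop_plus[OF bop_minus_op[OF b1[OF f] b2[OF f]] bop_minus_op[OF b1[OF g] b2[OF g]]]]])
         (use bop_X[OF psi_bop[OF f]] bop_X[OF psi_bop[OF g]] in \<open>simp add: opb_add[OF J] eta_fadd\<close>)
  qed (use gen(1) essD(1)[OF gen(2)] dense h in auto)
  thus ?thesis unfolding ess_def using b1[OF h] b2[OF h] by blast
qed

lemma intertwine_extend_right:
  assumes Q: "opb q Q" and gen: "\<And>i. hs i \<in> CM M" "\<And>i. ess (\<lambda>x. \<psi> (hs i) (Q x)) (\<lambda>x. Q (eta (hs i) x))"
    and dense: "\<And>h e. h \<in> CM M \<Longrightarrow> 0 < e \<Longrightarrow> \<exists>S c. finite S \<and> (\<forall>x\<in>M. cmod (h x - (\<Sum>j\<in>S. c j * hs j x)) \<le> e)"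
    and h: "h \<in> CM M"
  shows "ess (\<lambda>x. \<psi> h (Q x)) (\<lambda>x. Q (eta h x))"
proof -
  note bQ = opb_bop[OF Q]
  have b1: "bop p (\<lambda>x. \<psi> f (Q x))" and b2: "bop p (\<lambda>x. Q (eta f x))" if "f \<in> CM M" for f
    by (rule bop_comp[OF psi_bop[OF that] bQ], rule bop_comp[OF bQ bop_eta[OF that]])
  have "cpt ((\<lambda>f x. \<psi> f (Q x) - Q (eta f x)) h)"
  proof (rule cpt_extend[of "\<lambda>f x. \<psi> f (Q x) - Q (eta f x)" "(K\<psi> + 1) * q + q * (1 + 2 * RC)" hs])
    fix f assume f: "f \<in> CM M"
    show "bop p (\<lambda>x. \<psi> f (Q x) - Q (eta f x))" by (rule bop_minus_op[OF b1[OF f] b2[OF f]])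
    show "ess (\<lambda>x. \<psi> (fsmul c f) (Q x) - Q (eta (fsmul c f) x)) (\<lambda>x. vsmul c (\<psi> f (Q x) - Q (eta f x)))" for c
      by (rule ess_trans[OF ess_minus[OF ess_comp_right[OF psi_fsmul[OF f] bQ] ess_refl[OF b2[OF fsmul_CM[OF f]]]] ess_of_eq[OF bop_scale[OF bop_minus_op[OF b1[OF f] b2[OF f]]]]])
         (use bop_X[OF bop_eta[OF f]] in \<open>simp add: opb_smul[OF Q] eta_fsmul vsmul_algebra\<close>)
    show "\<exists>K. cpt K \<and> opb (((K\<psi> + 1) * q + q * (1 + 2 * RC)) * s) (\<lambda>x. (\<psi> f (Q x) - Q (eta f x)) + K x)"
      if s: "\<And>x. x \<in> M \<Longrightarrow> cmod (f x) \<le> s" and s0: "0 < s" for s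
    proof -
      obtain K where K: "cpt K" "opb (K\<psi> * s + s) (\<lambda>x. \<psi> f x + K x)" using psi_ess_bound[OF f s s0] by blast
      have "supnorm M f \<le> s" by (rule supnorm_least[OF s])
      hence "(1 + 2 * RC) * supnorm M f \<le> (1 + 2 * RC) * s" using RC_ge_1 by (intro mult_left_mono) auto
      from opb_mono[OF opb_eta[OF f] this] have et: "opb ((1 + 2 * RC) * s) (eta f)" .
      have "opb ((K\<psi> * s + s) * q + q * ((1 + 2 * RC) * s)) (\<lambda>x. (\<psi> f (Q x) + K (Q x)) - Q (eta f x))"
        by (rule opb_minus_op[OF opb_comp[OF K(2) Q] opb_comp[OF Q et]])
      hence "opb (((K\<psi> + 1) * q + q * (1 + 2 * RC)) * s) (\<lambda>x. (\<psi> f (Q x) + K (Q x)) - Q (eta f x))"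
        by (rule opb_mono) (simp add: algebra_simps)
      hence "opb (((K\<psi> + 1) * q + q * (1 + 2 * RC)) * s) (\<lambda>x. (\<psi> f (Q x) - Q (eta f x)) + K (Q x))"
        by (rule opb_cong) simp
      with cpt_comp_right[OF K(1) bQ] show ?thesis by blast
    qed
    fix g assume g: "g \<in> CM M"
    show "ess (\<lambda>x. \<psi> (fadd f g) (Q x) - Q (eta (fadd f g) x)) (\<lambda>x. (\<psi> f (Q x) - Q (eta f x)) + (\<psi> g (Q x) - Q (eta g x)))"
      by (rule ess_trans[OF ess_minus[OF ess_comp_right[OF psi_fadd[OF f g] bQ] ess_refl[OF b2[OF fadd_CM[OF f g]]]]
            ess_of_eq[OF bop_plus[OF bop_minus_op[OF b1[OF f] b2[OF f]] bop_minus_op[OF b1[OF g] b2[OF g]]]]])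
         (use bop_X[OF bop_eta[OF f]] bop_X[OF bop_eta[OF g]] in \<open>simp add: opb_add[OF Q] eta_fadd\<close>)
  qed (use gen(1) essD(1)[OF gen(2)] dense h in auto)
  thus ?thesis unfolding ess_def using b1[OF h] b2[OF h] by blast
qed

end

section \<open>Absorption\<close>

context calkin_rep
begin

text \<open>Modulo compacts a signed sum of values of \<psi> is the value at the signed sum, whose
  sup norm is at most the sum of the moduli. This is how a bound free of the number of pieces
  arises.\<close>

lemma signed_sum_bound:
  assumes F: "\<And>i. i < N \<Longrightarrow> F i \<in> CM M" and W: "\<And>i. i < N \<Longrightarrow> ess (W i) (\<psi> (F i))"
    and s: "\<And>x. x \<in> M \<Longrightarrow> (\<Sum>i<N. cmod (F i x)) \<le> s" and e: "0 < e"
  shows "\<exists>K. cpt K \<and> opb (K\<psi> * s + e) (\<lambda>x. (\<Sum>i<N. vsmul (of_real (sg i t)) (W i x)) + K x)"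
proof (rule ess_psi_bound)
  show "ess (\<lambda>x. \<Sum>i<N. vsmul (of_real (sg i t)) (W i x)) (\<psi> (\<lambda>x. \<Sum>i<N. of_real (sg i t) * F i x))"
    by (rule ess_trans[OF ess_sum[OF ess_scale[OF W]] ess_sym[OF psi_sum]]) (use F in auto)
  show "(\<lambda>x. \<Sum>i<N. of_real (sg i t) * F i x) \<in> CM M" by (rule sum_CM) (use F in auto)
  fix x assume x: "x \<in> M"
  have "cmod (\<Sum>i<N. of_real (sg i t) * F i x) \<le> (\<Sum>i<N. cmod (F i x))"
    by (rule order_trans[OF norm_sum]) (simp add: norm_mult)
  also have "\<dots> \<le> s" by (rule s[OF x])
  finally show "cmod (\<Sum>i<N. of_real (sg i t) * F i x) \<le> s" .
qed (rule e)

lemma absorption: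
  assumes n: "\<And>k. n k = Suc (\<nu> k)" and f: "\<And>k i. i < \<nu> k \<Longrightarrow> f k i \<in> CM M"
    and f1: "\<And>k x. x \<in> M \<Longrightarrow> (\<Sum>i<\<nu> k. f k i x * f k i x) = 1"
    and fd: "\<And>k x. x \<in> M \<Longrightarrow> (\<Sum>i<\<nu> k. cmod (f k i x)) \<le> 2^d"
    and hs: "\<And>j. hs j \<in> CM M"
    and osc: "\<And>k j i x. j \<le> k \<Longrightarrow> i < \<nu> k \<Longrightarrow> x \<in> M \<Longrightarrow> f k i x \<noteq> 0 \<Longrightarrow> cmod (hs j x - hs j (z k i)) \<le> 1 / 2^k"
    and dense: "\<And>h e. h \<in> CM M \<Longrightarrow> 0 < e \<Longrightarrow> \<exists>S c. finite S \<and> (\<forall>x\<in>M. cmod (h x - (\<Sum>j\<in>S. c j * hs j x)) \<le> e)"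
    and pts: "\<And>h r. h \<in> CM M \<Longrightarrow> (\<And>k i. i < n k \<Longrightarrow> cmod (h (z k i)) \<le> r) \<Longrightarrow> supnorm M h \<le> r"
  shows "\<exists>S R \<psi>'. inv_pair p S R \<and> calkin_iso p M \<psi>'
    \<and> opnorm21 p S * opnorm12 p R \<le> (2::real) ^ (12 * d) * K\<psi> ^ 12 * (12100 * RC\<^sup>2)
    \<and> (\<forall>h\<in>CM M. cpt_op p (\<lambda>x. vsub (eta h x) (S (\<psi> h (fst (R x)), \<psi>' h (snd (R x))))))"
proof -
  \<comment> \<open>The bound \<open>K\<psi> * 2^d\<close> for signed sums plus a slack of
    \<open>2^d\<close>. The slack scales with the estimate, so that the same L also serves the
    commutators after division by \<open>2^k\<close>.\<close>
  define L where "L = (K\<psi> + 1) * 2^d"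
  have L0: "0 \<le> L" using K_ge_1 by (simp add: L_def)
  have Le: "K\<psi> * 2^d + 2^d = L" "K\<psi> * (2^d / 2^k) + 2^d / 2^k = L / 2^k" for k
    by (simp_all add: L_def field_simps)
  have unit: "cpt (\<lambda>x. (\<Sum>i<\<nu> k. \<psi> (f k i) (\<psi> (f k i) x)) - x)" for k
  proof -
    have ff: "fmul (f k i) (f k i) \<in> CM M" if "i \<in> {..<\<nu> k}" for i using f[of i k] that by (auto intro: fmul_CM)
    have eq: "(\<lambda>x. \<Sum>i<\<nu> k. 1 * fmul (f k i) (f k i) x) = oneM M"
    proof
      fix x show "(\<Sum>i<\<nu> k. 1 * fmul (f k i) (f k i) x) = oneM M x"
        using f1[of x k] f[of _ k] by (cases "x \<in> M") (auto simp: fmul_def oneM_def CM_def intro!: sum.neutral)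
    qed
    have 1: "ess (\<psi> (oneM M)) (\<lambda>x. \<Sum>i<\<nu> k. vsmul 1 (\<psi> (fmul (f k i) (f k i)) x))"
      using psi_sum[of "{..<\<nu> k}" "\<lambda>i. fmul (f k i) (f k i)" "\<lambda>_. 1"] ff unfolding eq by simp
    have 2: "ess (\<lambda>x. \<Sum>i<\<nu> k. vsmul 1 (\<psi> (fmul (f k i) (f k i)) x)) (\<lambda>x. \<Sum>i<\<nu> k. \<psi> (f k i) (\<psi> (f k i) x))"
      unfolding vsmul_simps by (rule ess_sum) (use psi_fmul f in auto)
    show ?thesis using essD(1)[OF ess_trans[OF ess_sym[OF ess_trans[OF 1 2]] psi_one]] .
  qed
  have aess: "\<exists>K. cpt K \<and> opb L (\<lambda>x. (\<Sum>i<\<nu> k. vsmul (of_real (sg i e)) (\<psi> (f k i) x)) + K x)" for k e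
    unfolding Le(1)[symmetric] by (rule signed_sum_bound[of "\<nu> k" "f k"]) (use f fd ess_refl psi_bop in auto)
  \<comment> \<open>The function f_i (hs j - hs j (z_i)), of which both commutators are the image
    modulo compacts; by the choice of the partition it is at most |f_i| / 2^k for j <= k.\<close>
  define g where "g k j i = fadd (fmul (f k i) (hs j)) (fsmul (- hs j (z k i)) (f k i))" for k j i
  have gC: "g k j i \<in> CM M" if "i < \<nu> k" for k j i
    unfolding g_def by (rule fadd_CM[OF fmul_CM[OF f[OF that] hs] fsmul_CM[OF f[OF that]]])
  have gs: "(\<Sum>i<\<nu> k. cmod (g k j i x)) \<le> 2^d / 2^k" if x: "x \<in> M" and j: "j \<le> k" for k j x
  proof -
    have "(\<Sum>i<\<nu> k. cmod (g k j i x)) \<le> (\<Sum>i<\<nu> k. cmod (f k i x) * (1 / 2^k))"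
    proof (rule sum_mono)
      fix i assume i: "i \<in> {..<\<nu> k}"
      have "g k j i x = f k i x * (hs j x - hs j (z k i))" by (simp add: g_def fadd_def fmul_def fsmul_def algebra_simps)
      thus "cmod (g k j i x) \<le> cmod (f k i x) * (1 / 2^k)"
        using osc[OF j _ x, of i] i by (cases "f k i x = 0") (auto simp: norm_mult mult_left_mono intro: order_trans[OF mult_left_mono])
    qed
    also have "\<dots> = (\<Sum>i<\<nu> k. cmod (f k i x)) / 2^k" by (simp add: sum_divide_distrib)
    also have "\<dots> \<le> 2^d / 2^k" by (rule divide_right_mono[OF fd[OF x]]) simp
    finally show ?thesis .
  qed
  have W1: "ess (\<lambda>x. \<psi> (f k i) (\<psi> (hs j) x) - vsmul (hs j (z k i)) (\<psi> (f k i) x)) (\<psi> (g k j i))" if i: "i < \<nu> k" for k i j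
  proof -
    have "ess (\<psi> (g k j i)) (\<lambda>x. \<psi> (f k i) (\<psi> (hs j) x) + vsmul (- hs j (z k i)) (\<psi> (f k i) x))"
      unfolding g_def
      by (rule ess_trans[OF psi_fadd[OF fmul_CM[OF f[OF i] hs] fsmul_CM[OF f[OF i]]] ess_plus[OF psi_fmul[OF f[OF i] hs] psi_fsmul[OF f[OF i]]]])
    moreover have "vsmul (- c) y = - vsmul c y" for c y by (simp add: fun_eq_iff fun_apply_simps)
    ultimately show ?thesis by (simp add: ess_sym)
  qed
  have W2: "ess (\<lambda>x. \<psi> (hs j) (\<psi> (f k i) x) - vsmul (hs j (z k i)) (\<psi> (f k i) x)) (\<psi> (g k j i))" if i: "i < \<nu> k" for k i j
  proof -
    have c: "fmul (f k i) (hs j) = fmul (hs j) (f k i)" by (simp add: fmul_def mult.commute)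
    have "ess (\<psi> (g k j i)) (\<lambda>x. \<psi> (hs j) (\<psi> (f k i) x) + vsmul (- hs j (z k i)) (\<psi> (f k i) x))"
      unfolding g_def c
      by (rule ess_trans[OF psi_fadd[OF fmul_CM[OF hs f[OF i]] fsmul_CM[OF f[OF i]]] ess_plus[OF psi_fmul[OF hs f[OF i]] psi_fsmul[OF f[OF i]]]])
    moreover have "vsmul (- c) y = - vsmul c y" for c y by (simp add: fun_eq_iff fun_apply_simps)
    ultimately show ?thesis by (simp add: ess_sym)
  qed
  have comm1: "\<exists>K. cpt K \<and> opb (L / 2^k) (\<lambda>x. (\<Sum>i<\<nu> k. vsmul (of_real (sg i e)) (\<psi> (f k i) (\<psi> (hs j) x) - vsmul (hs j (z k i)) (\<psi> (f k i) x))) + K x)"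
    if "j \<le> k" for k j e
    unfolding Le(2)[symmetric] by (rule signed_sum_bound[of "\<nu> k" "g k j", OF gC W1 gs[OF _ that]]) auto
  have comm2: "\<exists>K. cpt K \<and> opb (L / 2^k) (\<lambda>x. (\<Sum>i<\<nu> k. vsmul (of_real (sg i e)) (\<psi> (hs j) (\<psi> (f k i) x) - vsmul (hs j (z k i)) (\<psi> (f k i) x))) + K x)"
    if "j \<le> k" for k j e
    unfolding Le(2)[symmetric] by (rule signed_sum_bound[of "\<nu> k" "g k j", OF gC W2 gs[OF _ that]]) auto
  have chi: "\<exists>s\<ge>0. \<forall>k i. cmod (hs j (z k i)) \<le> s" for j
    using supnorm_upper[OF hs zM] supnorm_nonneg[OF hs] by blast
  have "\<exists>J Q. opb (L + 2) J \<and> opb (3 * ((L + 2) * RC)) Q \<and> (\<forall>x\<in>X. Q (J x) = x)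
    \<and> (\<forall>x. mul (\<lambda>_ _. 1) (J x) = J x) \<and> (\<forall>y\<in>X. Q (mul (\<lambda>_ _. 1) y) = Q y)
    \<and> (\<forall>j. ess (\<lambda>x. J (\<psi> (hs j) x)) (\<lambda>x. mul (\<lambda>k i. hs j (z k i)) (J x)) \<and> ess (\<lambda>y. \<psi> (hs j) (Q y)) (\<lambda>y. Q (mul (\<lambda>k i. hs j (z k i)) y)))"
    by (rule block_dilation[of \<nu> L "\<lambda>k i. \<psi> (f k i)" "\<lambda>j. \<psi> (hs j)" "\<lambda>j k i. hs j (z k i)",
          OF n L0 psi_bop[OF f] psi_bop[OF hs] unit aess comm1 comm2 chi])
  then obtain J Q where JQ: "opb (L + 2) J" "opb (3 * ((L + 2) * RC)) Q" "\<And>x. x \<in> X \<Longrightarrow> Q (J x) = x"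
    "\<And>x. mul (\<lambda>_ _. 1) (J x) = J x" "\<And>y. y \<in> X \<Longrightarrow> Q (mul (\<lambda>_ _. 1) y) = Q y"
    "\<And>j. ess (\<lambda>x. J (\<psi> (hs j) x)) (\<lambda>x. mul (\<lambda>k i. hs j (z k i)) (J x))"
    "\<And>j. ess (\<lambda>y. \<psi> (hs j) (Q y)) (\<lambda>y. Q (mul (\<lambda>k i. hs j (z k i)) y))" by blast
  \<comment> \<open>The combination in which d and \<psi> enter the result: L + 2 = \<kappa> + 2^d +
    2 is at most 4 \<kappa>, because the norm of \<psi> is at least 1.\<close>
  define \<kappa> where "\<kappa> = K\<psi> * 2^d"
  have k1: "1 \<le> \<kappa>" using mult_mono[of 1 K\<psi> 1 "2^d"] K_ge_1 by (simp add: \<kappa>_def)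
  have "1 * 2^d \<le> K\<psi> * 2^d" using K_ge_1 by (intro mult_right_mono) auto
  moreover have "L = \<kappa> + 2^d" by (simp add: L_def \<kappa>_def algebra_simps)
  ultimately have L4: "L + 2 \<le> 4 * \<kappa>" using k1 unfolding \<kappa>_def by linarith
  have oJ: "opb (4 * \<kappa>) J" by (rule opb_mono[OF JQ(1) L4])
  have oQ: "opb (12 * RC * \<kappa>) Q"
  proof (rule opb_mono[OF JQ(2)])
    have "3 * ((L + 2) * RC) \<le> 3 * ((4 * \<kappa>) * RC)" using L4 RC_ge_1 by (intro mult_left_mono mult_right_mono) auto
    thus "3 * ((L + 2) * RC) \<le> 12 * RC * \<kappa>" by simp
  qed
  have eJ: "ess (\<lambda>x. J (\<psi> h x)) (\<lambda>x. eta h (J x))" if "h \<in> CM M" for h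
    by (rule intertwine_extend_left[OF oJ hs _ dense that]) (use JQ(6) in \<open>simp_all add: eta_eq_mul[OF JQ(4)]\<close>)
  have eQ: "ess (\<lambda>y. \<psi> h (Q y)) (\<lambda>y. Q (eta h y))" if "h \<in> CM M" for h
  proof (rule intertwine_extend_right[OF oQ hs _ dense that])
    fix i
    have "Q (eta (hs i) y) = Q (mul (\<lambda>k i'. hs i (z k i')) y)" if "y \<in> X" for y
      using JQ(5)[OF bop_X[OF bop_eta[OF hs] that]] by (simp add: mul_one_eta)
    hence "ess (\<lambda>y. Q (mul (\<lambda>k i'. hs i (z k i')) y)) (\<lambda>y. Q (eta (hs i) y))"
      by (intro ess_of_eq bop_comp[OF opb_bop[OF oQ] bop_eta[OF hs]]) simp
    thus "ess (\<lambda>y. \<psi> (hs i) (Q y)) (\<lambda>y. Q (eta (hs i) y))" by (rule ess_trans[OF JQ(7)])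
  qed simp_all
  \<comment> \<open>With u = RC \<kappa>^2 the two factors are at most 101 u and 109 u. Bounding
    both by 110 u produces 12100 = 110^2 and \<kappa>^4, which is enlarged to \<kappa>^12.\<close>
  have num: "(4 * \<kappa> + (1 + 4 * \<kappa> * (12 * RC * \<kappa>) + 4 * \<kappa> * (12 * RC * \<kappa>))) * (12 * RC * \<kappa> + (1 + 4 * \<kappa> * (12 * RC * \<kappa>) + 4 * \<kappa> * (12 * RC * \<kappa>)))
      \<le> (2::real) ^ (12 * d) * K\<psi> ^ 12 * (12100 * RC\<^sup>2)"
  proof -
    define u where "u = RC * \<kappa>\<^sup>2"
    have kk: "\<kappa> \<le> \<kappa>\<^sup>2" "1 \<le> \<kappa>\<^sup>2" using k1 by (auto simp: power2_eq_square mult_le_cancel_left1 intro: order_trans)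
    have u1: "\<kappa> \<le> u" "1 \<le> u" "RC * \<kappa> \<le> u"
      using mult_mono[of 1 RC \<kappa> "\<kappa>\<^sup>2"] mult_mono[of 1 RC 1 "\<kappa>\<^sup>2"] mult_mono[of RC RC \<kappa> "\<kappa>\<^sup>2"] RC_ge_1 k1 kk by (auto simp: u_def)
    have e: "4 * \<kappa> * (12 * RC * \<kappa>) = 48 * u" by (simp add: u_def power2_eq_square)
    have "(4 * \<kappa> + (1 + 48 * u + 48 * u)) * (12 * RC * \<kappa> + (1 + 48 * u + 48 * u)) \<le> (110 * u) * (110 * u)"
      using u1 k1 RC_ge_1 by (intro mult_mono) auto
    also have "\<dots> = \<kappa>^4 * (12100 * RC\<^sup>2)" by (simp add: u_def power2_eq_square power4_eq_xxxx)
    also have "\<dots> \<le> \<kappa>^12 * (12100 * RC\<^sup>2)" using k1 by (intro mult_right_mono power_increasing) auto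
    also have "\<kappa>^12 = (2::real) ^ (12 * d) * K\<psi> ^ 12" by (simp add: \<kappa>_def power_mult_distrib power_mult[symmetric] mult.commute)
    finally show ?thesis unfolding e .
  qed
  obtain S R \<psi>' where fin: "inv_pair p S R" "calkin_iso p M \<psi>'"
    "opnorm21 p S * opnorm12 p R \<le> (4 * \<kappa> + (1 + 4 * \<kappa> * (12 * RC * \<kappa>) + 4 * \<kappa> * (12 * RC * \<kappa>))) * (12 * RC * \<kappa> + (1 + 4 * \<kappa> * (12 * RC * \<kappa>) + 4 * \<kappa> * (12 * RC * \<kappa>)))"
    "\<forall>h\<in>CM M. cpt_op p (\<lambda>x. vsub (eta h x) (S (\<psi> h (fst (R x)), \<psi>' h (snd (R x)))))"
    using swindle[OF oJ oQ JQ(3) eJ eQ psi_bop pts] by blast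
  show ?thesis using fin(1,2,4) order_trans[OF fin(3) num] by blast
qed

end

context eta_rep
begin

lemma eta_unital_iso:
  assumes pts: "\<And>h r. h \<in> CM M \<Longrightarrow> (\<And>k i. i < n k \<Longrightarrow> cmod (h (z k i)) \<le> r) \<Longrightarrow> supnorm M h \<le> r"
  shows "unital_iso p M eta" "calkin_iso p M eta"
    "h \<in> CM M \<Longrightarrow> supnorm M h \<le> opnorm p (eta h)" "h \<in> CM M \<Longrightarrow> opnorm p (eta h) \<le> (1 + 2 * RC) * supnorm M h"
proof -
  have lowc: "supnorm M h \<le> calkin_norm p (eta h)" if "h \<in> CM M" for h
    by (rule pts[OF that eta_calkin_lower[OF that]])
  show low: "supnorm M h \<le> opnorm p (eta h)" if "h \<in> CM M" for h
    using lowc[OF that] calkin_norm_le_opnorm[OF bop_eta[OF that]] by linarith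
  show up: "opnorm p (eta h) \<le> (1 + 2 * RC) * supnorm M h" if "h \<in> CM M" for h
    by (rule opnorm_le[OF opb_eta[OF that]])
  have "\<exists>c>0. \<exists>C. \<forall>h\<in>CM M. c * supnorm M h \<le> opnorm p (eta h) \<and> opnorm p (eta h) \<le> C * supnorm M h"
    using low up by (intro exI[of _ 1] conjI exI[of _ "1 + 2 * RC"]) auto
  thus "unital_iso p M eta"
    unfolding unital_iso_def using bop_eta by (simp add: vadd_eq eta_fadd eta_fsmul eta_fmul eta_one)
  have "calkin_hom p M eta"
    unfolding calkin_hom_def
  proof (intro conjI ballI allI)
    fix f assume f: "f \<in> CM M"
    show "bop p (eta f)" by (rule bop_eta[OF f])
    show "ess_eq p (eta (fsmul c f)) (\<lambda>x. vsmul c (eta f x))" for c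
      by (rule ess_eq_if_ess[OF ess_of_eq[OF bop_scale[OF bop_eta[OF f]]]]) (simp add: eta_fsmul)
    fix g assume g: "g \<in> CM M"
    show "ess_eq p (eta (fadd f g)) (\<lambda>x. vadd (eta f x) (eta g x))" unfolding vadd_eq
      by (rule ess_eq_if_ess[OF ess_of_eq[OF bop_plus[OF bop_eta[OF f] bop_eta[OF g]]]]) (simp add: eta_fadd)
    show "ess_eq p (eta (fmul f g)) (\<lambda>x. eta f (eta g x))"
      by (rule ess_eq_if_ess[OF ess_of_eq[OF bop_comp[OF bop_eta[OF f] bop_eta[OF g]]]]) (simp add: eta_fmul)
  next
    show "ess_eq p (eta (oneM M)) (\<lambda>x. x)" by (rule ess_eq_if_ess[OF ess_of_eq[OF bop_id]]) (simp add: eta_one)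
  qed
  moreover have "calkin_bdd p M eta" unfolding calkin_bdd_def
    using order_trans[OF calkin_norm_le_opnorm[OF bop_eta] up] by blast
  moreover have "calkin_below p M eta" unfolding calkin_below_def using lowc by (intro exI[of _ 1]) simp
  ultimately show "calkin_iso p M eta" by (simp add: calkin_iso_def)
qed

end

theorem theorem6p13:
  fixes p :: real
  assumes "1 < p"
  shows "\<exists>lam\<ge>1. \<forall>(d::nat) (M::(nat \<Rightarrow> real) set).
    1 \<le> d \<and> M \<noteq> {} \<and> compact M \<and> (\<forall>z\<in>M. \<forall>i\<ge>d. z i = 0) \<longrightarrow>
    (\<exists>\<eta>. unital_iso p M \<eta>
      \<and> (\<forall>h\<in>CM M. supnorm M h / lam \<le> opnorm p (\<eta> h) \<and> opnorm p (\<eta> h) \<le> lam * supnorm M h)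
      \<and> similar_sum p M lam \<eta>
      \<and> calkin_iso p M \<eta>
      \<and> (\<forall>\<psi>. calkin_hom p M \<psi> \<and> calkin_bdd p M \<psi> \<longrightarrow>
           (\<exists>S Sinv \<psi>'. inv_pair p S Sinv
              \<and> calkin_iso p M \<psi>'
              \<and> opnorm21 p S * opnorm12 p Sinv \<le> (2::real) ^ (12 * d) * calkin_opnorm p M \<psi> ^ 12 * lam
              \<and> (\<forall>h\<in>CM M. cpt_op p
                   (\<lambda>x. vsub (\<eta> h x) (S (\<psi> h (fst (Sinv x)), \<psi>' h (snd (Sinv x)))))))))"
proof -
  interpret lp_space p by unfold_locales (rule assms)
  \<comment> \<open>The constant is exported from the locale with p as its only argument, so
    \<lambda> is fixed before d, M and the blocks are known.\<close>
  define r where "r = lp_blocks.RC p"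
  define lam where "lam = 12100 * r\<^sup>2"
  have r1: "1 \<le> r"
  proof -
    interpret lp_blocks p "\<lambda>_. 0" by unfold_locales
    show ?thesis unfolding r_def by (rule RC_ge_1)
  qed
  hence r2: "1 \<le> r\<^sup>2" "r \<le> r\<^sup>2" by (auto simp: power2_eq_square mult_le_cancel_left1 intro: order_trans)
  hence lam1: "1 \<le> lam" "1 + 2 * r \<le> lam" by (auto simp: lam_def)
  have main: "\<exists>\<eta>. unital_iso p M \<eta>
      \<and> (\<forall>h\<in>CM M. supnorm M h / lam \<le> opnorm p (\<eta> h) \<and> opnorm p (\<eta> h) \<le> lam * supnorm M h)
      \<and> similar_sum p M lam \<eta>
      \<and> calkin_iso p M \<eta>
      \<and> (\<forall>\<psi>. calkin_hom p M \<psi> \<and> calkin_bdd p M \<psi> \<longrightarrow>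
           (\<exists>S Sinv \<psi>'. inv_pair p S Sinv
              \<and> calkin_iso p M \<psi>'
              \<and> opnorm21 p S * opnorm12 p Sinv \<le> (2::real) ^ (12 * d) * calkin_opnorm p M \<psi> ^ 12 * lam
              \<and> (\<forall>h\<in>CM M. cpt_op p
                   (\<lambda>x. vsub (\<eta> h x) (S (\<psi> h (fst (Sinv x)), \<psi>' h (snd (Sinv x))))))))"
    if Mne: "M \<noteq> {}" and Mc: "compact M" and Md: "\<forall>z\<in>M. \<forall>i\<ge>d. z i = 0" for d and M :: "(nat \<Rightarrow> real) set"
  proof -
    obtain \<nu> :: "nat \<Rightarrow> nat" and f z hs where f: "\<And>k i. i < \<nu> k \<Longrightarrow> f k i \<in> CM M" and z: "\<And>k i. z k i \<in> M"
      and f1: "\<And>k x. x \<in> M \<Longrightarrow> (\<Sum>i<\<nu> k. f k i x * f k i x) = 1"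
      and fd: "\<And>k x. x \<in> M \<Longrightarrow> (\<Sum>i<\<nu> k. cmod (f k i x)) \<le> 2^d"
      and hs: "\<And>j. hs j \<in> CM M"
      and osc: "\<And>k j i x. j \<le> k \<Longrightarrow> i < \<nu> k \<Longrightarrow> x \<in> M \<Longrightarrow> f k i x \<noteq> 0 \<Longrightarrow> cmod (hs j x - hs j (z k i)) \<le> 1 / 2^k"
      and osc': "\<And>h e. h \<in> CM M \<Longrightarrow> 0 < e \<Longrightarrow> \<exists>k0. \<forall>k\<ge>k0. \<forall>i<\<nu> k. \<forall>x\<in>M. f k i x \<noteq> 0 \<longrightarrow> cmod (h x - h (z k i)) < e"
      and dense: "\<And>h e. h \<in> CM M \<Longrightarrow> 0 < e \<Longrightarrow> \<exists>S c. finite S \<and> (\<forall>x\<in>M. cmod (h x - (\<Sum>j\<in>S. c j * hs j x)) \<le> e)"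
      by (fact block_partition[OF Mc Mne Md])
    \<comment> \<open>One index beyond the partition is reserved for the correcting pair of
      \<open>block_dilation\<close>; its sample point is just some point of M.\<close>
    interpret eta_rep p "\<lambda>k. Suc (\<nu> k)" M z
      by unfold_locales (use Mc Mne z in auto)
    \<comment> \<open>The sample points detect the sup norm: at each x some f_i is nonzero because
      the squares sum to 1, and h(x) is then close to the value at the sample point of that
      piece.\<close>
    have pts: "supnorm M h \<le> c" if h: "h \<in> CM M" and c: "\<And>k i. i < Suc (\<nu> k) \<Longrightarrow> cmod (h (z k i)) \<le> c" for h c
    proof (rule supnorm_least, rule field_le_epsilon)
      fix x and e :: real assume x: "x \<in> M" and e: "0 < e"
      obtain k where k: "\<And>i. i < \<nu> k \<Longrightarrow> f k i x \<noteq> 0 \<Longrightarrow> cmod (h x - h (z k i)) < e" using osc'[OF h e] x by blast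
      have "\<exists>i<\<nu> k. f k i x \<noteq> 0"
      proof (rule ccontr)
        assume "\<not> ?thesis"
        hence "(\<Sum>i<\<nu> k. f k i x * f k i x) = 0" by (intro sum.neutral) auto
        thus False using f1[OF x, of k] by simp
      qed
      then obtain i where i: "i < \<nu> k" "f k i x \<noteq> 0" by blast
      have "cmod (h x) \<le> cmod (h (z k i)) + cmod (h x - h (z k i))" by (rule norm_triangle_sub)
      thus "cmod (h x) \<le> c + e" using k[OF i] c[of i k] i by simp
    qed
    have RCr: "RC = r" by (simp add: r_def)
    have eta: "unital_iso p M eta" "calkin_iso p M eta"
      "supnorm M h \<le> opnorm p (eta h)" "opnorm p (eta h) \<le> (1 + 2 * RC) * supnorm M h" if "h \<in> CM M" for h
      by (rule eta_unital_iso; use pts that in blast)+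
    have b1: "supnorm M h / lam \<le> opnorm p (eta h) \<and> opnorm p (eta h) \<le> lam * supnorm M h" if h: "h \<in> CM M" for h
    proof
      have "supnorm M h / lam \<le> supnorm M h / 1" using lam1 supnorm_nonneg[OF h] by (intro divide_left_mono) auto
      thus "supnorm M h / lam \<le> opnorm p (eta h)" using eta(3)[OF h] by simp
      have "(1 + 2 * r) * supnorm M h \<le> lam * supnorm M h" using lam1 supnorm_nonneg[OF h] by (intro mult_right_mono) auto
      thus "opnorm p (eta h) \<le> lam * supnorm M h" using eta(4)[OF h] by (simp add: RCr)
    qed
    have absorb: "\<exists>S Sinv \<psi>'. inv_pair p S Sinv \<and> calkin_iso p M \<psi>'
              \<and> opnorm21 p S * opnorm12 p Sinv \<le> (2::real) ^ (12 * d) * calkin_opnorm p M \<psi> ^ 12 * lam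
              \<and> (\<forall>h\<in>CM M. cpt_op p (\<lambda>x. vsub (eta h x) (S (\<psi> h (fst (Sinv x)), \<psi>' h (snd (Sinv x))))))"
      if psi: "calkin_hom p M \<psi>" "calkin_bdd p M \<psi>" for \<psi>
    proof -
      interpret calkin_rep p "\<lambda>k. Suc (\<nu> k)" M z \<psi> by unfold_locales (use psi in auto)
      show ?thesis
        unfolding lam_def RCr[symmetric]
        by (rule absorption[of \<nu> f d hs, OF refl f f1 fd hs osc dense pts])
    qed
    show ?thesis
      by (rule exI[of _ eta]) (use eta(1,2)[OF zero_CM] b1 eta_similar_sum[OF lam1(1)] absorb in blast)
  qed
  show ?thesis by (rule exI[of _ lam]) (use lam1(1) main in blast)
qed

end
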